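(* For any $f\in\mathcal D(\mathcal L)$ the unnormalized filter $\sigma$ is the unique strong solution to the Zakai equation: for any $t\in[0,T]$, $$\sigma_t(f)=f(\lambda_0)+\int_0^t\sigma_s(\mathcal Lf)\,ds+\int_0^t\int_0^{+\infty}\Big(\sigma_{s^-}\big(\lambda f(\lambda+\ell(z))\big)-\sigma_{s^-}(f)\Big)\big(m^{(1)}(ds,dz)-F^{(1)}(dz)\,ds\big).$$
   Context: Model under $\mathbf Q$. Fix $T>0$, constants $\alpha,\beta,\lambda_0,\rho>0$, a measurable $\ell:[0,+\infty)\to[0,+\infty)$ and distribution functions $F^{(1)},F^{(2)}$ on $(0,+\infty)$. Let $(\Omega,\mathcal F,\mathbf Q;\mathbb F)$, $\mathbb F=\{\mathcal F_t\}_{t\in[0,T]}$, satisfy the usual hypotheses and carry an $\mathbb F$-Poisson process $N^{(1)}$ with unit intensity, an $\mathbb F$-Poisson process $N^{(2)}$ with intensity $\rho$, with jump times $\{T^{(i)}_n\}_{n\ge1}$, and two i.i.d. sequences of positive marks $\{Z^{(i)}_n\}_{n\ge1}$ with distribution $F^{(i)}$, $i=1,2$ ($Z^{(i)}$ is a generic one), all mutually independent. With $m^{(i)}(dt,dz)=\sum_{n\ge1}\delta_{(T^{(i)}_n,Z^{(i)}_n)}(dt,dz)\mathbf 1_{\{T_n^{(i)}<+\infty\}}$, the $(\mathbf Q,\mathbb F)$-compensators are $F^{(1)}(dz)dt$ and $\rho F^{(2)}(dz)dt$. Assume $\mathbb E^{\mathbf Q}[Z^{(1)}]<+\infty$ and,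 for some $\varepsilon>0$, $\mathbb E^{\mathbf Q}[e^{\varepsilon\ell(Z^{(1)})}]<+\infty$ and $\mathbb E^{\mathbf Q}[e^{\varepsilon Z^{(2)}}]<+\infty$. Put $$\lambda_t=\beta+(\lambda_0-\beta)e^{-\alpha t}+\sum_{j=1}^{N^{(1)}_t}e^{-\alpha(t-T^{(1)}_j)}\ell(Z^{(1)}_j)+\sum_{j=1}^{N^{(2)}_t}e^{-\alpha(t-T^{(2)}_j)}Z^{(2)}_j,$$ $$L_t=\exp\Big(-\int_0^t(\lambda_s-1)ds+\int_0^t\ln(\lambda_{s^-})\,dN^{(1)}_s\Big),$$ which is a $(\mathbf Q,\mathbb F)$-martingale, and define the equivalent probability $\mathbf P$ by $d\mathbf P/d\mathbf Q|_{\mathcal F_T}=L_T$; $\mathbb E$ denotes expectation under $\mathbf P$. Under $\mathbf P$ the compensators of $m^{(1)},m^{(2)}$ are $\lambda_{t^-}F^{(1)}(dz)dt$ and $\rho F^{(2)}(dz)dt$. Unnormalized filter. $C_t=\sum_{j=1}^{N^{(1)}_t}Z^{(1)}_j$ and $\mathbb H=\{\mathcal H_t\}$ is its natural filtration. The unnormalized filter is the finite-measure-valued $\mathbb H$-adapted càdlàg process $\sigma_t(f)=\mathbb E^{\mathbf Q}[L_tf(\lambda_t)\mid\mathcal H_t]$. Notation: $\mu(f)=\int f\,d\mu$, and $\sigma_{s^-}(\lambda f(\lambda+\ell(z)))=\int xf(x+\ell(z))\sigma_{s^-}(dx)$. Generator. $$\mathcal Lf(\lambda)=\alpha(\beta-\lambda)f'(\lambda)+\int_0^{+\infty}[f(\lambda+\ell(z))-f(\lambda)]\lambda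 F^{(1)}(dz)+\int_0^{+\infty}[f(\lambda+z)-f(\lambda)]\rho F^{(2)}(dz),$$ and $\mathcal D(\mathcal L)$ is the class of $f\in C^1(0,+\infty)$ such that, for $t\in[0,T]$, $\mathbb E[\int_0^t\int_0^{+\infty}|f(\lambda_s+\ell(z))-f(\lambda_s)|\lambda_sF^{(1)}(dz)ds]<+\infty$, $\mathbb E[\int_0^t\int_0^{+\infty}|f(\lambda_s+z)-f(\lambda_s)|F^{(2)}(dz)ds]<+\infty$ and $\mathbb E[\int_0^t\lambda_s|f'(\lambda_s)|ds]<+\infty$. A strong solution is an $\mathbb H$-adapted càdlàg finite-measure-valued process on the given space for which the terms of the equation are well defined and which satisfies it for every $f\in\mathcal D(\mathcal L)$; uniqueness is up to indistinguishability. *)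

theory Defs
  imports "HOL-Probability.Probability"
begin

definition generated_by :: "'a measure \<Rightarrow> ('i \<Rightarrow> 'a \<Rightarrow> 'b::topological_space) \<Rightarrow> 'i set \<Rightarrow> 'a measure" where
  "generated_by M X I =
     sigma (space M) {X i -` A \<inter> space M | i A. i \<in> I \<and> A \<in> sets borel}"

definition usual_filtration :: "'a measure \<Rightarrow> (real \<Rightarrow> 'a measure) \<Rightarrow> real \<Rightarrow> bool" where
  "usual_filtration M F T \<longleftrightarrow>
     complete_measure M \<and>
     (\<forall>t\<in>{0..T}. subalgebra M (F t)) \<and>
     (\<forall>s\<in>{0..T}. \<forall>t\<in>{s..T}. sets (F s) \<subseteq> sets (F t)) \<and>
     null_sets M \<subseteq> sets (F 0) \<and>
     (\<forall>t\<in>{0..<T}. sets (F t) = (\<Inter>s\<in>{t<..T}. sets (F s)))"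

definition martingale_on :: "'a measure \<Rightarrow> (real \<Rightarrow> 'a measure) \<Rightarrow> real \<Rightarrow> (real \<Rightarrow> 'a \<Rightarrow> real) \<Rightarrow> bool" where
  "martingale_on M F T X \<longleftrightarrow>
     (\<forall>t\<in>{0..T}. X t \<in> borel_measurable (F t) \<and> integrable M (X t)) \<and>
     (\<forall>s\<in>{0..T}. \<forall>t\<in>{s..T}. AE \<omega> in M. real_cond_exp M (F s) (X t) \<omega> = X s \<omega>)"

definition poisson_process ::
  "'a measure \<Rightarrow> (real \<Rightarrow> 'a measure) \<Rightarrow> real \<Rightarrow> real \<Rightarrow> (real \<Rightarrow> 'a \<Rightarrow> nat) \<Rightarrow> bool" where
  "poisson_process M F T r N \<longleftrightarrow>
     (\<forall>t\<in>{0..T}. N t \<in> measurable (F t) (count_space UNIV)) \<and>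
     (\<forall>\<omega>\<in>space M. N 0 \<omega> = 0 \<and> mono_on {0..T} (\<lambda>t. N t \<omega>) \<and>
        (\<forall>t\<in>{0..<T}. continuous (at_right t) (\<lambda>s. N s \<omega>))) \<and>
     (\<forall>s\<in>{0..T}. \<forall>t\<in>{s<..T}.
        distr M (count_space UNIV) (\<lambda>\<omega>. N t \<omega> - N s \<omega>) = measure_pmf (poisson_pmf (r * (t - s))) \<and>
        prob_space.indep_set M (sets (F s))
          (sets (vimage_algebra (space M) (\<lambda>\<omega>. N t \<omega> - N s \<omega>) (count_space UNIV))))"

text \<open>On \<open>[0, T]\<close> only the jumps with index \<open>j \<le> N T \<omega>\<close> occur; for these
  \<open>jump_time N j \<omega>\<close> is the \<open>j\<close>-th jump time.  For larger \<open>j\<close> (infinite jump time) the value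
  is not used.\<close>

definition jump_time :: "(real \<Rightarrow> 'a \<Rightarrow> nat) \<Rightarrow> nat \<Rightarrow> 'a \<Rightarrow> real" where
  "jump_time N j \<omega> = Inf {t. 0 \<le> t \<and> j \<le> N t \<omega>}"

text \<open>The random measure \<open>\<Sum>\<^sub>j \<delta>(T\<^sub>j, Z\<^sub>j)\<close> on \<open>[0, T] \<times> (0, \<infinity>)\<close>.\<close>

definition jump_measure ::
  "real \<Rightarrow> (real \<Rightarrow> 'a \<Rightarrow> nat) \<Rightarrow> (nat \<Rightarrow> 'a \<Rightarrow> real) \<Rightarrow> 'a \<Rightarrow> (real \<times> real) measure" where
  "jump_measure T N Z \<omega> =
     distr (count_space {1..N T \<omega>}) (borel \<Otimes>\<^sub>M borel) (\<lambda>j. (jump_time N j \<omega>, Z j \<omega>))"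

text \<open>\<open>r K(dz) dt\<close> is the compensator of the random measure \<open>m\<close>.  It is deterministic and
  continuous in time, so no predictability condition is needed.\<close>

definition has_compensator ::
  "'a measure \<Rightarrow> (real \<Rightarrow> 'a measure) \<Rightarrow> real \<Rightarrow> ('a \<Rightarrow> (real \<times> real) measure) \<Rightarrow> real \<Rightarrow> real measure \<Rightarrow> bool" where
  "has_compensator M F T m r K \<longleftrightarrow>
     (\<forall>A\<in>sets borel. martingale_on M F T
        (\<lambda>t \<omega>. measure (m \<omega>) ({0<..t} \<times> A) - r * measure K A * t))"

text \<open>Finite Borel measures on the open half-line \<open>(0, \<infinity>)\<close>, the state space of the intensity,
  with the topology of weak convergence.\<close>

definition fin_meas :: "real measure \<Rightarrow> bool" where
  "fin_meas \<nu> \<longleftrightarrow> finite_measure \<nu> \<and> sets \<nu> = sets (restrict_space borel {0<..})"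

definition weakly_tendsto :: "(real \<Rightarrow> real measure) \<Rightarrow> real measure \<Rightarrow> real filter \<Rightarrow> bool" where
  "weakly_tendsto \<mu> \<nu> G \<longleftrightarrow>
     (\<forall>g::real \<Rightarrow> real. continuous_on {0<..} g \<longrightarrow> bounded (g ` {0<..}) \<longrightarrow>
        ((\<lambda>s. \<integral>x. g x \<partial>\<mu> s) \<longlongrightarrow> (\<integral>x. g x \<partial>\<nu>)) G)"

definition left_lim :: "(real \<Rightarrow> real measure) \<Rightarrow> real \<Rightarrow> real measure" where
  "left_lim \<mu> s = (THE \<nu>. fin_meas \<nu> \<and> weakly_tendsto \<mu> \<nu> (at_left s))"

definition cadlag_path :: "real \<Rightarrow> (real \<Rightarrow> real measure) \<Rightarrow> bool" where
  "cadlag_path T \<mu> \<longleftrightarrow>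
     (\<forall>t\<in>{0..<T}. weakly_tendsto \<mu> (\<mu> t) (at_right t)) \<and>
     (\<forall>t\<in>{0<..T}. \<exists>\<nu>. fin_meas \<nu> \<and> weakly_tendsto \<mu> \<nu> (at_left t))"

text \<open>Labels for the mutually independent sources of randomness.\<close>

datatype source = Count1 | Count2 | Mark1 nat | Mark2 nat

locale jump_cluster_model = prob_space Q
  for Q :: "'a measure" +
  fixes F :: "real \<Rightarrow> 'a measure"
    and T \<alpha> \<beta> l0 \<rho> :: real
    and ell :: "real \<Rightarrow> real"
    and F1 F2 :: "real measure"
    and N1 N2 :: "real \<Rightarrow> 'a \<Rightarrow> nat"
    and Z1 Z2 :: "nat \<Rightarrow> 'a \<Rightarrow> real"
  assumes T_pos: "T > 0"
    and params_pos: "\<alpha> > 0" "\<beta> > 0" "l0 > 0" "\<rho> > 0"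
    and ell_measurable: "ell \<in> borel_measurable (restrict_space borel {0..})"
    and ell_nonneg: "\<And>z. z \<ge> 0 \<Longrightarrow> ell z \<ge> 0"
    and F1_distribution: "real_distribution F1" "emeasure F1 {..0} = 0"
    and F2_distribution: "real_distribution F2" "emeasure F2 {..0} = 0"
    and usual: "usual_filtration Q F T"
    and N1_poisson: "poisson_process Q F T 1 N1"
    and N2_poisson: "poisson_process Q F T \<rho> N2"
    and Z1_marks: "\<And>n. n \<ge> 1 \<Longrightarrow> Z1 n \<in> borel_measurable Q"
                  "\<And>n. n \<ge> 1 \<Longrightarrow> distr Q borel (Z1 n) = F1"
                  "\<And>n \<omega>. n \<ge> 1 \<Longrightarrow> \<omega> \<in> space Q \<Longrightarrow> Z1 n \<omega> > 0"
    and Z2_marks: "\<And>n. n \<ge> 1 \<Longrightarrow> Z2 n \<in> borel_measurable Q"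
                  "\<And>n. n \<ge> 1 \<Longrightarrow> distr Q borel (Z2 n) = F2"
                  "\<And>n \<omega>. n \<ge> 1 \<Longrightarrow> \<omega> \<in> space Q \<Longrightarrow> Z2 n \<omega> > 0"
    and independent: "indep_sets
           (\<lambda>k. sets (case k of
                   Count1 \<Rightarrow> generated_by Q N1 {0..T}
                 | Count2 \<Rightarrow> generated_by Q N2 {0..T}
                 | Mark1 n \<Rightarrow> generated_by Q Z1 {n}
                 | Mark2 n \<Rightarrow> generated_by Q Z2 {n}))
           ({Count1, Count2} \<union> Mark1 ` {1..} \<union> Mark2 ` {1..})"
    and compensator1: "has_compensator Q F T (jump_measure T N1 Z1) 1 F1"
    and compensator2: "has_compensator Q F T (jump_measure T N2 Z2) \<rho> F2"
    and Z1_integrable: "integrable Q (Z1 1)"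
    and exp_moments: "\<exists>\<epsilon>>0. integrable Q (\<lambda>\<omega>. exp (\<epsilon> * ell (Z1 1 \<omega>))) \<and>
                             integrable Q (\<lambda>\<omega>. exp (\<epsilon> * Z2 1 \<omega>))"
begin

definition lam :: "real \<Rightarrow> 'a \<Rightarrow> real" where
  "lam t \<omega> = \<beta> + (l0 - \<beta>) * exp (- \<alpha> * t)
     + (\<Sum>j=1..N1 t \<omega>. exp (- \<alpha> * (t - jump_time N1 j \<omega>)) * ell (Z1 j \<omega>))
     + (\<Sum>j=1..N2 t \<omega>. exp (- \<alpha> * (t - jump_time N2 j \<omega>)) * Z2 j \<omega>)"

text \<open>The integral of \<open>ln (\<lambda>\<^sub>s\<^sub>-)\<close> against \<open>dN\<^sup>1\<close> is the sum over the jump times.\<close>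

definition L :: "real \<Rightarrow> 'a \<Rightarrow> real" where
  "L t \<omega> = exp (- (LINT s:{0..t}|lborel. lam s \<omega> - 1)
     + (\<Sum>j=1..N1 t \<omega>. ln (Lim (at_left (jump_time N1 j \<omega>)) (\<lambda>s. lam s \<omega>))))"

definition P :: "'a measure" where
  "P = density Q (\<lambda>\<omega>. ennreal (L T \<omega>))"

definition C :: "real \<Rightarrow> 'a \<Rightarrow> real" where
  "C t \<omega> = (\<Sum>j=1..N1 t \<omega>. Z1 j \<omega>)"

text \<open>The natural filtration of \<open>C\<close>, without completion.\<close>

definition H :: "real \<Rightarrow> 'a measure" where
  "H t = generated_by Q C {0..t}"

definition measure_process :: "(real \<Rightarrow> 'a \<Rightarrow> real measure) \<Rightarrow> bool" where
  "measure_process \<mu> \<longleftrightarrow>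
     (\<forall>t\<in>{0..T}. \<forall>\<omega>\<in>space Q. fin_meas (\<mu> t \<omega>)) \<and>
     (\<forall>t\<in>{0..T}. \<forall>A\<in>sets (restrict_space borel {0<..}).
        (\<lambda>\<omega>. measure (\<mu> t \<omega>) A) \<in> borel_measurable (H t)) \<and>
     (AE \<omega> in Q. cadlag_path T (\<lambda>t. \<mu> t \<omega>))"

definition unnormalized_filter :: "(real \<Rightarrow> 'a \<Rightarrow> real measure) \<Rightarrow> bool" where
  "unnormalized_filter \<sigma> \<longleftrightarrow>
     measure_process \<sigma> \<and>
     (\<forall>t\<in>{0..T}. \<forall>f::real \<Rightarrow> real.
        f \<in> borel_measurable (restrict_space borel {0<..}) \<longrightarrow> bounded (f ` {0<..}) \<longrightarrow>
        (AE \<omega> in Q. (\<integral>x. f x \<partial>\<sigma> t \<omega>) = real_cond_exp Q (H t) (\<lambda>\<omega>. L t \<omega> * f (lam t \<omega>)) \<omega>))"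

text \<open>Functions on \<open>(0, \<infinity>)\<close> are given as functions on the reals whose values outside
  \<open>(0, \<infinity>)\<close> are ignored.\<close>

definition gen :: "(real \<Rightarrow> real) \<Rightarrow> real \<Rightarrow> real" where
  "gen f x = \<alpha> * (\<beta> - x) * deriv f x
     + (LINT z:{0<..}|F1. (f (x + ell z) - f x) * x)
     + (LINT z:{0<..}|F2. (f (x + z) - f x) * \<rho>)"

definition gen_defined :: "(real \<Rightarrow> real) \<Rightarrow> real \<Rightarrow> bool" where
  "gen_defined f x \<longleftrightarrow>
     set_integrable F1 {0<..} (\<lambda>z. (f (x + ell z) - f x) * x) \<and>
     set_integrable F2 {0<..} (\<lambda>z. (f (x + z) - f x) * \<rho>)"

definition gen_domain :: "(real \<Rightarrow> real) set" where
  "gen_domain = {f. f C1_differentiable_on {0<..} \<and>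
     (\<forall>t\<in>{0..T}.
       (\<integral>\<^sup>+\<omega>. (\<integral>\<^sup>+s\<in>{0..t}. (\<integral>\<^sup>+z\<in>{0<..}.
          ennreal (\<bar>f (lam s \<omega> + ell z) - f (lam s \<omega>)\<bar> * lam s \<omega>) \<partial>F1) \<partial>lborel) \<partial>P) < \<infinity> \<and>
       (\<integral>\<^sup>+\<omega>. (\<integral>\<^sup>+s\<in>{0..t}. (\<integral>\<^sup>+z\<in>{0<..}.
          ennreal \<bar>f (lam s \<omega> + z) - f (lam s \<omega>)\<bar> \<partial>F2) \<partial>lborel) \<partial>P) < \<infinity> \<and>
       (\<integral>\<^sup>+\<omega>. (\<integral>\<^sup>+s\<in>{0..t}. ennreal (lam s \<omega> * \<bar>deriv f (lam s \<omega>)\<bar>) \<partial>lborel) \<partial>P) < \<infinity>)}"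

text \<open>For a path \<open>\<mu>\<close> of measures: the integrand
  \<open>\<mu>\<^sub>s\<^sub>-(\<lambda> f(\<lambda> + \<ell>(z))) - \<mu>\<^sub>s\<^sub>-(f)\<close> at \<open>(s, z)\<close>.\<close>

definition zakai_integrand :: "(real \<Rightarrow> real) \<Rightarrow> (real \<Rightarrow> real measure) \<Rightarrow> real \<times> real \<Rightarrow> real" where
  "zakai_integrand f \<mu> = (\<lambda>(s, z).
     (\<integral>x. x * f (x + ell z) \<partial>left_lim \<mu> s) - (\<integral>x. f x \<partial>left_lim \<mu> s))"

definition zakai_integrand_defined :: "(real \<Rightarrow> real) \<Rightarrow> (real \<Rightarrow> real measure) \<Rightarrow> real \<times> real \<Rightarrow> bool" where
  "zakai_integrand_defined f \<mu> = (\<lambda>(s, z).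
     integrable (left_lim \<mu> s) (\<lambda>x. x * f (x + ell z)) \<and> integrable (left_lim \<mu> s) f)"

text \<open>All integrals in the equation exist.  Integrability over a single \<open>x\<close>, \<open>s\<close> or \<open>(s, z)\<close> is
  required only up to null sets of the measure that integrates it, since \<open>f \<in> gen_domain\<close>
  guarantees no more than that; at the atoms of \<open>jump_measure\<close> this means at every jump.\<close>

definition zakai_well_defined :: "(real \<Rightarrow> real) \<Rightarrow> (real \<Rightarrow> 'a \<Rightarrow> real measure) \<Rightarrow> 'a \<Rightarrow> bool" where
  "zakai_well_defined f \<mu> \<omega> \<longleftrightarrow>
     (\<forall>t\<in>{0..T}. integrable (\<mu> t \<omega>) f) \<and>
     (AE s in lborel. s \<in> {0..T} \<longrightarrow>
        (AE x in \<mu> s \<omega>. gen_defined f x) \<and> integrable (\<mu> s \<omega>) (gen f)) \<and>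
     set_integrable lborel {0..T} (\<lambda>s. \<integral>x. gen f x \<partial>\<mu> s \<omega>) \<and>
     (\<forall>\<kappa>\<in>{jump_measure T N1 Z1 \<omega>, lborel \<Otimes>\<^sub>M F1}.
        (AE p in \<kappa>. p \<in> {0<..T} \<times> {0<..} \<longrightarrow> zakai_integrand_defined f (\<lambda>t. \<mu> t \<omega>) p) \<and>
        set_integrable \<kappa> ({0<..T} \<times> {0<..}) (zakai_integrand f (\<lambda>t. \<mu> t \<omega>)))"

definition zakai_equation :: "(real \<Rightarrow> real) \<Rightarrow> (real \<Rightarrow> 'a \<Rightarrow> real measure) \<Rightarrow> 'a \<Rightarrow> real \<Rightarrow> bool" where
  "zakai_equation f \<mu> \<omega> t \<longleftrightarrow>
     (\<integral>x. f x \<partial>\<mu> t \<omega>) = f l0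
       + (LINT s:{0..t}|lborel. (\<integral>x. gen f x \<partial>\<mu> s \<omega>))
       + ((LINT p:{0<..t} \<times> {0<..}|jump_measure T N1 Z1 \<omega>. zakai_integrand f (\<lambda>t. \<mu> t \<omega>) p)
          - (LINT p:{0<..t} \<times> {0<..}|lborel \<Otimes>\<^sub>M F1. zakai_integrand f (\<lambda>t. \<mu> t \<omega>) p))"

definition strong_solution :: "(real \<Rightarrow> 'a \<Rightarrow> real measure) \<Rightarrow> bool" where
  "strong_solution \<mu> \<longleftrightarrow>
     measure_process \<mu> \<and>
     (\<forall>f\<in>gen_domain. AE \<omega> in Q.
        zakai_well_defined f \<mu> \<omega> \<and> (\<forall>t\<in>{0..T}. zakai_equation f \<mu> \<omega> t))"

definition indistinguishable ::
  "(real \<Rightarrow> 'a \<Rightarrow> real measure) \<Rightarrow> (real \<Rightarrow> 'a \<Rightarrow> real measure) \<Rightarrow> bool" where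
  "indistinguishable \<mu> \<nu> \<longleftrightarrow> (AE \<omega> in Q. \<forall>t\<in>{0..T}. \<mu> t \<omega> = \<nu> t \<omega>)"

end

end

theory Submission
 imports Defs
begin

text \<open>The two marked Poisson processes are independent under \<open>Q\<close>, so the unnormalized filter is obtained by
freezing the observed one: \<open>\<sigma>\<^sub>t(f)(\<omega>)\<close> is the \<open>Q(d\<omega>')\<close>-integral of \<open>L\<^sub>t f(\<lambda>\<^sub>t)\<close> evaluated at the jumps of \<open>N\<^sup>1, Z\<^sup>1\<close>
along \<open>\<omega>\<close> and of \<open>N\<^sup>2, Z\<^sup>2\<close> along \<open>\<omega>'\<close>. Along a fixed pair of jump configurations \<open>L\<^sub>t f(\<lambda>\<^sub>t)\<close> satisfies an elementary
Ito formula; integrating it over \<open>\<omega>'\<close> and using the Campbell formula for the second process gives the Zakai equation.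
The integrability needed for this is extracted from the domain of the generator by the same formula applied to
\<open>sqrt (1 + f\<^sup>2)\<close>, damped by \<open>exp (- t)\<close> and cut at the \<open>n\<close>-th jump of \<open>N\<^sup>1\<close>.

For uniqueness take \<open>f\<^sub>k(x) = x\<^sup>k exp (- x / \<alpha>)\<close>. Between two jumps the drift of \<open>\<mu>\<^sub>t(f\<^sub>k)\<close> is a linear combination of
\<open>\<mu>\<^sub>t(f\<^sub>0), \<dots>, \<mu>\<^sub>t(f\<^sub>k)\<close> only: the rate \<open>1 / \<alpha>\<close> is the one for which the terms \<open>x\<^bsup>k+1\<^esup>\<close> of the transport and of the
jump part cancel. The system is triangular, and these moments determine a finite measure.\<close>

text \<open>The obstacle is integrability. Membership in \<open>gen_domain\<close> controls the
  increments and the derivative of \<open>f\<close> along the intensity under \<open>P\<close>, but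
  not \<open>f\<close> itself, whereas the equation contains \<lambda> f(\<lambda>) weighted by the
  likelihood. In Ito's formula this term stands on both sides, up to controlled increments, and can
  be cancelled only once it is known to be finite. The cut breaks the symmetry: the gain at an
  observed jump carries the level \<open>n - 1\<close>, the loss the level \<open>n\<close>, so
  finiteness follows by induction on \<open>n\<close>; damping at rate 1 removes the remaining
  zero-order term from the right-hand side. Balances are therefore kept in \<open>ennreal\<close>,
  each term on the side where it is nonnegative. For a single observed path the level is finally
  taken as N_T + 1, where the cut has no effect. Conditions under \<open>P\<close> involve the
  likelihood at \<open>T\<close>, the balances the likelihood at earlier times. The link is
  E[L_r psi] <= E[L_T psi] for psi >= 0 depending on the intensity at \<open>r\<close>; it is
  derived here from a bound on the first moment of the intensity that is uniform in
  \<open>n\<close>.\<close>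

abbreviation nni :: "'a measure \<Rightarrow> ('a \<Rightarrow> ennreal) \<Rightarrow> ennreal" where "nni \<equiv> nn_integral"
abbreviation lint :: "'a measure \<Rightarrow> ('a \<Rightarrow> 'b::{banach,second_countable_topology}) \<Rightarrow> 'b" where "lint \<equiv> lebesgue_integral"
abbreviation prodm :: "'a measure \<Rightarrow> 'b measure \<Rightarrow> ('a \<times> 'b) measure" (infixr "><" 80) where "M >< N \<equiv> M \<Otimes>\<^sub>M N"
abbreviation bm :: "'a measure \<Rightarrow> ('a \<Rightarrow> 'b::topological_space) set" where "bm \<equiv> borel_measurable"

type_synonym config = "nat \<times> (nat => real \<times> real)"

section \<open>Jump configurations and the pathwise Ito formula\<close>

text \<open>A configuration \<open>(n, v)\<close> has \<open>n\<close> jumps, \<open>v j = (time, mark)\<close> for \<open>1 \<le> j \<le> n\<close>. A relation \<open>R\<close> is always \<open>(\<le>)\<close>, for the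
right-continuous version of a process, or \<open>(<)\<close>, for its left limit.\<close>

definition num :: "config => nat" where "num c = fst c"
definition tm :: "config => nat => real" where "tm c j = fst (snd c j)"
definition mk :: "config => nat => real" where "mk c j = snd (snd c j)"

definition idx :: "(real => real => bool) => config => real => nat set" where
 "idx R c r = {j \<in> {1..num c}. R (tm c j) r}"

definition times :: "config => real set" where
 "times c = tm c ` {1..num c}"

definition config_ok :: "real => config => bool" where
 "config_ok T c \<longleftrightarrow> (\<forall>j\<in>{1..num c}. 0 < tm c j \<and> tm c j <= T \<and> 0 <= mk c j) \<and> inj_on (tm c) {1..num c}"

lemma finite_idx [simp, intro]: "finite (idx R c r)"
 by (simp add: idx_def)

lemma finite_times [simp, intro]: "finite (times c)"
 by (simp add: times_def)

lemma idx_in_Pow: "idx R c r \<in> Pow {1..num c}"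
 by (auto simp: idx_def)

lemma eventually_idx_right: "eventually (%u. idx (<=) c u = idx (<=) c r) (at_right r)"
proof -
 have "\<forall>\<^sub>F u in at_right r. \<forall>j\<in>{1..num c}. (tm c j <= u \<longleftrightarrow> tm c j <= r)"
 proof (rule eventually_ball_finite; safe?)
  fix j assume "j \<in> {1..num c}"
  show "\<forall>\<^sub>F u in at_right r. (tm c j <= u \<longleftrightarrow> tm c j <= r)"
  proof (cases "tm c j <= r")
   case True
   show ?thesis using eventually_at_right_less[of r] by eventually_elim (use True in auto)
  next
   case False
   then have "\<forall>\<^sub>F u in at_right r. u < tm c j"
    by (intro eventually_at_right_real[THEN eventually_mono]) (auto)
   then show ?thesis by eventually_elim (use False in auto)
  qed
 qed
 then show ?thesis by eventually_elim (auto simp: idx_def)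
qed

lemma eventually_idx_left:
 "eventually (%u. idx (<=) c u = idx (<) c r \<and> idx (<) c u = idx (<) c r) (at_left r)"
proof -
 have "\<forall>\<^sub>F u in at_left r. \<forall>j\<in>{1..num c}. (tm c j <= u \<longleftrightarrow> tm c j < r) \<and> (tm c j < u \<longleftrightarrow> tm c j < r)"
 proof (rule eventually_ball_finite; safe?)
  fix j assume "j \<in> {1..num c}"
  have ur: "\<forall>\<^sub>F u in at_left r. u < r" by (simp add: eventually_at_filter)
  show "\<forall>\<^sub>F u in at_left r. (tm c j <= u \<longleftrightarrow> tm c j < r) \<and> (tm c j < u \<longleftrightarrow> tm c j < r)"
  proof (cases "tm c j < r")
   case True
   then have "\<forall>\<^sub>F u in at_left r. tm c j < u"
    by (intro eventually_at_left_real[THEN eventually_mono]) (auto)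
   then show ?thesis by eventually_elim (use True in auto)
  next
   case False
   show ?thesis using ur by eventually_elim (use False in auto)
  qed
 qed
 then show ?thesis by eventually_elim (auto simp: idx_def)
qed

lemma eventually_idx_nhds:
 assumes "r \<notin> times c"
 shows "eventually (%u. idx (<=) c u = idx (<) c r) (nhds r)" "idx (<=) c r = idx (<) c r"
proof -
 show eq: "idx (<=) c r = idx (<) c r" using assms by (force simp: idx_def times_def)
 have "eventually (%u. idx (<=) c u = idx (<) c r) (at r)"
  using eventually_idx_right[of c r] eventually_idx_left[of c r] eq
  by (auto simp: eventually_at_split elim: eventually_mono)
 then show "eventually (%u. idx (<=) c u = idx (<) c r) (nhds r)"
  using eq unfolding eventually_nhds_conv_at by simp
qed

text \<open>The index sets take finitely many values, so a quantity that depends on them is a finite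
  sum of fixed terms, each restricted to the times at which the index sets have that value.
  Piecewise statements are reduced to single pieces in this way.\<close>

lemma Ball_Pow_idx_sum:
 fixes f :: "nat set => nat set => real"
 shows "f (idx R c r) (idx R d r) =
  (\<Sum>A\<in>Pow {1..num c}. \<Sum>B\<in>Pow {1..num d}. if idx R c r = A \<and> idx R d r = B then f A B else 0)"
proof -
 have "(\<Sum>A\<in>Pow {1..num c}. \<Sum>B\<in>Pow {1..num d}. if idx R c r = A \<and> idx R d r = B then f A B else 0)
  = (\<Sum>A\<in>Pow {1..num c}. if idx R c r = A then (\<Sum>B\<in>Pow {1..num d}. if idx R d r = B then f A B else 0) else 0)"
  by (intro sum.cong) auto
 also have "... = f (idx R c r) (idx R d r)"
  using idx_in_Pow[of R c r] idx_in_Pow[of R d r] by (simp add: sum.delta')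
 finally show ?thesis by simp
qed

lemma idx_eq_set_borel: "{r. idx (<) c r = A} \<in> sets borel"
proof -
 have "idx (<) c r = A \<longleftrightarrow> A \<subseteq> {1..num c} \<and> (\<forall>j\<in>{1..num c}. (tm c j < r) = (j \<in> A))" for r
  by (auto simp: idx_def)
 then have "{r. idx (<) c r = A} = {r \<in> space borel. A \<subseteq> {1..num c} \<and> (\<forall>j\<in>{1..num c}. (tm c j < r) = (j \<in> A))}"
  by simp
 also have "... \<in> sets borel" by measurable
 finally show ?thesis .
qed

lemma piecewise_continuous_integrable:
 fixes D :: "nat set => nat set => real => real"
 assumes D: "\<And>A B. A \<subseteq> {1..num c} ==> B \<subseteq> {1..num d} ==> continuous_on {0..} (D A B)"
  and st: "0 <= s" "s <= t"
 shows "set_integrable lborel {s..t} (%r. D (idx (<) c r) (idx (<) d r) r)"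
proof -
 let ?D = "%r. D (idx (<) c r) (idx (<) d r) r"
 have D1: "set_integrable lborel {s..t} (D A B)" if "A \<subseteq> {1..num c}" "B \<subseteq> {1..num d}" for A B
  using D[OF that] st by (intro borel_integrable_atLeastAtMost' continuous_on_subset[OF D[OF that]]) auto
 have "integrable lborel
  (%r. \<Sum>A\<in>Pow {1..num c}. \<Sum>B\<in>Pow {1..num d}. if idx (<) c r = A \<and> idx (<) d r = B then indicator {s..t} r * D A B r else 0)"
 proof (intro Bochner_Integration.integrable_sum)
  fix A B assume AB: "A \<in> Pow {1..num c}" "B \<in> Pow {1..num d}"
  let ?S = "{r. idx (<) c r = A} \<inter> {r. idx (<) d r = B}"
  have S: "?S \<in> sets borel" by (intro sets.Int idx_eq_set_borel)
  have "set_integrable lborel ({s..t} \<inter> ?S) (D A B)"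
   by (rule set_integrable_subset[OF D1]) (use AB S in auto)
  then show "integrable lborel (%r. if idx (<) c r = A \<and> idx (<) d r = B then indicator {s..t} r * D A B r else 0)"
   unfolding set_integrable_def by (rule Bochner_Integration.integrable_cong[OF refl, THEN iffD1, rotated]) (auto simp: indicator_def)
 qed
 then show "set_integrable lborel {s..t} ?D"
  unfolding set_integrable_def real_scaleR_def
  by (subst Ball_Pow_idx_sum[of "%A B. indicator {s..t} r * D A B r" for r])
qed

text \<open>Subtracting the sum of its jumps makes the path continuous; it then has derivative
  \<open>D\<close> off a finite set, and the fundamental theorem of calculus with finitely many
  exceptional points applies.\<close>

lemma piecewise_smooth_ftc:
 fixes V D :: "nat set => nat set => real => real"
 assumes V: "\<And>A B r. A \<subseteq> {1..num c} ==> B \<subseteq> {1..num d} ==> 0 <= r ==>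
   (V A B has_real_derivative D A B r) (at r)"
  and D: "\<And>A B. A \<subseteq> {1..num c} ==> B \<subseteq> {1..num d} ==> continuous_on {0..} (D A B)"
  and st: "0 <= s" "s <= t"
 shows "set_integrable lborel {s..t} (%r. D (idx (<) c r) (idx (<) d r) r)"
  and "V (idx (<=) c t) (idx (<=) d t) t - V (idx (<=) c s) (idx (<=) d s) s =
   (LINT r:{s..t}|lborel. D (idx (<) c r) (idx (<) d r) r)
   + (\<Sum>r\<in>{r\<in>times c \<union> times d. s < r \<and> r <= t}.
     V (idx (<=) c r) (idx (<=) d r) r - V (idx (<) c r) (idx (<) d r) r)"
proof -
 let ?J = "times c \<union> times d"
 let ?Vp = "%r. V (idx (<=) c r) (idx (<=) d r) r"
 let ?Vm = "%r. V (idx (<) c r) (idx (<) d r) r"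
 let ?D = "%r. D (idx (<) c r) (idx (<) d r) r"
 have sub: "idx R e r \<subseteq> {1..num e}" for R e r using idx_in_Pow by blast
 have int: "set_integrable lborel {s..t} ?D" by (rule piecewise_continuous_integrable[OF D st])
 then show "set_integrable lborel {s..t} ?D" .
 let ?S = "%u. \<Sum>r\<in>{r\<in>?J. r <= u}. ?Vp r - ?Vm r"
 let ?W = "%u. ?Vp u - ?S u"
 have cont: "isCont (V A B) r" if "A \<subseteq> {1..num c}" "B \<subseteq> {1..num d}" "0 <= r" for A B r
  using V[OF that] DERIV_isCont by blast
 have ev_right: "\<forall>\<^sub>F u in at_right r. {x\<in>?J. x <= u} = {x\<in>?J. x <= r}" for r
 proof -
  have "\<forall>\<^sub>F u in at_right r. \<forall>x\<in>?J. x <= u \<longleftrightarrow> x <= r"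
  proof (rule eventually_ball_finite, simp, safe?)
   \<comment> \<open>The configuration with a single jump at time \<open>x\<close> turns
     \<open>eventually_idx_right\<close> into a statement on the order of \<open>x\<close> and
     \<open>u\<close>.\<close>
   fix x
   show "\<forall>\<^sub>F u in at_right r. (x <= u \<longleftrightarrow> x <= r)"
    using eventually_idx_right[of "(1, %_. (x, 0))" r]
    by eventually_elim (auto simp: idx_def num_def tm_def)
   show "\<forall>\<^sub>F u in at_right r. (x <= u \<longleftrightarrow> x <= r)"
    using eventually_idx_right[of "(1, %_. (x, 0))" r]
    by eventually_elim (auto simp: idx_def num_def tm_def)
  qed
  then show ?thesis by eventually_elim auto
 qed
 have ev_left: "\<forall>\<^sub>F u in at_left r. {x\<in>?J. x <= u} = {x\<in>?J. x < r}" for r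
 proof -
  have "\<forall>\<^sub>F u in at_left r. \<forall>x\<in>?J. x <= u \<longleftrightarrow> x < r"
  proof (rule eventually_ball_finite, simp, rule ballI)
   fix x
   show "\<forall>\<^sub>F u in at_left r. (x <= u \<longleftrightarrow> x < r)"
    using eventually_idx_left[of "(1, %_. (x, 0))" r]
    by eventually_elim (auto simp: idx_def num_def tm_def)
  qed
  then show ?thesis by eventually_elim auto
 qed
 have Wright: "(?W \<longlongrightarrow> ?W r) (at_right r)" if "0 <= r" for r
 proof -
  have "((%u. V (idx (<=) c r) (idx (<=) d r) u - ?S r) \<longlongrightarrow> ?W r) (at_right r)"
   using cont[OF sub sub that] by (intro tendsto_intros) (auto simp: isCont_def intro: filterlim_at_split[THEN iffD1, THEN conjunct2])
  then show ?thesis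
   by (rule Lim_transform_eventually)
    (use eventually_idx_right[of c r] eventually_idx_right[of d r] ev_right[of r] in eventually_elim, simp)
 qed
 have Wleft: "(?W \<longlongrightarrow> ?W r) (at_left r)" if "0 < r" for r
 proof -
  let ?S' = "\<Sum>r\<in>{x\<in>?J. x < r}. ?Vp r - ?Vm r"
  have "?Vm r - ?S' = ?W r"
  proof (cases "r \<in> ?J")
   case True
   have "{x\<in>?J. x <= r} = insert r {x\<in>?J. x < r}" using True by auto
   then show ?thesis by simp
  next
   case False
   then have "{x\<in>?J. x <= r} = {x\<in>?J. x < r}" by (auto simp: le_less)
   then show ?thesis using False by (simp add: eventually_idx_nhds(2))
  qed
  moreover have "((%u. V (idx (<) c r) (idx (<) d r) u - ?S') \<longlongrightarrow> ?Vm r - ?S') (at_left r)"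
   using cont[OF sub sub less_imp_le[OF that]] by (intro tendsto_intros) (auto simp: isCont_def intro: filterlim_at_split[THEN iffD1, THEN conjunct1])
  ultimately show ?thesis
   by (auto elim!: Lim_transform_eventually)
    (use eventually_idx_left[of c r] eventually_idx_left[of d r] ev_left[of r] in eventually_elim, simp)
 qed
 have "(?D has_integral ?W t - ?W s) {s..t}"
 proof (rule fundamental_theorem_of_calculus_interior_strong[where S="?J"])
  fix r assume r: "r \<in> {s<..<t} - ?J"
  then have r0: "0 < r" using st by auto
  have ev: "\<forall>\<^sub>F u in nhds r. ?W u = V (idx (<) c r) (idx (<) d r) u - ?S r"
  proof -
   have "\<forall>\<^sub>F u in at r. {x\<in>?J. x <= u} = {x\<in>?J. x <= r}"
   proof -
    have "{x\<in>?J. x < r} = {x\<in>?J. x <= r}" using r by (auto simp: le_less)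
    then show ?thesis using ev_left[of r] ev_right[of r] by (simp add: eventually_at_split)
   qed
   then have "\<forall>\<^sub>F u in nhds r. {x\<in>?J. x <= u} = {x\<in>?J. x <= r}"
    unfolding eventually_nhds_conv_at by simp
   moreover have "\<forall>\<^sub>F u in nhds r. idx (<=) c u = idx (<) c r" "\<forall>\<^sub>F u in nhds r. idx (<=) d u = idx (<) d r"
    using r by (auto intro: eventually_idx_nhds)
   ultimately show ?thesis by eventually_elim simp
  qed
  have "((%u. V (idx (<) c r) (idx (<) d r) u - ?S r) has_real_derivative ?D r) (at r)"
   using V[OF sub sub less_imp_le[OF r0]] by (auto intro!: derivative_eq_intros)
  then have "(?W has_real_derivative ?D r) (at r)"
   using DERIV_cong_ev[OF refl ev refl] by blast
  then show "(?W has_vector_derivative ?D r) (at r)"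
   by (simp add: has_real_derivative_iff_has_vector_derivative)
 next
  show "continuous_on {s..t} ?W"
   unfolding continuous_on_eq_continuous_within
  proof
   fix r assume r: "r \<in> {s..t}"
   show "continuous (at r within {s..t}) ?W"
   proof (cases "r = s")
    case True
    then have "(?W \<longlongrightarrow> ?W r) (at_right r)" using st by (intro Wright) auto
    then show ?thesis unfolding continuous_within using True
     by (rule_tac tendsto_within_subset[where S="{s..}"]) (auto simp: at_within_Ici_at_right)
   next
    case False
    then have "(?W \<longlongrightarrow> ?W r) (at r)"
     using r st Wleft[of r] Wright[of r] by (auto intro!: filterlim_split_at)
    then show ?thesis unfolding continuous_within by (rule tendsto_within_subset) simp
   qed
  qed
 qed (use st in auto)
 then have "integral {s..t} ?D = ?W t - ?W s" by (rule integral_unique)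
 moreover have "(LINT r:{s..t}|lborel. ?D r) = integral {s..t} ?D"
  by (rule set_borel_integral_eq_integral(2)[OF int])
 moreover have "?S t - ?S s = (\<Sum>r\<in>{r\<in>?J. s < r \<and> r <= t}. ?Vp r - ?Vm r)"
 proof -
  have "{r\<in>?J. r <= t} = {r\<in>?J. r <= s} \<union> {r\<in>?J. s < r \<and> r <= t}" using st by auto
  then have "?S t = ?S s + (\<Sum>r\<in>{r\<in>?J. s < r \<and> r <= t}. ?Vp r - ?Vm r)"
   by (simp only:) (rule sum.union_disjoint, auto)
  then show ?thesis by simp
 qed
 ultimately show "?Vp t - ?Vp s = (LINT r:{s..t}|lborel. ?D r) + (\<Sum>r\<in>{r\<in>?J. s < r \<and> r <= t}. ?Vp r - ?Vm r)"
  by simp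
qed

section \<open>Intensity and likelihood as functions of a pair of configurations\<close>

locale intensity =
 fixes \<alpha> \<beta> l0 :: real
 assumes alpha_pos: "0 < \<alpha>" and beta_pos: "0 < \<beta>" and l0_pos: "0 < l0"
begin

text \<open>Intensity at time \<open>r\<close> if exactly the jumps in \<open>A\<close> and
  \<open>B\<close> have occurred. Keeping the index sets apart from the time makes each piece smooth
  in \<open>r\<close>; \<open>intn\<close> inserts the index sets of time \<open>r\<close>.\<close>

definition intS :: "nat set => nat set => config => config => real => real" where
 "intS A B c d r = \<beta> + (l0 - \<beta>) * exp (- \<alpha> * r)
  + (\<Sum>j\<in>A. exp (- \<alpha> * (r - tm c j)) * mk c j) + (\<Sum>j\<in>B. exp (- \<alpha> * (r - tm d j)) * mk d j)"

text \<open>The antiderivative of \<open>intS\<close> in which each jump contributes 0 at its own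
  jump time. Along the path it is therefore continuous and equals the integrated intensity.\<close>

definition cumS :: "nat set => nat set => config => config => real => real" where
 "cumS A B c d r = \<beta> * r + (l0 - \<beta>) * (1 - exp (- \<alpha> * r)) / \<alpha>
  + (\<Sum>j\<in>A. (1 - exp (- \<alpha> * (r - tm c j))) / \<alpha> * mk c j)
  + (\<Sum>j\<in>B. (1 - exp (- \<alpha> * (r - tm d j))) / \<alpha> * mk d j)"

definition intn :: "(real => real => bool) => config => config => real => real" where
 "intn R c d r = intS (idx R c r) (idx R d r) c d r"

text \<open>The density \<open>L\<close> of the change of measure, with the exponential of the sum
  of logarithms written as a product; its factors are left limits, hence
  \<open>intn (<)\<close>.\<close>

definition likS :: "nat set => nat set => config => config => real => real" where
 "likS A B c d r = exp (r - cumS A B c d r) * (\<Prod>j\<in>A. intn (<) c d (tm c j))"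

definition lik :: "(real => real => bool) => config => config => real => real" where
 "lik R c d r = likS (idx R c r) (idx R d r) c d r"

definition lmin :: real where "lmin = min \<beta> l0"

lemma lmin_pos: "0 < lmin"
 using beta_pos l0_pos by (simp add: lmin_def)

text \<open>Without jumps the intensity is a convex combination of \<beta> and the initial value,
  and jumps only add to it. Through this bound |f| is estimated by a multiple of \<lambda> |f| later
  on.\<close>

lemma intS_ge:
 assumes "\<And>j. j \<in> A ==> 0 <= mk c j" "\<And>j. j \<in> B ==> 0 <= mk d j" "0 <= r"
 shows "lmin <= intS A B c d r"
proof -
 define e where "e = exp (- \<alpha> * r)"
 have e: "0 <= e" "e <= 1" using assms(3) alpha_pos by (auto simp: e_def)
 have "lmin * (1 - e) <= \<beta> * (1 - e)" "lmin * e <= l0 * e"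
  using e by (auto simp: lmin_def intro!: mult_right_mono)
 then have "lmin <= \<beta> + (l0 - \<beta>) * e" by (simp add: algebra_simps)
 moreover have "0 <= (\<Sum>j\<in>A. exp (- \<alpha> * (r - tm c j)) * mk c j)"
   "0 <= (\<Sum>j\<in>B. exp (- \<alpha> * (r - tm d j)) * mk d j)"
  using assms by (auto intro!: sum_nonneg)
 ultimately show ?thesis unfolding intS_def e_def by linarith
qed

lemma intS_ge_ok:
 assumes "config_ok T c" "config_ok T d" "A \<subseteq> {1..num c}" "B \<subseteq> {1..num d}" "0 <= r"
 shows "lmin <= intS A B c d r"
 using assms by (intro intS_ge) (auto simp: config_ok_def)

lemma intn_ge:
 assumes "config_ok T c" "config_ok T d" "0 <= r"
 shows "lmin <= intn R c d r"
 unfolding intn_def using assms idx_in_Pow by (intro intS_ge_ok) auto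

lemma intn_pos:
 assumes "config_ok T c" "config_ok T d" "0 <= r"
 shows "0 < intn R c d r"
 using intn_ge[OF assms] lmin_pos by (rule less_le_trans[rotated])

lemma tm_pos: "config_ok T c ==> j \<in> {1..num c} ==> 0 < tm c j"
 by (simp add: config_ok_def)

lemma likS_pos:
 assumes "config_ok T c" "config_ok T d" "A \<subseteq> {1..num c}"
 shows "0 < likS A B c d r"
proof -
 have "0 <= tm c j" if "j \<in> A" for j
  using tm_pos[OF assms(1), of j] that assms(3) by (simp add: subset_iff)
 then have "0 < (\<Prod>j\<in>A. intn (<) c d (tm c j))"
  by (intro prod_pos intn_pos[OF assms(1,2)])
 then show ?thesis by (simp add: likS_def)
qed

lemma lik_pos: "config_ok T c ==> config_ok T d ==> 0 < lik R c d r"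
 unfolding lik_def using idx_in_Pow by (intro likS_pos) auto

lemma lik_nonneg: "config_ok T c ==> config_ok T d ==> 0 <= lik R c d r"
 using lik_pos by (simp add: less_imp_le)

lemma DERIV_intS: "(intS A B c d has_real_derivative \<alpha> * (\<beta> - intS A B c d r)) (at r)"
 unfolding intS_def
 by (auto intro!: derivative_eq_intros simp: sum_distrib_left sum_negf algebra_simps)

lemma DERIV_cumS: "(cumS A B c d has_real_derivative intS A B c d r) (at r)"
 unfolding intS_def cumS_def using alpha_pos
 by (auto intro!: derivative_eq_intros sum.cong simp: algebra_simps) (simp add: field_simps)

lemma DERIV_likS: "(likS A B c d has_real_derivative - (intS A B c d r - 1) * likS A B c d r) (at r)"
 unfolding likS_def
 by (rule derivative_eq_intros DERIV_cumS refl)+ (simp add: algebra_simps)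

lemma continuous_intS: "continuous_on S (intS A B c d)"
 by (intro continuous_at_imp_continuous_on ballI DERIV_isCont[OF DERIV_intS])

lemma continuous_likS: "continuous_on S (likS A B c d)"
 by (intro continuous_at_imp_continuous_on ballI DERIV_isCont[OF DERIV_likS])

lemma intn_right: "(intn (<=) c d \<longlongrightarrow> intn (<=) c d r) (at_right r)"
proof -
 have "(intS (idx (<=) c r) (idx (<=) d r) c d \<longlongrightarrow> intn (<=) c d r) (at_right r)"
  unfolding intn_def using DERIV_isCont[OF DERIV_intS] by (auto simp: isCont_def filterlim_at_split)
 then show ?thesis
  by (rule Lim_transform_eventually)
   (use eventually_idx_right[of c r] eventually_idx_right[of d r] in eventually_elim, simp add: intn_def)
qed

lemma intn_left: "(intn (<=) c d \<longlongrightarrow> intn (<) c d r) (at_left r)"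
proof -
 have "(intS (idx (<) c r) (idx (<) d r) c d \<longlongrightarrow> intn (<) c d r) (at_left r)"
  unfolding intn_def using DERIV_isCont[OF DERIV_intS] by (auto simp: isCont_def filterlim_at_split)
 then show ?thesis
  by (rule Lim_transform_eventually)
   (use eventually_idx_left[of c r] eventually_idx_left[of d r] in eventually_elim, simp add: intn_def)
qed

lemma lik_right: "(lik (<=) c d \<longlongrightarrow> lik (<=) c d r) (at_right r)"
proof -
 have "(likS (idx (<=) c r) (idx (<=) d r) c d \<longlongrightarrow> lik (<=) c d r) (at_right r)"
  unfolding lik_def using DERIV_isCont[OF DERIV_likS] by (auto simp: isCont_def filterlim_at_split)
 then show ?thesis
  by (rule Lim_transform_eventually)
   (use eventually_idx_right[of c r] eventually_idx_right[of d r] in eventually_elim, simp add: lik_def)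
qed

lemma lik_left: "(lik (<=) c d \<longlongrightarrow> lik (<) c d r) (at_left r)"
proof -
 have "(likS (idx (<) c r) (idx (<) d r) c d \<longlongrightarrow> lik (<) c d r) (at_left r)"
  unfolding lik_def using DERIV_isCont[OF DERIV_likS] by (auto simp: isCont_def filterlim_at_split)
 then show ?thesis
  by (rule Lim_transform_eventually)
   (use eventually_idx_left[of c r] eventually_idx_left[of d r] in eventually_elim, simp add: lik_def)
qed

lemma intn_lik_off:
 assumes "r \<notin> times c \<union> times d"
 shows "intn (<=) c d r = intn (<) c d r" "lik (<=) c d r = lik (<) c d r"
 using assms by (auto simp: intn_def lik_def eventually_idx_nhds(2))

lemma idx_le_split: "idx (<=) c r = idx (<) c r \<union> {j\<in>{1..num c}. tm c j = r}"
 by (auto simp: idx_def)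

text \<open>A jump at time \<open>r\<close> enters with the factor 1 - exp 0 = 0.\<close>

lemma cumS_jump: "cumS (idx (<=) c r) (idx (<=) d r) c d r = cumS (idx (<) c r) (idx (<) d r) c d r"
proof -
 have "(\<Sum>j\<in>idx (<=) e r. (1 - exp (- \<alpha> * (r - tm e j))) / \<alpha> * mk e j) =
   (\<Sum>j\<in>idx (<) e r. (1 - exp (- \<alpha> * (r - tm e j))) / \<alpha> * mk e j)" for e
  unfolding idx_le_split by (rule sum.mono_neutral_right) auto
 then show ?thesis by (simp add: cumS_def)
qed

lemma cumS_eq_integral:
 assumes "config_ok T c" "config_ok T d" "0 <= t"
 shows "set_integrable lborel {0..t} (intn (<=) c d)"
  and "(LINT s:{0..t}|lborel. intn (<=) c d s) = cumS (idx (<=) c t) (idx (<=) d t) c d t"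
proof -
 note ftc = piecewise_smooth_ftc[of c d "%A B. cumS A B c d" "%A B. intS A B c d" 0 t,
   OF DERIV_cumS continuous_intS order.refl assms(3)]
 have ae: "AE r in lborel. indicator {0..t} r *\<^sub>R intn (<) c d r = indicator {0..t} r *\<^sub>R intn (<=) c d r"
 proof (rule AE_I')
  show "times c \<union> times d \<in> null_sets lborel"
   by (intro finite_imp_null_set_lborel) auto
  show "{r \<in> space lborel. indicator {0..t} r *\<^sub>R intn (<) c d r \<noteq> indicator {0..t} r *\<^sub>R intn (<=) c d r} \<subseteq> times c \<union> times d"
   by (rule subsetI, rule ccontr) (simp add: intn_lik_off)
 qed
 have i: "set_integrable lborel {0..t} (intn (<) c d)"
  using ftc(1) by (simp add: intn_def[abs_def])
 have [measurable]: "(%r. indicator {0..t} r *\<^sub>R intn (<) c d r) \<in> bm lborel"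
  using i by (auto simp: set_integrable_def)
 \<comment> \<open>The right-continuous path differs from the measurable left-continuous one at
   finitely many points, where a finite sum of point indicators corrects it.\<close>
 have "(%r. indicator {0..t} r *\<^sub>R intn (<=) c d r) \<in> bm lborel"
 proof -
  have "(%r. indicator {0..t} r *\<^sub>R intn (<) c d r +
    (\<Sum>x\<in>times c \<union> times d. indicator {x} r * (indicator {0..t} x *\<^sub>R (intn (<=) c d x - intn (<) c d x)))) \<in> bm lborel"
   by measurable
  also have "(%r. indicator {0..t} r *\<^sub>R intn (<) c d r +
    (\<Sum>x\<in>times c \<union> times d. indicator {x} r * (indicator {0..t} x *\<^sub>R (intn (<=) c d x - intn (<) c d x))))
   = (%r. indicator {0..t} r *\<^sub>R intn (<=) c d r)" (is "?l = ?r")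
  proof
   fix r
   show "?l r = ?r r"
   proof (cases "r \<in> times c \<union> times d")
    case True
    have "(\<Sum>x\<in>times c \<union> times d. indicator {x} r * (indicator {0..t} x *\<^sub>R (intn (<=) c d x - intn (<) c d x)))
     = (\<Sum>x\<in>{r}. indicator {x} r * (indicator {0..t} x *\<^sub>R (intn (<=) c d x - intn (<) c d x)))"
     by (rule sum.mono_neutral_right) (use True in \<open>auto simp: indicator_def\<close>)
    then show ?thesis by (simp add: indicator_def)
   next
    case False
    have "(\<Sum>x\<in>times c \<union> times d. indicator {x} r * (indicator {0..t} x *\<^sub>R (intn (<=) c d x - intn (<) c d x))) = 0"
     by (rule sum.neutral) (use False in \<open>auto simp: indicator_def\<close>)
    then show ?thesis using False by (simp add: intn_lik_off)
   qed
  qed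
  finally show ?thesis .
 qed
 then show "set_integrable lborel {0..t} (intn (<=) c d)"
  using i ae integrable_cong_AE[of "%r. indicator {0..t} r *\<^sub>R intn (<) c d r" lborel "%r. indicator {0..t} r *\<^sub>R intn (<=) c d r"]
  by (auto simp: set_integrable_def)
 have "idx (<=) e 0 = {}" if "config_ok T e" for e
  using that by (force simp: idx_def config_ok_def)
 then have "cumS (idx (<=) c 0) (idx (<=) d 0) c d 0 = 0" using assms by (simp add: cumS_def)
 then have "cumS (idx (<=) c t) (idx (<=) d t) c d t = (LINT r:{0..t}|lborel. intn (<) c d r)"
  using ftc(2) by (simp add: cumS_jump intn_def)
 also have "... = (LINT r:{0..t}|lborel. intn (<=) c d r)"
  unfolding set_lebesgue_integral_def
  using ae \<open>(%r. indicator {0..t} r *\<^sub>R intn (<=) c d r) \<in> bm lborel\<close>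
   \<open>(%r. indicator {0..t} r *\<^sub>R intn (<) c d r) \<in> bm lborel\<close>
  by (intro integral_cong_AE) auto
 finally show "(LINT s:{0..t}|lborel. intn (<=) c d s) = cumS (idx (<=) c t) (idx (<=) d t) c d t" by simp
qed

lemma idx_insert:
 assumes "config_ok T c" "j \<in> {1..num c}"
 shows "idx (<=) c (tm c j) = insert j (idx (<) c (tm c j))" "j \<notin> idx (<) c (tm c j)"
proof -
 have "tm c x = tm c j \<longleftrightarrow> x = j" if "x \<in> {1..num c}" for x
  using assms that by (auto simp: config_ok_def inj_on_eq_iff)
 then show "idx (<=) c (tm c j) = insert j (idx (<) c (tm c j))"
  using assms(2) by (auto simp: idx_def le_less)
qed (simp add: idx_def)

lemma jump_c:
 assumes c: "config_ok T c" and dis: "times c \<inter> times d = {}" and j: "j \<in> {1..num c}"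
 shows "idx (<=) d (tm c j) = idx (<) d (tm c j)"
  and "card (idx (<=) c (tm c j)) = Suc (card (idx (<) c (tm c j)))"
  and "intn (<=) c d (tm c j) = intn (<) c d (tm c j) + mk c j"
  and "lik (<=) c d (tm c j) = lik (<) c d (tm c j) * intn (<) c d (tm c j)"
proof -
 have "tm c j \<in> times c" using j by (auto simp: times_def)
 then show d: "idx (<=) d (tm c j) = idx (<) d (tm c j)"
  using dis by (intro eventually_idx_nhds) auto
 have i: "idx (<=) c (tm c j) = insert j (idx (<) c (tm c j))" "j \<notin> idx (<) c (tm c j)"
  using idx_insert[OF c j] by auto
 show "card (idx (<=) c (tm c j)) = Suc (card (idx (<) c (tm c j)))" using i by simp
 show "intn (<=) c d (tm c j) = intn (<) c d (tm c j) + mk c j"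
  using i d by (simp add: intn_def intS_def)
 show "lik (<=) c d (tm c j) = lik (<) c d (tm c j) * intn (<) c d (tm c j)"
  using i(2) by (simp add: lik_def likS_def cumS_jump) (simp add: i(1))
qed

text \<open>The product in \<open>likS\<close> runs over the first configuration and the integrated
  intensity is continuous, so an unobserved jump moves the intensity but not the likelihood.\<close>

lemma jump_d:
 assumes d: "config_ok T d" and dis: "times c \<inter> times d = {}" and j: "j \<in> {1..num d}"
 shows "idx (<=) c (tm d j) = idx (<) c (tm d j)"
  and "intn (<=) c d (tm d j) = intn (<) c d (tm d j) + mk d j"
  and "lik (<=) c d (tm d j) = lik (<) c d (tm d j)"
proof -
 have "tm d j \<in> times d" using j by (auto simp: times_def)
 then show c: "idx (<=) c (tm d j) = idx (<) c (tm d j)"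
  using dis by (intro eventually_idx_nhds) auto
 have i: "idx (<=) d (tm d j) = insert j (idx (<) d (tm d j))" "j \<notin> idx (<) d (tm d j)"
  using idx_insert[OF d j] by auto
 show "intn (<=) c d (tm d j) = intn (<) c d (tm d j) + mk d j"
  using i c by (simp add: intn_def intS_def)
 show "lik (<=) c d (tm d j) = lik (<) c d (tm d j)"
  using cumS_jump[of c "tm d j" d] by (simp add: lik_def likS_def c)
qed

text \<open>Ito's formula for \<open>exp (- K t) h(N\<^sub>t) L\<^sub>t g(\<lambda>\<^sub>t)\<close> along a single pair of configurations.\<close>

lemma pathwise_ito:
 fixes K :: real and h :: "nat => real"
 assumes c: "config_ok T c" and d: "config_ok T d" and dis: "times c \<inter> times d = {}"
  and g: "\<And>x. 0 < x ==> (g has_real_derivative g' x) (at x)" and g': "continuous_on {0<..} g'"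
  and st: "0 <= s" "s <= t"
 defines "Y \<equiv> %R r. exp (- K * r) * h (card (idx R c r)) * lik R c d r * g (intn R c d r)"
  and "D \<equiv> %r. exp (- K * r) * h (card (idx (<) c r)) * lik (<) c d r *
    (\<alpha> * (\<beta> - intn (<) c d r) * g' (intn (<) c d r) - (intn (<) c d r - 1 + K) * g (intn (<) c d r))"
 shows "set_integrable lborel {s..t} D"
  and "Y (<=) t - Y (<=) s = (LINT r:{s..t}|lborel. D r)
   + (\<Sum>j\<in>{j\<in>{1..num c}. s < tm c j \<and> tm c j <= t}. exp (- K * tm c j) * lik (<) c d (tm c j) *
     (h (Suc (card (idx (<) c (tm c j)))) * intn (<) c d (tm c j) * g (intn (<) c d (tm c j) + mk c j)
      - h (card (idx (<) c (tm c j))) * g (intn (<) c d (tm c j))))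
   + (\<Sum>j\<in>{j\<in>{1..num d}. s < tm d j \<and> tm d j <= t}. exp (- K * tm d j) * lik (<) c d (tm d j) *
     h (card (idx (<) c (tm d j))) * (g (intn (<) c d (tm d j) + mk d j) - g (intn (<) c d (tm d j))))"
proof -
 define VS where "VS A B r = exp (- K * r) * h (card A) * likS A B c d r * g (intS A B c d r)" for A B r
 define DS where "DS A B r = exp (- K * r) * h (card A) * likS A B c d r *
    (\<alpha> * (\<beta> - intS A B c d r) * g' (intS A B c d r) - (intS A B c d r - 1 + K) * g (intS A B c d r))" for A B r
 have ipos: "0 < intS A B c d r" if "A \<subseteq> {1..num c}" "B \<subseteq> {1..num d}" "0 <= r" for A B r
  using intS_ge_ok[OF c d that] lmin_pos by linarith
 have gc: "continuous_on {0<..} g"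
  using g DERIV_continuous_on has_field_derivative_at_within by (metis greaterThan_iff)
 have V: "(VS A B has_real_derivative DS A B r) (at r)" if "A \<subseteq> {1..num c}" "B \<subseteq> {1..num d}" "0 <= r" for A B r
 proof -
  have gi: "((%r. g (intS A B c d r)) has_real_derivative g' (intS A B c d r) * (\<alpha> * (\<beta> - intS A B c d r))) (at r)"
   by (rule DERIV_chain2[OF g[OF ipos[OF that]] DERIV_intS])
  show ?thesis unfolding VS_def DS_def
   by (rule derivative_eq_intros DERIV_likS gi refl)+ (simp add: algebra_simps)
 qed
 have Dc: "continuous_on {0..} (DS A B)" if "A \<subseteq> {1..num c}" "B \<subseteq> {1..num d}" for A B
 proof -
  have sub: "intS A B c d ` {0..} \<subseteq> {0<..}" using ipos[OF that] by auto
  have "continuous_on {0..} (%r. g (intS A B c d r))" "continuous_on {0..} (%r. g' (intS A B c d r))"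
   using continuous_on_compose2[OF gc continuous_intS sub] continuous_on_compose2[OF g' continuous_intS sub]
   by auto
  then show ?thesis unfolding DS_def by (intro continuous_intros continuous_intS continuous_likS)
 qed
 note ftc = piecewise_smooth_ftc[of c d VS DS s t, OF V Dc st]
 have Yeq: "Y R r = VS (idx R c r) (idx R d r) r" for R r
  by (simp add: Y_def VS_def lik_def intn_def)
 have Deq: "D = (%r. DS (idx (<) c r) (idx (<) d r) r)"
  by (simp add: fun_eq_iff D_def DS_def lik_def intn_def)
 show "set_integrable lborel {s..t} D" using ftc(1) by (simp add: Deq)
 let ?Jc = "{j\<in>{1..num c}. s < tm c j \<and> tm c j <= t}" and ?Jd = "{j\<in>{1..num d}. s < tm d j \<and> tm d j <= t}"
 have "{r\<in>times c \<union> times d. s < r \<and> r <= t} = tm c ` ?Jc \<union> tm d ` ?Jd"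
  by (auto simp: times_def)
 moreover have "tm c ` ?Jc \<inter> tm d ` ?Jd = {}"
 proof -
  have "tm c ` ?Jc \<subseteq> times c" "tm d ` ?Jd \<subseteq> times d" by (auto simp: times_def)
  then show ?thesis using dis by blast
 qed
 ultimately have "(\<Sum>r\<in>{r\<in>times c \<union> times d. s < r \<and> r <= t}. Y (<=) r - Y (<) r)
  = (\<Sum>r\<in>tm c ` ?Jc. Y (<=) r - Y (<) r) + (\<Sum>r\<in>tm d ` ?Jd. Y (<=) r - Y (<) r)"
  by (simp add: sum.union_disjoint)
 also have "(\<Sum>r\<in>tm c ` ?Jc. Y (<=) r - Y (<) r) = (\<Sum>j\<in>?Jc. Y (<=) (tm c j) - Y (<) (tm c j))"
  using c by (subst sum.reindex) (auto simp: config_ok_def intro: inj_on_subset)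
 also have "(\<Sum>r\<in>tm d ` ?Jd. Y (<=) r - Y (<) r) = (\<Sum>j\<in>?Jd. Y (<=) (tm d j) - Y (<) (tm d j))"
  using d by (subst sum.reindex) (auto simp: config_ok_def intro: inj_on_subset)
 also have "(\<Sum>j\<in>?Jc. Y (<=) (tm c j) - Y (<) (tm c j)) = (\<Sum>j\<in>?Jc. exp (- K * tm c j) * lik (<) c d (tm c j) *
     (h (Suc (card (idx (<) c (tm c j)))) * intn (<) c d (tm c j) * g (intn (<) c d (tm c j) + mk c j)
      - h (card (idx (<) c (tm c j))) * g (intn (<) c d (tm c j))))"
  by (intro sum.cong refl) (simp add: Y_def jump_c[OF c dis] algebra_simps)
 also have "(\<Sum>j\<in>?Jd. Y (<=) (tm d j) - Y (<) (tm d j)) = (\<Sum>j\<in>?Jd. exp (- K * tm d j) * lik (<) c d (tm d j) *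
     h (card (idx (<) c (tm d j))) * (g (intn (<) c d (tm d j) + mk d j) - g (intn (<) c d (tm d j))))"
  by (intro sum.cong refl) (simp add: Y_def jump_d[OF d dis] algebra_simps)
 finally show "Y (<=) t - Y (<=) s = (LINT r:{s..t}|lborel. D r)
   + (\<Sum>j\<in>?Jc. exp (- K * tm c j) * lik (<) c d (tm c j) *
     (h (Suc (card (idx (<) c (tm c j)))) * intn (<) c d (tm c j) * g (intn (<) c d (tm c j) + mk c j)
      - h (card (idx (<) c (tm c j))) * g (intn (<) c d (tm c j))))
   + (\<Sum>j\<in>?Jd. exp (- K * tm d j) * lik (<) c d (tm d j) *
     h (card (idx (<) c (tm d j))) * (g (intn (<) c d (tm d j) + mk d j) - g (intn (<) c d (tm d j))))"
  using ftc(2) unfolding Yeq[symmetric] Deq by simp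
qed

end

section \<open>Marked Poisson processes\<close>

text \<open>Both bounds come from exp(- x) >= 1 - x. The quadratic one makes two jumps in one cell
  of a fine mesh negligible.\<close>

lemma poisson_tail:
 assumes "0 < x"
 shows "measure (measure_pmf (poisson_pmf x)) {1..} <= x" "measure (measure_pmf (poisson_pmf x)) {2..} <= x\<^sup>2"
proof -
 have e: "1 - x <= exp (- x)" using exp_ge_add_one_self[of "- x"] by simp
 have "measure (measure_pmf (poisson_pmf x)) {1..} = 1 - measure (measure_pmf (poisson_pmf x)) {0}"
  by (subst measure_pmf.prob_compl[symmetric]) (auto intro!: arg_cong[where f="measure _"])
 then show "measure (measure_pmf (poisson_pmf x)) {1..} <= x"
  using e assms by (simp add: measure_pmf_single)
 have "measure (measure_pmf (poisson_pmf x)) {2..} = 1 - measure (measure_pmf (poisson_pmf x)) {0, 1}"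
  by (subst measure_pmf.prob_compl[symmetric]) (auto intro!: arg_cong[where f="measure _"])
 also have "measure (measure_pmf (poisson_pmf x)) {0, 1} = (1 + x) * exp (- x)"
  using assms by (simp add: measure_measure_pmf_finite algebra_simps)
 also have "1 - ... <= 1 - (1 + x) * (1 - x)"
  using e assms by (intro diff_left_mono mult_left_mono) auto
 finally show "measure (measure_pmf (poisson_pmf x)) {2..} <= x\<^sup>2"
  by (simp add: algebra_simps power2_eq_square)
qed

text \<open>By completeness every subset of a null set lies in \<open>G\<close>, so changing a
  function on a null set does not affect its measurability with respect to \<open>G\<close>.\<close>

lemma borel_measurable_AE_complete:
 assumes f: "f \<in> bm G" and ae: "AE x in M. f x = (g x :: real)"
  and "complete_measure M" "null_sets M \<subseteq> sets G" "space G = space M" "sets G \<subseteq> sets M"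
 shows "g \<in> bm G"
proof (rule measurableI)
 fix A :: "real set" assume A: "A \<in> sets borel"
 from ae obtain N where N: "N \<in> null_sets M" "{x\<in>space M. f x \<noteq> g x} \<subseteq> N"
  by (auto simp: eventually_ae_filter)
 have sub: "B \<in> sets G" if "B \<subseteq> N" for B
  using assms(3,4) N(1) that complete_measure.complete2[of M B N] by auto
 have "g -` A \<inter> space G = (f -` A \<inter> space G - N) \<union> (g -` A \<inter> space G \<inter> N)"
  using N(2) assms(5) by auto
 also have "... \<in> sets G"
  using measurable_sets[OF f A] sub by auto
 finally show "g -` A \<inter> space G \<in> sets G" .
qed simp

locale marked_poisson = prob_space Q for Q :: "'a measure" +
 fixes F :: "real => 'a measure" and T r :: real and N :: "real => 'a => nat"
  and Z :: "nat => 'a => real" and K :: "real measure"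
 assumes T_pos': "0 < T" and rate_pos: "0 < r"
  and usual': "usual_filtration Q F T"
  and poisson: "poisson_process Q F T r N"
  and Z_meas: "\<And>n. 1 <= n ==> Z n \<in> bm Q"
  and Z_pos: "\<And>n w. 1 <= n ==> w \<in> space Q ==> 0 < Z n w"
  and compensator: "has_compensator Q F T (jump_measure T N Z) r K"
  and K_distr: "real_distribution K"
begin

lemma N_zero: "w \<in> space Q ==> N 0 w = 0"
 using poisson by (simp add: poisson_process_def)

lemma N_mono: "w \<in> space Q ==> 0 <= s ==> s <= t ==> t <= T ==> N s w <= N t w"
 using poisson by (auto simp: poisson_process_def mono_on_def)

lemma N_right: "w \<in> space Q ==> 0 <= s ==> s < T ==> \<forall>\<^sub>F u in at_right s. N u w = N s w"
 using poisson by (auto simp: poisson_process_def continuous_within tendsto_discrete)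

lemma F_subalg: "t \<in> {0..T} ==> subalgebra Q (F t)"
 using usual' by (simp add: usual_filtration_def)

lemma F_mono: "0 <= s ==> s <= t ==> t <= T ==> sets (F s) \<subseteq> sets (F t)"
 using usual' by (auto simp: usual_filtration_def)

lemma space_F: "t \<in> {0..T} ==> space (F t) = space Q"
 using F_subalg by (simp add: subalgebra_def)

lemma sets_F: "t \<in> {0..T} ==> sets (F t) \<subseteq> sets Q"
 using F_subalg by (simp add: subalgebra_def)

lemma N_F: "t \<in> {0..T} ==> N t \<in> measurable (F t) (count_space UNIV)"
 using poisson by (simp add: poisson_process_def)

lemma measurable_F_mono:
 assumes "f \<in> measurable (F s) M'" "0 <= s" "s <= t" "t <= T"
 shows "f \<in> measurable (F t) M'"
 using assms F_mono[OF assms(2-4)] space_F[of s] space_F[of t] by (auto simp: measurable_def)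

lemma measurable_F_Q: "f \<in> measurable (F s) M' ==> s \<in> {0..T} ==> f \<in> measurable Q M'"
 using F_subalg measurable_from_subalg by blast

lemma N_Q: "t \<in> {0..T} ==> N t \<in> measurable Q (count_space UNIV)"
 using N_F measurable_F_Q by blast

lemma null_F: "t \<in> {0..T} ==> null_sets Q \<subseteq> sets (F t)"
proof -
 assume t: "t \<in> {0..T}"
 have "null_sets Q \<subseteq> sets (F 0)" using usual' unfolding usual_filtration_def by blast
 then show ?thesis using F_mono[of 0 t] t by auto
qed

lemma complete_Q: "complete_measure Q"
 using usual' by (simp add: usual_filtration_def)

text \<open>An integer-valued right-continuous path is constant just after each time, so the infimum
  that defines the jump time is attained. The bound \<open>j <= N T w\<close> makes the set
  nonempty.\<close>

lemma jump_time_le_iff: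
 assumes w: "w \<in> space Q" and j: "j <= N T w" and t: "t \<in> {0..T}"
 shows "jump_time N j w <= t \<longleftrightarrow> j <= N t w"
proof -
 let ?S = "{t. 0 <= t \<and> j <= N t w}"
 let ?\<tau> = "Inf ?S"
 have bdd: "bdd_below ?S" by (auto intro: bdd_belowI)
 have TS: "T \<in> ?S" using j T_pos' by auto
 have tau0: "0 <= ?\<tau>" using TS by (intro cInf_greatest) auto
 have tauT: "?\<tau> <= T" using TS bdd by (rule cInf_lower)
 have att: "j <= N ?\<tau> w"
 proof (cases "?\<tau> = T")
  case True then show ?thesis using j by simp
 next
  case False
  then have lt: "?\<tau> < T" using tauT by simp
  obtain b where b: "b > ?\<tau>" "\<And>u. ?\<tau> < u ==> u < b ==> N u w = N ?\<tau> w"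
   using N_right[OF w tau0 lt] unfolding eventually_at_right_field by auto
  obtain u where "u \<in> ?S" "u < b" using cInf_lessD[OF _ b(1)] TS by blast
  then show ?thesis using b(2)[of u] cInf_lower[OF \<open>u \<in> ?S\<close> bdd] by (cases "u = ?\<tau>") auto
 qed
 show ?thesis unfolding jump_time_def
 proof
  assume "?\<tau> <= t"
  then show "j <= N t w" using att N_mono[OF w tau0, of t] t by auto
 next
  assume "j <= N t w" then show "?\<tau> <= t" using bdd t by (intro cInf_lower) auto
 qed
qed

lemma jump_time_bounds:
 assumes w: "w \<in> space Q" and j: "j \<in> {1..N T w}"
 shows "0 < jump_time N j w" "jump_time N j w <= T"
 using jump_time_le_iff[OF w, of j 0] jump_time_le_iff[OF w, of j T] j N_zero[OF w] T_pos' by auto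

lemma increment_set:
 assumes "s \<in> {0..T}" "t \<in> {0..T}"
 shows "{w\<in>space Q. N s w + k <= N t w} \<in> sets Q"
proof -
 have [measurable]: "(%w. real (N u w)) \<in> bm Q" if "u \<in> {0..T}" for u
  using measurable_compose[OF N_Q[OF that], of real borel] by simp
 have "{w\<in>space Q. N s w + k <= N t w} = {w\<in>space Q. real (N s w) + real k <= real (N t w)}"
  by (simp flip: of_nat_add)
 also have "... \<in> sets Q" using assms by measurable
 finally show ?thesis .
qed

text \<open>\<open>poisson_process\<close> asks the paths to be monotone and right-continuous, which
  allows jumps of size two; the jump times are distinct only almost surely.\<close>

definition good :: "'a => bool" where
 "good w \<longleftrightarrow> inj_on (%j. jump_time N j w) {1..N T w}"

lemma prob_increment:
 assumes "0 <= s" "s < t" "t <= T"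
 shows "prob {w\<in>space Q. N s w + 1 <= N t w} <= r * (t - s)"
  and "prob {w\<in>space Q. N s w + 2 <= N t w} <= (r * (t - s))\<^sup>2"
proof -
 have d: "distr Q (count_space UNIV) (%w. N t w - N s w) = measure_pmf (poisson_pmf (r * (t - s)))"
  using poisson assms by (auto simp: poisson_process_def)
 have m: "(%w. N t w - N s w) \<in> measurable Q (count_space UNIV)"
 proof -
  have [measurable]: "N s \<in> measurable Q (count_space UNIV)" "N t \<in> measurable Q (count_space UNIV)"
   using N_Q[of s] N_Q[of t] assms by auto
  show ?thesis by measurable
 qed
 have "prob {w\<in>space Q. N s w + k <= N t w} = measure (measure_pmf (poisson_pmf (r * (t - s)))) {k..}" if "1 <= k" for k
 proof -
  have "{w\<in>space Q. N s w + k <= N t w} = (%w. N t w - N s w) -` {k..} \<inter> space Q"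
   using that by auto
  then show ?thesis using m by (simp add: d[symmetric] measure_distr)
 qed
 from this[of 1] this[of 2] show "prob {w\<in>space Q. N s w + 1 <= N t w} <= r * (t - s)"
  "prob {w\<in>space Q. N s w + 2 <= N t w} <= (r * (t - s))\<^sup>2"
  using poisson_tail[of "r * (t - s)"] rate_pos assms by auto
qed

lemma mesh_index:
 fixes x t :: real
 assumes "0 < x" "x <= t" "0 < n"
 obtains i where "i < n" "t * real i / real n < x" "x <= t * real (Suc i) / real n"
proof -
 define P where "P i \<longleftrightarrow> x <= t * real i / real n" for i
 have P: "P n" using assms by (simp add: P_def)
 define m where "m = (LEAST i. P i)"
 have Pm: "P m" "m <= n" unfolding m_def using P by (auto intro: LeastI Least_le)
 have "m \<noteq> 0"
 proof
  assume "m = 0" then show False using Pm(1) assms by (simp add: P_def)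
 qed
 then obtain i where i: "m = Suc i" by (cases m) auto
 have "\<not> P i" using not_less_Least[of i P] i unfolding m_def by simp
 then show thesis using that[of i] Pm i by (auto simp: P_def not_le)
qed

text \<open>Two equal jump times force an increment of at least 2 over some cell of every mesh. With
  n cells this has probability at most n (r T / n)^2, which tends to 0.\<close>

lemma AE_good: "AE w in Q. good w"
proof -
 define B where "B n = (\<Union>i<n. {w\<in>space Q. N (T * real i / real n) w + 2 <= N (T * real (Suc i) / real n) w})" for n
 have t: "T * real i / real n \<in> {0..T}" if "i <= n" for i n
  using that T_pos' by (cases "n = 0") (auto simp: field_simps)
 have B1: "{w\<in>space Q. N (T * real i / real n) w + 2 <= N (T * real (Suc i) / real n) w} \<in> sets Q" if "i < n" for i n
  using that by (intro increment_set t) auto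
 have B: "B n \<in> sets Q" for n unfolding B_def using B1 by (intro sets.finite_UN) auto
 have PB: "prob (B n) <= (r * T)\<^sup>2 / real n" if n: "0 < n" for n
 proof -
  have "prob (B n) <= (\<Sum>i<n. prob {w\<in>space Q. N (T * real i / real n) w + 2 <= N (T * real (Suc i) / real n) w})"
   unfolding B_def using B1 by (intro finite_measure_subadditive_finite) auto
  also have "... <= (\<Sum>i<n. (r * (T / real n))\<^sup>2)"
  proof (rule sum_mono)
   fix i assume "i \<in> {..<n}"
   then have "prob {w\<in>space Q. N (T * real i / real n) w + 2 <= N (T * real (Suc i) / real n) w}
    <= (r * (T * real (Suc i) / real n - T * real i / real n))\<^sup>2"
    using t[of i n] t[of "Suc i" n] n T_pos' by (intro prob_increment) (auto simp: field_simps)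
   also have "T * real (Suc i) / real n - T * real i / real n = T / real n" by (simp add: distrib_left add_divide_distrib)
   finally show "prob {w\<in>space Q. N (T * real i / real n) w + 2 <= N (T * real (Suc i) / real n) w} <= (r * (T / real n))\<^sup>2" .
  qed
  also have "... = (r * T)\<^sup>2 / real n" using n by (simp add: power2_eq_square field_simps)
  finally show ?thesis .
 qed
 let ?B = "\<Inter>n. B (Suc n)"
 have "prob ?B <= (r * T)\<^sup>2 / real (Suc n)" for n
 proof -
  have "prob ?B <= prob (B (Suc n))" using B by (intro finite_measure_mono) auto
  also have "... <= (r * T)\<^sup>2 / real (Suc n)" by (intro PB) simp
  finally show ?thesis .
 qed
 moreover have "(%n. (r * T)\<^sup>2 / real (Suc n)) \<longlonglongrightarrow> 0"
  using LIMSEQ_Suc[OF lim_const_over_n[of "(r * T)\<^sup>2"]] by simp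
 ultimately have "prob ?B <= 0" by (intro LIMSEQ_le_const) auto
 then have "prob ?B = 0" by (simp add: measure_le_0_iff)
 then have null: "?B \<in> null_sets Q" using B by (intro null_setsI) (auto simp: emeasure_eq_measure)
 show ?thesis
 proof (rule AE_I'[OF null], safe)
  fix w n assume w: "w \<in> space Q" and ng: "\<not> good w"
  then obtain j k where jk: "j \<in> {1..N T w}" "k \<in> {1..N T w}" "j < k" "jump_time N j w = jump_time N k w"
   unfolding good_def inj_on_def by (metis linorder_neqE_nat)
  obtain i where i: "i < Suc n" "T * real i / real (Suc n) < jump_time N j w" "jump_time N j w <= T * real (Suc i) / real (Suc n)"
   using mesh_index[of "jump_time N j w" T "Suc n"] jump_time_bounds[OF w jk(1)] by auto
  have "\<not> j <= N (T * real i / real (Suc n)) w" "k <= N (T * real (Suc i) / real (Suc n)) w"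
   using i jk jump_time_le_iff[OF w, of j "T * real i / real (Suc n)"] t[of i "Suc n"]
    jump_time_le_iff[OF w, of k "T * real (Suc i) / real (Suc n)"] t[of "Suc i" "Suc n"] by auto
  then show "w \<in> B (Suc n)" using i(1) w jk(3) unfolding B_def by (auto intro!: bexI[of _ i])
 qed
qed

text \<open>A jump at \<open>s\<close> is an increment over every left neighbourhood of
  \<open>s\<close>, and these increments have probabilities tending to 0. This separates the jumps
  of the second process from any given finite set of times.\<close>

lemma AE_no_jump:
 assumes s: "0 < s" "s <= T"
 shows "AE w in Q. s \<notin> (%j. jump_time N j w) ` {1..N T w}"
proof -
 define u where "u n = s * (1 - 1 / real (Suc n))" for n
 have u: "0 <= u n" "u n < s" for n using s by (auto simp: u_def field_simps)
 define B where "B n = {w\<in>space Q. N (u n) w + 1 <= N s w}" for n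
 have B: "B n \<in> sets Q" for n
  unfolding B_def using u[of n] s by (intro increment_set) auto
 let ?B = "\<Inter>n. B n"
 have "prob ?B <= r * s / real (Suc n)" for n
 proof -
  have "prob ?B <= prob (B n)" using B by (intro finite_measure_mono) auto
  also have "... <= r * (s - u n)" unfolding B_def using u s by (intro prob_increment) auto
  also have "... = r * s / real (Suc n)" by (simp add: u_def field_simps)
  finally show ?thesis .
 qed
 moreover have "(%n. r * s / real (Suc n)) \<longlonglongrightarrow> 0"
  using LIMSEQ_Suc[OF lim_const_over_n[of "r * s"]] by simp
 ultimately have "prob ?B <= 0" by (intro LIMSEQ_le_const) auto
 then have "prob ?B = 0" by (simp add: measure_le_0_iff)
 then have null: "?B \<in> null_sets Q" using B by (intro null_setsI) (auto simp: emeasure_eq_measure)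
 show ?thesis
 proof (rule AE_I'[OF null], clarsimp)
  fix w n j assume w: "w \<in> space Q" and j: "s = jump_time N j w" "Suc 0 <= j" "j <= N T w"
  have "\<not> j <= N (u n) w" "j <= N s w"
   using jump_time_le_iff[OF w j(3), of "u n"] jump_time_le_iff[OF w j(3), of s] u[of n] s j by auto
  then show "w \<in> B n" using w by (auto simp: B_def)
 qed
qed

lemma mesh_times: "i <= n ==> t \<in> {0..T} ==> t * real i / real n \<in> {0..t}"
 by (cases "n = 0") (auto simp: field_simps mult_left_mono)

text \<open>As soon as the mesh is finer than the smallest gap between jump times, no cell contains
  two jumps.\<close>

lemma eventually_unit_increments:
 assumes w: "w \<in> space Q" and g: "good w" and t: "t \<in> {0..T}"
 shows "\<forall>\<^sub>F n in sequentially. \<forall>i<n. N (t * real (Suc i) / real n) w <= Suc (N (t * real i / real n) w)"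
proof -
 let ?I = "{1..N T w}"
 have lim: "(%n. t / real n) \<longlonglongrightarrow> 0" by (rule lim_const_over_n)
 have "\<forall>\<^sub>F n in sequentially. \<forall>p\<in>?I \<times> ?I. fst p \<noteq> snd p \<longrightarrow> t / real n < \<bar>jump_time N (fst p) w - jump_time N (snd p) w\<bar>"
 proof (rule eventually_ball_finite, simp, safe)
  fix j k assume jk: "j \<in> ?I" "k \<in> ?I"
  show "\<forall>\<^sub>F n in sequentially. fst (j, k) \<noteq> snd (j, k) \<longrightarrow> t / real n < \<bar>jump_time N (fst (j, k)) w - jump_time N (snd (j, k)) w\<bar>"
  proof (cases "j = k")
   case False
   then have "0 < \<bar>jump_time N j w - jump_time N k w\<bar>"
    using g jk by (auto simp: good_def dest: inj_onD)
   then show ?thesis using order_tendstoD(2)[OF lim] by (auto elim: eventually_mono)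
  qed simp
 qed
 then show ?thesis
 proof eventually_elim
  case (elim n)
  show ?case
  proof (intro allI impI, rule ccontr)
   fix i assume i: "i < n" and ng: "\<not> N (t * real (Suc i) / real n) w <= Suc (N (t * real i / real n) w)"
   let ?a = "t * real i / real n" and ?b = "t * real (Suc i) / real n"
   let ?j = "Suc (N ?a w)"
   have ab: "?a \<in> {0..T}" "?b \<in> {0..T}"
    using mesh_times[of i n t] mesh_times[of "Suc i" n t] i t by auto
   have NT: "N ?b w <= N T w" using ab by (intro N_mono[OF w]) auto
   have "?a < jump_time N ?j w" "jump_time N ?j w <= ?b" "?a < jump_time N (Suc ?j) w" "jump_time N (Suc ?j) w <= ?b"
    using jump_time_le_iff[OF w, of ?j ?a] jump_time_le_iff[OF w, of ?j ?b] ab ng NT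
     jump_time_le_iff[OF w, of "Suc ?j" ?a] jump_time_le_iff[OF w, of "Suc ?j" ?b] by (auto simp: not_le)
   then have "\<bar>jump_time N ?j w - jump_time N (Suc ?j) w\<bar> <= ?b - ?a" by linarith
   also have "?b - ?a = t / real n" by (simp add: distrib_left add_divide_distrib)
   also have "... < \<bar>jump_time N ?j w - jump_time N (Suc ?j) w\<bar>"
    using elim[rule_format, of "(?j, Suc ?j)"] ng NT by auto
   finally show False by simp
  qed
 qed
qed

text \<open>A way to read the \<open>j\<close>-th term off the partial sums: exactly one cell takes
  the count from \<open>j - 1\<close> to \<open>j\<close>, and there the sum grows by that term. It
  makes single marks measurable when only their sums are known to be so.\<close>

lemma mesh_jump_unique:
 assumes w: "w \<in> space Q" and t: "t \<in> {0..T}" and n: "0 < n"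
  and unit: "\<forall>i<n. N (t * real (Suc i) / real n) w <= Suc (N (t * real i / real n) w)"
  and j: "1 <= j"
 shows "(\<Sum>i<n. if N (t * real i / real n) w = j - 1 \<and> N (t * real (Suc i) / real n) w = j
   then (\<Sum>k=1..N (t * real (Suc i) / real n) w. v k) - (\<Sum>k=1..N (t * real i / real n) w. v k) else (0::real))
  = (if j <= N t w then v j else 0)"
proof -
 let ?t = "%i. t * real i / real n"
 let ?P = "%i. N (?t i) w = j - 1 \<and> N (?t (Suc i)) w = j"
 have mono: "N (?t a) w <= N (?t b) w" if "a <= b" "b <= n" for a b
 proof (rule N_mono[OF w])
  show "0 <= ?t a" using t by simp
  show "?t a <= ?t b" using that t by (simp add: divide_right_mono mult_left_mono)
  show "?t b <= T" using mesh_times[OF that(2) t] t by auto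
 qed
 have val: "(\<Sum>k=1..N (?t (Suc i)) w. v k) - (\<Sum>k=1..N (?t i) w. v k) = v j" if "?P i" for i
  using that j by (cases j) auto
 have tn: "?t n = t" using n by simp
 show ?thesis
 proof (cases "j <= N t w")
  case True
  define m where "m = (LEAST i. j <= N (?t i) w)"
  have m: "j <= N (?t m) w" "m <= n" unfolding m_def
   using True tn by (auto intro: LeastI[of _ n] Least_le)
  have "m \<noteq> 0" using m(1) j N_zero[OF w] by (auto intro!: Nat.gr0I)
  then obtain i where i: "m = Suc i" by (cases m) auto
  have less: "N (?t i) w < j" using not_less_Least[of i "%i. j <= N (?t i) w"] i unfolding m_def by simp
  have "i < n" using m i by simp
  moreover have "N (?t (Suc i)) w <= Suc (N (?t i) w)" using unit \<open>i < n\<close> by blast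
  ultimately have Pi: "?P i" "i < n" using m(1) less unfolding i by linarith+
  have uniq: "i' = i" if "?P i'" "i' < n" for i'
  proof (rule ccontr)
   assume "i' \<noteq> i"
   then consider "Suc i' <= i" | "Suc i <= i'" by linarith
   then show False using mono[of "Suc i'" i] mono[of "Suc i" i'] that Pi j by cases auto
  qed
  have "(\<Sum>i<n. if ?P i then (\<Sum>k=1..N (?t (Suc i)) w. v k) - (\<Sum>k=1..N (?t i) w. v k) else 0)
   = (\<Sum>i'<n. if i' = i then v j else 0)"
  proof (intro sum.cong refl)
   fix i' assume "i' \<in> {..<n}"
   then have "?P i' \<longleftrightarrow> i' = i" using uniq[of i'] Pi(1) by blast
   then show "(if ?P i' then (\<Sum>k=1..N (?t (Suc i')) w. v k) - (\<Sum>k=1..N (?t i') w. v k) else 0) = (if i' = i then v j else 0)"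
    using val[OF Pi(1)] by (simp only: if_True if_False split: if_split) simp
  qed
  then show ?thesis using True Pi by simp
 next
  case False
  have "\<not> ?P i" if "i < n" for i using mono[of "Suc i" n] that False tn by auto
  then show ?thesis using False
   by (simp only: if_False) (intro sum.neutral ballI, simp only: lessThan_iff if_False)
 qed
qed

text \<open>With positive terms the partial sum grows exactly on the cells that contain a jump, so
  the count can be read off the sums. This is applied to \<open>C\<close>, from which the count has
  to be recovered.\<close>

lemma mesh_count:
 assumes w: "w \<in> space Q" and t: "t \<in> {0..T}" and n: "0 < n"
  and unit: "\<forall>i<n. N (t * real (Suc i) / real n) w <= Suc (N (t * real i / real n) w)"
  and v: "\<And>k. 1 <= k ==> 0 < (v k :: real)"
 shows "(\<Sum>i<n. if (\<Sum>k=1..N (t * real i / real n) w. v k) < (\<Sum>k=1..N (t * real (Suc i) / real n) w. v k)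
   then 1 else (0::real)) = real (N t w)"
proof -
 let ?t = "%i. t * real i / real n"
 have "(if (\<Sum>k=1..N (?t i) w. v k) < (\<Sum>k=1..N (?t (Suc i)) w. v k) then 1 else (0::real))
  = real (N (?t (Suc i)) w) - real (N (?t i) w)" if i: "i < n" for i
 proof -
  have "N (?t i) w <= N (?t (Suc i)) w"
  proof (rule N_mono[OF w])
   show "0 <= ?t i" using t by simp
   show "?t i <= ?t (Suc i)" using t by (simp add: divide_right_mono mult_left_mono)
   show "?t (Suc i) <= T" using mesh_times[of "Suc i" n t] t i by auto
  qed
  then have "N (?t (Suc i)) w = N (?t i) w \<or> N (?t (Suc i)) w = Suc (N (?t i) w)"
   using unit i by (auto simp: le_Suc_eq simp del: of_nat_Suc)
  then show ?thesis using v[of "Suc (N (?t i) w)"] by (auto simp del: of_nat_Suc)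
 qed
 then have "(\<Sum>i<n. if (\<Sum>k=1..N (?t i) w. v k) < (\<Sum>k=1..N (?t (Suc i)) w. v k) then 1 else (0::real))
  = (\<Sum>i<n. real (N (?t (Suc i)) w) - real (N (?t i) w))" by (intro sum.cong) auto
 also have "... = real (N (?t n) w) - real (N (?t 0) w)"
  using sum_lessThan_telescope[of "%i. real (N (?t i) w)" n] by simp
 also have "... = real (N t w)" using n N_zero[OF w] by simp
 finally show ?thesis .
qed

end

section \<open>Measurability of random configurations, coordinate by coordinate\<close>

definition cfg_meas :: "'b measure => ('b => config) => bool" where
 "cfg_meas M c \<longleftrightarrow> (%x. num (c x)) \<in> measurable M (count_space UNIV) \<and>
  (\<forall>j. (%x. tm (c x) j) \<in> bm M \<and> (%x. mk (c x) j) \<in> bm M)"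

lemma cfg_meas_const: "cfg_meas M (%_. c)"
 by (simp add: cfg_meas_def)

lemma cfg_meas_compose: "cfg_meas M c ==> f \<in> measurable M' M ==> cfg_meas M' (%x. c (f x))"
 by (auto simp: cfg_meas_def intro: measurable_compose[rotated])

lemma sum_idx: "sum f (idx R c r) = (\<Sum>j=1..num c. if R (tm c j) r then f j else (0::real))"
 unfolding idx_def by (rule sum.inter_filter) simp

lemma prod_idx: "prod f (idx R c r) = (\<Prod>j=1..num c. if R (tm c j) r then f j else (1::real))"
 unfolding idx_def by (rule prod.inter_filter) simp

lemma cfg_meas_sum:
 assumes c: "cfg_meas M c" and f: "\<And>j. (%x. f j x :: real) \<in> bm M"
 shows "(%x. \<Sum>j=1..num (c x). f j x) \<in> bm M"
 using c f measurable_compose_countable[of "%n x. \<Sum>j=1..n. f j x" M borel "%x. num (c x)"]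
 by (simp add: cfg_meas_def)

lemma cfg_meas_prod:
 assumes c: "cfg_meas M c" and f: "\<And>j. (%x. f j x :: real) \<in> bm M"
 shows "(%x. \<Prod>j=1..num (c x). f j x) \<in> bm M"
 using c f measurable_compose_countable[of "%n x. \<Prod>j=1..n. f j x" M borel "%x. num (c x)"]
 by (simp add: cfg_meas_def)

definition is_ord :: "(real => real => bool) => bool" where "is_ord R \<longleftrightarrow> R = (<) \<or> R = (<=)"

lemma is_ord [simp]: "is_ord (<)" "is_ord (<=)" by (auto simp: is_ord_def)

lemma cfg_meas_pred:
 assumes "cfg_meas M c" "r \<in> bm M" "is_ord R"
 shows "Measurable.pred M (%x. R (tm (c x) j) (r x))"
proof -
 have [measurable]: "(%x. tm (c x) j) \<in> bm M" "r \<in> bm M"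
  using assms by (auto simp: cfg_meas_def)
 from assms(3) show ?thesis unfolding is_ord_def
 proof
  assume "R = (<)" then show ?thesis by simp
 next
  assume "R = (<=)" then show ?thesis by simp
 qed
qed

lemma cfg_meas_card:
 assumes c: "cfg_meas M c" and r: "r \<in> bm M" and R: "is_ord R"
 shows "(%x. card (idx R (c x) (r x))) \<in> measurable M (count_space UNIV)"
proof -
 have [measurable]: "Measurable.pred M (%x. R (tm (c x) j) (r x))" for j by (rule cfg_meas_pred[OF c r R])
 have "(%x. real (card (idx R (c x) (r x)))) = (%x. \<Sum>j=1..num (c x). if R (tm (c x) j) (r x) then 1 else 0)"
  by (simp only: sum_idx[of "%_. 1", symmetric]) simp
 also have "... \<in> bm M" by (intro cfg_meas_sum[OF c]) measurable
 finally have "(%x. real (card (idx R (c x) (r x)))) \<in> bm M" .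
 from measurable_compose[OF measurable_compose[OF this measurable_real_floor], of nat "count_space UNIV"]
 show ?thesis by simp
qed

context intensity
begin

lemma meas_intn:
 assumes c: "cfg_meas M c" and d: "cfg_meas M d" and r: "r \<in> bm M" and R: "is_ord R"
 shows "(%x. intn R (c x) (d x) (r x)) \<in> bm M"
proof -
 note [measurable] = r
 have 1: "(%x. \<Sum>j=1..num (e x). if R (tm (e x) j) (r x) then exp (- \<alpha> * (r x - tm (e x) j)) * mk (e x) j else 0) \<in> bm M"
  if e: "cfg_meas M e" for e
 proof -
  have [measurable]: "Measurable.pred M (%x. R (tm (e x) j) (r x))" for j by (rule cfg_meas_pred[OF e r R])
  have [measurable]: "(%x. tm (e x) j) \<in> bm M" "(%x. mk (e x) j) \<in> bm M" for j
   using e by (auto simp: cfg_meas_def)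
  show ?thesis by (intro cfg_meas_sum[OF e]) measurable
 qed
 have [measurable]: "(%x. \<Sum>j\<in>idx R (c x) (r x). exp (- \<alpha> * (r x - tm (c x) j)) * mk (c x) j) \<in> bm M"
  "(%x. \<Sum>j\<in>idx R (d x) (r x). exp (- \<alpha> * (r x - tm (d x) j)) * mk (d x) j) \<in> bm M"
  using 1[OF c] 1[OF d] unfolding sum_idx by auto
 show ?thesis unfolding intn_def intS_def by measurable
qed

lemma meas_lik:
 assumes c: "cfg_meas M c" and d: "cfg_meas M d" and r: "r \<in> bm M" and R: "is_ord R"
 shows "(%x. lik R (c x) (d x) (r x)) \<in> bm M"
proof -
 note [measurable] = r
 have 1: "(%x. \<Sum>j=1..num (e x). if R (tm (e x) j) (r x) then (1 - exp (- \<alpha> * (r x - tm (e x) j))) / \<alpha> * mk (e x) j else 0) \<in> bm M"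
  if e: "cfg_meas M e" for e
 proof -
  have [measurable]: "Measurable.pred M (%x. R (tm (e x) j) (r x))" for j by (rule cfg_meas_pred[OF e r R])
  have [measurable]: "(%x. tm (e x) j) \<in> bm M" "(%x. mk (e x) j) \<in> bm M" for j
   using e by (auto simp: cfg_meas_def)
  show ?thesis by (intro cfg_meas_sum[OF e]) measurable
 qed
 have [measurable]: "(%x. \<Sum>j\<in>idx R (c x) (r x). (1 - exp (- \<alpha> * (r x - tm (c x) j))) / \<alpha> * mk (c x) j) \<in> bm M"
  "(%x. \<Sum>j\<in>idx R (d x) (r x). (1 - exp (- \<alpha> * (r x - tm (d x) j))) / \<alpha> * mk (d x) j) \<in> bm M"
  using 1[OF c] 1[OF d] unfolding sum_idx by auto
 have [measurable]: "Measurable.pred M (%x. R (tm (c x) j) (r x))" for j by (rule cfg_meas_pred[OF c r R])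
 have [measurable]: "(%x. intn (<) (c x) (d x) (tm (c x) j)) \<in> bm M" for j
  using c by (intro meas_intn c d) (auto simp: cfg_meas_def)
 have [measurable]: "(%x. \<Prod>j\<in>idx R (c x) (r x). intn (<) (c x) (d x) (tm (c x) j)) \<in> bm M"
  unfolding prod_idx by (intro cfg_meas_prod[OF c]) measurable
 show ?thesis unfolding lik_def likS_def cumS_def by measurable
qed

lemma intn_cong_left:
 assumes "idx R c' u = idx R c u" "\<And>j. j \<in> idx R c u ==> snd c' j = snd c j"
 shows "intn R c' d u = intn R c d u"
 unfolding intn_def intS_def using assms by (simp add: tm_def mk_def cong: sum.cong)

lemma intn_cong_right:
 assumes "idx R d' u = idx R d u" "\<And>j. j \<in> idx R d u ==> snd d' j = snd d j"
 shows "intn R c d' u = intn R c d u"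
 unfolding intn_def intS_def using assms by (simp add: tm_def mk_def cong: sum.cong)

text \<open>Non-anticipation: intensity and likelihood at \<open>t\<close> look only at the jumps up
  to \<open>t\<close>. Together with \<open>stopc\<close> this makes them adapted.\<close>

lemma lik_cong_left:
 assumes "is_ord R" and a: "\<And>u R. u <= t ==> is_ord R ==> idx R c' u = idx R c u"
  "\<And>j. j \<in> idx (<=) c t ==> snd c' j = snd c j"
 shows "lik R c' d t = lik R c d t" "intn R c' d t = intn R c d t"
proof -
 have s: "idx R c u \<subseteq> idx (<=) c t" if "u <= t" "is_ord R" for u R
  using that by (auto simp: idx_def is_ord_def)
 have i: "intn R c' d u = intn R c d u" if "u <= t" "is_ord R" for u R
  using a s[OF that] that by (intro intn_cong_left) auto
 show "intn R c' d t = intn R c d t" using assms(1) by (intro i) auto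
 have j: "tm c' j = tm c j" "mk c' j = mk c j" "tm c j <= t" if "j \<in> idx R c t" for j
 proof -
  have j: "j \<in> idx (<=) c t" using s[OF order_refl assms(1)] that by blast
  then show "tm c' j = tm c j" "mk c' j = mk c j" using a(2)[OF j] by (simp_all add: tm_def mk_def)
  show "tm c j <= t" using j by (simp add: idx_def)
 qed
 have "(\<Prod>j\<in>idx R c t. intn (<) c' d (tm c' j)) = (\<Prod>j\<in>idx R c t. intn (<) c d (tm c j))"
  using j i[OF _ is_ord(1)] by (intro prod.cong refl) simp
 moreover have "cumS (idx R c t) B c' d t = cumS (idx R c t) B c d t" for B
  using j by (simp add: cumS_def cong: sum.cong)
 ultimately show "lik R c' d t = lik R c d t"
  unfolding lik_def likS_def using a(1)[of t R] assms(1) by simp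
qed

lemma lik_cong_right:
 assumes "is_ord R" and a: "\<And>u R. u <= t ==> is_ord R ==> idx R d' u = idx R d u"
  "\<And>j. j \<in> idx (<=) d t ==> snd d' j = snd d j"
 shows "lik R c d' t = lik R c d t" "intn R c d' t = intn R c d t"
proof -
 have s: "idx R d u \<subseteq> idx (<=) d t" if "u <= t" "is_ord R" for u R
  using that by (auto simp: idx_def is_ord_def)
 have i: "intn R c d' u = intn R c d u" if "u <= t" "is_ord R" for u R
  using a s[OF that] that by (intro intn_cong_right) auto
 show "intn R c d' t = intn R c d t" using assms(1) by (intro i) auto
 have j: "tm d' j = tm d j" "mk d' j = mk d j" if "j \<in> idx R d t" for j
 proof -
  have j: "j \<in> idx (<=) d t" using s[OF order_refl assms(1)] that by blast
  then show "tm d' j = tm d j" "mk d' j = mk d j" using a(2)[OF j] by (simp_all add: tm_def mk_def)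
 qed
 have "(\<Prod>j\<in>idx R c t. intn (<) c d' (tm c j)) = (\<Prod>j\<in>idx R c t. intn (<) c d (tm c j))"
 proof (intro prod.cong refl)
  fix j assume "j \<in> idx R c t"
  then have "tm c j <= t" using assms(1) by (auto simp: idx_def is_ord_def)
  then show "intn (<) c d' (tm c j) = intn (<) c d (tm c j)" by (rule i) simp
 qed
 moreover have "cumS A (idx R d t) c d' t = cumS A (idx R d t) c d t" for A
  using j by (simp add: cumS_def cong: sum.cong)
 ultimately show "lik R c d' t = lik R c d t"
  unfolding lik_def likS_def using a(1)[of t R] assms(1) by simp
qed

end

text \<open>Used with \<open>n\<close> the number of jumps up to \<open>t\<close>: the result is
  measurable from the past of \<open>t\<close> and has the same jumps as the original up to
  \<open>t\<close>. Constants in the other entries keep every coordinate measurable.\<close>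

definition stopc :: "real => nat => config => config" where
 "stopc U n c = (n, %j. if 1 <= j \<and> j <= n then snd c j else (U, 0))"

lemma idx_stopc:
 assumes "idx (<=) c t = {1..n}" "u <= t" "is_ord R"
 shows "idx R (stopc U n c) u = idx R c u"
proof -
 have "R (tm c j) u ==> j \<in> {1..num c} ==> j \<in> {1..n}" for j
  using assms(2,3) unfolding assms(1)[symmetric] by (auto simp: idx_def is_ord_def)
 moreover have "{1..n} \<subseteq> {1..num c}" unfolding assms(1)[symmetric] using idx_in_Pow by blast
 ultimately show ?thesis
  by (auto simp: idx_def stopc_def num_def tm_def)
qed

lemma snd_stopc: "idx (<=) c t = {1..n} ==> j \<in> idx (<=) c t ==> snd (stopc U n c) j = snd c j"
 by (simp add: stopc_def)

context marked_poisson
begin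

text \<open>The default values are those of \<open>stopc (T + 1)\<close>, so that stopping at the
  horizon changes nothing.\<close>

definition cfg :: "(real => real) => 'a => config" where
 "cfg ph w = (N T w, %j. if 1 <= j \<and> j <= N T w then (jump_time N j w, ph (Z j w)) else (T + 1, 0))"

lemma num_cfg [simp]: "num (cfg ph w) = N T w"
 by (simp add: num_def cfg_def)

lemma tm_cfg: "1 <= j ==> j <= N T w ==> tm (cfg ph w) j = jump_time N j w"
 by (simp add: tm_def cfg_def)

lemma mk_cfg: "1 <= j ==> j <= N T w ==> mk (cfg ph w) j = ph (Z j w)"
 by (simp add: mk_def cfg_def)

lemma idx_cfg:
 assumes "w \<in> space Q" "t \<in> {0..T}"
 shows "idx (<=) (cfg ph w) t = {1..N t w}"
proof -
 have "N t w <= N T w" using assms by (intro N_mono) auto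
 then show ?thesis using jump_time_le_iff[OF assms(1) _ assms(2)]
  by (auto simp: idx_def tm_cfg)
qed

lemma config_ok_cfg:
 assumes w: "w \<in> space Q" and "good w" and ph: "\<And>z. 0 < z ==> 0 <= ph z"
 shows "config_ok T (cfg ph w)"
proof -
 have "inj_on (tm (cfg ph w)) {1..N T w}"
  using assms(2) unfolding good_def by (rule inj_on_cong[THEN iffD1, rotated]) (simp add: tm_cfg)
 then show ?thesis unfolding config_ok_def
  using jump_time_bounds[OF w] Z_pos[OF _ w] ph by (auto simp: tm_cfg mk_cfg)
qed

lemma times_cfg: "times (cfg ph w) = (%j. jump_time N j w) ` {1..N T w}"
 unfolding times_def by (auto simp: tm_cfg intro!: image_cong)

text \<open>What a sigma-algebra must know to make the configuration stopped at \<open>t\<close>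
  measurable: the counts, and the marks of the jumps that have occurred. It is verified for
  \<open>Q\<close>, for \<open>F t\<close>, for the generated \<open>G1\<close> and
  \<open>G2\<close> and for the completed observations \<open>Hbar t\<close>.\<close>

definition obs :: "'a measure => real => bool" where
 "obs G t \<longleftrightarrow> space G = space Q \<and> (\<forall>s\<in>{0..t}. N s \<in> measurable G (count_space UNIV)) \<and>
  (\<forall>j\<ge>1. (%w. if j <= N t w then Z j w else 0) \<in> bm G)"

lemma cfg_meas_stop:
 assumes G: "obs G t" and t: "t \<in> {0..T}" and ph: "ph \<in> bm (restrict_space borel {0..})"
 shows "cfg_meas G (%w. stopc (T + 1) (N t w) (cfg ph w))"
proof -
 have sp: "space G = space Q" using G by (simp add: obs_def)
 have Nm: "N s \<in> measurable G (count_space UNIV)" if "s \<in> {0..t}" for s using G that by (auto simp: obs_def)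
 have Nt [measurable]: "N t \<in> measurable G (count_space UNIV)" using Nm[of t] t by auto
 have NT: "N t w <= N T w" if "w \<in> space Q" for w using t that by (intro N_mono) auto
 let ?c = "%w. stopc (T + 1) (N t w) (cfg ph w)"
 have tmeq: "tm (?c w) j = (if 1 <= j \<and> j <= N t w then jump_time N j w else T + 1)"
  and mkeq: "mk (?c w) j = (if 1 <= j \<and> j <= N t w then ph (Z j w) else 0)" if "w \<in> space Q" for w j
  using NT[OF that] by (auto simp: stopc_def tm_def mk_def cfg_def)
 have set: "{w\<in>space G. j <= N s w} \<in> sets G" if "s \<in> {0..t}" for s j
 proof -
  have [measurable]: "N s \<in> measurable G (count_space UNIV)" using Nm that by auto
  show ?thesis by measurable
 qed
 have "(%w. tm (?c w) j) \<in> bm G" for j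
  unfolding borel_measurable_iff_le
 proof
  fix x
  have iff: "jump_time N j w <= x \<longleftrightarrow> j <= N (min x t) w"
   if "w \<in> space Q" "1 <= j" "j <= N t w" "0 <= x" for w
   using jump_time_le_iff[OF that(1), of j "min x t"] jump_time_le_iff[OF that(1), of j t] NT[OF that(1)] t that
   by (auto simp: min_def split: if_splits)
  \<comment> \<open>In the first three cases the event is trivial, because jump times lie in (0, T]
    and the default is \<open>T + 1\<close>. In the last one it says that the \<open>j\<close>-th
    jump has occurred by \<open>min x t\<close>.\<close>
  consider "T + 1 <= x" | "x < 0" | "j = 0" "x < T + 1" | "1 <= j" "0 <= x" "x < T + 1" by linarith
  then show "{w\<in>space G. tm (?c w) j <= x} \<in> sets G"
  proof cases
   case 1
   have "{w\<in>space G. tm (?c w) j <= x} = space G"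
   proof -
    have "tm (?c w) j <= x" if "w \<in> space Q" for w
     using jump_time_bounds(2)[OF that, of j] NT[OF that] 1 by (auto simp: tmeq[OF that])
    then show ?thesis using sp by auto
   qed
   then show ?thesis by simp
  next
   case 2
   have "{w\<in>space G. tm (?c w) j <= x} = {}"
   proof -
    have "\<not> tm (?c w) j <= x" if "w \<in> space Q" for w
     using jump_time_bounds(1)[OF that, of j] NT[OF that] 2 T_pos' by (auto simp: tmeq[OF that])
    then show ?thesis using sp by blast
   qed
   then show ?thesis by (metis sets.empty_sets)
  next
   case 3
   have "\<not> tm (?c w) j <= x" if "w \<in> space Q" for w using tmeq[OF that] 3 by simp
   then have "{w\<in>space G. tm (?c w) j <= x} = {}" using sp by blast
   then show ?thesis by (metis sets.empty_sets)
  next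
   case 4
   have "{w\<in>space G. tm (?c w) j <= x} = {w\<in>space G. j <= N (min x t) w}"
   proof -
    have "tm (?c w) j <= x \<longleftrightarrow> j <= N (min x t) w" if w: "w \<in> space Q" for w
    proof (cases "j <= N t w")
     case True then show ?thesis using iff[OF w] 4 by (simp add: tmeq[OF w])
    next
     case False
     then show ?thesis using N_mono[OF w, of "min x t" t] t 4 by (auto simp: tmeq[OF w])
    qed
    then show ?thesis using sp by auto
   qed
   then show ?thesis using set[of "min x t" j] 4 t by simp
  qed
 qed
 moreover have "(%w. mk (?c w) j) \<in> bm G" for j
 proof (cases "1 <= j")
  case True
  define W where "W = (%w. if j <= N t w then Z j w else 0)"
  have "W \<in> bm G" using G True by (simp add: obs_def W_def)
  then have "W \<in> measurable G (restrict_space borel {0..})"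
   using sp less_imp_le[OF Z_pos[OF True]] by (intro measurable_restrict_space2) (auto simp: W_def)
  then have [measurable]: "(%w. ph (W w)) \<in> bm G" using ph by (rule measurable_compose)
  have "(%w. if j <= N t w then ph (W w) else 0) \<in> bm G" by measurable
  then show ?thesis
   by (rule measurable_cong[THEN iffD1, rotated]) (use True in \<open>auto simp: mkeq sp W_def\<close>)
 next
  case False
  have "mk (?c w) j = 0" if "w \<in> space G" for w using False that sp by (simp add: mkeq)
  then show ?thesis by (simp cong: measurable_cong)
 qed
 ultimately show ?thesis unfolding cfg_meas_def using Nt by (simp add: num_def stopc_def)
qed

lemma stopc_cfg_T: "stopc (T + 1) (N T w) (cfg ph w) = cfg ph w"
 by (auto simp: stopc_def cfg_def)

lemma cfg_meas_cfg:
 assumes "obs G T" "ph \<in> bm (restrict_space borel {0..})"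
 shows "cfg_meas G (cfg ph)"
 using cfg_meas_stop[OF assms(1) _ assms(2)] T_pos' by (simp add: stopc_cfg_T)

lemma obs_Q: "obs Q T"
proof -
 have [measurable]: "N T \<in> measurable Q (count_space UNIV)" using N_Q T_pos' by auto
 show ?thesis unfolding obs_def using N_Q Z_meas by auto
qed

lemma jump_measure_count:
 assumes w: "w \<in> space Q" and t: "t \<in> {0..T}" and A: "A \<in> sets borel"
 shows "measure (jump_measure T N Z w) ({0<..t} \<times> A) = (\<Sum>k=1..N t w. indicator A (Z k w))"
proof -
 have "(%j. (jump_time N j w, Z j w)) -` ({0<..t} \<times> A) \<inter> {1..N T w} = {k \<in> {1..N t w}. Z k w \<in> A}"
  using jump_time_bounds[OF w] jump_time_le_iff[OF w _ t] N_mono[OF w, of t T] t by auto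
 then have "measure (jump_measure T N Z w) ({0<..t} \<times> A) = real (card {k \<in> {1..N t w}. Z k w \<in> A})"
 proof -
  have "{k \<in> {1..N t w}. Z k w \<in> A} \<subseteq> {1..N T w}" using N_mono[OF w, of t T] t by auto
  then have "measure (count_space {1..N T w}) {k \<in> {1..N t w}. Z k w \<in> A} = real (card {k \<in> {1..N t w}. Z k w \<in> A})"
   by (subst measure_def, subst emeasure_count_space_finite) (auto simp: enn2real_of_nat)
  moreover assume "(%j. (jump_time N j w, Z j w)) -` ({0<..t} \<times> A) \<inter> {1..N T w} = {k \<in> {1..N t w}. Z k w \<in> A}"
  moreover have "(%j. (jump_time N j w, Z j w)) \<in> measurable (count_space {1..N T w}) (borel >< borel)"
   by (simp add: space_pair_measure)
  ultimately show ?thesis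
   unfolding jump_measure_def using A by (subst measure_distr) auto
 qed
 also have "... = (\<Sum>k\<in>{k \<in> {1..N t w}. Z k w \<in> A}. 1)" by simp
 also have "... = (\<Sum>k=1..N t w. if Z k w \<in> A then 1 else 0)"
  by (rule sum.inter_filter) simp
 also have "... = (\<Sum>k=1..N t w. indicator A (Z k w))"
  by (intro sum.cong refl) (simp add: indicator_def)
 finally show ?thesis .
qed

definition cnt :: "real set => real => 'a => real" where
 "cnt A t w = (\<Sum>k=1..N t w. indicator A (Z k w))"

lemma cnt_F:
 assumes t: "t \<in> {0..T}" and A: "A \<in> sets borel"
 shows "cnt A t \<in> bm (F t)" "integrable Q (cnt A t)"
proof -
 let ?X = "%w. measure (jump_measure T N Z w) ({0<..t} \<times> A) - r * measure K A * t"
 have "?X \<in> bm (F t)" "integrable Q ?X"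
  using compensator t A unfolding has_compensator_def martingale_on_def by auto
 then have "(%w. ?X w + r * measure K A * t) \<in> bm (F t)" "integrable Q (%w. ?X w + r * measure K A * t)"
  using borel_measurable_add[OF _ borel_measurable_const, of ?X "F t" "r * measure K A * t"]
   Bochner_Integration.integrable_add[OF _ integrable_const, of ?X "r * measure K A * t"] by auto
 then have m: "(%w. measure (jump_measure T N Z w) ({0<..t} \<times> A)) \<in> bm (F t)"
   and i: "integrable Q (%w. measure (jump_measure T N Z w) ({0<..t} \<times> A))" by auto
 show "cnt A t \<in> bm (F t)"
  using m by (rule measurable_cong[THEN iffD1, rotated]) (simp add: space_F[OF t] cnt_def jump_measure_count[OF _ t A])
 show "integrable Q (cnt A t)"
  using i by (rule Bochner_Integration.integrable_cong[OF refl, THEN iffD1, rotated]) (simp add: cnt_def jump_measure_count[OF _ t A])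
qed

text \<open>The martingale property tested on a set of \<open>F a\<close>. This is Campbell's
  formula on a predictable rectangle.\<close>

lemma increment_identity:
 assumes t: "0 <= a" "a <= b" "b <= T" and A: "A \<in> sets borel" and G: "G \<in> sets (F a)"
 shows "lint Q (%w. indicator G w * (cnt A b w - cnt A a w)) = r * measure K A * (b - a) * prob G"
proof -
 have ab: "a \<in> {0..T}" "b \<in> {0..T}" using t by auto
 interpret sub: finite_measure_subalgebra Q "F a"
  by unfold_locales (rule F_subalg[OF ab(1)])
 let ?X = "%t w. cnt A t w - r * measure K A * t"
 have "martingale_on Q F T (%t w. measure (jump_measure T N Z w) ({0<..t} \<times> A) - r * measure K A * t)"
  using compensator A by (simp add: has_compensator_def)
 then have "AE w in Q. real_cond_exp Q (F a) (%w. measure (jump_measure T N Z w) ({0<..b} \<times> A) - r * measure K A * b) w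
   = measure (jump_measure T N Z w) ({0<..a} \<times> A) - r * measure K A * a"
  using t ab by (auto simp: martingale_on_def)
 moreover have "AE w in Q. real_cond_exp Q (F a) (%w. measure (jump_measure T N Z w) ({0<..b} \<times> A) - r * measure K A * b) w
   = real_cond_exp Q (F a) (?X b) w"
 proof (rule sub.real_cond_exp_cong)
  have "(%w. ?X b w) \<in> bm Q" using cnt_F(2)[OF ab(2) A] by auto
  then show "(%w. measure (jump_measure T N Z w) ({0<..b} \<times> A) - r * measure K A * b) \<in> bm Q"
   using jump_measure_count[OF _ ab(2) A] by (simp add: cnt_def cong: measurable_cong)
  show "?X b \<in> bm Q" by fact
 qed (use jump_measure_count[OF _ ab(2) A] in \<open>simp add: cnt_def\<close>)
 ultimately have ce: "AE w in Q. real_cond_exp Q (F a) (?X b) w = ?X a w"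
  using AE_space by eventually_elim (use jump_measure_count[OF _ ab(1) A] in \<open>simp add: cnt_def\<close>)
 have GQ: "G \<in> sets Q" using G sets_F[OF ab(1)] by auto
 have int: "integrable Q (?X t)" if "t \<in> {0..T}" for t using cnt_F(2)[OF that A] by auto
 have "(\<integral>w\<in>G. ?X b w \<partial>Q) = (\<integral>w\<in>G. real_cond_exp Q (F a) (?X b) w \<partial>Q)"
  by (rule sub.real_cond_exp_intA[OF int[OF ab(2)] G])
 also have "... = (\<integral>w\<in>G. ?X a w \<partial>Q)"
  using ce GQ int[OF ab(1)] unfolding set_lebesgue_integral_def
  by (intro integral_cong_AE) (auto intro!: borel_measurable_integrable)
 finally have eq: "lint Q (%w. indicator G w * ?X b w) = lint Q (%w. indicator G w * ?X a w)"
  by (simp add: set_lebesgue_integral_def)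
 have i2: "integrable Q (%w. indicator G w * ?X t w)" if "t \<in> {0..T}" for t
  using integrable_mult_indicator[OF GQ int[OF that]] by simp
 have i3: "integrable Q (%w. indicator G w * (r * measure K A * (b - a)))"
  using GQ by (intro integrable_mult_left) (simp add: emeasure_eq_measure)
 have "lint Q (%w. indicator G w * (cnt A b w - cnt A a w))
  = lint Q (%w. indicator G w * ?X b w - indicator G w * ?X a w + indicator G w * (r * measure K A * (b - a)))"
  by (intro Bochner_Integration.integral_cong refl) (simp add: algebra_simps)
 also have "... = lint Q (%w. indicator G w * (r * measure K A * (b - a)))"
  using i2[OF ab(1)] i2[OF ab(2)] i3 eq by (simp add: Bochner_Integration.integral_add Bochner_Integration.integral_diff)
 also have "... = r * measure K A * (b - a) * prob G" using GQ by simp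
 finally show ?thesis .
qed

text \<open>By \<open>mesh_jump_unique\<close> the term is almost surely a limit of expressions in
  counts and partial sums on a mesh, and the exceptional null set belongs to \<open>G\<close>. The
  freedom in \<open>v\<close> covers both the marks and the indicators of marks.\<close>

lemma obs_from_marks:
 assumes G: "space G = space Q" "sets G \<subseteq> sets Q" "null_sets Q \<subseteq> sets G" and t: "t \<in> {0..T}"
  and N: "\<And>s. s \<in> {0..t} ==> N s \<in> measurable G (count_space UNIV)"
  and V: "\<And>s. s \<in> {0..t} ==> (%w. \<Sum>k=1..N s w. v k w) \<in> bm G"
  and j: "1 <= j"
 shows "(%w. if j <= N t w then v j w else (0::real)) \<in> bm G"
proof -
 let ?t = "%n i. t * real i / real n"
 define W where "W n w = (\<Sum>i<n. if N (?t n i) w = j - 1 \<and> N (?t n (Suc i)) w = j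
   then (\<Sum>k=1..N (?t n (Suc i)) w. v k w) - (\<Sum>k=1..N (?t n i) w. v k w) else 0)" for n w
 have mW: "W n \<in> bm G" for n
  unfolding W_def
 proof (intro borel_measurable_sum)
  fix i assume "i \<in> {..<n}"
  then have i: "?t n i \<in> {0..t}" "?t n (Suc i) \<in> {0..t}"
   using mesh_times[of i n t] mesh_times[of "Suc i" n t] t by auto
  note [measurable] = N[OF i(1)] N[OF i(2)] V[OF i(1)] V[OF i(2)]
  show "(%w. if N (?t n i) w = j - 1 \<and> N (?t n (Suc i)) w = j
   then (\<Sum>k=1..N (?t n (Suc i)) w. v k w) - (\<Sum>k=1..N (?t n i) w. v k w) else 0) \<in> bm G"
   by measurable
 qed
 have lim: "(%n. W n w) \<longlonglongrightarrow> (if j <= N t w then v j w else 0)" if "w \<in> space Q" "good w" for w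
 proof (rule tendsto_eventually)
  show "\<forall>\<^sub>F n in sequentially. W n w = (if j <= N t w then v j w else 0)"
   using eventually_unit_increments[OF that t] eventually_gt_at_top[of 0]
  proof eventually_elim
   case (elim n)
   then show ?case unfolding W_def using mesh_jump_unique[OF that(1) t _ _ j] by blast
  qed
 qed
 have "(%w. lim (%n. W n w)) \<in> bm G" using mW by (rule borel_measurable_lim_metric)
 moreover have "AE w in Q. lim (%n. W n w) = (if j <= N t w then v j w else 0)"
  using AE_good AE_space by eventually_elim (rule limI[OF lim])
 ultimately show ?thesis
  by (rule borel_measurable_AE_complete) (use G complete_Q in auto)
qed

text \<open>Adaptedness of the marks is not an axiom; it is extracted from the compensator. The
  martingale is adapted, hence so is the number of marks in each Borel set \<open>A\<close>, hence
  so is the event that the \<open>j\<close>-th jump has occurred with mark in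
  \<open>A\<close>.\<close>

lemma obs_F:
 assumes t: "t \<in> {0..T}"
 shows "obs (F t) t"
 unfolding obs_def
proof (intro conjI ballI allI impI)
 show "space (F t) = space Q" by (rule space_F[OF t])
 show Ns: "N s \<in> measurable (F t) (count_space UNIV)" if "s \<in> {0..t}" for s
  using that t by (intro measurable_F_mono[OF N_F[of s]]) auto
 fix j :: nat assume j: "1 <= j"
 show "(%w. if j <= N t w then Z j w else 0) \<in> bm (F t)"
 proof (rule measurableI)
  fix A :: "real set" assume A: "A \<in> sets borel"
  have m: "(%w. if j <= N t w then indicator A (Z j w) else (0::real)) \<in> bm (F t)"
  proof (rule obs_from_marks[OF space_F[OF t] sets_F[OF t] null_F[OF t] t Ns _ j])
   fix s assume s: "s \<in> {0..t}"
   then show "(%w. \<Sum>k=1..N s w. indicator A (Z k w) :: real) \<in> bm (F t)"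
    using cnt_F(1)[of s A] A t measurable_F_mono[of "cnt A s" s borel t] by (auto simp: cnt_def[abs_def])
  qed auto
  have [measurable]: "N t \<in> measurable (F t) (count_space UNIV)" using N_F t by auto
  \<comment> \<open>Before the \<open>j\<close>-th jump the value is 0, which contributes to the
    preimage exactly if 0 lies in \<open>A\<close>.\<close>
  have "(%w. if j <= N t w then Z j w else 0) -` A \<inter> space (F t) =
   (%w. if j <= N t w then indicator A (Z j w) else (0::real)) -` {1} \<inter> space (F t) \<union>
   (if 0 \<in> A then {w\<in>space (F t). \<not> j <= N t w} else {})" (is "?L = ?R")
  proof (rule set_eqI)
   fix w show "w \<in> ?L \<longleftrightarrow> w \<in> ?R"
    by (cases "j <= N t w"; cases "Z j w \<in> A"; cases "0 \<in> A") simp_all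
  qed
  also have "... \<in> sets (F t)"
  proof (intro sets.Un)
   show "(%w. if j <= N t w then indicator A (Z j w) else (0::real)) -` {1} \<inter> space (F t) \<in> sets (F t)"
    by (rule measurable_sets[OF m]) simp
   have "{w\<in>space (F t). \<not> j <= N t w} \<in> sets (F t)" by measurable
   then show "(if 0 \<in> A then {w\<in>space (F t). \<not> j <= N t w} else {}) \<in> sets (F t)" by (simp split: if_split)
  qed
  finally show "(%w. if j <= N t w then Z j w else 0) -` A \<inter> space (F t) \<in> sets (F t)" .
 qed simp
qed

end

context marked_poisson
begin

section \<open>Campbell's formula\<close>

definition pred_gen :: "(real \<times> 'a) set set" where
 "pred_gen = {{a<..b} \<times> G | a b G. 0 <= a \<and> a <= b \<and> b <= T \<and> G \<in> sets (F a)}"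

text \<open>The predictable sigma-algebra on (0, T] x Omega: in a generating rectangle the
  information \<open>F a\<close> precedes every time in it.\<close>

definition Pred :: "(real \<times> 'a) measure" where
 "Pred = sigma ({0<..T} \<times> space Q) pred_gen"

lemma pred_gen_Pow: "pred_gen \<subseteq> Pow ({0<..T} \<times> space Q)"
proof
 fix X assume "X \<in> pred_gen"
 then obtain a b G where X: "X = {a<..b} \<times> G" "0 <= a" "a <= b" "b <= T" "G \<in> sets (F a)"
  by (auto simp: pred_gen_def)
 have "G \<subseteq> space Q" using X sets.sets_into_space[of G "F a"] space_F[of a] by auto
 then show "X \<in> Pow ({0<..T} \<times> space Q)" using X by auto
qed

lemma space_Pred [simp]: "space Pred = {0<..T} \<times> space Q"
 unfolding Pred_def using pred_gen_Pow by (simp add: space_measure_of_conv)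

lemma sets_Pred: "sets Pred = sigma_sets ({0<..T} \<times> space Q) pred_gen"
 unfolding Pred_def using pred_gen_Pow by simp

lemma rect_Pred: "0 <= a ==> a <= b ==> b <= T ==> G \<in> sets (F a) ==> {a<..b} \<times> G \<in> sets Pred"
 unfolding sets_Pred by (rule sigma_sets.Basic) (auto simp: pred_gen_def)

lemma step_Pred:
 assumes ab: "0 <= a" "a <= b" "b <= T" and Y: "Y \<in> bm (F a)"
 shows "(%(t, w). indicator {a<..b} t * Y w :: real) \<in> bm Pred"
proof (rule measurableI)
 fix A :: "real set" assume A: "A \<in> sets borel"
 have sF: "space (F a) = space Q" using ab by (intro space_F) auto
 let ?S = "{a<..b} \<times> space Q"
 have S: "?S \<in> sets Pred" using sets.top[of "F a"] ab by (intro rect_Pred) (auto simp: sF)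
 have Y1: "{a<..b} \<times> (Y -` A \<inter> space Q) \<in> sets Pred"
  using measurable_sets[OF Y A] ab by (intro rect_Pred) (auto simp: sF)
 have "(%(t, w). indicator {a<..b} t * Y w) -` A \<inter> space Pred =
  {a<..b} \<times> (Y -` A \<inter> space Q) \<union> (if 0 \<in> A then space Pred - ?S else {})"
  (is "?L = ?R")
 proof (rule set_eqI)
  fix p :: "real \<times> 'a"
  obtain t w where p: "p = (t, w)" by (cases p)
  show "p \<in> ?L \<longleftrightarrow> p \<in> ?R"
  proof (cases "a < t \<and> t <= b")
   case True
   then have "0 < t" "t <= T" "indicator {a<..b} t = (1::real)" using ab by auto
   then show ?thesis using True by (auto simp: p)
  next
   case False
   then have "indicator {a<..b} t = (0::real)" by auto
   then show ?thesis using False by (auto simp: p)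
  qed
 qed
 also have "... \<in> sets Pred" using sets.Un[OF Y1 sets.Diff[OF sets.top S]] Y1 by (simp split: if_split)
 finally show "(%(t, w). indicator {a<..b} t * Y w) -` A \<inter> space Pred \<in> sets Pred" .
qed simp

text \<open>The value at \<open>t\<close> is the limit of the values at the last mesh points before
  \<open>t\<close>, and the corresponding step processes are predictable.\<close>

lemma left_cont_Pred:
 assumes X: "\<And>t. t \<in> {0..T} ==> X t \<in> bm (F t)"
  and lc: "\<And>w t. w \<in> space Q ==> 0 < t ==> t <= T ==> ((%s. X s w) \<longlongrightarrow> X t w) (at_left t)"
 shows "(%p. X (fst p) (snd p) :: real) \<in> bm Pred"
proof (rule borel_measurable_LIMSEQ_real)
 let ?t = "%n i. T * real i / real (Suc n)"
 let ?X = "%n p. \<Sum>i<Suc n. indicator {?t n i<..?t n (Suc i)} (fst p) * X (?t n i) (snd p)"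
 have tT: "?t n i \<in> {0..T}" if "i <= Suc n" for n i
  using mesh_times[OF that, of T] T_pos' by auto
 have tmono: "?t n i <= ?t n j" if "i <= j" for n i j
  using that T_pos' by (simp add: divide_right_mono)
 show "?X n \<in> bm Pred" for n
 proof (rule borel_measurable_sum)
  fix i assume "i \<in> {..<Suc n}"
  then have "(%(t, w). indicator {?t n i<..?t n (Suc i)} t * X (?t n i) w) \<in> bm Pred"
   using tT[of i n] tT[of "Suc i" n] tmono[of i "Suc i" n] by (intro step_Pred X) auto
  then show "(%p. indicator {?t n i<..?t n (Suc i)} (fst p) * X (?t n i) (snd p)) \<in> bm Pred"
   by (simp add: case_prod_beta')
 qed
 fix p assume "p \<in> space Pred"
 then obtain t w where p: "p = (t, w)" "0 < t" "t <= T" "w \<in> space Q" by auto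
 have "\<exists>i. i < Suc n \<and> ?t n i < t \<and> t <= ?t n (Suc i)" for n
  using mesh_index[OF p(2,3), of "Suc n"] by (metis zero_less_Suc)
 then obtain i where i: "\<And>n. i n < Suc n" "\<And>n. ?t n (i n) < t" "\<And>n. t <= ?t n (Suc (i n))" by metis
 have eq: "?X n p = X (?t n (i n)) w" for n
 proof -
  have "j = i n" if "?t n j < t" "t <= ?t n (Suc j)" for j
  proof (rule ccontr)
   assume "j \<noteq> i n"
   then consider "Suc j <= i n" | "Suc (i n) <= j" by linarith
   then show False
    using tmono[of "Suc j" "i n" n] tmono[of "Suc (i n)" j n] that i(2,3)[of n] by cases linarith+
  qed
  then have "indicator {?t n j<..?t n (Suc j)} t = (if j = i n then 1 else (0::real))" for j
  proof (cases "j = i n")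
   case True
   then show ?thesis using i(2,3)[of n] by (simp only: greaterThanAtMost_iff indicator_simps simp_thms if_True)
  next
   case False
   then have "t \<notin> {?t n j<..?t n (Suc j)}" using \<open>\<And>j. ?t n j < t ==> t <= ?t n (Suc j) ==> j = i n\<close>[of j]
    unfolding greaterThanAtMost_iff by blast
   from indicator_simps(2)[OF this] show ?thesis using False by (simp only: if_False)
  qed
  then have "?X n p = (\<Sum>j<Suc n. if j = i n then X (?t n j) w else 0)"
   unfolding p by (intro sum.cong refl) simp
  then show ?thesis using i(1)[of n] by simp
 qed
 have "(%n. ?t n (i n)) \<longlonglongrightarrow> t"
 proof (rule tendsto_sandwich)
  show "(%n. t - T / real (Suc n)) \<longlonglongrightarrow> t"
   using tendsto_diff[OF tendsto_const LIMSEQ_Suc[OF lim_const_over_n[of T]], of t] by simp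
  have "t - T / real (Suc n) <= ?t n (i n)" for n
   using i(3)[of n] by (simp add: distrib_left add_divide_distrib)
  then show "\<forall>\<^sub>F n in sequentially. t - T / real (Suc n) <= ?t n (i n)" by simp
  show "\<forall>\<^sub>F n in sequentially. ?t n (i n) <= t" using less_imp_le[OF i(2)] by (intro always_eventually allI)
 qed simp
 then have "filterlim (%n. ?t n (i n)) (at_left t) sequentially"
  using i(2) by (subst filterlim_at) (auto simp del: of_nat_Suc intro!: always_eventually dest: less_imp_neq)
 from filterlim_compose[OF lc[OF p(4,2,3)] this]
 have "(%n. ?X n p) \<longlonglongrightarrow> X t w" unfolding eq .
 then show "(%n. ?X n p) \<longlonglongrightarrow> X (fst p) (snd p)" by (simp only: p(1) fst_conv snd_conv)
qed

text \<open>Total versions of jump times and marks. The default \<open>T\<close> keeps the time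
  inside (0, T], the time axis of \<open>Pred\<close>.\<close>

definition jt :: "nat => 'a => real" where
 "jt j w = (if 1 <= j \<and> j <= N T w then jump_time N j w else T)"

definition jz :: "nat => 'a => real" where
 "jz j w = (if 1 <= j \<and> j <= N T w then Z j w else 0)"

lemma jt_meas [measurable]: "jt j \<in> bm Q"
proof -
 have [measurable]: "(%w. tm (cfg (%_. 0) w) j) \<in> bm Q"
  using cfg_meas_cfg[OF obs_Q, of "%_. 0"] by (auto simp: cfg_meas_def)
 have [measurable]: "N T \<in> measurable Q (count_space UNIV)" using N_Q T_pos' by auto
 have "(%w. if 1 <= j \<and> j <= N T w then tm (cfg (%_. 0) w) j else T) \<in> bm Q" by measurable
 then show ?thesis by (rule measurable_cong[THEN iffD1, rotated]) (simp add: jt_def tm_cfg)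
qed

lemma jz_meas [measurable]: "jz j \<in> bm Q"
proof (cases "1 <= j")
 case True
 have [measurable]: "N T \<in> measurable Q (count_space UNIV)" "Z j \<in> bm Q" using N_Q T_pos' Z_meas True by auto
 show ?thesis unfolding jz_def by measurable
next
 case False then show ?thesis by (simp add: jz_def[abs_def])
qed

lemma jt_bounds: "w \<in> space Q ==> 0 < jt j w \<and> jt j w <= T"
 using jump_time_bounds[of w j] T_pos' by (auto simp: jt_def)

lemma campbell_map_meas:
 "(%p. ((jt (snd p) (fst p), fst p), jz (snd p) (fst p))) \<in> measurable (Q >< count_space UNIV) (Pred >< borel)"
proof (rule measurable_Pair)
 have 1: "(%p. jt (snd p) (fst p)) \<in> bm (Q >< count_space UNIV)"
  by (rule measurable_compose_countable[of "%j p. jt j (fst p)"]) measurable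
 show "(%p. jz (snd p) (fst p)) \<in> bm (Q >< count_space UNIV)"
  by (rule measurable_compose_countable[of "%j p. jz j (fst p)"]) measurable
 show "(%p. (jt (snd p) (fst p), fst p)) \<in> measurable (Q >< count_space UNIV) Pred"
  unfolding Pred_def
 proof (rule measurable_measure_of[OF pred_gen_Pow])
  show "(%p. (jt (snd p) (fst p), fst p)) \<in> space (Q >< count_space UNIV) \<rightarrow> {0<..T} \<times> space Q"
   using jt_bounds by (auto simp: space_pair_measure)
  fix y assume "y \<in> pred_gen"
  then obtain a b G where y: "y = {a<..b} \<times> G" "0 <= a" "a <= b" "b <= T" "G \<in> sets (F a)"
   by (auto simp: pred_gen_def)
  have G: "G \<in> sets Q" using y sets_F[of a] by auto
  have "(%p. (jt (snd p) (fst p), fst p)) -` y \<inter> space (Q >< count_space UNIV)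
   = {p\<in>space (Q >< count_space UNIV). a < jt (snd p) (fst p) \<and> jt (snd p) (fst p) <= b \<and> fst p \<in> G}"
   using y by auto
  also have "... \<in> sets (Q >< count_space UNIV)" using 1 G by measurable
  finally show "(%p. (jt (snd p) (fst p), fst p)) -` y \<inter> space (Q >< count_space UNIV) \<in> sets (Q >< count_space UNIV)" .
 qed
qed

definition LT :: "real measure" where "LT = restrict_space lborel {0<..T}"

lemma finite_LT: "finite_measure LT"
 unfolding LT_def by (rule finite_measureI) (use T_pos' in \<open>simp add: emeasure_restrict_space space_restrict_space\<close>)

lemma id_Pred: "(%x. x) \<in> measurable (LT >< Q) Pred"
 unfolding Pred_def
proof (rule measurable_measure_of[OF pred_gen_Pow])
 show "(%x. x) \<in> space (LT >< Q) \<rightarrow> {0<..T} \<times> space Q"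
  by (auto simp: space_pair_measure LT_def space_restrict_space)
 fix y assume "y \<in> pred_gen"
 then obtain a b G where y: "y = {a<..b} \<times> G" "0 <= a" "a <= b" "b <= T" "G \<in> sets (F a)"
  by (auto simp: pred_gen_def)
 have G: "G \<in> sets Q" using y sets_F[of a] by auto
 have "{a<..b} \<in> sets LT" using y unfolding LT_def sets_restrict_space by (auto intro!: image_eqI[of _ _ "{a<..b}"])
 then have "y \<in> sets (LT >< Q)" using G y by auto
 then show "(%x. x) -` y \<inter> space (LT >< Q) \<in> sets (LT >< Q)" by auto
qed

text \<open>The Doleans measure of the marked process: an integral against it is the expected sum
  over all jumps. \<open>mu_comp\<close> is its counterpart for the compensator, and Campbell's
  formula is their equality.\<close>

definition mu_jump :: "((real \<times> 'a) \<times> real) measure" where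
 "mu_jump = distr (density (Q >< count_space UNIV) (%p. indicator {1..N T (fst p)} (snd p))) (Pred >< borel)
  (%p. ((jt (snd p) (fst p), fst p), jz (snd p) (fst p)))"

definition mu_comp :: "((real \<times> 'a) \<times> real) measure" where
 "mu_comp = scale_measure (ennreal r) (distr (LT >< Q) Pred (%x. x) >< K)"

lemma sets_K [simp]: "sets K = sets borel"
 using K_distr by (auto simp: real_distribution_def real_distribution_axioms_def)

lemma space_K [simp]: "space K = UNIV"
 using sets_eq_imp_space_eq[OF sets_K] by simp

lemma prob_space_K: "prob_space K"
 using K_distr by (simp add: real_distribution_def)

lemma ind_meas: "(%p. indicator {1..N T (fst p)} (snd p) :: ennreal) \<in> bm (Q >< count_space UNIV)"
proof -
 have [measurable]: "N T \<in> measurable Q (count_space UNIV)" using N_Q T_pos' by auto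
 have "(%p. if 1 <= snd p \<and> snd p <= N T (fst p) then 1 else 0 :: ennreal) \<in> bm (Q >< count_space UNIV)"
  by (rule measurable_compose_countable[of "%j p. if 1 <= j \<and> j <= N T (fst p) then 1 else 0"]) measurable
 then show ?thesis by (rule measurable_cong[THEN iffD1, rotated]) (auto simp: indicator_def)
qed

lemma nn_integral_mu_jump:
 assumes H: "H \<in> bm (Pred >< borel)"
 shows "nni mu_jump (%p. H p) = nni Q (%w. (\<Sum>j=1..N T w. H ((jump_time N j w, w), Z j w)))"
proof -
 let ?f = "%p. ((jt (snd p) (fst p), fst p), jz (snd p) (fst p))"
 interpret C: sigma_finite_measure "count_space (UNIV::nat set)"
  by (rule sigma_finite_measure_count_space)
 have m: "(%p. H (?f p)) \<in> bm (Q >< count_space UNIV)"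
  using measurable_compose[OF campbell_map_meas H] .
 have m': "(%p. indicator {1..N T (fst p)} (snd p) * H (?f p)) \<in> bm (Q >< count_space UNIV)"
  using m ind_meas by (rule borel_measurable_times_ennreal[rotated])
 have "nni mu_jump (%p. H p) = nni (density (Q >< count_space UNIV) (%p. indicator {1..N T (fst p)} (snd p))) (%p. H (?f p))"
  unfolding mu_jump_def using campbell_map_meas H by (intro nn_integral_distr) auto
 also have "... = nni (Q >< count_space UNIV) (%p. indicator {1..N T (fst p)} (snd p) * H (?f p))"
  using m ind_meas by (intro nn_integral_density) auto
 also have "... = nni Q (%w. nni (count_space UNIV) (%j. indicator {1..N T w} j * H (?f (w, j))))"
  by (subst C.nn_integral_fst[OF m', symmetric]) simp
 also have "... = nni Q (%w. (\<Sum>j=1..N T w. H ((jump_time N j w, w), Z j w)))"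
 proof (intro nn_integral_cong)
  fix w
  have "nni (count_space UNIV) (%j. indicator {1..N T w} j * H (?f (w, j))) = nni (count_space UNIV) (%j. H (?f (w, j)) * indicator {1..N T w} j)"
   by (simp add: mult.commute)
  also have "... = nni (count_space {1..N T w}) (%j. H (?f (w, j)))"
   by (simp add: nn_integral_count_space_indicator)
  also have "... = (\<Sum>j=1..N T w. H (?f (w, j)))" by (rule nn_integral_count_space_finite) simp
  also have "... = (\<Sum>j=1..N T w. H ((jump_time N j w, w), Z j w))"
   by (intro sum.cong refl) (simp add: jt_def jz_def)
  finally show "nni (count_space UNIV) (%j. indicator {1..N T w} j * H (?f (w, j))) = (\<Sum>j=1..N T w. H ((jump_time N j w, w), Z j w))" .
 qed
 finally show ?thesis .
qed

lemma nn_integral_mu_comp: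
 assumes H: "H \<in> bm (Pred >< borel)"
 shows "nni mu_comp (%p. H p) = ennreal r * nni Q (%w. (\<integral>\<^sup>+t\<in>{0<..T}. nni K (%z. H ((t, w), z)) \<partial>lborel))"
proof -
 interpret K: prob_space K by (rule prob_space_K)
 interpret LT: finite_measure LT by (rule finite_LT)
 interpret LQ: pair_sigma_finite LT Q ..
 have H': "H \<in> bm (distr (LT >< Q) Pred (%x. x) >< K)"
  using H by (subst measurable_cong_sets[OF sets_pair_measure_cong refl]) auto
 have m: "(%x. nni K (%z. H (x, z))) \<in> bm Pred"
  using K.borel_measurable_nn_integral_fst[of H Pred] H
  by (subst (asm) measurable_cong_sets[OF sets_pair_measure_cong refl]) auto
 have m2: "(%x. nni K (%z. H (x, z))) \<in> bm (LT >< Q)"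
  using measurable_compose[OF id_Pred m] .
 have "nni mu_comp (%p. H p) = ennreal r * nni ((distr (LT >< Q) Pred (%x. x) >< K)) (%p. H p)"
  unfolding mu_comp_def using H' by (intro nn_integral_scale_measure) auto
 also have "nni ((distr (LT >< Q) Pred (%x. x) >< K)) (%p. H p) = nni (distr (LT >< Q) Pred (%x. x)) (%x. nni K (%z. H (x, z)))"
  using K.nn_integral_fst[OF H'] by simp
 also have "... = nni (LT >< Q) (%x. nni K (%z. H (x, z)))"
  using m id_Pred by (subst nn_integral_distr) auto
 also have "... = nni Q (%w. nni LT (%t. nni K (%z. H ((t, w), z))))"
  using LQ.nn_integral_snd[OF m2] by simp
 also have "... = nni Q (%w. (\<integral>\<^sup>+t\<in>{0<..T}. nni K (%z. H ((t, w), z)) \<partial>lborel))"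
  unfolding LT_def by (intro nn_integral_cong nn_integral_restrict_space) simp
 finally show ?thesis .
qed

lemma Pred_borel_generator:
 "sets (Pred >< (borel :: real measure)) = sigma_sets (({0<..T} \<times> space Q) \<times> UNIV) {a \<times> b | a b. a \<in> pred_gen \<and> b \<in> sets (borel :: real measure)}"
proof -
 have "{0<..T} \<times> space Q \<in> pred_gen"
  unfolding pred_gen_def using T_pos' sets.top[of "F 0"] space_F[of 0]
  by (intro CollectI exI[of _ 0] exI[of _ T] exI[of _ "space Q"]) auto
 then have c: "\<exists>E\<subseteq>pred_gen. countable E \<and> {0<..T} \<times> space Q = \<Union>E"
  by (intro exI[of _ "{{0<..T} \<times> space Q}"]) auto
 have "sets (Pred >< (borel :: real measure)) = sets (sigma ({0<..T} \<times> space Q) pred_gen >< sigma UNIV (sets (borel :: real measure)))"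
  unfolding Pred_def by (intro sets_pair_measure_cong refl) (metis sets.sets_measure_of_eq space_borel)
 also have "... = sets (sigma (({0<..T} \<times> space Q) \<times> UNIV) {a \<times> b | a b. a \<in> pred_gen \<and> b \<in> sets (borel :: real measure)})"
  by (subst sigma_prod[OF c pred_gen_Pow]) (auto intro!: exI[of _ "{UNIV}"])
 also have "... = sigma_sets (({0<..T} \<times> space Q) \<times> UNIV) {a \<times> b | a b. a \<in> pred_gen \<and> b \<in> sets (borel :: real measure)}"
  using pred_gen_Pow by (subst sets_measure_of) auto
 finally show ?thesis .
qed

lemma pred_gen_Int: "X \<in> pred_gen ==> Y \<in> pred_gen ==> X \<inter> Y \<in> pred_gen"
proof -
 assume "X \<in> pred_gen" "Y \<in> pred_gen"
 then obtain a b G a' b' G' where X: "X = {a<..b} \<times> G" "0 <= a" "a <= b" "b <= T" "G \<in> sets (F a)"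
  and Y: "Y = {a'<..b'} \<times> G'" "0 <= a'" "a' <= b'" "b' <= T" "G' \<in> sets (F a')"
  by (auto simp: pred_gen_def)
 \<comment> \<open>The outer maximum keeps the endpoints ordered when the two time intervals are
   disjoint; the interval is then empty.\<close>
 let ?a = "max a a'" and ?b = "max (max a a') (min b b')"
 have "G \<in> sets (F ?a)" "G' \<in> sets (F ?a)"
  using F_mono[of a ?a] F_mono[of a' ?a] X Y by (auto simp: max_def split: if_splits)
 moreover have "X \<inter> Y = {?a<..?b} \<times> (G \<inter> G')"
  using X(1) Y(1) by (auto simp: max_def min_def split: if_splits)
 moreover have "0 <= ?a" "?a <= ?b" "?b <= T" using X Y by auto
 ultimately show "X \<inter> Y \<in> pred_gen" unfolding pred_gen_def by blast
qed

lemma mu_jump_rect: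
 assumes ab: "0 <= a" "a <= b" "b <= T" "G \<in> sets (F a)" and A: "A \<in> sets borel"
 shows "emeasure mu_jump (({a<..b} \<times> G) \<times> A) = ennreal (r * measure K A * (b - a) * prob G)"
proof -
 have R: "({a<..b} \<times> G) \<times> A \<in> sets (Pred >< borel)" using rect_Pred[OF ab] A by auto
 have abT: "a \<in> {0..T}" "b \<in> {0..T}" using ab by auto
 have "emeasure mu_jump (({a<..b} \<times> G) \<times> A) = nni mu_jump (%p. indicator (({a<..b} \<times> G) \<times> A) p)"
  using R by (simp add: mu_jump_def)
 also have "... = nni Q (%w. (\<Sum>j=1..N T w. indicator (({a<..b} \<times> G) \<times> A) ((jump_time N j w, w), Z j w)))"
  using R by (intro nn_integral_mu_jump) auto
 also have "... = nni Q (%w. ennreal (indicator G w * (cnt A b w - cnt A a w)))"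
 proof (intro nn_integral_cong)
  fix w assume w: "w \<in> space Q"
  have Nab: "N a w <= N b w" "N b w <= N T w" using N_mono[OF w] ab by auto
  have "(\<Sum>j=1..N T w. indicator (({a<..b} \<times> G) \<times> A) ((jump_time N j w, w), Z j w) :: ennreal)
   = (\<Sum>j=1..N T w. ennreal (indicator G w * (if N a w < j \<and> j <= N b w then indicator A (Z j w) else 0)))"
  proof (intro sum.cong refl)
   fix j assume j: "j \<in> {1..N T w}"
   have "a < jump_time N j w \<longleftrightarrow> N a w < j" "jump_time N j w <= b \<longleftrightarrow> j <= N b w"
    using jump_time_le_iff[OF w _ abT(1), of j] jump_time_le_iff[OF w _ abT(2), of j] j by auto
   then show "(indicator (({a<..b} \<times> G) \<times> A) ((jump_time N j w, w), Z j w) :: ennreal)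
    = ennreal (indicator G w * (if N a w < j \<and> j <= N b w then indicator A (Z j w) else 0))"
    by (auto simp: indicator_def)
  qed
  also have "... = ennreal (\<Sum>j=1..N T w. indicator G w * (if N a w < j \<and> j <= N b w then indicator A (Z j w) else 0))"
   by (intro sum_ennreal) (auto simp: indicator_def)
  also have "(\<Sum>j=1..N T w. indicator G w * (if N a w < j \<and> j <= N b w then indicator A (Z j w) else 0))
   = indicator G w * (\<Sum>j\<in>{j\<in>{1..N T w}. N a w < j \<and> j <= N b w}. indicator A (Z j w) :: real)"
   by (simp only: sum_distrib_left[symmetric] sum.inter_filter[OF finite_atLeastAtMost])
  also have "{j\<in>{1..N T w}. N a w < j \<and> j <= N b w} = {1..N b w} - {1..N a w}" using Nab by auto
  also have "(\<Sum>j\<in>{1..N b w} - {1..N a w}. indicator A (Z j w)) = cnt A b w - cnt A a w"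
   unfolding cnt_def using Nab by (intro sum_diff) auto
  finally show "(\<Sum>j=1..N T w. indicator (({a<..b} \<times> G) \<times> A) ((jump_time N j w, w), Z j w))
   = ennreal (indicator G w * (cnt A b w - cnt A a w))" .
 qed
 also have "... = ennreal (lint Q (%w. indicator G w * (cnt A b w - cnt A a w)))"
 proof (rule nn_integral_eq_integral)
  have G: "G \<in> sets Q" using ab sets_F[OF abT(1)] by auto
  show "integrable Q (%w. indicator G w * (cnt A b w - cnt A a w))"
   using integrable_mult_indicator[OF G Bochner_Integration.integrable_diff[OF cnt_F(2)[OF abT(2) A] cnt_F(2)[OF abT(1) A]]] by simp
  have "0 <= cnt A b w - cnt A a w" if "w \<in> space Q" for w
   unfolding cnt_def using N_mono[OF that, of a b] ab by (auto intro!: sum_mono2)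
  then show "AE w in Q. 0 <= indicator G w * (cnt A b w - cnt A a w)"
   by (intro AE_I2) (simp add: mult_nonneg_nonneg)
 qed
 finally show ?thesis by (simp only: increment_identity[OF ab(1-3) A ab(4)])
qed

lemma mu_comp_rect:
 assumes ab: "0 <= a" "a <= b" "b <= T" "G \<in> sets (F a)" and A: "A \<in> sets borel"
 shows "emeasure mu_comp (({a<..b} \<times> G) \<times> A) = ennreal (r * measure K A * (b - a) * prob G)"
proof -
 interpret K: prob_space K by (rule prob_space_K)
 interpret LT: finite_measure LT by (rule finite_LT)
 have abT: "a \<in> {0..T}" using ab by auto
 have G: "G \<in> sets Q" using ab sets_F[OF abT] by auto
 have LTi: "{a<..b} \<in> sets LT" using ab unfolding LT_def sets_restrict_space by (auto intro!: image_eqI[of _ _ "{a<..b}"])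
 have eLT: "emeasure LT {a<..b} = ennreal (b - a)"
  unfolding LT_def using ab by (subst emeasure_restrict_space) auto
 have "emeasure (distr (LT >< Q) Pred (%x. x)) ({a<..b} \<times> G) = emeasure (LT >< Q) ({a<..b} \<times> G)"
  using emeasure_distr[OF id_Pred rect_Pred[OF ab]] sets.sets_into_space[OF LTi] sets.sets_into_space[OF G]
  by (simp add: space_pair_measure Int_absorb2 Sigma_mono)
 also have "... = ennreal (b - a) * emeasure Q G"
  using emeasure_pair_measure_Times[OF LTi G] by (simp add: eLT)
 finally have e1: "emeasure (distr (LT >< Q) Pred (%x. x)) ({a<..b} \<times> G) = ennreal (b - a) * emeasure Q G" .
 have "emeasure mu_comp (({a<..b} \<times> G) \<times> A) = ennreal r * emeasure (distr (LT >< Q) Pred (%x. x) >< K) (({a<..b} \<times> G) \<times> A)"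
  by (simp add: mu_comp_def)
 also have "emeasure (distr (LT >< Q) Pred (%x. x) >< K) (({a<..b} \<times> G) \<times> A)
  = emeasure (distr (LT >< Q) Pred (%x. x)) ({a<..b} \<times> G) * emeasure K A"
  using rect_Pred[OF ab] A by (intro K.emeasure_pair_measure_Times) auto
 also have "ennreal r * (emeasure (distr (LT >< Q) Pred (%x. x)) ({a<..b} \<times> G) * emeasure K A) = ennreal (r * measure K A * (b - a) * prob G)"
  unfolding e1 using rate_pos ab by (simp add: emeasure_eq_measure K.emeasure_eq_measure ennreal_mult[symmetric] mult_ac)
 finally show ?thesis .
qed

text \<open>Both measures are finite and, by \<open>increment_identity\<close>, agree on the
  intersection-stable family of predictable rectangles times Borel sets.\<close>

lemma mu_jump_eq_comp: "mu_jump = mu_comp"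
proof (rule measure_eqI_generator_eq)
 let ?E = "{a \<times> b | a b. a \<in> pred_gen \<and> b \<in> sets (borel :: real measure)}"
 let ?Om = "({0<..T} \<times> space Q) \<times> (UNIV :: real set)"
 show "Int_stable ?E"
 proof (rule Int_stableI, safe)
  fix a a' and b b' :: "real set" assume "a \<in> pred_gen" "a' \<in> pred_gen" "b \<in> sets borel" "b' \<in> sets borel"
  then show "\<exists>c d. a \<times> b \<inter> a' \<times> b' = c \<times> d \<and> c \<in> pred_gen \<and> d \<in> sets borel"
   using pred_gen_Int[of a a'] by (intro exI[of _ "a \<inter> a'"] exI[of _ "b \<inter> b'"]) auto
 qed
 show "?E \<subseteq> Pow ?Om" using pred_gen_Pow by auto
 show "sets mu_jump = sigma_sets ?Om ?E" by (simp add: mu_jump_def Pred_borel_generator)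
 show "sets mu_comp = sigma_sets ?Om ?E"
 proof -
  have "sets mu_comp = sets (Pred >< (borel :: real measure))"
   unfolding mu_comp_def sets_scale_measure by (intro sets_pair_measure_cong) auto
  then show ?thesis by (simp add: Pred_borel_generator)
 qed
 show "emeasure mu_jump X = emeasure mu_comp X" if X: "X \<in> ?E" for X
 proof -
  from X obtain a b G A where "X = ({a<..b} \<times> G) \<times> A" "0 <= a" "a <= b" "b <= T" "G \<in> sets (F a)" "A \<in> sets borel"
   by (auto simp: pred_gen_def)
  then show ?thesis using mu_jump_rect[of a b G A] mu_comp_rect[of a b G A] by simp
 qed
 have sp: "space Q \<in> sets (F 0)" using sets.top[of "F 0"] space_F[of 0] T_pos' by auto
 show "range (%i::nat. ?Om) \<subseteq> ?E"
 proof -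
  have "{0<..T} \<times> space Q \<in> pred_gen" unfolding pred_gen_def using T_pos' sp
   by (intro CollectI exI[of _ 0] exI[of _ T] exI[of _ "space Q"]) auto
  then show ?thesis by (intro image_subsetI CollectI exI[of _ "{0<..T} \<times> space Q"] exI[of _ "UNIV::real set"]) auto
 qed
 show "(\<Union>i::nat. ?Om) = ?Om" by simp
 show "emeasure mu_jump ?Om \<noteq> \<infinity>" using mu_jump_rect[of 0 T "space Q" UNIV] T_pos' sp by simp
qed

lemma campbell:
 assumes H: "H \<in> bm (Pred >< borel)"
 shows "nni Q (%w. (\<Sum>j=1..N T w. H ((jump_time N j w, w), Z j w)))
  = ennreal r * nni Q (%w. (\<integral>\<^sup>+t\<in>{0<..T}. nni K (%z. H ((t, w), z)) \<partial>lborel))"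
 using nn_integral_mu_jump[OF H] nn_integral_mu_comp[OF H] by (simp add: mu_jump_eq_comp)

end

context intensity
begin

text \<open>Left-continuity of the version for \<open>(<)\<close> itself, from which its
  predictability follows.\<close>

lemma intn_left': "(intn (<) c d \<longlongrightarrow> intn (<) c d r) (at_left r)"
proof -
 have "(intS (idx (<) c r) (idx (<) d r) c d \<longlongrightarrow> intn (<) c d r) (at_left r)"
  unfolding intn_def using DERIV_isCont[OF DERIV_intS] by (auto simp: isCont_def filterlim_at_split)
 then show ?thesis
  by (rule Lim_transform_eventually)
   (use eventually_idx_left[of c r] eventually_idx_left[of d r] in eventually_elim, simp add: intn_def)
qed

lemma lik_left': "(lik (<) c d \<longlongrightarrow> lik (<) c d r) (at_left r)"
proof -
 have "(likS (idx (<) c r) (idx (<) d r) c d \<longlongrightarrow> lik (<) c d r) (at_left r)"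
  unfolding lik_def using DERIV_isCont[OF DERIV_likS] by (auto simp: isCont_def filterlim_at_split)
 then show ?thesis
  by (rule Lim_transform_eventually)
   (use eventually_idx_left[of c r] eventually_idx_left[of d r] in eventually_elim, simp add: lik_def)
qed

end

lemma card_idx_left: "((%u. h (card (idx (<) c u)) :: real) \<longlongrightarrow> h (card (idx (<) c r))) (at_left r)"
 by (rule tendsto_eventually) (use eventually_idx_left[of c r] in eventually_elim, simp)

sublocale jump_cluster_model \<subseteq> intensity \<alpha> \<beta> l0
 by unfold_locales (use params_pos in auto)

sublocale jump_cluster_model \<subseteq> M1: marked_poisson Q F T 1 N1 Z1 F1
 by (intro marked_poisson.intro marked_poisson_axioms.intro prob_space_axioms T_pos zero_less_one
   usual N1_poisson Z1_marks(1,3) compensator1 F1_distribution(1))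

sublocale jump_cluster_model \<subseteq> M2: marked_poisson Q F T \<rho> N2 Z2 F2
 by (intro marked_poisson.intro marked_poisson_axioms.intro prob_space_axioms T_pos params_pos(4)
   usual N2_poisson Z2_marks(1,3) compensator2 F2_distribution(1))

section \<open>The two configurations of the model, independence and freezing\<close>

context jump_cluster_model
begin

text \<open>Marks are stored as the jumps that they cause in the intensity: through
  \<open>ell\<close> for the first process, unchanged for the second.\<close>

definition c1 :: "'a => config" where "c1 = M1.cfg ell"
definition c2 :: "'a => config" where "c2 = M2.cfg (%z. z)"

lemma id_restrict_meas: "(%z. z) \<in> bm (restrict_space borel {0::real..})"
 by (rule measurable_restrict_space1) simp

lemma c1_cong:
 assumes "w \<in> space Q" "t \<in> {0..T}" "is_ord R"
 defines "c' \<equiv> stopc (T + 1) (N1 t w) (c1 w)"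
 shows "lik R c' d t = lik R (c1 w) d t" "intn R c' d t = intn R (c1 w) d t" "idx R c' t = idx R (c1 w) t"
proof -
 have i: "idx (<=) (c1 w) t = {1..N1 t w}" using M1.idx_cfg[OF assms(1,2)] by (simp add: c1_def)
 have a: "idx R c' u = idx R (c1 w) u" if "u <= t" "is_ord R" for u R
  unfolding c'_def using idx_stopc[OF i that] .
 have b: "snd c' j = snd (c1 w) j" if "j \<in> idx (<=) (c1 w) t" for j
  unfolding c'_def using snd_stopc[OF i that] .
 show "lik R c' d t = lik R (c1 w) d t" "intn R c' d t = intn R (c1 w) d t"
  using lik_cong_left[OF assms(3) a b] by auto
 show "idx R c' t = idx R (c1 w) t" using a[OF order_refl assms(3)] .
qed

lemma c2_cong:
 assumes "w \<in> space Q" "t \<in> {0..T}" "is_ord R"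
 defines "c' \<equiv> stopc (T + 1) (N2 t w) (c2 w)"
 shows "lik R d c' t = lik R d (c2 w) t" "intn R d c' t = intn R d (c2 w) t"
proof -
 have i: "idx (<=) (c2 w) t = {1..N2 t w}" using M2.idx_cfg[OF assms(1,2)] by (simp add: c2_def)
 have a: "idx R c' u = idx R (c2 w) u" if "u <= t" "is_ord R" for u R
  unfolding c'_def using idx_stopc[OF i that] .
 have b: "snd c' j = snd (c2 w) j" if "j \<in> idx (<=) (c2 w) t" for j
  unfolding c'_def using snd_stopc[OF i that] .
 show "lik R d c' t = lik R d (c2 w) t" "intn R d c' t = intn R d (c2 w) t"
  using lik_cong_right[OF assms(3) a b] by auto
qed

lemma c1_obs_meas:
 assumes G: "M1.obs G t" and t: "t \<in> {0..T}" and f: "f \<in> measurable M G" and d: "cfg_meas M d" and R: "is_ord R"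
 shows "(%x. intn R (c1 (f x)) (d x) t) \<in> bm M"
  and "(%x. lik R (c1 (f x)) (d x) t) \<in> bm M"
  and "(%x. card (idx R (c1 (f x)) t)) \<in> measurable M (count_space UNIV)"
proof -
 have c: "cfg_meas M (%x. stopc (T + 1) (N1 t (f x)) (c1 (f x)))"
  unfolding c1_def by (rule cfg_meas_compose[OF M1.cfg_meas_stop[OF G t ell_measurable] f])
 have sp: "f x \<in> space Q" if "x \<in> space M" for x
  using measurable_space[OF f that] G by (simp add: M1.obs_def)
 note e = c1_cong[OF sp t R]
 show "(%x. intn R (c1 (f x)) (d x) t) \<in> bm M"
  by (rule measurable_cong[THEN iffD1, OF _ meas_intn[OF c d _ R, of "%_. t"]]) (simp_all add: e)
 show "(%x. lik R (c1 (f x)) (d x) t) \<in> bm M"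
  by (rule measurable_cong[THEN iffD1, OF _ meas_lik[OF c d _ R, of "%_. t"]]) (simp_all add: e)
 show "(%x. card (idx R (c1 (f x)) t)) \<in> measurable M (count_space UNIV)"
  by (rule measurable_cong[THEN iffD1, OF _ cfg_meas_card[OF c _ R, of "%_. t"]]) (simp_all add: e)
qed

lemma c2_obs_meas:
 assumes G: "M2.obs G t" and t: "t \<in> {0..T}" and f: "f \<in> measurable M G" and d: "cfg_meas M d" and R: "is_ord R"
 shows "(%x. intn R (d x) (c2 (f x)) t) \<in> bm M"
  and "(%x. lik R (d x) (c2 (f x)) t) \<in> bm M"
proof -
 have c: "cfg_meas M (%x. stopc (T + 1) (N2 t (f x)) (c2 (f x)))"
  unfolding c2_def by (rule cfg_meas_compose[OF M2.cfg_meas_stop[OF G t id_restrict_meas] f])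
 have sp: "f x \<in> space Q" if "x \<in> space M" for x
  using measurable_space[OF f that] G by (simp add: M2.obs_def)
 note e = c2_cong[OF sp t R]
 show "(%x. intn R (d x) (c2 (f x)) t) \<in> bm M"
  by (rule measurable_cong[THEN iffD1, OF _ meas_intn[OF d c _ R, of "%_. t"]]) (simp_all add: e)
 show "(%x. lik R (d x) (c2 (f x)) t) \<in> bm M"
  by (rule measurable_cong[THEN iffD1, OF _ meas_lik[OF d c _ R, of "%_. t"]]) (simp_all add: e)
qed

text \<open>The second configuration is held fixed, as it is when Campbell's formula is applied to
  the first process.\<close>

lemma c1_Pred:
 shows "(%p. intn (<) (c1 (snd p)) d (fst p)) \<in> bm M1.Pred"
  and "(%p. lik (<) (c1 (snd p)) d (fst p)) \<in> bm M1.Pred"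
  and "(%p. h (card (idx (<) (c1 (snd p)) (fst p))) :: real) \<in> bm M1.Pred"
proof -
 note m = c1_obs_meas[where f="%x. x" and d="%_. d", OF M1.obs_F _ measurable_ident_sets[OF refl] cfg_meas_const is_ord(1)]
 show "(%p. intn (<) (c1 (snd p)) d (fst p)) \<in> bm M1.Pred"
 proof (rule M1.left_cont_Pred[where X="%t w. intn (<) (c1 w) d t"])
  fix t assume "t \<in> {0..T}" then show "(%w. intn (<) (c1 w) d t) \<in> bm (F t)" by (rule m(1)[rotated]) fact
 qed (rule intn_left')
 show "(%p. lik (<) (c1 (snd p)) d (fst p)) \<in> bm M1.Pred"
 proof (rule M1.left_cont_Pred[where X="%t w. lik (<) (c1 w) d t"])
  fix t assume "t \<in> {0..T}" then show "(%w. lik (<) (c1 w) d t) \<in> bm (F t)" by (rule m(2)[rotated]) fact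
 qed (rule lik_left')
 show "(%p. h (card (idx (<) (c1 (snd p)) (fst p))) :: real) \<in> bm M1.Pred"
 proof (rule M1.left_cont_Pred[where X="%t w. h (card (idx (<) (c1 w) t))"])
  fix t assume t: "t \<in> {0..T}"
  have "(%w. card (idx (<) (c1 w) t)) \<in> measurable (F t) (count_space UNIV)" by (rule m(3)[OF t t])
  then show "(%w. h (card (idx (<) (c1 w) t))) \<in> bm (F t)"
   by (rule measurable_compose) simp
 qed (rule card_idx_left)
qed

lemma c2_Pred:
 shows "(%p. intn (<) c (c2 (snd p)) (fst p)) \<in> bm M2.Pred"
  and "(%p. lik (<) c (c2 (snd p)) (fst p)) \<in> bm M2.Pred"
proof -
 note m = c2_obs_meas[where f="%x. x" and d="%_. c", OF M2.obs_F _ measurable_ident_sets[OF refl] cfg_meas_const is_ord(1)]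
 show "(%p. intn (<) c (c2 (snd p)) (fst p)) \<in> bm M2.Pred"
 proof (rule M2.left_cont_Pred[where X="%t w. intn (<) c (c2 w) t"])
  fix t assume "t \<in> {0..T}" then show "(%w. intn (<) c (c2 w) t) \<in> bm (F t)" by (rule m(1)[rotated]) fact
 qed (rule intn_left')
 show "(%p. lik (<) c (c2 (snd p)) (fst p)) \<in> bm M2.Pred"
 proof (rule M2.left_cont_Pred[where X="%t w. lik (<) c (c2 w) t"])
  fix t assume "t \<in> {0..T}" then show "(%w. lik (<) c (c2 w) t) \<in> bm (F t)" by (rule m(2)[rotated]) fact
 qed (rule lik_left')
qed

lemma c1_meas: "f \<in> measurable M Q ==> cfg_meas M (%x. c1 (f x))"
 unfolding c1_def by (rule cfg_meas_compose[OF M1.cfg_meas_cfg[OF M1.obs_Q ell_measurable]])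

lemma c2_meas: "f \<in> measurable M Q ==> cfg_meas M (%x. c2 (f x))"
 unfolding c2_def by (rule cfg_meas_compose[OF M2.cfg_meas_cfg[OF M2.obs_Q id_restrict_meas]])

definition okp :: "config => config => bool" where
 "okp c d \<longleftrightarrow> config_ok T c \<and> config_ok T d \<and> times c \<inter> times d = {}"

lemma c1_ok: "AE w in Q. config_ok T (c1 w)"
 using M1.AE_good AE_space by eventually_elim (simp add: c1_def M1.config_ok_cfg ell_nonneg)

lemma c2_ok: "AE w in Q. config_ok T (c2 w)"
 using M2.AE_good AE_space by eventually_elim (simp add: c2_def M2.config_ok_cfg)

lemma times_bounds: "config_ok T c ==> x \<in> times c ==> 0 < x \<and> x <= T"
 by (auto simp: config_ok_def times_def)

text \<open>The fixed configuration has finitely many jump times, and the second process almost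
  surely misses each of them.\<close>

lemma okp_c2: "config_ok T c ==> AE w in Q. okp c (c2 w)"
proof -
 assume d: "config_ok T c"
 have "AE w in Q. \<forall>x\<in>times c. x \<notin> times (c2 w)"
 proof (rule AE_finite_allI[OF finite_times])
  fix x assume "x \<in> times c"
  then show "AE w in Q. x \<notin> times (c2 w)"
   using M2.AE_no_jump[of x] times_bounds[OF d] by (simp add: c2_def M2.times_cfg)
 qed
 then show ?thesis using c2_ok by eventually_elim (use d in \<open>auto simp: okp_def\<close>)
qed

text \<open>The two sources of randomness without completion: the independence assumed for counts
  and single marks can then be grouped into independence of \<open>G1\<close> and
  \<open>G2\<close>.\<close>

definition G1 :: "'a measure" where
 "G1 = sigma (space Q) (sets (generated_by Q N1 {0..T}) \<union> (\<Union>n\<in>{1..}. sets (generated_by Q Z1 {n})))"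

definition G2 :: "'a measure" where
 "G2 = sigma (space Q) (sets (generated_by Q N2 {0..T}) \<union> (\<Union>n\<in>{1..}. sets (generated_by Q Z2 {n})))"

lemma generated_Pow: "{X i -` A \<inter> space M | i A. i \<in> I \<and> A \<in> sets borel} \<subseteq> Pow (space M)"
 by auto

lemma sets_generated: "sets (generated_by M X I) = sigma_sets (space M) {X i -` A \<inter> space M | i A. i \<in> I \<and> A \<in> sets borel}"
 unfolding generated_by_def by (rule sets_measure_of[OF generated_Pow])

lemma space_generated: "space (generated_by M X I) = space M"
 unfolding generated_by_def by (rule space_measure_of[OF generated_Pow])

lemma sets_generated_Pow: "sets (generated_by M X I) \<subseteq> Pow (space M)"
 using sets.space_closed[of "generated_by M X I"] by (simp add: space_generated)

lemma generated_in: "i \<in> I ==> A \<in> sets borel ==> X i -` A \<inter> space M \<in> sets (generated_by M X I)"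
 unfolding sets_generated by (rule sigma_sets.Basic) auto

lemma sigma_gen_obs:
 fixes X :: "real => 'a => nat" and Y :: "nat => 'a => real"
 defines "G \<equiv> sigma (space Q) (sets (generated_by Q X {0..T}) \<union> (\<Union>n\<in>{1..}. sets (generated_by Q Y {n})))"
 shows "space G = space Q" "\<And>s. s \<in> {0..T} ==> X s \<in> measurable G (count_space UNIV)"
  "\<And>j. 1 <= j ==> Y j \<in> bm G"
proof -
 let ?E = "sets (generated_by Q X {0..T}) \<union> (\<Union>n\<in>{1..}. sets (generated_by Q Y {n}))"
 have P: "?E \<subseteq> Pow (space Q)" by (intro Un_least UN_least sets_generated_Pow)
 have s: "sets G = sigma_sets (space Q) ?E" unfolding G_def by (rule sets_measure_of[OF P])
 show sp: "space G = space Q" unfolding G_def by (rule space_measure_of[OF P])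
 show "X s \<in> measurable G (count_space UNIV)" if "s \<in> {0..T}" for s
 proof (rule measurableI)
  fix A :: "nat set"
  have "A \<in> sets borel" by (simp add: sets_borel_eq_count_space)
  then have "X s -` A \<inter> space Q \<in> ?E" by (intro UnI1 generated_in[OF that])
  then show "X s -` A \<inter> space G \<in> sets G" unfolding sp s by (rule sigma_sets.Basic)
 qed simp
 show "Y j \<in> bm G" if "1 <= j" for j
 proof (rule measurableI)
  fix A :: "real set" assume "A \<in> sets borel"
  then have "Y j -` A \<inter> space Q \<in> sets (generated_by Q Y {j})" by (intro generated_in) auto
  then have "Y j -` A \<inter> space Q \<in> ?E" using that by (intro UnI2 UN_I[of j]) auto
  then show "Y j -` A \<inter> space G \<in> sets G" unfolding sp s by (rule sigma_sets.Basic)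
 qed simp
qed

lemma obs_G1: "M1.obs G1 T"
proof -
 note g = sigma_gen_obs[where X=N1 and Y=Z1, folded G1_def]
 have [measurable]: "N1 T \<in> measurable G1 (count_space UNIV)" using g(2) T_pos by auto
 show ?thesis unfolding M1.obs_def using g by auto
qed

lemma obs_G2: "M2.obs G2 T"
proof -
 note g = sigma_gen_obs[where X=N2 and Y=Z2, folded G2_def]
 have [measurable]: "N2 T \<in> measurable G2 (count_space UNIV)" using g(2) T_pos by auto
 show ?thesis unfolding M2.obs_def using g by auto
qed

lemma indep_G: "indep_set (sets G1) (sets G2)"
proof -
 define E where "E k = sets (case k of
         Count1 => generated_by Q N1 {0..T}
        | Count2 => generated_by Q N2 {0..T}
        | Mark1 n => generated_by Q Z1 {n}
        | Mark2 n => generated_by Q Z2 {n})" for k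
 define I where "I b = (if b then {Count1} \<union> Mark1 ` {1..} else {Count2} \<union> Mark2 ` {1..})" for b
 have U: "(\<Union>b\<in>UNIV. I b) = {Count1, Count2} \<union> Mark1 ` {1..} \<union> Mark2 ` {1..}"
  by (auto simp: I_def UNIV_bool)
 have "indep_sets (%b. sigma_sets (space Q) (\<Union>i\<in>I b. E i)) UNIV"
 proof (rule indep_sets_collect_sigma)
  show "indep_sets E (\<Union>b\<in>UNIV. I b)" unfolding U using independent by (simp add: E_def[abs_def])
  show "Int_stable (E i)" for i unfolding E_def by (rule sets.Int_stable)
  show "disjoint_family_on I UNIV" by (auto simp: disjoint_family_on_def I_def)
 qed
 moreover have "sets G1 = sigma_sets (space Q) (\<Union>i\<in>I True. E i)"
 proof -
  have "(\<Union>i\<in>I True. E i) = sets (generated_by Q N1 {0..T}) \<union> (\<Union>n\<in>{1..}. sets (generated_by Q Z1 {n}))"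
   by (simp add: I_def E_def)
  moreover have "... \<subseteq> Pow (space Q)" by (intro Un_least UN_least sets_generated_Pow)
  ultimately show ?thesis unfolding G1_def by (simp add: sets_measure_of)
 qed
 moreover have "sets G2 = sigma_sets (space Q) (\<Union>i\<in>I False. E i)"
 proof -
  have "(\<Union>i\<in>I False. E i) = sets (generated_by Q N2 {0..T}) \<union> (\<Union>n\<in>{1..}. sets (generated_by Q Z2 {n}))"
   by (simp add: I_def E_def)
  moreover have "... \<subseteq> Pow (space Q)" by (intro Un_least UN_least sets_generated_Pow)
  ultimately show ?thesis unfolding G2_def by (simp add: sets_measure_of)
 qed
 ultimately have "case_bool (sets G1) (sets G2) b = sigma_sets (space Q) (\<Union>i\<in>I b. E i)" for b
  by (cases b) simp_all
 then have "case_bool (sets G1) (sets G2) = (%b. sigma_sets (space Q) (\<Union>i\<in>I b. E i))" by (rule ext)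
 then show ?thesis unfolding indep_set_def
  using \<open>indep_sets (%b. sigma_sets (space Q) (\<Union>i\<in>I b. E i)) UNIV\<close> by (simp only:)
qed

lemma space_G: "space G1 = space Q" "space G2 = space Q"
 using obs_G1 obs_G2 by (auto simp: M1.obs_def M2.obs_def)

lemma sets_G_Q: "sets G1 \<subseteq> sets Q" "sets G2 \<subseteq> sets Q"
 using indep_G by (auto simp: indep_set_def indep_sets_def UNIV_bool)

lemma id_G: "(%x. x) \<in> measurable Q G1" "(%x. x) \<in> measurable Q G2"
 using sets_G_Q space_G by (auto simp: measurable_def)

lemma G_pair_Q: "f \<in> measurable (G1 >< G2) M ==> f \<in> measurable (Q >< Q) M"
proof -
 assume f: "f \<in> measurable (G1 >< G2) M"
 have "(%p. (fst p, snd p)) \<in> measurable (Q >< Q) (G1 >< G2)"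
  by (rule measurable_Pair) (use measurable_compose[OF measurable_fst id_G(1)] measurable_compose[OF measurable_snd id_G(2)] in auto)
 from measurable_compose[OF this f] show ?thesis by simp
qed

text \<open>Independence says that the map from w to (w, w) carries \<open>Q\<close> to a product
  measure on \<open>G1 >< G2\<close>. A function of both sources may therefore be integrated over
  two separate copies of the probability space, in either order.\<close>

lemma freeze:
 assumes f: "f \<in> bm (G1 >< G2)"
 shows "nni Q (%w. f (w, w)) = nni Q (%w'. nni Q (%w. f (w, w')))"
  and "nni Q (%w. f (w, w)) = nni Q (%w. nni Q (%w'. f (w, w')))"
proof -
 have eq: "sigma_sets (space Q) {(%x. x) -` A \<inter> space Q | A. A \<in> sets G} = sets G" if "space G = space Q" for G :: "'a measure"
 proof -
  have "{(%x. x) -` A \<inter> space Q | A. A \<in> sets G} = sets G"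
   using sets.sets_into_space[of _ G] that by (auto simp: Int_absorb2)
  then show ?thesis using sets.sigma_sets_eq[of G] that by simp
 qed
 have "indep_var G1 (%x. x) G2 (%x. x)"
  unfolding indep_var_eq eq[OF space_G(1)] eq[OF space_G(2)] using id_G indep_G by blast
 then have d: "distr Q G1 (%x. x) >< distr Q G2 (%x. x) = distr Q (G1 >< G2) (%x. (x, x))"
  unfolding indep_var_distribution_eq by simp
 interpret D2: prob_space "distr Q G2 (%x. x)" by (rule prob_space_distr[OF id_G(2)])
 have diag: "(%x. (x, x)) \<in> measurable Q (G1 >< G2)" using id_G by (rule measurable_Pair)
 have f': "f \<in> bm (distr Q G1 (%x. x) >< distr Q G2 (%x. x))"
  using f by (subst measurable_cong_sets[OF sets_pair_measure_cong refl]) auto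
 have f2: "(%w. nni (distr Q G2 (%x. x)) (%w'. f (w, w'))) \<in> bm G1"
  using D2.borel_measurable_nn_integral_fst[OF f'] by simp
 have f3: "(%w'. f (w, w')) \<in> bm G2" if "w \<in> space Q" for w
  using measurable_Pair2[OF f, of w] that space_G by simp
 have "nni Q (%w. f (w, w)) = nni (distr Q (G1 >< G2) (%x. (x, x))) (%p. f p)"
  using f diag by (subst nn_integral_distr) auto
 also have "... = nni (distr Q G1 (%x. x)) (%w. nni (distr Q G2 (%x. x)) (%w'. f (w, w')))"
  unfolding d[symmetric] using D2.nn_integral_fst[OF f'] by simp
 also have "... = nni Q (%w. nni (distr Q G2 (%x. x)) (%w'. f (w, w')))"
  using f2 id_G by (subst nn_integral_distr) auto
 also have "... = nni Q (%w. nni Q (%w'. f (w, w')))"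
  using f3 id_G by (intro nn_integral_cong) (subst nn_integral_distr, auto)
 finally show *: "nni Q (%w. f (w, w)) = nni Q (%w. nni Q (%w'. f (w, w')))" .
 interpret QQ: pair_sigma_finite Q Q ..
 show "nni Q (%w. f (w, w)) = nni Q (%w'. nni Q (%w. f (w, w')))"
  unfolding * using QQ.Fubini'[of "%x y. f (x, y)"] G_pair_Q[OF f] by simp
qed

lemma lam_eq:
 assumes "w \<in> space Q" "t \<in> {0..T}"
 shows "lam t w = intn (<=) (c1 w) (c2 w) t"
proof -
 have "N1 t w <= N1 T w" "N2 t w <= N2 T w"
  using M1.N_mono[OF assms(1), of t T] M2.N_mono[OF assms(1), of t T] assms(2) by auto
 then show ?thesis
  unfolding lam_def intn_def intS_def c1_def c2_def M1.idx_cfg[OF assms] M2.idx_cfg[OF assms]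
  by (auto intro!: sum.cong simp: M1.tm_cfg M1.mk_cfg M2.tm_cfg M2.mk_cfg)
qed

text \<open>The time integral in \<open>L\<close> has the closed form \<open>cumS\<close>, and the
  limits from the left are values of \<open>intn (<)\<close>. One null set serves all times.\<close>

lemma L_eq: "AE w in Q. \<forall>t\<in>{0..T}. L t w = lik (<=) (c1 w) (c2 w) t"
 using c1_ok c2_ok AE_space
proof eventually_elim
 case (elim w)
 show ?case
 proof
  fix t assume t: "t \<in> {0..T}"
  let ?c = "c1 w" and ?d = "c2 w"
  have ieq: "lam s w = intn (<=) ?c ?d s" if "s \<in> {0..T}" for s using lam_eq[OF elim(3) that] .
  note cum = cumS_eq_integral[OF elim(1,2), of t]
  have "(LINT s:{0..t}|lborel. lam s w - 1) = (LINT s:{0..t}|lborel. intn (<=) ?c ?d s - 1)"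
   using t by (intro set_lebesgue_integral_cong) (auto simp: ieq)
  also have "... = (LINT s:{0..t}|lborel. intn (<=) ?c ?d s) - (LINT s:{0..t}|lborel. 1)"
   using cum t by (intro set_integral_diff) (auto simp: set_integrable_def)
  also have "... = cumS (idx (<=) ?c t) (idx (<=) ?d t) ?c ?d t - t"
   using cum t by (simp add: set_lebesgue_integral_def)
  finally have 1: "(LINT s:{0..t}|lborel. lam s w - 1) = cumS (idx (<=) ?c t) (idx (<=) ?d t) ?c ?d t - t" .
  have N: "N1 t w <= N1 T w" using M1.N_mono[OF elim(3), of t T] t by auto
  have lim: "Lim (at_left (jump_time N1 j w)) (%s. lam s w) = intn (<) ?c ?d (tm ?c j)"
   and pos: "0 < intn (<) ?c ?d (tm ?c j)" if j: "j \<in> {1..N1 t w}" for j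
  proof -
   have j': "j \<in> {1..N1 T w}" using j N by auto
   have tm: "tm ?c j = jump_time N1 j w" using j' by (simp add: c1_def M1.tm_cfg)
   note b = M1.jump_time_bounds[OF elim(3) j']
   have "\<forall>\<^sub>F s in at_left (tm ?c j). s \<in> {0<..<tm ?c j}"
    using eventually_at_left_real[of 0 "tm ?c j"] b tm by simp
   then have "\<forall>\<^sub>F s in at_left (tm ?c j). intn (<=) ?c ?d s = lam s w"
    by eventually_elim (use b tm ieq in auto)
   with intn_left have "((%s. lam s w) \<longlongrightarrow> intn (<) ?c ?d (tm ?c j)) (at_left (tm ?c j))"
    by (rule Lim_transform_eventually)
   then show "Lim (at_left (jump_time N1 j w)) (%s. lam s w) = intn (<) ?c ?d (tm ?c j)"
    unfolding tm by (intro tendsto_Lim) auto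
   show "0 < intn (<) ?c ?d (tm ?c j)" using b tm by (intro intn_pos[OF elim(1,2)]) auto
  qed
  have i: "idx (<=) ?c t = {1..N1 t w}" using M1.idx_cfg[OF elim(3) t] by (simp add: c1_def)
  have "(\<Sum>j=1..N1 t w. ln (Lim (at_left (jump_time N1 j w)) (%s. lam s w))) = (\<Sum>j=1..N1 t w. ln (intn (<) ?c ?d (tm ?c j)))"
   using lim by (intro sum.cong) auto
  then have "L t w = exp (t - cumS (idx (<=) ?c t) (idx (<=) ?d t) ?c ?d t) * (\<Prod>j=1..N1 t w. exp (ln (intn (<) ?c ?d (tm ?c j))))"
   unfolding L_def 1 by (simp add: exp_add exp_sum)
  also have "... = lik (<=) ?c ?d t" unfolding lik_def likS_def i using pos by (intro arg_cong2[where f="(*)"] refl prod.cong) auto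
  finally show "L t w = lik (<=) ?c ?d t" .
 qed
qed

end

section \<open>The damped and cut balance along one path\<close>

lemma nn_integral_Ioc:
 fixes q :: "real => real"
 assumes q: "set_integrable lborel {s..t} q" and nn: "\<And>r. r \<in> {s..t} ==> 0 <= q r"
 shows "nni lborel (%r. ennreal (indicator {s<..t} r * q r)) = ennreal (LINT r:{s..t}|lborel. q r)"
proof -
 have "nni lborel (%r. ennreal (indicator {s<..t} r * q r)) = nni lborel (%r. ennreal (indicator {s..t} r * q r))"
  by (intro nn_integral_cong_AE, use AE_lborel_singleton[of s] in eventually_elim) (auto simp: indicator_def)
 also have "... = ennreal (LINT r:{s..t}|lborel. q r)"
  unfolding set_lebesgue_integral_def real_scaleR_def using q nn
  by (intro nn_integral_eq_integral) (auto simp: set_integrable_def indicator_def)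
 finally show ?thesis .
qed

text \<open>Smooth only on the state space (0, \<infinity>), but Borel on the whole line, because
  the occupation measures \<open>nu\<close> live on \<open>borel\<close>.\<close>

definition C1pos :: "(real => real) => (real => real) => bool" where
 "C1pos g g' \<longleftrightarrow> g \<in> bm borel \<and> g' \<in> bm borel \<and>
  (\<forall>x>0. (g has_real_derivative g' x) (at x)) \<and> continuous_on {0<..} g'"

context intensity
begin

text \<open>Weight of the time \<open>r\<close> in Ito's formula on (s, t] for the process damped at
  rate \<open>K\<close> and killed at the \<open>n\<close>-th observed jump.\<close>

definition wt :: "real => real => real => nat => config => config => real => real" where
 "wt s t K n c d r = indicator {s<..t} r * (exp (- K * r) * (if card (idx (<) c r) < n then 1 else 0) * lik (<) c d r)"

lemma wt_nonneg: "config_ok T c ==> config_ok T d ==> 0 <= wt s t K n c d r"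
 using lik_nonneg by (simp add: wt_def)

lemma sum_filter_indicator:
 "(\<Sum>j\<in>{j\<in>{1..num c}. s < tm c j \<and> tm c j <= t}. f j) = (\<Sum>j=1..num c. indicator {s<..t} (tm c j) * (f j :: real))"
proof -
 have "(\<Sum>j=1..num c. indicator {s<..t} (tm c j) * f j) = (\<Sum>j=1..num c. if s < tm c j \<and> tm c j <= t then f j else 0)"
  by (intro sum.cong) (auto simp: indicator_def)
 then show ?thesis by (simp add: sum.inter_filter)
qed

text \<open>Ito's formula with h the indicator of fewer than \<open>n\<close> jumps, every term put
  on the side where it is nonnegative, so that expectations can be taken before any integrability is
  known. A jump raises the count by one, which is why the gain at an observed jump carries the level
  \<open>n - 1\<close>.\<close>

lemma pathwise_cut:
 fixes K :: real and n :: nat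
 assumes c: "config_ok T c" and d: "config_ok T d" and dis: "times c \<inter> times d = {}"
  and g: "C1pos g g'" and nn: "\<And>x. 0 <= g x" and st: "0 <= s" "s <= t"
 defines "Y \<equiv> %r. exp (- K * r) * (if card (idx (<=) c r) < n then 1 else 0) * lik (<=) c d r * g (intn (<=) c d r)"
  and "l \<equiv> intn (<) c d" and "a \<equiv> %x. \<alpha> * (\<beta> - x) * g' x"
 shows "ennreal (Y t) + nni lborel (%r. ennreal (wt s t K n c d r * (l r * g (l r) + max 0 (- a (l r)) + max 0 (K - 1) * g (l r))))
   + ennreal (\<Sum>j=1..num c. wt s t K n c d (tm c j) * g (l (tm c j)))
   + ennreal (\<Sum>j=1..num d. wt s t K n c d (tm d j) * max 0 (g (l (tm d j)) - g (l (tm d j) + mk d j)))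
  = ennreal (Y s) + nni lborel (%r. ennreal (wt s t K n c d r * (max 0 (a (l r)) + max 0 (1 - K) * g (l r))))
   + ennreal (\<Sum>j=1..num c. wt s t K (n - 1) c d (tm c j) * (l (tm c j) * g (l (tm c j) + mk c j)))
   + ennreal (\<Sum>j=1..num d. wt s t K n c d (tm d j) * max 0 (g (l (tm d j) + mk d j) - g (l (tm d j))))"
proof -
 define h where "h m = (if m < n then 1 else 0 :: real)" for m
 define w where "w r = exp (- K * r) * h (card (idx (<) c r)) * lik (<) c d r" for r
 \<comment> \<open>\<open>P2 x - P1 x\<close> is the drift \<open>a x - (x - 1 + K) * g x\<close>,
   split into parts that are nonnegative for positive \<open>x\<close>.\<close>
 define P1 where "P1 x = x * g x + max 0 (- a x) + max 0 (K - 1) * g x" for x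
 define P2 where "P2 x = max 0 (a x) + max 0 (1 - K) * g x" for x
 have gd: "\<And>x. 0 < x ==> (g has_real_derivative g' x) (at x)" and g': "continuous_on {0<..} g'"
  using g by (auto simp: C1pos_def)
 have gc: "continuous_on {0<..} g"
  using gd DERIV_continuous_on has_field_derivative_at_within by (metis greaterThan_iff)
 have w0: "0 <= w r" for r using lik_nonneg[OF c d] by (simp add: w_def h_def)
 have l0': "0 < l r" if "0 <= r" for r unfolding l_def by (rule intn_pos[OF c d that])
 have Pc: "continuous_on {0<..} P1" "continuous_on {0<..} P2"
  unfolding P1_def P2_def a_def by (intro continuous_intros gc g')+
 have int: "set_integrable lborel {s..t} (%r. w r * P (l r))" if P: "continuous_on {0<..} P" for P
 proof -
  have "set_integrable lborel {s..t} (%r. (%A B r. exp (- K * r) * h (card A) * likS A B c d r * P (intS A B c d r)) (idx (<) c r) (idx (<) d r) r)"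
  proof (rule piecewise_continuous_integrable[OF _ st])
   fix A B assume AB: "A \<subseteq> {1..num c}" "B \<subseteq> {1..num d}"
   have "0 < intS A B c d r" if "0 <= r" for r using intS_ge_ok[OF c d AB that] lmin_pos by linarith
   then have sub: "intS A B c d ` {0..} \<subseteq> {0<..}" by auto
   show "continuous_on {0..} (%r. exp (- K * r) * h (card A) * likS A B c d r * P (intS A B c d r))"
    by (intro continuous_intros continuous_likS continuous_on_compose2[OF P continuous_intS sub])
  qed
  then show ?thesis by (simp add: w_def l_def lik_def intn_def)
 qed
 have P0: "0 <= P1 (l r)" "0 <= P2 (l r)" if "0 <= r" for r
  using l0'[OF that] nn by (auto simp: P1_def P2_def)
 have wtw: "wt s t K n c d r = indicator {s<..t} r * w r" for r by (simp add: wt_def w_def h_def)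
 have wt1: "wt s t K (n - 1) c d r = indicator {s<..t} r * (exp (- K * r) * lik (<) c d r * h (Suc (card (idx (<) c r))))" for r
  by (auto simp: wt_def h_def)
 have I: "nni lborel (%r. ennreal (wt s t K n c d r * P (l r))) = ennreal (LINT r:{s..t}|lborel. w r * P (l r))"
  if "continuous_on {0<..} P" "\<And>r. 0 <= r ==> 0 <= P (l r)" for P
  unfolding wtw mult.assoc using int[OF that(1)] that(2) w0 st by (intro nn_integral_Ioc) auto
 let ?I1 = "LINT r:{s..t}|lborel. w r * P1 (l r)" and ?I2 = "LINT r:{s..t}|lborel. w r * P2 (l r)"
 have I0: "0 <= ?I1" "0 <= ?I2"
  unfolding set_lebesgue_integral_def using P0 w0 st
  by (auto intro!: Bochner_Integration.integral_nonneg simp: indicator_def)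
 let ?C1 = "\<Sum>j=1..num c. wt s t K n c d (tm c j) * g (l (tm c j))"
 let ?C2 = "\<Sum>j=1..num c. wt s t K (n - 1) c d (tm c j) * (l (tm c j) * g (l (tm c j) + mk c j))"
 let ?D1 = "\<Sum>j=1..num d. wt s t K n c d (tm d j) * max 0 (g (l (tm d j)) - g (l (tm d j) + mk d j))"
 let ?D2 = "\<Sum>j=1..num d. wt s t K n c d (tm d j) * max 0 (g (l (tm d j) + mk d j) - g (l (tm d j)))"
 note ito = pathwise_ito[OF c d dis gd g' st, of K h]
 have "Y t - Y s = (LINT r:{s..t}|lborel. w r * P2 (l r) - w r * P1 (l r)) + (?C2 - ?C1) + (?D2 - ?D1)"
 proof -
  have 1: "(LINT r:{s..t}|lborel. exp (- K * r) * h (card (idx (<) c r)) * lik (<) c d r *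
    (\<alpha> * (\<beta> - intn (<) c d r) * g' (intn (<) c d r) - (intn (<) c d r - 1 + K) * g (intn (<) c d r)))
   = (LINT r:{s..t}|lborel. w r * P2 (l r) - w r * P1 (l r))"
  proof (intro set_lebesgue_integral_cong allI impI)
   fix r
   have "P2 x - P1 x = a x - (x - 1 + K) * g x" for x
    by (simp add: P1_def P2_def max_def algebra_simps)
   then show "exp (- K * r) * h (card (idx (<) c r)) * lik (<) c d r *
    (\<alpha> * (\<beta> - intn (<) c d r) * g' (intn (<) c d r) - (intn (<) c d r - 1 + K) * g (intn (<) c d r)) = w r * P2 (l r) - w r * P1 (l r)"
    unfolding right_diff_distrib[symmetric] by (simp add: w_def l_def a_def)
  qed simp
  have 2: "(\<Sum>j\<in>{j\<in>{1..num c}. s < tm c j \<and> tm c j <= t}. exp (- K * tm c j) * lik (<) c d (tm c j) *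
     (h (Suc (card (idx (<) c (tm c j)))) * intn (<) c d (tm c j) * g (intn (<) c d (tm c j) + mk c j)
      - h (card (idx (<) c (tm c j))) * g (intn (<) c d (tm c j)))) = ?C2 - ?C1"
   unfolding sum_filter_indicator sum_subtractf[symmetric] wt1
   by (intro sum.cong refl) (simp add: wt1 wtw w_def l_def algebra_simps)
  have 3: "(\<Sum>j\<in>{j\<in>{1..num d}. s < tm d j \<and> tm d j <= t}. exp (- K * tm d j) * lik (<) c d (tm d j) *
     h (card (idx (<) c (tm d j))) * (g (intn (<) c d (tm d j) + mk d j) - g (intn (<) c d (tm d j)))) = ?D2 - ?D1"
   unfolding sum_filter_indicator sum_subtractf[symmetric]
   by (intro sum.cong refl) (simp add: wtw w_def l_def max_def algebra_simps)
  show ?thesis using ito(2) unfolding 1 2 3 by (simp add: Y_def h_def)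
 qed
 also have "(LINT r:{s..t}|lborel. w r * P2 (l r) - w r * P1 (l r)) = ?I2 - ?I1"
  by (intro set_integral_diff int Pc)
 finally have eq: "Y t + ?I1 + ?C1 + ?D1 = Y s + ?I2 + ?C2 + ?D2" by simp
 have nnY: "0 <= Y r" for r using lik_nonneg[OF c d] nn by (simp add: Y_def)
 have tm0: "0 <= tm c j" if "j \<in> {1..num c}" for j using tm_pos[OF c that] by simp
 have n1: "0 <= ?C1" by (intro sum_nonneg mult_nonneg_nonneg wt_nonneg[OF c d] nn)
 have n2: "0 <= ?C2" using l0' tm0
  by (intro sum_nonneg mult_nonneg_nonneg wt_nonneg[OF c d] nn) (auto intro: less_imp_le)
 have n3: "0 <= ?D1" "0 <= ?D2" by (intro sum_nonneg mult_nonneg_nonneg wt_nonneg[OF c d]; simp)+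
 have "ennreal (Y t) + ennreal ?I1 + ennreal ?C1 + ennreal ?D1 = ennreal (Y t + ?I1 + ?C1 + ?D1)"
  using nnY[of t] I0 n1 n3 by (simp add: ennreal_plus del: ennreal_plus_if)
 also have "... = ennreal (Y s) + ennreal ?I2 + ennreal ?C2 + ennreal ?D2"
  unfolding eq using nnY[of s] I0 n2 n3 by (simp add: ennreal_plus del: ennreal_plus_if)
 finally show ?thesis
  using I[OF Pc(1) P0(1)] I[OF Pc(2) P0(2)] by (simp add: P1_def P2_def)
qed

lemma meas_wt:
 assumes c: "cfg_meas M c" and d: "cfg_meas M d" and r: "r \<in> bm M"
 shows "(%x. wt s t K n (c x) (d x) (r x)) \<in> bm M"
proof -
 have [measurable]: "(%x. card (idx (<) (c x) (r x))) \<in> measurable M (count_space UNIV)"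
  "(%x. lik (<) (c x) (d x) (r x)) \<in> bm M" "r \<in> bm M"
  using cfg_meas_card[OF c r] meas_lik[OF c d r] r by auto
 show ?thesis unfolding wt_def by measurable
qed

end

context jump_cluster_model
begin

text \<open>\<open>ell\<close> is measurable on [0, \<infinity>) only; its extension by
  \<open>ell 0\<close> is Borel on the line and agrees with \<open>ell\<close> at every
  mark.\<close>

definition ell' :: "real => real" where "ell' z = ell (max 0 z)"

lemma ell'_meas [measurable]: "ell' \<in> bm borel"
proof -
 have "(%z::real. max 0 z) \<in> measurable borel (restrict_space borel {0..})"
  by (rule measurable_restrict_space2) auto
 from measurable_compose[OF this ell_measurable] show ?thesis by (simp add: ell'_def[abs_def])
qed

lemma ell'_nonneg: "0 <= ell' z"
 by (simp add: ell'_def ell_nonneg)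

lemma num_c1: "num (c1 w) = N1 T w" by (simp add: c1_def)
lemma num_c2: "num (c2 w) = N2 T w" by (simp add: c2_def)

lemma c1_jump:
 assumes "w \<in> space Q" "j \<in> {1..N1 T w}"
 shows "tm (c1 w) j = jump_time N1 j w" "mk (c1 w) j = ell' (Z1 j w)"
 using assms Z1_marks(3)[of j w] by (auto simp: c1_def M1.tm_cfg M1.mk_cfg ell'_def max_def)

lemma c2_jump:
 assumes "w \<in> space Q" "j \<in> {1..N2 T w}"
 shows "tm (c2 w) j = jump_time N2 j w" "mk (c2 w) j = Z2 j w"
 using assms by (auto simp: c2_def M2.tm_cfg M2.mk_cfg)

lemma campbell1:
 assumes meas: "Ph \<in> bm (M1.Pred >< borel)" and 0: "\<And>r w z. r \<notin> {0<..T} ==> Ph ((r, w), z) = 0"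
 shows "nni Q (%w. (\<Sum>j=1..num (c1 w). Ph ((tm (c1 w) j, w), Z1 j w)))
  = nni Q (%w. nni lborel (%r. nni F1 (%z. Ph ((r, w), z))))"
proof -
 have "nni Q (%w. (\<Sum>j=1..num (c1 w). Ph ((tm (c1 w) j, w), Z1 j w)))
  = nni Q (%w. (\<Sum>j=1..N1 T w. Ph ((jump_time N1 j w, w), Z1 j w)))"
  by (intro nn_integral_cong) (simp add: num_c1 c1_jump)
 also have "... = nni Q (%w. (\<integral>\<^sup>+t\<in>{0<..T}. nni F1 (%z. Ph ((t, w), z)) \<partial>lborel))"
  using M1.campbell[OF meas] by simp
 also have "... = nni Q (%w. nni lborel (%r. nni F1 (%z. Ph ((r, w), z))))"
  by (intro nn_integral_cong) (auto simp: indicator_def 0)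
 finally show ?thesis .
qed

lemma campbell2:
 assumes meas: "Ph \<in> bm (M2.Pred >< borel)" and 0: "\<And>r w z. r \<notin> {0<..T} ==> Ph ((r, w), z) = 0"
 shows "nni Q (%w. (\<Sum>j=1..num (c2 w). Ph ((tm (c2 w) j, w), mk (c2 w) j)))
  = ennreal \<rho> * nni Q (%w. nni lborel (%r. nni F2 (%z. Ph ((r, w), z))))"
proof -
 have "nni Q (%w. (\<Sum>j=1..num (c2 w). Ph ((tm (c2 w) j, w), mk (c2 w) j)))
  = nni Q (%w. (\<Sum>j=1..N2 T w. Ph ((jump_time N2 j w, w), Z2 j w)))"
  by (intro nn_integral_cong) (simp add: num_c2 c2_jump)
 also have "... = ennreal \<rho> * nni Q (%w. (\<integral>\<^sup>+t\<in>{0<..T}. nni F2 (%z. Ph ((t, w), z)) \<partial>lborel))"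
  by (rule M2.campbell[OF meas])
 also have "nni Q (%w. (\<integral>\<^sup>+t\<in>{0<..T}. nni F2 (%z. Ph ((t, w), z)) \<partial>lborel)) = nni Q (%w. nni lborel (%r. nni F2 (%z. Ph ((r, w), z))))"
  by (intro nn_integral_cong) (auto simp: indicator_def 0)
 finally show ?thesis .
qed

lemma time_Pred: "(%p. fst p) \<in> bm M1.Pred" "(%p. fst p) \<in> bm M2.Pred"
 using M1.left_cont_Pred[of "%t _. t"] M2.left_cont_Pred[of "%t _. t"] by (auto intro: tendsto_ident_at)

lemma wt_Pred1: "(%p. wt s t K n (c1 (snd p)) d (fst p)) \<in> bm M1.Pred"
proof -
 note [measurable] = c1_Pred(2)[of d] c1_Pred(3)[of "%m. if m < n then 1 else 0"] time_Pred(1)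
 show ?thesis unfolding wt_def by measurable
qed

section \<open>Balance equations on the product space\<close>

abbreviation QQ :: "('a \<times> 'a) measure" where "QQ \<equiv> Q >< Q"

text \<open>The first component of the pair carries the observed process, the second one the
  unobserved process.\<close>

definition lev :: "(real => real => bool) => 'a \<times> 'a => real => real" where
 "lev R p = intn R (c1 (fst p)) (c2 (snd p))"

text \<open>The factor taken at time \<open>s\<close> is a test function of the past; it makes the
  balance over (s, t] a statement conditional on the intensity at \<open>s\<close>.\<close>

definition wgt :: "(real => real) => real => real => real => nat => 'a \<times> 'a => real => real" where
 "wgt ph s t K n p r = ph (lev (<=) p s) * wt s t K n (c1 (fst p)) (c2 (snd p)) r"

text \<open>Here \<open>Ph\<close> receives the original mark of the first process, whose law is
  \<open>F1\<close>; where the jump of the intensity is meant, \<open>ell'\<close> is applied inside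
  \<open>Ph\<close>.\<close>

definition S1 where
 "S1 ph s t K n Ph p = (\<Sum>j=1..num (c1 (fst p)). ennreal (wgt ph s t K n p (tm (c1 (fst p)) j)) *
  Ph (lev (<) p (tm (c1 (fst p)) j), M1.jz j (fst p)) :: ennreal)"

definition S2 where
 "S2 ph s t K n Ph p = (\<Sum>j=1..num (c2 (snd p)). ennreal (wgt ph s t K n p (tm (c2 (snd p)) j)) *
  Ph (lev (<) p (tm (c2 (snd p)) j), mk (c2 (snd p)) j) :: ennreal)"

definition I0 where
 "I0 ph s t K n Ps p = nni lborel (%r. ennreal (wgt ph s t K n p r) * Ps (lev (<) p r))"

text \<open>The weighted occupation measure of the left limits of the intensity over two copies of
  \<open>Q\<close>. Time integrals and jump sums of the balance all become integrals against
  it.\<close>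

definition nu :: "(real => real) => real => real => real => nat => real measure" where
 "nu ph s t K n = distr (density (QQ >< lborel) (%q. ennreal (wgt ph s t K n (fst q) (snd q)))) borel
  (%q. lev (<) (fst q) (snd q))"

lemma sets_nu [simp, measurable_cong]: "sets (nu ph s t K n) = sets borel"
 and space_nu [simp]: "space (nu ph s t K n) = UNIV"
 by (simp_all add: nu_def)

lemma c1_cfg: "f \<in> measurable M QQ ==> cfg_meas M (%x. c1 (fst (f x)))"
 by (intro c1_meas) measurable

lemma c2_cfg: "f \<in> measurable M QQ ==> cfg_meas M (%x. c2 (snd (f x)))"
 by (intro c2_meas) measurable

lemma lev_meas:
 assumes "f \<in> measurable M QQ" "r \<in> bm M" "is_ord R"
 shows "(%x. lev R (f x) (r x)) \<in> bm M"
 unfolding lev_def using c1_cfg[OF assms(1)] c2_cfg[OF assms(1)] assms(2,3) by (rule meas_intn)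

lemma lik_meas:
 assumes "f \<in> measurable M QQ" "r \<in> bm M" "is_ord R"
 shows "(%x. lik R (c1 (fst (f x))) (c2 (snd (f x))) (r x)) \<in> bm M"
 using c1_cfg[OF assms(1)] c2_cfg[OF assms(1)] assms(2,3) by (rule meas_lik)

lemma wgt_meas:
 assumes f: "f \<in> measurable M QQ" and r: "r \<in> bm M" and ph: "ph \<in> bm borel"
 shows "(%x. wgt ph s t K n (f x) (r x)) \<in> bm M"
proof -
 have [measurable]: "(%x. ph (lev (<=) (f x) s)) \<in> bm M"
  by (rule measurable_compose[OF lev_meas[OF f] ph]) auto
 note [measurable] = meas_wt[OF c1_cfg[OF f] c2_cfg[OF f] r, of s t K n]
 show ?thesis unfolding wgt_def by measurable
qed

text \<open>Splits off a step process on (s, t] with an \<open>F s\<close>-measurable value, so that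
  both factors are predictable when one of the scenarios is fixed.\<close>

lemma wgt_mult: "wgt ph s t K n p r = (indicator {s<..t} r * ph (lev (<=) p s)) * wt s t K n (c1 (fst p)) (c2 (snd p)) r"
 by (simp add: wgt_def wt_def indicator_def)

lemma wt_Pred2: "(%q. wt s t K n c (c2 (snd q)) (fst q)) \<in> bm M2.Pred"
proof -
 have [measurable]: "(%q. card (idx (<) c (fst q))) \<in> measurable M2.Pred (count_space UNIV)"
  by (rule cfg_meas_card[OF cfg_meas_const time_Pred(2)]) simp
 note [measurable] = c2_Pred(2)[of c] time_Pred(2)
 show ?thesis unfolding wt_def by measurable
qed

lemma wgt_Pred1:
 assumes st: "0 <= s" "s <= t" "t <= T" and ph: "ph \<in> bm borel"
 shows "(%q. wgt ph s t K n (snd q, w') (fst q)) \<in> bm M1.Pred"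
proof -
 have sT: "s \<in> {0..T}" using st by auto
 have "(%w. intn (<=) (c1 w) (c2 w') s) \<in> bm (F s)"
  by (rule c1_obs_meas(1)[where f="%x. x" and d="%_. c2 w'", OF M1.obs_F[OF sT] sT measurable_ident_sets[OF refl] cfg_meas_const is_ord(2)])
 from M1.step_Pred[OF st measurable_compose[OF this ph]]
 have [measurable]: "(%q. indicator {s<..t} (fst q) * ph (lev (<=) (snd q, w') s)) \<in> bm M1.Pred"
  by (simp add: case_prod_beta' lev_def)
 note [measurable] = wt_Pred1[of s t K n "c2 w'"]
 show ?thesis unfolding wgt_mult fst_conv snd_conv by measurable
qed

lemma wgt_Pred2:
 assumes st: "0 <= s" "s <= t" "t <= T" and ph: "ph \<in> bm borel"
 shows "(%q. wgt ph s t K n (w, snd q) (fst q)) \<in> bm M2.Pred"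
proof -
 have sT: "s \<in> {0..T}" using st by auto
 have "(%w'. intn (<=) (c1 w) (c2 w') s) \<in> bm (F s)"
  by (rule c2_obs_meas(1)[where f="%x. x" and d="%_. c1 w", OF M2.obs_F[OF sT] sT measurable_ident_sets[OF refl] cfg_meas_const is_ord(2)])
 from M2.step_Pred[OF st measurable_compose[OF this ph]]
 have [measurable]: "(%q. indicator {s<..t} (fst q) * ph (lev (<=) (w, snd q) s)) \<in> bm M2.Pred"
  by (simp add: case_prod_beta' lev_def)
 note [measurable] = wt_Pred2[of s t K n "c1 w"]
 show ?thesis unfolding wgt_mult fst_conv snd_conv by measurable
qed

context
 fixes ph :: "real => real" and s t K :: real and n :: nat
 assumes st: "0 <= s" "s <= t" "t <= T" and ph: "ph \<in> bm borel"
begin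

lemma I0_meas: "Ps \<in> bm borel ==> I0 ph s t K n Ps \<in> bm QQ"
proof -
 assume [measurable]: "Ps \<in> bm borel"
 note [measurable] = wgt_meas[OF measurable_fst measurable_snd[of QQ borel] ph, of s t K n] lev_meas[OF measurable_fst measurable_snd[of QQ borel] is_ord(1)]
 have "(%q. ennreal (wgt ph s t K n (fst q) (snd q)) * Ps (lev (<) (fst q) (snd q))) \<in> bm (QQ >< borel)"
  by measurable
 then have "(%q. ennreal (wgt ph s t K n (fst q) (snd q)) * Ps (lev (<) (fst q) (snd q))) \<in> bm (QQ >< lborel)"
  by (subst measurable_cong_sets[OF sets_pair_measure_cong refl]) auto
 from lborel.borel_measurable_nn_integral_fst[OF this] show ?thesis unfolding I0_def[abs_def] by simp
qed

lemma E_I0: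
 assumes Ps[measurable]: "Ps \<in> bm borel"
 shows "nni QQ (%p. I0 ph s t K n Ps p) = nni (nu ph s t K n) (%x. Ps x)"
proof -
 have sn: "snd \<in> bm (QQ >< lborel)" using measurable_snd[of QQ lborel] by simp
 note [measurable] = wgt_meas[OF measurable_fst sn ph, of s t K n] lev_meas[OF measurable_fst sn is_ord(1)]
 have m: "(%q. ennreal (wgt ph s t K n (fst q) (snd q)) * Ps (lev (<) (fst q) (snd q))) \<in> bm (QQ >< lborel)"
  by measurable
 have "nni (nu ph s t K n) (%x. Ps x) = nni (density (QQ >< lborel) (%q. ennreal (wgt ph s t K n (fst q) (snd q)))) (%q. Ps (lev (<) (fst q) (snd q)))"
  unfolding nu_def by (rule nn_integral_distr) measurable
 also have "... = nni (QQ >< lborel) (%q. ennreal (wgt ph s t K n (fst q) (snd q)) * Ps (lev (<) (fst q) (snd q)))"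
  by (rule nn_integral_density) measurable
 also have "... = nni QQ (%p. I0 ph s t K n Ps p)"
  using lborel.nn_integral_fst[OF m] by (simp add: I0_def)
 finally show ?thesis by simp
qed

lemma S1_meas:
 assumes [measurable]: "Ph \<in> bm (borel >< borel)"
 shows "S1 ph s t K n Ph \<in> bm QQ"
proof -
 have id: "(%x. x) \<in> measurable QQ QQ" by simp
 have c: "cfg_meas QQ (%p. c1 (fst p))" by (rule c1_cfg[OF id])
 have [measurable]: "(%p. tm (c1 (fst p)) j) \<in> bm QQ" for j using c by (simp add: cfg_meas_def)
 have N: "(%p. num (c1 (fst p))) \<in> measurable QQ (count_space UNIV)" using c by (simp add: cfg_meas_def)
 note [measurable] = wgt_meas[OF id _ ph, of "%p. tm (c1 (fst p)) j" s t K n for j] lev_meas[OF id _ is_ord(1), of "%p. tm (c1 (fst p)) j" for j]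
 have "(%p. \<Sum>j=1..m. ennreal (wgt ph s t K n p (tm (c1 (fst p)) j)) *
  Ph (lev (<) p (tm (c1 (fst p)) j), M1.jz j (fst p))) \<in> bm QQ" for m by measurable
 from measurable_compose_countable[OF this N] show ?thesis unfolding S1_def[abs_def] .
qed

lemma S2_meas:
 assumes [measurable]: "Ph \<in> bm (borel >< borel)"
 shows "S2 ph s t K n Ph \<in> bm QQ"
proof -
 have id: "(%x. x) \<in> measurable QQ QQ" by simp
 have c: "cfg_meas QQ (%p. c2 (snd p))" by (rule c2_cfg[OF id])
 have [measurable]: "(%p. tm (c2 (snd p)) j) \<in> bm QQ" "(%p. mk (c2 (snd p)) j) \<in> bm QQ" for j
  using c by (simp_all add: cfg_meas_def)
 have N: "(%p. num (c2 (snd p))) \<in> measurable QQ (count_space UNIV)" using c by (simp add: cfg_meas_def)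
 note [measurable] = wgt_meas[OF id _ ph, of "%p. tm (c2 (snd p)) j" s t K n for j] lev_meas[OF id _ is_ord(1), of "%p. tm (c2 (snd p)) j" for j]
 have "(%p. \<Sum>j=1..m. ennreal (wgt ph s t K n p (tm (c2 (snd p)) j)) *
  Ph (lev (<) p (tm (c2 (snd p)) j), mk (c2 (snd p)) j)) \<in> bm QQ" for m by measurable
 from measurable_compose_countable[OF this N] show ?thesis unfolding S2_def[abs_def] .
qed

lemma wgt_0: "r \<notin> {0<..T} ==> wgt ph s t K n p r = 0"
 using st by (auto simp: wgt_def wt_def indicator_def)

text \<open>For fixed \<open>w'\<close> the summand is predictable in \<open>w\<close>, so
  Campbell's formula for the first process applies with the second scenario as a parameter.\<close>

lemma E_S1_fixed:
 assumes Ph: "Ph \<in> bm (borel >< borel)"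
 shows "nni Q (%w. S1 ph s t K n Ph (w, w')) = nni Q (%w. I0 ph s t K n (%x. nni F1 (%z. Ph (x, z))) (w, w'))"
proof -
 define \<Theta> where "\<Theta> q = ennreal (wgt ph s t K n (snd (fst q), w') (fst (fst q))) * Ph (lev (<) (snd (fst q), w') (fst (fst q)), snd q)" for q
 note [measurable] = wgt_Pred1[OF st ph, of K n w'] Ph
 have [measurable]: "(%q. lev (<) (snd q, w') (fst q)) \<in> bm M1.Pred"
  using c1_Pred(1)[of "c2 w'"] by (simp add: lev_def)
 have m: "\<Theta> \<in> bm (M1.Pred >< borel)" unfolding \<Theta>_def by measurable
 have "nni Q (%w. S1 ph s t K n Ph (w, w')) = nni Q (%w. (\<Sum>j=1..num (c1 w). \<Theta> ((tm (c1 w) j, w), Z1 j w)))"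
  by (intro nn_integral_cong) (simp add: S1_def \<Theta>_def M1.jz_def num_c1)
 also have "... = nni Q (%w. nni lborel (%r. nni F1 (%z. \<Theta> ((r, w), z))))"
  by (rule campbell1[OF m]) (simp add: \<Theta>_def wgt_0)
 also have "... = nni Q (%w. I0 ph s t K n (%x. nni F1 (%z. Ph (x, z))) (w, w'))"
 proof (intro nn_integral_cong)
  fix w
  show "nni lborel (%r. nni F1 (%z. \<Theta> ((r, w), z))) = I0 ph s t K n (%x. nni F1 (%z. Ph (x, z))) (w, w')"
   unfolding I0_def \<Theta>_def fst_conv snd_conv
   by (intro nn_integral_cong nn_integral_cmult) (use measurable_Pair2[OF Ph] in \<open>simp add: measurable_cong_sets[OF M1.sets_K refl]\<close>)
 qed
 finally show ?thesis .
qed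

lemma E_S2_fixed:
 assumes Ph: "Ph \<in> bm (borel >< borel)"
 shows "nni Q (%w'. S2 ph s t K n Ph (w, w')) = ennreal \<rho> * nni Q (%w'. I0 ph s t K n (%x. nni F2 (%z. Ph (x, z))) (w, w'))"
proof -
 define \<Theta> where "\<Theta> q = ennreal (wgt ph s t K n (w, snd (fst q)) (fst (fst q))) * Ph (lev (<) (w, snd (fst q)) (fst (fst q)), snd q)" for q
 note [measurable] = wgt_Pred2[OF st ph, of K n w] Ph
 have [measurable]: "(%q. lev (<) (w, snd q) (fst q)) \<in> bm M2.Pred"
  using c2_Pred(1)[of "c1 w"] by (simp add: lev_def)
 have m: "\<Theta> \<in> bm (M2.Pred >< borel)" unfolding \<Theta>_def by measurable
 have "nni Q (%w'. S2 ph s t K n Ph (w, w')) = nni Q (%w'. (\<Sum>j=1..num (c2 w'). \<Theta> ((tm (c2 w') j, w'), mk (c2 w') j)))"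
  by (intro nn_integral_cong) (simp add: S2_def \<Theta>_def)
 also have "... = ennreal \<rho> * nni Q (%w'. nni lborel (%r. nni F2 (%z. \<Theta> ((r, w'), z))))"
  by (rule campbell2[OF m]) (simp add: \<Theta>_def wgt_0)
 also have "nni Q (%w'. nni lborel (%r. nni F2 (%z. \<Theta> ((r, w'), z)))) = nni Q (%w'. I0 ph s t K n (%x. nni F2 (%z. Ph (x, z))) (w, w'))"
 proof (intro nn_integral_cong)
  fix w'
  show "nni lborel (%r. nni F2 (%z. \<Theta> ((r, w'), z))) = I0 ph s t K n (%x. nni F2 (%z. Ph (x, z))) (w, w')"
   unfolding I0_def \<Theta>_def fst_conv snd_conv
   by (intro nn_integral_cong nn_integral_cmult) (use measurable_Pair2[OF Ph] in \<open>simp add: measurable_cong_sets[OF M2.sets_K refl]\<close>)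
 qed
 finally show ?thesis .
qed

lemma kernel_meas:
 fixes Ph :: "real \<times> real => ennreal"
 assumes Ph: "Ph \<in> bm (borel >< borel)"
 shows "(%x. nni F1 (%z. Ph (x, z))) \<in> bm borel" "(%x. nni F2 (%z. Ph (x, z))) \<in> bm borel"
proof -
 interpret P1: prob_space F1 by (rule M1.prob_space_K)
 interpret P2: prob_space F2 by (rule M2.prob_space_K)
 have e: "sets ((borel :: real measure) >< F1) = sets (borel >< borel)" "sets ((borel :: real measure) >< F2) = sets (borel >< borel)"
  by (intro sets_pair_measure_cong refl M1.sets_K M2.sets_K)+
 have "Ph \<in> bm (borel >< F1)" "Ph \<in> bm (borel >< F2)"
  using Ph unfolding measurable_cong_sets[OF e(1) refl] measurable_cong_sets[OF e(2) refl] by simp_all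
 from P1.borel_measurable_nn_integral_fst[OF this(1)] P2.borel_measurable_nn_integral_fst[OF this(2)]
 show "(%x. nni F1 (%z. Ph (x, z))) \<in> bm borel" "(%x. nni F2 (%z. Ph (x, z))) \<in> bm borel" .
qed

lemma E_S1:
 assumes Ph: "Ph \<in> bm (borel >< borel)"
 shows "nni QQ (%p. S1 ph s t K n Ph p) = nni (nu ph s t K n) (%x. nni F1 (%z. Ph (x, z)))"
proof -
 interpret PP: pair_sigma_finite Q Q ..
 have "nni QQ (%p. S1 ph s t K n Ph p) = nni Q (%w'. nni Q (%w. S1 ph s t K n Ph (w, w')))"
  using PP.nn_integral_snd[OF S1_meas[OF Ph]] by simp
 also have "... = nni Q (%w'. nni Q (%w. I0 ph s t K n (%x. nni F1 (%z. Ph (x, z))) (w, w')))"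
  by (simp only: E_S1_fixed[OF Ph])
 also have "... = nni QQ (%p. I0 ph s t K n (%x. nni F1 (%z. Ph (x, z))) p)"
  using PP.nn_integral_snd[OF I0_meas[OF kernel_meas(1)[OF Ph]]] by simp
 finally show ?thesis by (simp only: E_I0[OF kernel_meas(1)[OF Ph]])
qed

lemma E_S2:
 assumes Ph: "Ph \<in> bm (borel >< borel)"
 shows "nni QQ (%p. S2 ph s t K n Ph p) = ennreal \<rho> * nni (nu ph s t K n) (%x. nni F2 (%z. Ph (x, z)))"
proof -
 have m: "(%w. nni Q (%w'. I0 ph s t K n (%x. nni F2 (%z. Ph (x, z))) (w, w'))) \<in> bm Q"
  using borel_measurable_nn_integral_fst[OF I0_meas[OF kernel_meas(2)[OF Ph]]] by simp
 have "nni QQ (%p. S2 ph s t K n Ph p) = nni Q (%w. nni Q (%w'. S2 ph s t K n Ph (w, w')))"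
  using nn_integral_fst[OF S2_meas[OF Ph]] by simp
 also have "... = ennreal \<rho> * nni Q (%w. nni Q (%w'. I0 ph s t K n (%x. nni F2 (%z. Ph (x, z))) (w, w')))"
  by (simp only: E_S2_fixed[OF Ph] nn_integral_cmult[OF m])
 also have "nni Q (%w. nni Q (%w'. I0 ph s t K n (%x. nni F2 (%z. Ph (x, z))) (w, w'))) = nni QQ (%p. I0 ph s t K n (%x. nni F2 (%z. Ph (x, z))) p)"
  using nn_integral_fst[OF I0_meas[OF kernel_meas(2)[OF Ph]]] by simp
 finally show ?thesis by (simp only: E_I0[OF kernel_meas(2)[OF Ph]])
qed

end

text \<open>Countable quantifiers over indices, a form from which the measurability of
  \<open>okp\<close> can be read off.\<close>

lemma config_ok_alt:
 "config_ok T c \<longleftrightarrow> (\<forall>j. 1 <= j \<longrightarrow> j <= num c \<longrightarrow> 0 < tm c j \<and> tm c j <= T \<and> 0 <= mk c j) \<and>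
  (\<forall>i j. 1 <= i \<longrightarrow> i <= num c \<longrightarrow> 1 <= j \<longrightarrow> j <= num c \<longrightarrow> tm c i = tm c j \<longrightarrow> i = j)"
 unfolding config_ok_def inj_on_def Ball_def atLeastAtMost_iff by meson

lemma times_disjoint_alt:
 "times c \<inter> times d = {} \<longleftrightarrow>
  (\<forall>i j. 1 <= i \<longrightarrow> i <= num c \<longrightarrow> 1 <= j \<longrightarrow> j <= num d \<longrightarrow> tm c i \<noteq> tm d j)"
proof
 assume "times c \<inter> times d = {}"
 then have "tm c i \<noteq> tm d j" if "i \<in> {1..num c}" "j \<in> {1..num d}" for i j
  using imageI[OF that(1), of "tm c"] imageI[OF that(2), of "tm d"] unfolding times_def by (metis IntI empty_iff)
 then show "\<forall>i j. 1 <= i \<longrightarrow> i <= num c \<longrightarrow> 1 <= j \<longrightarrow> j <= num d \<longrightarrow> tm c i \<noteq> tm d j" by simp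
qed (auto simp: times_def)

lemma AE_okp: "AE p in QQ. okp (c1 (fst p)) (c2 (snd p))"
proof -
 interpret PP: pair_sigma_finite Q Q ..
 have id: "(%x. x) \<in> measurable QQ QQ" by simp
 have [measurable]: "(%p. num (c1 (fst p))) \<in> measurable QQ (count_space UNIV)"
  "(%p. num (c2 (snd p))) \<in> measurable QQ (count_space UNIV)"
  "\<And>j. (%p. tm (c1 (fst p)) j) \<in> bm QQ" "\<And>j. (%p. mk (c1 (fst p)) j) \<in> bm QQ"
  "\<And>j. (%p. tm (c2 (snd p)) j) \<in> bm QQ" "\<And>j. (%p. mk (c2 (snd p)) j) \<in> bm QQ"
  using c1_cfg[OF id] c2_cfg[OF id] by (simp_all add: cfg_meas_def)
 have m: "{p\<in>space QQ. okp (c1 (fst p)) (c2 (snd p))} \<in> sets QQ"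
  unfolding okp_def config_ok_alt times_disjoint_alt by measurable
 have "AE w in Q. AE w' in Q. okp (c1 (fst (w, w'))) (c2 (snd (w, w')))"
  using c1_ok by eventually_elim (use okp_c2 in simp)
 with m show ?thesis by (rule PP.AE_pair_measure)
qed

definition Yv where
 "Yv ph s K n g t p = ph (lev (<=) p s) * (exp (- K * t) * (if card (idx (<=) (c1 (fst p)) t) < n then 1 else 0)
   * lik (<=) (c1 (fst p)) (c2 (snd p)) t * g (lev (<=) p t) :: real)"

lemma Yv_meas:
 assumes [measurable]: "ph \<in> bm borel" "g \<in> bm borel"
 shows "Yv ph s K n g t \<in> bm QQ"
proof -
 have id: "(%x. x) \<in> measurable QQ QQ" by simp
 note [measurable] = lev_meas[OF id borel_measurable_const is_ord(2)] lik_meas[OF id borel_measurable_const is_ord(2)]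
  cfg_meas_card[OF c1_cfg[OF id] borel_measurable_const is_ord(2)]
 show ?thesis unfolding Yv_def[abs_def] by measurable
qed

lemma pointwise_balance:
 assumes p: "p \<in> space QQ" and ok: "okp (c1 (fst p)) (c2 (snd p))"
  and st: "0 <= s" "s <= t" "t <= T"
  and ph: "ph \<in> bm borel" "\<And>x. 0 <= ph x"
  and g: "C1pos g g'" and nn: "\<And>x. 0 <= g x"
 defines "a \<equiv> %x. \<alpha> * (\<beta> - x) * g' x"
 shows "ennreal (Yv ph s K n g t p) + I0 ph s t K n (%x. ennreal (x * g x + max 0 (- a x) + max 0 (K - 1) * g x)) p
   + S1 ph s t K n (%(x, z). ennreal (g x)) p + S2 ph s t K n (%(x, z). ennreal (max 0 (g x - g (x + z)))) p
  = ennreal (Yv ph s K n g s p) + I0 ph s t K n (%x. ennreal (max 0 (a x) + max 0 (1 - K) * g x)) p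
   + S1 ph s t K (n - 1) (%(x, z). ennreal (x * g (x + ell' z))) p
   + S2 ph s t K n (%(x, z). ennreal (max 0 (g (x + z) - g x))) p"
proof -
 let ?c = "c1 (fst p)" and ?d = "c2 (snd p)"
 have c: "config_ok T ?c" and d: "config_ok T ?d" and dis: "times ?c \<inter> times ?d = {}"
  using ok by (auto simp: okp_def)
 have [measurable]: "g \<in> bm borel" "g' \<in> bm borel" using g by (auto simp: C1pos_def)
 have w: "fst p \<in> space Q" using p by (auto simp: space_pair_measure)
 let ?f = "ph (lev (<=) p s)"
 have f0: "0 <= ?f" by (rule ph)
 have w0: "0 <= wt s t K m ?c ?d r" for m r by (rule wt_nonneg[OF c d])
 have wg: "ennreal (wgt ph s t K m p r) = ennreal ?f * ennreal (wt s t K m ?c ?d r)" for m r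
  unfolding wgt_def using f0 by (rule ennreal_mult')
 have lev: "intn (<) ?c ?d r = lev (<) p r" for r by (simp add: lev_def)
 have pm: "(%_. p) \<in> measurable lborel QQ" using p by simp
 have id: "(%x. x) \<in> bm lborel" by simp
 note [measurable] = lev_meas[OF pm id is_ord(1)] meas_wt[OF c1_cfg[OF pm] c2_cfg[OF pm] id]
 have h1: "ennreal ?f * nni lborel (%r. ennreal (wt s t K n ?c ?d r * A (lev (<) p r))) = I0 ph s t K n (%x. ennreal (A x)) p"
  if [measurable]: "A \<in> bm borel" for A
  unfolding I0_def wg using w0
  by (subst nn_integral_cmult[symmetric]) (auto simp: ennreal_mult' mult.assoc intro!: nn_integral_cong)
 have h2: "ennreal ?f * ennreal (\<Sum>j=1..num e. wt s t K m ?c ?d (tm e j) * B j)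
  = (\<Sum>j=1..num e. ennreal (wgt ph s t K m p (tm e j)) * ennreal (B j))"
  if "\<And>j. j \<in> {1..num e} ==> 0 <= B j" for B e m
 proof -
  have "ennreal (\<Sum>j=1..num e. wt s t K m ?c ?d (tm e j) * B j) = (\<Sum>j=1..num e. ennreal (wt s t K m ?c ?d (tm e j) * B j))"
   using that w0 by (intro sum_ennreal[symmetric]) auto
  also have "... = (\<Sum>j=1..num e. ennreal (wt s t K m ?c ?d (tm e j)) * ennreal (B j))"
   using w0 by (intro sum.cong refl ennreal_mult')
  finally show ?thesis unfolding wg by (simp add: sum_distrib_left mult.assoc)
 qed
 have mk: "mk ?c j = ell' (M1.jz j (fst p))" if "j \<in> {1..num ?c}" for j
  using c1_jump(2)[OF w] that by (simp add: num_c1 M1.jz_def)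
 have l0': "0 <= lev (<) p (tm ?c j)" if "j \<in> {1..num ?c}" for j
  unfolding lev_def using intn_pos[OF c d less_imp_le[OF tm_pos[OF c that]]] by (simp add: less_imp_le)
 have Y: "ennreal ?f * ennreal (exp (- K * r) * (if card (idx (<=) ?c r) < n then 1 else 0) * lik (<=) ?c ?d r * g (intn (<=) ?c ?d r))
   = ennreal (Yv ph s K n g r p)" for r
  unfolding Yv_def lev_def by (rule ennreal_mult'[symmetric]) (rule ph)
 note cut = pathwise_cut[OF c d dis g nn st(1,2), of K n, folded a_def]
 have C1: "ennreal ?f * ennreal (\<Sum>j=1..num ?c. wt s t K n ?c ?d (tm ?c j) * g (lev (<) p (tm ?c j))) = S1 ph s t K n (%(x, z). ennreal (g x)) p"
  unfolding S1_def using nn by (subst h2) auto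
 have C2: "ennreal ?f * ennreal (\<Sum>j=1..num ?c. wt s t K (n - 1) ?c ?d (tm ?c j) * (lev (<) p (tm ?c j) * g (lev (<) p (tm ?c j) + mk ?c j)))
   = S1 ph s t K (n - 1) (%(x, z). ennreal (x * g (x + ell' z))) p"
  unfolding S1_def using nn l0' by (subst h2) (auto simp: mk intro!: mult_nonneg_nonneg)
 have D: "ennreal ?f * ennreal (\<Sum>j=1..num ?d. wt s t K n ?c ?d (tm ?d j) * max 0 (g (lev (<) p (tm ?d j)) - g (lev (<) p (tm ?d j) + mk ?d j)))
   = S2 ph s t K n (%(x, z). ennreal (max 0 (g x - g (x + z)))) p"
  "ennreal ?f * ennreal (\<Sum>j=1..num ?d. wt s t K n ?c ?d (tm ?d j) * max 0 (g (lev (<) p (tm ?d j) + mk ?d j) - g (lev (<) p (tm ?d j))))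
   = S2 ph s t K n (%(x, z). ennreal (max 0 (g (x + z) - g x))) p"
  unfolding S2_def by (subst h2; simp)+
 have I: "ennreal ?f * nni lborel (%r. ennreal (wt s t K n ?c ?d r * (lev (<) p r * g (lev (<) p r) + max 0 (- a (lev (<) p r)) + max 0 (K - 1) * g (lev (<) p r))))
   = I0 ph s t K n (%x. ennreal (x * g x + max 0 (- a x) + max 0 (K - 1) * g x)) p"
  "ennreal ?f * nni lborel (%r. ennreal (wt s t K n ?c ?d r * (max 0 (a (lev (<) p r)) + max 0 (1 - K) * g (lev (<) p r))))
   = I0 ph s t K n (%x. ennreal (max 0 (a x) + max 0 (1 - K) * g x)) p"
  unfolding a_def by (rule h1, measurable)+
 show ?thesis
  using arg_cong[OF cut, of "%x. ennreal ?f * x"] unfolding lev distrib_left[of "ennreal ?f"] Y C1 C2 D a_def I[unfolded a_def] .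
qed

text \<open>Expectation of \<open>pointwise_balance\<close>, where Campbell's formula turns the jump
  sums into integrals against \<open>nu\<close>. The identity holds in \<open>ennreal\<close>; terms
  may be cancelled only after they are known to be finite.\<close>

lemma balance:
 assumes st: "0 <= s" "s <= t" "t <= T"
  and ph: "ph \<in> bm borel" "\<And>x. 0 <= ph x"
  and g: "C1pos g g'" and nn: "\<And>x. 0 <= g x"
 defines "a \<equiv> %x. \<alpha> * (\<beta> - x) * g' x"
 shows "nni QQ (%p. ennreal (Yv ph s K n g t p)) + nni (nu ph s t K n) (%x. ennreal (x * g x + max 0 (- a x) + max 0 (K - 1) * g x))
   + nni (nu ph s t K n) (%x. ennreal (g x)) + ennreal \<rho> * nni (nu ph s t K n) (%x. nni F2 (%z. ennreal (max 0 (g x - g (x + z)))))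
  = nni QQ (%p. ennreal (Yv ph s K n g s p)) + nni (nu ph s t K n) (%x. ennreal (max 0 (a x) + max 0 (1 - K) * g x))
   + nni (nu ph s t K (n - 1)) (%x. nni F1 (%z. ennreal (x * g (x + ell' z))))
   + ennreal \<rho> * nni (nu ph s t K n) (%x. nni F2 (%z. ennreal (max 0 (g (x + z) - g x))))"
proof -
 interpret P1: prob_space F1 by (rule M1.prob_space_K)
 have [measurable]: "g \<in> bm borel" "g' \<in> bm borel" using g by (auto simp: C1pos_def)
 have [measurable]: "a \<in> bm borel" unfolding a_def by measurable
 note ms = I0_meas[OF st ph(1)] S1_meas[OF st ph(1)] S2_meas[OF st ph(1)]
 have my: "(%p. ennreal (Yv ph s K n g r p)) \<in> bm QQ" for r
  by (rule measurable_compose[OF Yv_meas measurable_ennreal]) (use ph in measurable)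
 have mm: "I0 ph s t K n (%x. ennreal (x * g x + max 0 (- a x) + max 0 (K - 1) * g x)) \<in> bm QQ"
  "I0 ph s t K n (%x. ennreal (max 0 (a x) + max 0 (1 - K) * g x)) \<in> bm QQ"
  "S1 ph s t K n (%(x, z). ennreal (g x)) \<in> bm QQ"
  "S1 ph s t K (n - 1) (%(x, z). ennreal (x * g (x + ell' z))) \<in> bm QQ"
  "S2 ph s t K n (%(x, z). ennreal (max 0 (g x - g (x + z)))) \<in> bm QQ"
  "S2 ph s t K n (%(x, z). ennreal (max 0 (g (x + z) - g x))) \<in> bm QQ"
  by (intro ms; measurable)+
 have "nni QQ (%p. ennreal (Yv ph s K n g t p) + I0 ph s t K n (%x. ennreal (x * g x + max 0 (- a x) + max 0 (K - 1) * g x)) p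
   + S1 ph s t K n (%(x, z). ennreal (g x)) p + S2 ph s t K n (%(x, z). ennreal (max 0 (g x - g (x + z)))) p)
  = nni QQ (%p. ennreal (Yv ph s K n g s p) + I0 ph s t K n (%x. ennreal (max 0 (a x) + max 0 (1 - K) * g x)) p
   + S1 ph s t K (n - 1) (%(x, z). ennreal (x * g (x + ell' z))) p
   + S2 ph s t K n (%(x, z). ennreal (max 0 (g (x + z) - g x))) p)"
 proof (rule nn_integral_cong_AE)
  show "AE p in QQ. ennreal (Yv ph s K n g t p) + I0 ph s t K n (%x. ennreal (x * g x + max 0 (- a x) + max 0 (K - 1) * g x)) p
   + S1 ph s t K n (%(x, z). ennreal (g x)) p + S2 ph s t K n (%(x, z). ennreal (max 0 (g x - g (x + z)))) p
  = ennreal (Yv ph s K n g s p) + I0 ph s t K n (%x. ennreal (max 0 (a x) + max 0 (1 - K) * g x)) p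
   + S1 ph s t K (n - 1) (%(x, z). ennreal (x * g (x + ell' z))) p
   + S2 ph s t K n (%(x, z). ennreal (max 0 (g (x + z) - g x))) p"
   using AE_okp AE_space
  proof eventually_elim
   case (elim p)
   show ?case unfolding a_def by (rule pointwise_balance[OF elim(2,1) st ph g nn])
  qed
 qed
 note e = this
 have E: "nni QQ (%p. I0 ph s t K n (%x. ennreal (x * g x + max 0 (- a x) + max 0 (K - 1) * g x)) p) = nni (nu ph s t K n) (%x. ennreal (x * g x + max 0 (- a x) + max 0 (K - 1) * g x))"
  "nni QQ (%p. I0 ph s t K n (%x. ennreal (max 0 (a x) + max 0 (1 - K) * g x)) p) = nni (nu ph s t K n) (%x. ennreal (max 0 (a x) + max 0 (1 - K) * g x))"
  by (intro E_I0[OF st ph(1)]; measurable)+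
 have S: "nni QQ (%p. S1 ph s t K n (%(x, z). ennreal (g x)) p) = nni (nu ph s t K n) (%x. ennreal (g x))"
  by (subst E_S1[OF st ph(1)]) (simp_all add: P1.emeasure_space_1[simplified])
 have S': "nni QQ (%p. S1 ph s t K (n - 1) (%(x, z). ennreal (x * g (x + ell' z))) p) = nni (nu ph s t K (n - 1)) (%x. nni F1 (%z. ennreal (x * g (x + ell' z))))"
  by (subst E_S1[OF st ph(1)]) simp_all
 have D: "nni QQ (%p. S2 ph s t K n (%(x, z). ennreal (max 0 (g x - g (x + z)))) p) = ennreal \<rho> * nni (nu ph s t K n) (%x. nni F2 (%z. ennreal (max 0 (g x - g (x + z)))))"
  "nni QQ (%p. S2 ph s t K n (%(x, z). ennreal (max 0 (g (x + z) - g x))) p) = ennreal \<rho> * nni (nu ph s t K n) (%x. nni F2 (%z. ennreal (max 0 (g (x + z) - g x))))"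
  by (subst E_S2[OF st ph(1)]; simp)+
 have add4: "nni QQ (%p. f1 p + f2 p + f3 p + f4 p) = nni QQ (%p. f1 p) + nni QQ (%p. f2 p) + nni QQ (%p. f3 p) + nni QQ (%p. f4 p)"
  if [measurable]: "f1 \<in> bm QQ" "f2 \<in> bm QQ" "f3 \<in> bm QQ" "f4 \<in> bm QQ"
  for f1 f2 f3 f4 :: "'a \<times> 'a => ennreal"
  by (simp add: nn_integral_add)
 show ?thesis using e unfolding add4[OF my mm(1,3,5)] add4[OF my mm(2,4,6)] E S S' D .
qed

lemma nu_le:
 assumes st: "0 <= s" "s <= t" "t <= T" and st': "0 <= s'" "s' <= t'" "t' <= T"
  and ph: "ph \<in> bm borel" and ph': "ph' \<in> bm borel" and ps: "ps \<in> bm borel"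
  and le: "\<And>p r. okp (c1 (fst p)) (c2 (snd p)) ==> wgt ph s t K n p r <= B * wgt ph' s' t' K' n' p r" and B: "0 <= B"
 shows "nni (nu ph s t K n) (%x. ps x) <= ennreal B * nni (nu ph' s' t' K' n') (%x. ps x)"
proof -
 have m: "I0 ph' s' t' K' n' ps \<in> bm QQ" by (rule I0_meas[OF st' ph' ps])
 have "nni QQ (%p. I0 ph s t K n ps p) <= nni QQ (%p. ennreal B * I0 ph' s' t' K' n' ps p)"
 proof (intro nn_integral_mono_AE, use AE_okp AE_space in eventually_elim)
  fix p assume ok: "okp (c1 (fst p)) (c2 (snd p))" and p: "p \<in> space QQ"
  have pm: "(%_. p) \<in> measurable lborel QQ" using p by simp
  have id: "(%x. x) \<in> bm lborel" by simp
  note [measurable] = lev_meas[OF pm id is_ord(1)] wgt_meas[OF pm id ph'] ps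
  have "I0 ph s t K n ps p <= nni lborel (%r. ennreal B * (ennreal (wgt ph' s' t' K' n' p r) * ps (lev (<) p r)))"
   unfolding I0_def mult.assoc[symmetric] using le[OF ok] B
   by (intro nn_integral_mono mult_right_mono) (auto simp: ennreal_mult'[symmetric] intro!: ennreal_leI)
  also have "... = ennreal B * I0 ph' s' t' K' n' ps p"
   unfolding I0_def by (rule nn_integral_cmult) measurable
  finally show "I0 ph s t K n ps p <= ennreal B * I0 ph' s' t' K' n' ps p" .
 qed
 then show ?thesis using m by (simp add: E_I0[OF st ph ps] E_I0[OF st' ph' ps] nn_integral_cmult)
qed

lemma nu_mono:
 assumes st: "0 <= s" "s <= t" "t <= T" and ph: "ph \<in> bm borel" "\<And>x. 0 <= ph x"
  and ps: "ps \<in> bm borel" and n: "n <= m" and K: "K' <= K"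
 shows "nni (nu ph s t K n) (%x. ps x) <= nni (nu ph s t K' m) (%x. ps x)"
proof -
 have "wgt ph s t K n p r <= 1 * wgt ph s t K' m p r" if ok: "okp (c1 (fst p)) (c2 (snd p))" for p r
 proof (cases "r \<in> {s<..t}")
  case True
  then have "exp (- K * r) <= exp (- K' * r)" using K st by (simp add: mult_right_mono)
  moreover have "0 <= lik (<) (c1 (fst p)) (c2 (snd p)) r" using ok by (intro lik_nonneg[of T]) (auto simp: okp_def)
  ultimately show ?thesis unfolding wgt_def wt_def using True ph(2) n
   by (auto intro!: mult_left_mono mult_right_mono)
 qed (simp add: wgt_def wt_def)
 from nu_le[OF st st ph(1) ph(1) ps this] show ?thesis by simp
qed

lemma nu_pos:
 assumes st: "0 <= s" "s <= t" "t <= T" and ph: "ph \<in> bm borel"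
 shows "AE x in nu ph s t K n. lmin <= x"
proof (rule AE_I')
 have "emeasure (nu ph s t K n) {..<lmin} = nni (nu ph s t K n) (%x. indicator {..<lmin} x)" by simp
 also have "... = nni QQ (%p. I0 ph s t K n (indicator {..<lmin}) p)" by (rule E_I0[OF st ph, symmetric]) simp
 also have "... = nni QQ (%p. 0)"
 proof (intro nn_integral_cong_AE, use AE_okp in eventually_elim)
  fix p assume ok: "okp (c1 (fst p)) (c2 (snd p))"
  have "ennreal (wgt ph s t K n p r) * indicator {..<lmin} (lev (<) p r) = 0" for r
  proof (cases "r \<in> {s<..t}")
   case True
   then have "lmin <= lev (<) p r" unfolding lev_def using ok st by (intro intn_ge[of T]) (auto simp: okp_def)
   then show ?thesis by simp
  qed (simp add: wgt_def wt_def)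
  then show "I0 ph s t K n (indicator {..<lmin}) p = 0" unfolding I0_def by (simp only: nn_integral_const mult_zero_left)
 qed
 finally show "{..<lmin} \<in> null_sets (nu ph s t K n)" by (intro null_setsI) auto
qed auto

lemma initial_values:
 assumes "okp (c1 (fst p)) (c2 (snd p))"
 shows "idx (<=) (c1 (fst p)) 0 = {}" "lev (<=) p 0 = l0" "lik (<=) (c1 (fst p)) (c2 (snd p)) 0 = 1"
proof -
 have "idx (<=) e 0 = {}" if "config_ok T e" for e
  using that by (force simp: idx_def config_ok_def)
 then have i: "idx (<=) (c1 (fst p)) 0 = {}" "idx (<=) (c2 (snd p)) 0 = {}" using assms by (auto simp: okp_def)
 then show "idx (<=) (c1 (fst p)) 0 = {}" "lev (<=) p 0 = l0" "lik (<=) (c1 (fst p)) (c2 (snd p)) 0 = 1"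
  by (auto simp: lev_def intn_def intS_def lik_def likS_def cumS_def)
qed

lemma E_Yv_0:
 "0 < n ==> nni QQ (%p. ennreal (Yv ph 0 K n g 0 p)) = ennreal (ph l0 * g l0)"
proof -
 assume n: "0 < n"
 interpret PP: prob_space QQ by (rule prob_space_pair) (unfold_locales)
 have "nni QQ (%p. ennreal (Yv ph 0 K n g 0 p)) = nni QQ (%p. ennreal (ph l0 * g l0))"
  by (intro nn_integral_cong_AE, use AE_okp in eventually_elim) (use n in \<open>simp add: Yv_def initial_values\<close>)
 then show ?thesis by (simp add: PP.emeasure_space_1)
qed

section \<open>First moment of the intensity and monotonicity of the likelihood\<close>

abbreviation one :: "real => real" where "one \<equiv> %_. 1"

lemma C1pos_one: "C1pos one (%_. 0)"
 by (simp add: C1pos_def)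

lemma nu_zero: "0 <= s ==> s <= t ==> t <= T ==> ph \<in> bm borel ==> ps \<in> bm borel ==> nni (nu ph s t K 0) (%x. ps x) = 0"
proof (subst E_I0[symmetric])
 have "I0 ph s t K 0 ps = (%_. 0)" by (simp add: fun_eq_iff I0_def wgt_def wt_def)
 then show "nni QQ (%p. I0 ph s t K 0 ps p) = 0" by simp
qed

text \<open>For g = 1 and K = 1 the drift corrections vanish and the balance reads: terminal value +
  first moment at level n + mass at level n = 1 + first moment at level n - 1. Induction gives the
  first bound; monotonicity of the first moment in n then gives the second.\<close>

lemma nu_first_bounds:
 shows "nni (nu one 0 T 1 n) (%x. ennreal x) <= of_nat n" and "emeasure (nu one 0 T 1 n) UNIV <= 1"
proof -
 interpret P1: prob_space F1 by (rule M1.prob_space_K)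
 define a where "a n = nni (nu one 0 T 1 n) (%x. ennreal x)" for n
 have T0: "0 <= T" "(0::real) <= 0" "T <= T" using T_pos by auto
 have step: "a n + emeasure (nu one 0 T 1 n) UNIV <= 1 + a (n - 1)" if n: "0 < n" for n
 proof -
  have "a n + emeasure (nu one 0 T 1 n) UNIV <= nni QQ (%p. ennreal (Yv one 0 1 n one T p)) + a n + emeasure (nu one 0 T 1 n) UNIV"
   by (simp add: add.assoc)
  also have "... = 1 + a (n - 1)"
   using balance[OF T0(2,1,3) _ _ C1pos_one, of one 1 n] n E_Yv_0[OF n, of one 1 one]
   by (simp add: P1.emeasure_space_1[simplified] a_def)
  finally show ?thesis .
 qed
 have mono: "a n <= a m" if "n <= m" for n m
  unfolding a_def using T0 that by (intro nu_mono) auto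
 have an: "a n <= of_nat n" for n
 proof (induction n)
  case 0
  have "a 0 = 0" unfolding a_def using T0 by (intro nu_zero) auto
  then show ?case by simp
 next
  case (Suc n)
  have "a (Suc n) <= a (Suc n) + emeasure (nu one 0 T 1 (Suc n)) UNIV" by simp
  also have "... <= 1 + a n" using step[of "Suc n"] by simp
  also have "... <= 1 + of_nat n" by (intro add_left_mono Suc)
  finally show ?case by simp
 qed
 then show "nni (nu one 0 T 1 n) (%x. ennreal x) <= of_nat n" by (simp add: a_def)
 show "emeasure (nu one 0 T 1 n) UNIV <= 1"
 proof (cases "n = 0")
  case True
  have "emeasure (nu one 0 T 1 0) UNIV = nni (nu one 0 T 1 0) (%x. 1)" by simp
  also have "... = 0" using T0 by (intro nu_zero) auto
  finally show ?thesis using True by simp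
 next
  case False
  have "emeasure (nu one 0 T 1 n) UNIV + a n <= 1 + a n"
   using order_trans[OF step[of n] add_left_mono[OF mono[of "n - 1" n], of 1]] False by (simp add: add.commute)
  moreover have "a n < \<top>" using an[of n] by (rule le_less_trans) (simp add: of_nat_less_top)
  ultimately show ?thesis by (metis add.commute ennreal_add_left_cancel_le infinity_ennreal_def less_irrefl)
 qed
qed

declare M1.sets_K [measurable_cong] M2.sets_K [measurable_cong]

lemma F_pos: "AE z in F1. 0 < z" "AE z in F2. 0 < z"
proof -
 have "{..0} \<in> null_sets F1" "{..0} \<in> null_sets F2"
  using F1_distribution F2_distribution by (auto simp: null_sets_def)
 then show "AE z in F1. 0 < z" "AE z in F2. 0 < z"
  by (auto dest!: AE_not_in elim!: eventually_mono)
qed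

text \<open>First moments from exponential ones, by x <= exp(\<epsilon> x) / \<epsilon>.\<close>

lemma F_moments: "nni F1 (%z. ennreal (ell' z)) < \<infinity>" "nni F2 (%z. ennreal z) < \<infinity>"
proof -
 obtain \<epsilon> where e: "0 < \<epsilon>" "integrable Q (%w. exp (\<epsilon> * ell (Z1 1 w)))" "integrable Q (%w. exp (\<epsilon> * Z2 1 w))"
  using exp_moments by auto
 have le: "x <= exp (\<epsilon> * x) / \<epsilon>" for x
 proof -
  have "\<epsilon> * x <= exp (\<epsilon> * x)" using exp_ge_add_one_self[of "\<epsilon> * x"] by linarith
  then show ?thesis using e(1) by (simp add: le_divide_eq mult.commute)
 qed
 have fin: "nni Q (%w. ennreal (exp (\<epsilon> * X w) / \<epsilon>)) < \<infinity>" if "integrable Q (%w. exp (\<epsilon> * X w))" for X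
  using integrable_divide_zero[of "\<epsilon>" Q "%w. exp (\<epsilon> * X w)"] that e(1)
  by (subst nn_integral_eq_integral) auto
 have [measurable]: "Z1 (Suc 0) \<in> bm Q" "Z2 (Suc 0) \<in> bm Q" using Z1_marks(1) Z2_marks(1) by auto
 have d: "F1 = distr Q borel (Z1 1)" "F2 = distr Q borel (Z2 1)" using Z1_marks(2) Z2_marks(2) by auto
 have "nni F1 (%z. ennreal (ell' z)) = nni Q (%w. ennreal (ell' (Z1 1 w)))"
  unfolding d by (subst nn_integral_distr) auto
 also have "... <= nni Q (%w. ennreal (exp (\<epsilon> * ell (Z1 1 w)) / \<epsilon>))"
 proof (intro nn_integral_mono ennreal_leI)
  fix w assume "w \<in> space Q"
  then have "ell' (Z1 1 w) = ell (Z1 1 w)" using Z1_marks(3)[of 1 w] by (simp add: ell'_def max_def)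
  then show "ell' (Z1 1 w) <= exp (\<epsilon> * ell (Z1 1 w)) / \<epsilon>" using le by simp
 qed
 also have "... < \<infinity>" by (rule fin[OF e(2)])
 finally show "nni F1 (%z. ennreal (ell' z)) < \<infinity>" .
 have "nni F2 (%z. ennreal z) = nni Q (%w. ennreal (Z2 1 w))"
  unfolding d by (subst nn_integral_distr) auto
 also have "... <= nni Q (%w. ennreal (exp (\<epsilon> * Z2 1 w) / \<epsilon>))"
  by (intro nn_integral_mono ennreal_leI le)
 also have "... < \<infinity>" by (rule fin[OF e(3)])
 finally show "nni F2 (%z. ennreal z) < \<infinity>" .
qed

text \<open>A bounded concave substitute for the identity: it makes every term of the balance finite,
  so that the quadratic terms can be cancelled.\<close>

definition sat :: "real => real => real" where
 "sat M x = (if 0 < x then x / (1 + x / M) else 0)"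

definition sat' :: "real => real => real" where
 "sat' M x = (if 0 < x then 1 / (1 + x / M) ^ 2 else 0)"

lemma C1pos_sat:
 assumes M: "0 < M"
 shows "C1pos (sat M) (sat' M)"
 unfolding C1pos_def
proof (intro conjI allI impI)
 show "sat M \<in> bm borel" "sat' M \<in> bm borel"
  unfolding sat_def[abs_def] sat'_def[abs_def] by measurable
 fix x :: real assume x: "0 < x"
 have p: "0 < 1 + y / M" if "0 < y" for y using that M by (intro add_pos_pos) auto
 have "((%x. x / (1 + x / M)) has_real_derivative 1 / (1 + x / M) ^ 2) (at x)"
  using p[OF x] M by (auto intro!: derivative_eq_intros simp: power2_eq_square divide_simps) (simp add: field_simps)
 note d = this
 have ev: "\<forall>\<^sub>F y in nhds x. y / (1 + y / M) = sat M y"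
  using eventually_nhds_in_open[of "{0<..}" x] x by (auto simp: sat_def elim: eventually_mono)
 have "(sat M has_real_derivative 1 / (1 + x / M) ^ 2) (at x)"
  using DERIV_cong_ev[OF refl ev refl] d by blast
 then show "(sat M has_real_derivative sat' M x) (at x)" using x by (simp add: sat'_def)
next
 have p: "1 + y / M \<noteq> 0" if "0 < y" for y using add_pos_pos[of 1 "y / M"] that M by auto
 have "continuous_on {0<..} (%x. 1 / (1 + x / M) ^ 2)" using p M by (intro continuous_intros) auto
 then show "continuous_on {0<..} (sat' M)"
  by (rule continuous_on_eq) (simp add: sat'_def)
qed

text \<open>The fifth bound says that \<open>sat M x / x\<close> is nonincreasing. For g =
  \<open>sat M\<close> it gives x g(x + e) <= x g(x) + e g(x): the gain at an observed jump exceeds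
  the quadratic loss x g(x) only by the lower-order term e g(x).\<close>

lemma sat_bounds:
 assumes M: "0 < M" and x: "0 < x" and e: "0 <= e"
 shows "0 <= sat M x" "sat M x <= M" "sat M x <= x" "x <= M ==> x <= 2 * sat M x"
  and "x * sat M (x + e) <= (x + e) * sat M x" "sat M (x + e) <= sat M x + e"
  and "0 <= sat' M x" "sat' M x <= 1"
proof -
 let ?d = "%x. 1 + x / M"
 have d: "1 <= ?d x" "?d x <= ?d (x + e)" using M x e by (auto simp: divide_right_mono)
 have d0: "0 < ?d x" using d by linarith
 show "0 <= sat M x" using x d0 by (simp add: sat_def)
 show "sat M x <= M" using x M d0 by (simp add: sat_def divide_le_eq) (simp add: distrib_left)
 show "sat M x <= x" using x d d0 by (simp add: sat_def divide_le_eq)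
 show "x <= 2 * sat M x" if "x <= M"
 proof -
  have "?d x <= 2" using that M by simp
  then have "x * ?d x <= x * 2" using x by (intro mult_left_mono) auto
  then show ?thesis using x d0 by (simp add: sat_def le_divide_eq mult.commute)
 qed
 show "x * sat M (x + e) <= (x + e) * sat M x"
 proof -
  have "x * ((x + e) / ?d (x + e)) <= x * ((x + e) / ?d x)"
   using x e d d0 by (intro mult_left_mono divide_left_mono) auto
  then show ?thesis using x e by (simp add: sat_def mult_ac)
 qed
 show "sat M (x + e) <= sat M x + e"
 proof -
  have "(x + e) / ?d (x + e) <= (x + e) / ?d x" using x e d d0 by (intro divide_left_mono) auto
  also have "... = x / ?d x + e / ?d x" by (simp add: add_divide_distrib)
  also have "e / ?d x <= e / 1" using e d by (intro divide_left_mono) auto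
  finally show ?thesis using x e by (simp add: sat_def)
 qed
 show "0 <= sat' M x" by (simp add: sat'_def)
 have "1 <= ?d x ^ 2" using d by simp
 then show "sat' M x <= 1" using x by (simp add: sat'_def divide_le_eq)
qed

lemma sat_nonneg: "0 < M ==> 0 <= sat M x"
 using sat_bounds(1)[of M x 0] by (cases "0 < x") (auto simp: sat_def)

text \<open>With the damping rate 2 + m1 the left-hand side contains (1 + m1) g: the part m1 g pays
  for the mean jump of the intensity, and g is the quantity to be bounded. The quadratic part
  \<open>A\<close> is finite by \<open>nu_first_bounds\<close>, since g <= M and g <= x, and
  cancels. The bound depends neither on \<open>n\<close> nor on \<open>M\<close>.\<close>

lemma nu_sat_bound:
 assumes M: "0 < M" and m1: "0 <= m1" "nni F1 (%z. ennreal (ell' z)) = ennreal m1"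
  and m2: "0 <= m2" "nni F2 (%z. ennreal z) = ennreal m2"
 shows "nni (nu one 0 T (2 + m1) n) (%x. ennreal (sat M x)) <= ennreal (l0 + \<alpha> * \<beta> + \<rho> * m2)"
proof (cases "n = 0")
 case True
 have [measurable]: "sat M \<in> bm borel" using C1pos_sat[OF M] by (simp add: C1pos_def)
 show ?thesis unfolding True using T_pos by (subst nu_zero) auto
next
 case False
 interpret P1: prob_space F1 by (rule M1.prob_space_K)
 interpret P2: prob_space F2 by (rule M2.prob_space_K)
 let ?g = "sat M" and ?K = "2 + m1"
 let ?nu = "nu one 0 T ?K"
 have [measurable]: "?g \<in> bm borel" "sat' M \<in> bm borel" using C1pos_sat[OF M] by (auto simp: C1pos_def)
 have T0: "(0::real) <= 0" "0 <= T" "T <= T" using T_pos by auto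
 have one: "one \<in> bm borel" "\<And>x. 0 <= one x" by auto
 have pos: "AE x in ?nu k. 0 < x" for k
  using nu_pos[OF T0 one(1)] by eventually_elim (use lmin_pos in linarith)
 have mass: "emeasure (?nu k) UNIV <= 1" for k
 proof -
  have "nni (?nu k) (%x. 1) <= nni (nu one 0 T 1 k) (%x. 1)" using T0 one m1 by (intro nu_mono) auto
  then show ?thesis using nu_first_bounds(2)[of k] by simp
 qed
 have first: "nni (?nu k) (%x. ennreal x) < \<top>" for k
 proof -
  have "nni (?nu k) (%x. ennreal x) <= nni (nu one 0 T 1 k) (%x. ennreal x)" using T0 one m1 by (intro nu_mono) auto
  also have "... <= of_nat k" by (rule nu_first_bounds)
  finally show ?thesis by (rule le_less_trans) (simp add: of_nat_less_top)
 qed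
 have le4: "b <= a + b + c + d" for a b c d :: ennreal
  by (intro add_increasing2[of d] add_increasing2[of c] add_increasing) auto
 define A where "A = nni (?nu n) (%x. ennreal (x * ?g x + m1 * ?g x))"
 define G where "G = nni (?nu n) (%x. ennreal (?g x))"
 have "A <= nni (?nu n) (%x. ennreal (M + m1) * ennreal x)"
  unfolding A_def
 proof (rule nn_integral_mono_AE, use pos[of n] in eventually_elim)
  case (elim x)
  have "x * ?g x + m1 * ?g x <= x * M + m1 * x"
   using sat_bounds(1,2,3)[OF M elim order_refl] m1 elim by (intro add_mono mult_left_mono) auto
  then have "ennreal (x * ?g x + m1 * ?g x) <= ennreal ((M + m1) * x)" by (intro ennreal_leI) (simp add: algebra_simps)
  then show "ennreal (x * ?g x + m1 * ?g x) <= ennreal (M + m1) * ennreal x"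
   using elim M m1 by (simp add: ennreal_mult del: ennreal_plus_if)
 qed
 also have "... < \<top>" using first[of n] by (simp add: nn_integral_cmult ennreal_mult_less_top)
 finally have Afin: "A < \<top>" .
 have "A + G <= nni (?nu n) (%x. ennreal (x * ?g x + max 0 (- (\<alpha> * (\<beta> - x) * sat' M x)) + max 0 (?K - 1) * ?g x))"
 proof -
  have "A + G = nni (?nu n) (%x. ennreal (x * ?g x + m1 * ?g x) + ennreal (?g x))"
   unfolding A_def G_def by (rule nn_integral_add[symmetric]) measurable
  also have "... <= nni (?nu n) (%x. ennreal (x * ?g x + max 0 (- (\<alpha> * (\<beta> - x) * sat' M x)) + max 0 (?K - 1) * ?g x))"
  proof (rule nn_integral_mono_AE, use pos[of n] in eventually_elim)
  fix x :: real assume x: "0 < x"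
  have g0: "0 <= ?g x" using sat_nonneg[OF M] .
  have "ennreal (x * ?g x + m1 * ?g x) + ennreal (?g x) = ennreal (x * ?g x + m1 * ?g x + ?g x)"
   using x g0 m1 by (intro ennreal_plus[symmetric]) auto
  also have "... <= ennreal (x * ?g x + max 0 (- (\<alpha> * (\<beta> - x) * sat' M x)) + max 0 (?K - 1) * ?g x)"
   using m1 by (intro ennreal_leI) (simp add: max_def algebra_simps)
  finally show "ennreal (x * ?g x + m1 * ?g x) + ennreal (?g x) <= ennreal (x * ?g x + max 0 (- (\<alpha> * (\<beta> - x) * sat' M x)) + max 0 (?K - 1) * ?g x)" .
  qed
  finally show ?thesis .
 qed
 also have "... <= nni QQ (%p. ennreal (Yv one 0 ?K n ?g T p)) + nni (?nu n) (%x. ennreal (x * ?g x + max 0 (- (\<alpha> * (\<beta> - x) * sat' M x)) + max 0 (?K - 1) * ?g x))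
   + nni (?nu n) (%x. ennreal (?g x)) + ennreal \<rho> * nni (?nu n) (%x. nni F2 (%z. ennreal (max 0 (?g x - ?g (x + z)))))"
  by (rule le4)
 also have "... = nni QQ (%p. ennreal (Yv one 0 ?K n ?g 0 p)) + nni (?nu n) (%x. ennreal (max 0 (\<alpha> * (\<beta> - x) * sat' M x) + max 0 (1 - ?K) * ?g x))
   + nni (?nu (n - 1)) (%x. nni F1 (%z. ennreal (x * ?g (x + ell' z))))
   + ennreal \<rho> * nni (?nu n) (%x. nni F2 (%z. ennreal (max 0 (?g (x + z) - ?g x))))"
  by (rule balance[OF T0 one C1pos_sat[OF M] sat_nonneg[OF M]])
 also have "... <= ennreal l0 + ennreal (\<alpha> * \<beta>) + A + ennreal \<rho> * ennreal m2"
 proof (intro add_mono mult_left_mono)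
  show "nni QQ (%p. ennreal (Yv one 0 ?K n ?g 0 p)) <= ennreal l0"
   using E_Yv_0[of n one ?K ?g] False sat_bounds(3)[OF M l0_pos order_refl] by (simp add: ennreal_leI)
  have "nni (?nu n) (%x. ennreal (max 0 (\<alpha> * (\<beta> - x) * sat' M x) + max 0 (1 - ?K) * ?g x)) <= nni (?nu n) (%x. ennreal (\<alpha> * \<beta>))"
  proof (rule nn_integral_mono_AE, use pos[of n] in eventually_elim)
   case (elim x)
   note b = sat_bounds(7,8)[OF M elim order_refl]
   have "(\<beta> - x) * sat' M x <= \<beta> * sat' M x" using b elim by (intro mult_right_mono) auto
   also have "... <= \<beta> * 1" using b params_pos by (intro mult_left_mono) auto
   finally have "\<alpha> * ((\<beta> - x) * sat' M x) <= \<alpha> * \<beta>" using params_pos by simp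
   then show ?case using m1 params_pos by (intro ennreal_leI) (auto simp: mult.assoc)
  qed
  also have "... = ennreal (\<alpha> * \<beta>) * emeasure (?nu n) UNIV" by simp
  also have "... <= ennreal (\<alpha> * \<beta>) * 1" by (intro mult_left_mono mass) simp
  finally show "nni (?nu n) (%x. ennreal (max 0 (\<alpha> * (\<beta> - x) * sat' M x) + max 0 (1 - ?K) * ?g x)) <= ennreal (\<alpha> * \<beta>)" by simp
  have "nni (?nu (n - 1)) (%x. nni F1 (%z. ennreal (x * ?g (x + ell' z)))) <= nni (?nu (n - 1)) (%x. ennreal (x * ?g x + m1 * ?g x))"
  proof (rule nn_integral_mono_AE, use pos[of "n - 1"] in eventually_elim)
   case (elim x)
   have g0: "0 <= ?g x" using sat_nonneg[OF M] .
   have "nni F1 (%z. ennreal (x * ?g (x + ell' z))) <= nni F1 (%z. ennreal (x * ?g x) + ennreal (?g x) * ennreal (ell' z))"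
   proof (intro nn_integral_mono)
    fix z
    have "ennreal (x * ?g (x + ell' z)) <= ennreal (x * ?g x + ?g x * ell' z)"
     using sat_bounds(5)[OF M elim ell'_nonneg, of z] by (intro ennreal_leI) (simp add: algebra_simps)
    then show "ennreal (x * ?g (x + ell' z)) <= ennreal (x * ?g x) + ennreal (?g x) * ennreal (ell' z)"
     using elim g0 ell'_nonneg[of z] by (simp add: ennreal_plus ennreal_mult del: ennreal_plus_if)
   qed
   also have "... = ennreal (x * ?g x) + ennreal (?g x) * ennreal m1"
    by (subst nn_integral_add) (simp_all add: nn_integral_cmult m1(2) P1.emeasure_space_1[simplified])
   also have "... = ennreal (x * ?g x + m1 * ?g x)"
    using elim g0 m1 by (simp add: ennreal_plus ennreal_mult[symmetric] mult.commute del: ennreal_plus_if)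
   finally show ?case .
  qed
  also have "... <= A" unfolding A_def using T0 one by (intro nu_mono) auto
  finally show "nni (?nu (n - 1)) (%x. nni F1 (%z. ennreal (x * ?g (x + ell' z)))) <= A" .
  have "nni (?nu n) (%x. nni F2 (%z. ennreal (max 0 (?g (x + z) - ?g x)))) <= nni (?nu n) (%x. ennreal m2)"
  proof (rule nn_integral_mono_AE, use pos[of n] in eventually_elim)
   case (elim x)
   have "nni F2 (%z. ennreal (max 0 (?g (x + z) - ?g x))) <= nni F2 (%z. ennreal z)"
   proof (rule nn_integral_mono_AE, use F_pos(2) in eventually_elim)
    case (elim z)
    then show ?case using sat_bounds(6)[OF M \<open>0 < x\<close>, of z] by (intro ennreal_leI) auto
   qed
   then show ?case by (simp add: m2)
  qed
  also have "... = ennreal m2 * emeasure (?nu n) UNIV" by simp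
  also have "... <= ennreal m2 * 1" by (intro mult_left_mono mass) simp
  finally show "nni (?nu n) (%x. nni F2 (%z. ennreal (max 0 (?g (x + z) - ?g x)))) <= ennreal m2" by simp
 qed simp
 also have "... = A + ennreal (l0 + \<alpha> * \<beta> + \<rho> * m2)"
  using l0_pos params_pos m2 by (simp add: ennreal_plus ennreal_mult add_ac del: ennreal_plus_if)
 finally show "G <= ennreal (l0 + \<alpha> * \<beta> + \<rho> * m2)"
  using Afin by (metis ennreal_add_left_cancel_le infinity_ennreal_def less_irrefl)
qed

text \<open>Up to M the function \<open>sat M\<close> is at least x / 2, so letting M tend to
  infinity gives a bound uniform in \<open>n\<close>. The damping is then removed at the cost of a
  factor exp(K T).\<close>

lemma nu_first_moment_bound: "\<exists>B. \<forall>n. nni (nu one 0 T 0 n) (%x. ennreal x) <= ennreal B"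
proof -
 obtain m1 where m1: "0 <= m1" "nni F1 (%z. ennreal (ell' z)) = ennreal m1"
  using F_moments(1) by (cases "nni F1 (%z. ennreal (ell' z))") auto
 obtain m2 where m2: "0 <= m2" "nni F2 (%z. ennreal z) = ennreal m2"
  using F_moments(2) by (cases "nni F2 (%z. ennreal z)") auto
 let ?B = "l0 + \<alpha> * \<beta> + \<rho> * m2" and ?K = "2 + m1"
 have T0: "(0::real) <= 0" "0 <= T" "T <= T" using T_pos by auto
 have one: "one \<in> bm borel" "\<And>x. 0 <= one x" by auto
 have B: "0 <= ?B" using l0_pos params_pos m2 by auto
 have pos: "AE x in nu one 0 T ?K n. 0 < x" for n
  using nu_pos[OF T0 one(1)] by eventually_elim (use lmin_pos in linarith)
 have 1: "nni (nu one 0 T ?K n) (%x. ennreal x * indicator {..real (Suc k)} x) <= ennreal (2 * ?B)" for n k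
 proof -
  have [measurable]: "sat (real (Suc k)) \<in> bm borel" using C1pos_sat[of "real (Suc k)"] by (simp add: C1pos_def)
  have "nni (nu one 0 T ?K n) (%x. ennreal x * indicator {..real (Suc k)} x) <= nni (nu one 0 T ?K n) (%x. 2 * ennreal (sat (real (Suc k)) x))"
  proof (rule nn_integral_mono_AE, use pos in eventually_elim)
   case (elim x)
   have "ennreal (2 * sat (real (Suc k)) x) = 2 * ennreal (sat (real (Suc k)) x)"
    using sat_nonneg[of "real (Suc k)" x] by (subst ennreal_mult) auto
   moreover have "x <= real (Suc k) ==> ennreal x <= ennreal (2 * sat (real (Suc k)) x)"
    using sat_bounds(4)[of "real (Suc k)" x 0] elim by (intro ennreal_leI) simp
   ultimately show ?case by (cases "x <= real (Suc k)") (simp_all del: of_nat_Suc)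
  qed
  also have "... = 2 * nni (nu one 0 T ?K n) (%x. ennreal (sat (real (Suc k)) x))" by (rule nn_integral_cmult) measurable
  also have "... <= 2 * ennreal ?B" using nu_sat_bound[OF _ m1 m2] by (intro mult_left_mono) auto
  also have "... = ennreal (2 * ?B)" using B by (subst ennreal_mult) auto
  finally show ?thesis .
 qed
 have 2: "nni (nu one 0 T ?K n) (%x. ennreal x) <= ennreal (2 * ?B)" for n
 proof (rule LIMSEQ_le_const2)
  show "(%k. nni (nu one 0 T ?K n) (%x. ennreal x * indicator {..real (Suc k)} x)) \<longlonglongrightarrow> nni (nu one 0 T ?K n) (%x. ennreal x)"
  proof (rule nn_integral_LIMSEQ)
   show "incseq (%k x. ennreal x * indicator {..real (Suc k)} x)"
    by (auto simp: incseq_def le_fun_def indicator_def)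
   fix x :: real
   obtain k0 where k0: "x <= real k0" using real_arch_simple by blast
   have "\<forall>\<^sub>F k in sequentially. ennreal x * indicator {..real (Suc k)} x = ennreal x"
    using eventually_ge_at_top[of k0] by eventually_elim (use k0 in \<open>auto simp: indicator_def\<close>)
   then show "(%k. ennreal x * indicator {..real (Suc k)} x) \<longlonglongrightarrow> ennreal x" by (rule tendsto_eventually)
  qed measurable
 qed (use 1 in auto)
 have "nni (nu one 0 T 0 n) (%x. ennreal x) <= ennreal (exp (?K * T)) * nni (nu one 0 T ?K n) (%x. ennreal x)" for n
 proof (rule nu_le[OF T0 T0 one(1) one(1)])
  fix p r assume ok: "okp (c1 (fst p)) (c2 (snd p))"
  show "wgt one 0 T 0 n p r <= exp (?K * T) * wgt one 0 T ?K n p r"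
  proof (cases "r \<in> {0<..T}")
   case True
   have "?K * r <= ?K * T" using True m1 by (intro mult_left_mono) auto
   then have "1 <= exp (?K * T) * exp (- ?K * r)" by (simp add: exp_add[symmetric] algebra_simps)
   moreover have "0 <= lik (<) (c1 (fst p)) (c2 (snd p)) r" using ok by (intro lik_nonneg[of T]) (auto simp: okp_def)
   ultimately show ?thesis using True mult_right_mono[of 1 "exp (?K * T) * exp (- ?K * r)" "lik (<) (c1 (fst p)) (c2 (snd p)) r"]
    by (simp add: wgt_def wt_def mult.assoc)
  qed (simp add: wgt_def wt_def)
 qed auto
 also have "... n <= ennreal (exp (?K * T)) * ennreal (2 * ?B)" for n by (intro mult_left_mono 2) simp
 finally have "nni (nu one 0 T 0 n) (%x. ennreal x) <= ennreal (exp (?K * T) * (2 * ?B))" for n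
  using B by (simp add: ennreal_mult)
 then show ?thesis by blast
qed

end

lemma ennreal_le_cancel: "a + c <= b + c ==> c < \<top> ==> a <= (b :: ennreal)"
 by (metis add.commute ennreal_add_left_cancel_le infinity_ennreal_def less_irrefl)

context jump_cluster_model
begin

abbreviation Lk :: "real => 'a \<times> 'a => real" where
 "Lk t p \<equiv> lik (<=) (c1 (fst p)) (c2 (snd p)) t"

lemma QQ_meas [measurable]: "Lk t \<in> bm QQ" "(%p. lev (<=) p t) \<in> bm QQ"
 using lik_meas[of "%x. x" QQ "%_. t" "(<=)"] lev_meas[of "%x. x" QQ "%_. t" "(<=)"] by auto

lemma Yv_one: "Yv ph s 0 n one u p = (if card (idx (<=) (c1 (fst p)) u) < n then ph (lev (<=) p s) * Lk u p else 0)"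
 by (simp add: Yv_def)

lemma E_Yv_limit:
 assumes ph: "ph \<in> bm borel"
 shows "(%n. nni QQ (%p. ennreal (Yv ph s 0 n one u p))) \<longlonglongrightarrow> nni QQ (%p. ennreal (ph (lev (<=) p s) * Lk u p))"
proof (rule nn_integral_LIMSEQ)
 show "incseq (%n p. ennreal (Yv ph s 0 n one u p))"
  by (auto simp: incseq_def le_fun_def Yv_one)
 show "(%p. ennreal (Yv ph s 0 n one u p)) \<in> bm QQ" for n
  by (rule measurable_compose[OF Yv_meas measurable_ennreal]) (use ph in auto)
 fix p
 have "\<forall>\<^sub>F n in sequentially. ennreal (Yv ph s 0 n one u p) = ennreal (ph (lev (<=) p s) * Lk u p)"
  using eventually_gt_at_top[of "card (idx (<=) (c1 (fst p)) u)"] by eventually_elim (simp add: Yv_one)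
 then show "(%n. ennreal (Yv ph s 0 n one u p)) \<longlonglongrightarrow> ennreal (ph (lev (<=) p s) * Lk u p)"
  by (rule tendsto_eventually)
qed

context
 fixes ph :: "real => real" and s t B :: real
 assumes st: "0 <= s" "s <= t" "t <= T" and ph: "ph \<in> bm borel" "\<And>x. 0 <= ph x" "\<And>x. ph x <= B"
begin

lemma wgt_bound:
 assumes ok: "okp (c1 (fst p)) (c2 (snd p))" and K: "0 <= K"
 shows "wgt ph s t 0 n p r <= (B * exp (K * T)) * wgt one 0 T K n p r"
proof (cases "r \<in> {s<..t}")
 case True
 have l: "0 <= lik (<) (c1 (fst p)) (c2 (snd p)) r" using ok by (intro lik_nonneg[of T]) (auto simp: okp_def)
 have "K * r <= K * T" using True K st by (intro mult_left_mono) auto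
 then have "1 <= exp (K * T) * exp (- K * r)" by (simp add: exp_add[symmetric] algebra_simps)
 then have "ph (lev (<=) p s) * 1 <= B * (exp (K * T) * exp (- K * r))"
  using ph(2,3)[of "lev (<=) p s"] by (intro mult_mono) auto
 then have "ph (lev (<=) p s) * lik (<) (c1 (fst p)) (c2 (snd p)) r <= B * (exp (K * T) * exp (- K * r)) * lik (<) (c1 (fst p)) (c2 (snd p)) r"
  using l by (intro mult_right_mono) auto
 then show ?thesis using True st by (auto simp: wgt_def wt_def mult_ac)
next
 case False
 have "0 <= B" using ph(2,3)[of 0] by simp
 moreover have "0 <= wgt one 0 T K n p r" using ok wt_nonneg[of T "c1 (fst p)" "c2 (snd p)"] by (simp add: wgt_def okp_def)
 ultimately show ?thesis using False by (auto simp: wgt_def wt_def)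
qed

lemma nu_first_finite: "\<exists>C. \<forall>n. nni (nu ph s t 0 n) (%x. ennreal x) <= ennreal C"
proof -
 obtain C where C: "\<And>n. nni (nu one 0 T 0 n) (%x. ennreal x) <= ennreal C" using nu_first_moment_bound by blast
 have B: "0 <= B" using ph(2,3)[of 0] by simp
 have "nni (nu ph s t 0 n) (%x. ennreal x) <= ennreal (B * exp (0 * T)) * nni (nu one 0 T 0 n) (%x. ennreal x)" for n
  by (rule nu_le[OF st _ _ _ ph(1) _ _ wgt_bound]) (use T_pos B in auto)
 also have "... n <= ennreal (B * exp (0 * T)) * ennreal C" for n by (intro mult_left_mono C) simp
 also have "... = ennreal (B * C)" using B by (simp add: ennreal_mult')
 finally show ?thesis by blast
qed

lemma nu_mass_finite: "nni (nu ph s t 0 n) (%x. 1) < \<top>"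
proof -
 have B: "0 <= B" using ph(2,3)[of 0] by simp
 have "nni (nu ph s t 0 n) (%x. 1) <= ennreal (B * exp (1 * T)) * nni (nu one 0 T 1 n) (%x. 1)"
  by (rule nu_le[OF st _ _ _ ph(1) _ _ wgt_bound]) (use T_pos B in auto)
 also have "... <= ennreal (B * exp (1 * T)) * 1"
  using nu_first_bounds(2)[of n] by (intro mult_left_mono) auto
 finally show ?thesis by (rule le_less_trans) simp
qed

text \<open>For g = 1 and K = 0 the mass of \<open>nu\<close> appears on both sides and cancels. The
  two first moments that remain differ by the flow lost at the cut.\<close>

lemma E_Yv_step:
 assumes n: "0 < n"
 shows "nni QQ (%p. ennreal (Yv ph s 0 n one t p)) + nni (nu ph s t 0 n) (%x. ennreal x)
  = nni QQ (%p. ennreal (Yv ph s 0 n one s p)) + nni (nu ph s t 0 (n - 1)) (%x. ennreal x)"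
proof -
 interpret P1: prob_space F1 by (rule M1.prob_space_K)
 let ?m = "nni (nu ph s t 0 n) (%x. 1)"
 have "?m + (nni QQ (%p. ennreal (Yv ph s 0 n one t p)) + nni (nu ph s t 0 n) (%x. ennreal x))
  = ?m + (nni QQ (%p. ennreal (Yv ph s 0 n one s p)) + nni (nu ph s t 0 (n - 1)) (%x. ennreal x))"
  using balance[OF st ph(1,2) C1pos_one, of 0 n] by (simp add: P1.emeasure_space_1[simplified] add_ac)
 then show ?thesis using nu_mass_finite[of n] by (simp only: ennreal_add_left_cancel) auto
qed

text \<open>The first moments increase in \<open>n\<close> and are bounded, so those at levels
  \<open>n\<close> and \<open>n + 1\<close> have the same finite limit, which cancels: in the limit
  nothing escapes through the cut.\<close>

lemma E_lik_mono_bounded: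
 "nni QQ (%p. ennreal (ph (lev (<=) p s) * Lk s p)) <= nni QQ (%p. ennreal (ph (lev (<=) p s) * Lk t p))" (is "?a <= ?b")
proof -
 let ?Y = "%n u. nni QQ (%p. ennreal (Yv ph s 0 n one u p))" and ?x = "%n. nni (nu ph s t 0 n) (%x. ennreal x)"
 have inc: "incseq ?x" by (intro incseq_SucI nu_mono[OF st ph(1,2)]) auto
 note lim = LIMSEQ_SUP[OF inc]
 obtain C where C: "\<And>n. ?x n <= ennreal C" using nu_first_finite by blast
 have "(SUP n. ?x n) <= ennreal C" by (intro SUP_least C)
 then have fin: "(SUP n. ?x n) < \<top>" by (rule le_less_trans) simp
 have le: "?Y n t <= ?b" for n
  by (intro nn_integral_mono) (auto simp: Yv_one)
 have "?Y (Suc n) s + ?x n <= ?b + ?x (Suc n)" for n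
  using E_Yv_step[of "Suc n"] le[of "Suc n"] add_right_mono[OF le[of "Suc n"], of "?x (Suc n)"] by simp
 moreover have "(%n. ?Y (Suc n) s + ?x n) \<longlonglongrightarrow> ?a + (SUP n. ?x n)"
  by (intro tendsto_add LIMSEQ_Suc[OF E_Yv_limit[OF ph(1)]] lim)
 moreover have "(%n. ?b + ?x (Suc n)) \<longlonglongrightarrow> ?b + (SUP n. ?x n)"
  by (intro tendsto_add tendsto_const LIMSEQ_Suc[OF lim])
 ultimately have "?a + (SUP n. ?x n) <= ?b + (SUP n. ?x n)"
  by (intro LIMSEQ_le) auto
 then show ?thesis by (rule ennreal_le_cancel) (rule fin)
qed

end

text \<open>The balance from time 0 has initial value 1; the first moment at level \<open>n\<close>
  is at most the one at level \<open>n + 1\<close>, which is finite and cancels.\<close>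

lemma E_lik_le_1:
 assumes t: "0 <= t" "t <= T"
 shows "nni QQ (%p. ennreal (Lk t p)) <= 1"
proof -
 have one: "one \<in> bm borel" "\<And>x. 0 <= one x" "\<And>x. one x <= 1" by auto
 note h = order_refl[of "0::real"] t one
 let ?x = "%n. nni (nu one 0 t 0 n) (%x. ennreal x)"
 obtain C where C: "\<And>n. ?x n <= ennreal C" using nu_first_finite[OF h] by blast
 have "nni QQ (%p. ennreal (Yv one 0 0 (Suc n) one t p)) <= 1" for n
 proof -
  have "nni QQ (%p. ennreal (Yv one 0 0 (Suc n) one t p)) + ?x (Suc n) = 1 + ?x n"
   using E_Yv_step[OF h, of "Suc n"] E_Yv_0[of "Suc n" one 0 one] by simp
  also have "... <= 1 + ?x (Suc n)" by (intro add_left_mono nu_mono[OF h(1-5)]) auto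
  finally show ?thesis by (rule ennreal_le_cancel) (use le_less_trans[OF C[of "Suc n"] ennreal_less_top] in simp)
 qed
 moreover have "(%n. nni QQ (%p. ennreal (Yv one 0 0 (Suc n) one t p))) \<longlonglongrightarrow> nni QQ (%p. ennreal (1 * Lk t p))"
  by (rule LIMSEQ_Suc[OF E_Yv_limit[OF one(1)]])
 ultimately show ?thesis by (intro LIMSEQ_le_const2) auto
qed

lemma E_lik_mono:
 fixes ps :: "real => ennreal"
 assumes st: "0 <= s" "s <= t" "t <= T" and ps[measurable]: "ps \<in> bm borel"
 shows "nni QQ (%p. ennreal (Lk s p) * ps (lev (<=) p s)) <= nni QQ (%p. ennreal (Lk t p) * ps (lev (<=) p s))"
proof (rule LIMSEQ_le_const2)
 let ?ps = "%k x. min (ps x) (of_nat k)"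
 show "(%k. nni QQ (%p. ennreal (Lk s p) * ?ps k (lev (<=) p s))) \<longlonglongrightarrow> nni QQ (%p. ennreal (Lk s p) * ps (lev (<=) p s))"
 proof (rule nn_integral_LIMSEQ)
  show "incseq (%k p. ennreal (Lk s p) * ?ps k (lev (<=) p s))"
   by (auto simp: incseq_def le_fun_def intro!: mult_left_mono min.mono of_nat_mono)
  fix p
  show "(%k. ennreal (Lk s p) * ?ps k (lev (<=) p s)) \<longlonglongrightarrow> ennreal (Lk s p) * ps (lev (<=) p s)"
   using tendsto_min[OF tendsto_const of_nat_tendsto_top_ennreal, of "ps (lev (<=) p s)"]
   by (intro ennreal_tendsto_cmult) (auto simp: min_absorb1)
 qed measurable
 show "\<exists>N. \<forall>k\<ge>N. nni QQ (%p. ennreal (Lk s p) * ?ps k (lev (<=) p s)) <= nni QQ (%p. ennreal (Lk t p) * ps (lev (<=) p s))"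
 proof (intro exI allI impI)
  fix k :: nat
  define ph where "ph x = enn2real (?ps k x)" for x
  have [measurable]: "ph \<in> bm borel" unfolding ph_def[abs_def] by measurable
  have fin: "?ps k x < \<top>" for x by (simp add: min_less_iff_disj of_nat_less_top)
  have e: "ennreal (ph x) = ?ps k x" for x unfolding ph_def using fin[of x] by simp
  have p: "0 <= ph x" for x by (simp add: ph_def)
  have "ennreal (ph x) <= ennreal (real k)" for x unfolding e by (simp add: ennreal_of_nat_eq_real_of_nat)
  then have b: "ph x <= real k" for x by (simp add: ennreal_le_iff)
  have m: "ennreal (ph (lev (<=) p s) * Lk u p) = ennreal (Lk u p) * ?ps k (lev (<=) p s)" for u p
   by (simp only: ennreal_mult'[OF p] e mult.commute)
  have "nni QQ (%p. ennreal (Lk s p) * ?ps k (lev (<=) p s)) <= nni QQ (%p. ennreal (Lk t p) * ?ps k (lev (<=) p s))"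
   using E_lik_mono_bounded[where ph=ph and B="real k", OF st _ p b] unfolding m by simp
  also have "... <= nni QQ (%p. ennreal (Lk t p) * ps (lev (<=) p s))"
   by (intro nn_integral_mono mult_left_mono) auto
  finally show "nni QQ (%p. ennreal (Lk s p) * ?ps k (lev (<=) p s)) <= nni QQ (%p. ennreal (Lk t p) * ps (lev (<=) p s))" .
 qed
qed

lemma time_integral_meas:
 assumes c: "cfg_meas M c" and d: "cfg_meas M d" and ps[measurable]: "ps \<in> bm borel" and R: "is_ord R"
 shows "(%x. nni lborel (%r. indicator {0<..T} r * ps (intn R (c x) (d x) r))) \<in> bm M"
proof -
 have s: "snd \<in> bm (M >< lborel)" using measurable_snd[of M lborel] by simp
 note [measurable] = meas_intn[OF cfg_meas_compose[OF c measurable_fst] cfg_meas_compose[OF d measurable_fst] s R] s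
 have "(%q. indicator {0<..T} (snd q) * ps (intn R (c (fst q)) (d (fst q)) (snd q))) \<in> bm (M >< lborel)"
  by measurable
 from lborel.borel_measurable_nn_integral_fst[OF this] show ?thesis by simp
qed

lemma off_jumps_AE: "AE r in lborel. r \<notin> times c \<union> times d"
 by (rule AE_not_in) (auto intro!: finite_imp_null_set_lborel)

text \<open>The weight at time \<open>r\<close> contains the likelihood at \<open>r\<close>, the
  conditions under \<open>P\<close> the likelihood at \<open>T\<close>. \<open>E_lik_mono\<close>
  exchanges them for each fixed \<open>r\<close>, which is why the order of integration is reversed
  before and after.\<close>

lemma nu_dom:
 assumes ps[measurable]: "ps \<in> bm borel" and K: "0 <= K"
 shows "nni (nu one 0 T K n) (%x. ps x) <= nni QQ (%p. ennreal (Lk T p) * nni lborel (%r. indicator {0<..T} r * ps (lev (<=) p r)))"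
proof -
 interpret PP: prob_space QQ by (rule prob_space_pair) (unfold_locales)
 interpret PL: pair_sigma_finite QQ lborel ..
 have T0: "(0::real) <= 0" "0 <= T" "T <= T" using T_pos by auto
 have id: "(%x. x) \<in> measurable QQ QQ" by simp
 have s: "snd \<in> bm (QQ >< lborel)" using measurable_snd[of QQ lborel] by simp
 note [measurable] = lev_meas[OF measurable_fst s is_ord(2)] lik_meas[OF measurable_fst s is_ord(2)] s
 have f: "(%(p, r). indicator {0<..T} r * (ennreal (Lk r p) * ps (lev (<=) p r))) \<in> bm (QQ >< lborel)"
  unfolding case_prod_beta' by measurable
 have [measurable]: "(%q. Lk T (fst q)) \<in> bm (QQ >< lborel)"
  using measurable_compose[OF measurable_fst QQ_meas(1)] .
 have g: "(%(p, r). indicator {0<..T} r * (ennreal (Lk T p) * ps (lev (<=) p r))) \<in> bm (QQ >< lborel)"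
  unfolding case_prod_beta' by measurable
 have "nni (nu one 0 T K n) (%x. ps x) = nni QQ (%p. I0 one 0 T K n ps p)"
  using E_I0[OF T0, of one ps K n] by simp
 also have "... <= nni QQ (%p. nni lborel (%r. indicator {0<..T} r * (ennreal (Lk r p) * ps (lev (<=) p r))))"
 proof (rule nn_integral_mono_AE, use AE_okp in eventually_elim)
  fix p assume ok: "okp (c1 (fst p)) (c2 (snd p))"
  show "I0 one 0 T K n ps p <= nni lborel (%r. indicator {0<..T} r * (ennreal (Lk r p) * ps (lev (<=) p r)))"
   unfolding I0_def
  proof (rule nn_integral_mono_AE, use off_jumps_AE[of "c1 (fst p)" "c2 (snd p)"] in eventually_elim)
   fix r assume r: "r \<notin> times (c1 (fst p)) \<union> times (c2 (snd p))"
   show "ennreal (wgt one 0 T K n p r) * ps (lev (<) p r) <= indicator {0<..T} r * (ennreal (Lk r p) * ps (lev (<=) p r))"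
   proof (cases "r \<in> {0<..T}")
    case True
    have l: "0 <= lik (<) (c1 (fst p)) (c2 (snd p)) r" using ok by (intro lik_nonneg[of T]) (auto simp: okp_def)
    have "exp (- K * r) * lik (<) (c1 (fst p)) (c2 (snd p)) r <= 1 * lik (<) (c1 (fst p)) (c2 (snd p)) r"
     using K True l by (intro mult_right_mono) auto
    then have "wgt one 0 T K n p r <= lik (<) (c1 (fst p)) (c2 (snd p)) r"
     using True l by (auto simp: wgt_def wt_def)
    then show ?thesis using True intn_lik_off[OF r] by (auto simp: lev_def intro!: mult_right_mono ennreal_leI)
   qed (simp add: wgt_def wt_def)
  qed
 qed
 also have "... = nni lborel (%r. nni QQ (%p. indicator {0<..T} r * (ennreal (Lk r p) * ps (lev (<=) p r))))"
  using PL.Fubini'[OF f] by simp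
 also have "... <= nni lborel (%r. nni QQ (%p. indicator {0<..T} r * (ennreal (Lk T p) * ps (lev (<=) p r))))"
 proof (rule nn_integral_mono)
  fix r
  show "nni QQ (%p. indicator {0<..T} r * (ennreal (Lk r p) * ps (lev (<=) p r))) <= nni QQ (%p. indicator {0<..T} r * (ennreal (Lk T p) * ps (lev (<=) p r)))"
   using E_lik_mono[of r T ps] by (cases "r \<in> {0<..T}") auto
 qed
 also have "... = nni QQ (%p. nni lborel (%r. indicator {0<..T} r * (ennreal (Lk T p) * ps (lev (<=) p r))))"
  using PL.Fubini'[OF g] by simp
 also have "... = nni QQ (%p. ennreal (Lk T p) * nni lborel (%r. indicator {0<..T} r * ps (lev (<=) p r)))"
 proof (rule nn_integral_cong)
  fix p assume p: "p \<in> space QQ"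
  have pm: "(%_. p) \<in> measurable lborel QQ" using p by simp
  note [measurable] = lev_meas[OF pm measurable_ident_sets[OF sets_lborel] is_ord(2)]
  show "nni lborel (%r. indicator {0<..T} r * (ennreal (Lk T p) * ps (lev (<=) p r))) = ennreal (Lk T p) * nni lborel (%r. indicator {0<..T} r * ps (lev (<=) p r))"
   by (subst nn_integral_cmult[symmetric]) (auto simp: mult_ac)
 qed
 finally show ?thesis .
qed

lemma L_meas:
 assumes t: "t \<in> {0..T}"
 shows "L t \<in> bm Q"
proof (rule borel_measurable_AE_complete)
 have id: "(%x. x) \<in> measurable Q Q" by simp
 show "(%w. lik (<=) (c1 w) (c2 w) t) \<in> bm Q"
  using meas_lik[OF c1_meas[OF id] c2_meas[OF id], of "%_. t" "(<=)"] by simp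
 show "AE w in Q. lik (<=) (c1 w) (c2 w) t = L t w" using L_eq by eventually_elim (use t in auto)
 show "complete_measure Q" by (rule M1.complete_Q)
 show "null_sets Q \<subseteq> sets Q" by (simp add: null_sets_def subset_eq)
qed simp_all

text \<open>Change of measure followed by \<open>freeze\<close>: expectations under \<open>P\<close>
  become integrals over two independent scenarios.\<close>

lemma P_time_integral:
 assumes ps[measurable]: "ps \<in> bm borel"
 shows "nni P (%w. (\<integral>\<^sup>+s\<in>{0..T}. ps (lam s w) \<partial>lborel))
  = nni QQ (%p. ennreal (Lk T p) * nni lborel (%r. indicator {0<..T} r * ps (lev (<=) p r)))"
proof -
 have id: "(%x. x) \<in> measurable Q Q" by simp
 define h where "h w = nni lborel (%r. indicator {0<..T} r * ps (intn (<=) (c1 w) (c2 w) r))" for w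
 have h: "h \<in> bm Q" unfolding h_def[abs_def]
  by (rule time_integral_meas[OF c1_meas[OF id] c2_meas[OF id] ps is_ord(2)])
 have hl: "(\<integral>\<^sup>+s\<in>{0..T}. ps (lam s w) \<partial>lborel) = h w" if w: "w \<in> space Q" for w
  unfolding h_def
 proof (rule nn_integral_cong_AE, use AE_lborel_singleton[of 0] in eventually_elim)
  fix r :: real assume "r \<noteq> 0"
  then show "ps (lam r w) * indicator {0..T} r = indicator {0<..T} r * ps (intn (<=) (c1 w) (c2 w) r)"
   using lam_eq[OF w, of r] by (auto simp: indicator_def)
 qed
 have [measurable]: "L T \<in> bm Q" using L_meas T_pos by auto
 have "nni P (%w. (\<integral>\<^sup>+s\<in>{0..T}. ps (lam s w) \<partial>lborel)) = nni P (%w. h w)"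
  by (rule nn_integral_cong) (simp add: hl P_def)
 also have "... = nni Q (%w. ennreal (L T w) * h w)"
  unfolding P_def using h by (subst nn_integral_density) auto
 also have "... = nni Q (%w. (%p. ennreal (Lk T p) * nni lborel (%r. indicator {0<..T} r * ps (lev (<=) p r))) (w, w))"
  by (rule nn_integral_cong_AE, use L_eq in eventually_elim) (use T_pos in \<open>simp add: h_def lev_def\<close>)
 also have "... = nni Q (%w. nni Q (%w'. (%p. ennreal (Lk T p) * nni lborel (%r. indicator {0<..T} r * ps (lev (<=) p r))) (w, w')))"
 proof (rule freeze(2))
  have c: "cfg_meas (G1 >< G2) (%p. c1 (fst p))" "cfg_meas (G1 >< G2) (%p. c2 (snd p))"
   unfolding c1_def c2_def
   by (rule cfg_meas_compose[OF M1.cfg_meas_cfg[OF obs_G1 ell_measurable] measurable_fst],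
     rule cfg_meas_compose[OF M2.cfg_meas_cfg[OF obs_G2 id_restrict_meas] measurable_snd])
  note [measurable] = time_integral_meas[OF c ps is_ord(2)] meas_lik[OF c borel_measurable_const is_ord(2)]
  show "(%p. ennreal (Lk T p) * nni lborel (%r. indicator {0<..T} r * ps (lev (<=) p r))) \<in> bm (G1 >< G2)"
   unfolding lev_def by measurable
 qed
 also have "... = nni QQ (%p. ennreal (Lk T p) * nni lborel (%r. indicator {0<..T} r * ps (lev (<=) p r)))"
 proof (rule nn_integral_fst)
  have i: "(%x. x) \<in> measurable QQ QQ" by simp
  note [measurable] = time_integral_meas[OF c1_cfg[OF i] c2_cfg[OF i] ps is_ord(2), folded lev_def]
  show "(%p. ennreal (Lk T p) * nni lborel (%r. indicator {0<..T} r * ps (lev (<=) p r))) \<in> bm QQ"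
   by measurable
 qed
 finally show ?thesis .
qed

end

section \<open>Finite measures on the half-line and their exponentially damped moments\<close>

lemma power_exp_bound:
 fixes x c :: real
 assumes "0 <= x" "0 < c"
 shows "x ^ k * exp (- c * x) <= fact k / c ^ k"
proof -
 have s: "(%n. (c * x) ^ n /\<^sub>R fact n) sums exp (c * x)" by (rule exp_converges)
 \<comment> \<open>One term of the exponential series is at most its sum.\<close>
 have "(c * x) ^ k /\<^sub>R fact k <= (\<Sum>n. (c * x) ^ n /\<^sub>R fact n)"
  using sum_le_suminf[of "%n. (c * x) ^ n /\<^sub>R fact n" "{k}"] s assms by (simp add: sums_iff)
 then have "c ^ k * x ^ k <= fact k * exp (c * x)"
  using s by (simp add: sums_iff power_mult_distrib divide_simps inverse_eq_divide mult.commute)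
 then have "c ^ k * x ^ k * exp (- c * x) <= fact k * exp (c * x) * exp (- c * x)" by (intro mult_right_mono) auto
 also have "... = fact k" by (simp add: exp_minus)
 finally show ?thesis using assms by (simp add: field_simps)
qed

lemma fin_meas_space: "fin_meas mu ==> space mu = {0<..}"
 unfolding fin_meas_def by (auto dest: sets_eq_imp_space_eq simp: space_restrict_space)

lemma fin_meas_borel:
 assumes "fin_meas mu" "f \<in> bm borel"
 shows "f \<in> bm mu"
proof -
 have "sets mu = sets (restrict_space borel {0<..})" using assms(1) by (simp add: fin_meas_def)
 from measurable_cong_sets[OF this refl] show ?thesis using measurable_restrict_space1[OF assms(2)] by blast
qed

lemma fin_meas_integrable:
 fixes f :: "real => 'b::{banach,second_countable_topology}"
 assumes "fin_meas mu" "f \<in> bm borel" "\<And>x. 0 < x ==> norm (f x) <= B"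
 shows "integrable mu f"
proof -
 interpret finite_measure mu using assms(1) by (simp add: fin_meas_def)
 show ?thesis
  by (rule integrable_const_bound[of _ B]) (use assms fin_meas_borel fin_meas_space in auto)
qed

lemma norm_power_exp:
 fixes w :: complex
 assumes "0 < x"
 shows "norm (of_real (x ^ k) * exp (w * of_real x)) = x ^ k * exp (- (- Re w) * x)"
 using assms by (simp add: norm_mult norm_power)

text \<open>Expand exp((w' - w) x) into its power series and integrate termwise. The partial sums
  are dominated by x^k exp(- c x) with c = - Re w - |w' - w| > 0, which explains the radius - Re w.
  Since all \<open>k\<close> are carried along, the step can be repeated.\<close>

lemma laplace_step:
 fixes w w' :: complex
 assumes mu: "fin_meas mu" and \<nu>: "fin_meas \<nu>"
  and eq: "\<And>k. lint mu (%x. of_real (x ^ k) * exp (w * of_real x)) = lint \<nu> (%x. of_real (x ^ k) * exp (w * of_real x))"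
  and w': "norm (w' - w) < - Re w"
 shows "lint mu (%x. of_real (x ^ k) * exp (w' * of_real x)) = lint \<nu> (%x. of_real (x ^ k) * exp (w' * of_real x))"
proof -
 define h where "h = w' - w"
 define c where "c = - Re w - norm h"
 have c: "0 < c" using w' by (simp add: c_def h_def)
 have rw: "0 < - Re w" using w' norm_ge_zero[of "w' - w"] by linarith
 define S where "S n x = (\<Sum>m<n. (h ^ m / fact m) * (of_real (x ^ (k + m)) * exp (w * of_real x)))" for n and x :: real
 have Sx: "S n x = of_real (x ^ k) * exp (w * of_real x) * (\<Sum>m<n. (h * of_real x) ^ m / fact m)" for n x
  unfolding S_def sum_distrib_left by (intro sum.cong refl) (simp add: power_add power_mult_distrib)
 have lim: "(%n. S n x) \<longlonglongrightarrow> of_real (x ^ k) * exp (w' * of_real x)" for x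
 proof -
  have "(%m. (h * of_real x) ^ m /\<^sub>R fact m) sums exp (h * of_real x)" by (rule exp_converges)
  then have "(%n. \<Sum>m<n. (h * of_real x) ^ m / fact m) \<longlonglongrightarrow> exp (h * of_real x)"
   by (simp add: sums_def scaleR_conv_of_real divide_inverse mult.commute)
  then have "(%n. S n x) \<longlonglongrightarrow> of_real (x ^ k) * exp (w * of_real x) * exp (h * of_real x)"
   unfolding Sx by (intro tendsto_mult tendsto_const)
  also have "of_real (x ^ k) * exp (w * of_real x) * exp (h * of_real x) = of_real (x ^ k) * exp (w' * of_real x)"
   by (simp add: h_def exp_add[symmetric] mult.assoc distrib_right[symmetric])
  finally show ?thesis .
 qed
 have bd: "norm (S n x) <= x ^ k * exp (- c * x)" if x: "0 < x" for n x
 proof -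
  have "norm (\<Sum>m<n. (h * of_real x) ^ m / fact m) <= (\<Sum>m<n. (norm h * x) ^ m /\<^sub>R fact m)"
   by (rule order_trans[OF norm_sum])
    (use x in \<open>auto intro!: sum_mono simp: norm_divide norm_power norm_mult norm_inverse norm_fact divide_inverse mult.commute\<close>)
  also have "... <= exp (norm h * x)"
   using sum_le_suminf[OF summable_exp_generic[of "norm h * x"], of "{..<n}"] x
   by (simp add: exp_def)
  finally have "norm (S n x) <= x ^ k * exp (- (- Re w) * x) * exp (norm h * x)"
   unfolding Sx norm_mult[of "_ * _"] norm_power_exp[OF x] using x by (intro mult_left_mono) auto
  also have "... = x ^ k * exp (- c * x)" by (simp add: c_def mult.assoc exp_add[symmetric] algebra_simps)
  finally show ?thesis .
 qed
 have main: "(%n. \<Sum>m<n. (h ^ m / fact m) * lint ka (%x. of_real (x ^ (k + m)) * exp (w * of_real x)))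
   \<longlonglongrightarrow> lint ka (%x. of_real (x ^ k) * exp (w' * of_real x))" if ka: "fin_meas ka" for ka
 proof -
  have i: "integrable ka (%x. of_real (x ^ m) * exp (w * of_real x))" for m
  proof (rule fin_meas_integrable[OF ka])
   fix x :: real assume x: "0 < x"
   show "norm (of_real (x ^ m) * exp (w * of_real x)) <= fact m / (- Re w) ^ m"
    unfolding norm_power_exp[OF x] using x rw by (intro power_exp_bound) auto
  qed measurable
  have "(%n. lint ka (%x. S n x)) \<longlonglongrightarrow> lint ka (%x. of_real (x ^ k) * exp (w' * of_real x))"
  proof (rule integral_dominated_convergence[where w="%x. x ^ k * exp (- c * x)"])
   show "integrable ka (%x. x ^ k * exp (- c * x))"
    by (rule fin_meas_integrable[OF ka, of _ "fact k / c ^ k"]) (use c power_exp_bound[of _ c k] in auto)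
   show "(%x. of_real (x ^ k) * exp (w' * of_real x)) \<in> bm ka"
    by (rule fin_meas_borel[OF ka]) measurable
   show "S n \<in> bm ka" for n unfolding S_def[abs_def]
    by (rule fin_meas_borel[OF ka]) measurable
   show "AE x in ka. norm (S n x) <= x ^ k * exp (- c * x)" for n
    using bd fin_meas_space[OF ka] by auto
  qed (use lim in auto)
  also have "(%n. lint ka (%x. S n x)) = (%n. \<Sum>m<n. (h ^ m / fact m) * lint ka (%x. of_real (x ^ (k + m)) * exp (w * of_real x)))"
   unfolding S_def by (intro ext) (simp only: integral_mult_right_zero Bochner_Integration.integral_sum integrable_mult_right i)
  finally show ?thesis .
 qed
 show ?thesis using main[OF mu] main[OF \<nu>] unfolding eq by (rule LIMSEQ_unique)
qed

text \<open>The tilted characteristic functions are analytic in a strip; \<open>laplace_step\<close> moves along the line.\<close>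

lemma fin_meas_eqI:
 assumes mu: "fin_meas mu" and \<nu>: "fin_meas \<nu>" and a: "0 < a"
  and eq: "\<And>k. lint mu (%x. x ^ k * exp (- a * x)) = lint \<nu> (%x. x ^ k * exp (- a * x))"
 shows "mu = \<nu>"
proof -
 have e0: "lint mu (%x. of_real (x ^ k) * exp (complex_of_real (- a) * of_real x)) = lint \<nu> (%x. of_real (x ^ k) * exp (complex_of_real (- a) * of_real x))" for k
 proof -
  have "of_real (x ^ k) * exp (complex_of_real (- a) * of_real x) = complex_of_real (x ^ k * exp (- a * x))" for x
   by (simp add: exp_of_real[symmetric])
  then show ?thesis using eq[of k] by (simp only: integral_complex_of_real)
 qed
 have line: "lint mu (%x. exp (Complex (- a) u * of_real x)) = lint \<nu> (%x. exp (Complex (- a) u * of_real x))" for u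
 proof -
  \<comment> \<open>Enough steps for each one, of length |u| / n, to be shorter than the radius
    \<open>a\<close>, which is the same at every point of the vertical line.\<close>
  obtain n :: nat where n: "\<bar>u\<bar> / a < real n" using reals_Archimedean2 by blast
  have n0: "0 < real n" using n a by (smt (verit) divide_nonneg_nonneg abs_ge_zero)
  have "lint mu (%x. of_real (x ^ k) * exp (Complex (- a) (u * real j / real n) * of_real x))
    = lint \<nu> (%x. of_real (x ^ k) * exp (Complex (- a) (u * real j / real n) * of_real x))" for j k
  proof (induction j arbitrary: k)
   case 0
   then show ?case using e0[of k] by (simp add: Complex_eq)
  next
   case (Suc j)
   show ?case
   proof (rule laplace_step[OF mu \<nu> Suc])
    have "Complex (- a) (u * real (Suc j) / real n) - Complex (- a) (u * real j / real n) = Complex 0 (u / real n)"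
     by (simp add: complex_eq_iff diff_divide_distrib[symmetric] algebra_simps)
    then show "norm (Complex (- a) (u * real (Suc j) / real n) - Complex (- a) (u * real j / real n)) < - Re (Complex (- a) (u * real j / real n))"
     using n n0 a by (simp add: cmod_def real_sqrt_abs abs_divide pos_divide_less_eq mult.commute del: real_sqrt_divide power_divide)
   qed
  qed
  from this[of 0 n] show ?thesis using n0 by simp
 qed
 define m where "m ka = distr ka borel (%x::real. x)" for ka
 define c where "c ka = lint ka (%x. exp (- a * x))" for ka :: "real measure"
 have cc: "c mu = c \<nu>" using eq[of 0] by (simp add: c_def)
 have ms: "emeasure ka A = emeasure (m ka) A" if "fin_meas ka" "A \<in> sets ka" for ka A
 proof -
  have A: "A \<in> sets borel" "A \<subseteq> {0<..}" using that by (auto simp: fin_meas_def sets_restrict_space_iff)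
  have "(%x. x) -` A \<inter> space ka = A" using A fin_meas_space[OF that(1)] by auto
  then show ?thesis unfolding m_def using A fin_meas_borel[OF that(1), of "%x. x"] by (simp add: emeasure_distr)
 qed
 have i: "integrable ka (%x. exp (- a * x))" if "fin_meas ka" for ka
  by (rule fin_meas_integrable[OF that, of _ 1]) (use a in auto)
 define D where "D ka = density (m ka) (%x. ennreal (exp (- a * x) / c ka))" for ka
 have "m mu = m \<nu>"
 proof (cases "c mu = 0")
  \<comment> \<open>The density exp(- a x) is positive, so vanishing tilted mass forces the zero
    measure.\<close>
  case True
  have "emeasure (m ka) A = 0" if ka: "fin_meas ka" "c ka = 0" for ka A
  proof -
   have "AE x in ka. exp (- a * x) = 0"
    using integral_nonneg_eq_0_iff_AE[OF i[OF ka(1)]] ka(2) by (simp add: c_def)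
   then have "AE x in ka. False" by eventually_elim simp
   then have "emeasure ka (space ka) = 0" by (simp add: AE_iff_measurable[OF _ refl])
   then have "emeasure ka B = 0" for B by (metis emeasure_eq_0 emeasure_notin_sets sets.sets_into_space sets.top)
   then show ?thesis unfolding m_def using fin_meas_borel[OF ka(1), of "%x. x"]
    by (cases "A \<in> sets borel") (simp_all add: emeasure_distr emeasure_notin_sets)
  qed
  then show ?thesis using True cc mu \<nu> by (intro measure_eqI) (auto simp: m_def)
 next
  case False
  have dist: "real_distribution (D ka)" and ch: "char (D ka) u = lint ka (%x. exp (Complex (- a) u * of_real x)) / c ka"
   and inv: "density (D ka) (%x. ennreal (c ka * exp (a * x))) = m ka"
   if ka: "fin_meas ka" "c ka \<noteq> 0" for ka u
  proof -
   have c0: "0 < c ka" using ka(2) unfolding c_def by (simp add: less_le integral_nonneg)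
   have idm: "(%x. x) \<in> measurable ka borel" by (rule fin_meas_borel[OF ka(1)]) simp
   have "emeasure (D ka) (space (D ka)) = nni (m ka) (%x. ennreal (exp (- a * x) / c ka))"
    unfolding D_def by (simp add: emeasure_density m_def)
   also have "... = nni ka (%x. ennreal (exp (- a * x) / c ka))"
    unfolding m_def using idm by (subst nn_integral_distr) auto
   also have "... = ennreal (lint ka (%x. exp (- a * x) / c ka))"
    using i[OF ka(1)] c0 by (intro nn_integral_eq_integral) auto
   also have "... = 1" using c0 by (simp add: c_def)
   finally show "real_distribution (D ka)"
    by (intro real_distribution.intro prob_spaceI real_distribution_axioms.intro) (auto simp: D_def m_def)
   have "char (D ka) u = lint (m ka) (%x. (exp (- a * x) / c ka) *\<^sub>R iexp (u * x))"
    unfolding char_def D_def using c0 by (subst integral_density) (auto simp: m_def)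
   also have "... = lint ka (%x. (exp (- a * x) / c ka) *\<^sub>R iexp (u * x))"
    unfolding m_def using idm by (subst integral_distr) auto
   also have "... = lint ka (%x. exp (Complex (- a) u * of_real x) / c ka)"
    by (intro Bochner_Integration.integral_cong refl)
     (simp add: scaleR_conv_of_real exp_of_real[symmetric] exp_add[symmetric] Complex_eq algebra_simps)
   finally show "char (D ka) u = lint ka (%x. exp (Complex (- a) u * of_real x)) / c ka" by simp
   have "density (D ka) (%x. ennreal (c ka * exp (a * x))) = density (m ka) (%x. ennreal (exp (- a * x) / c ka) * ennreal (c ka * exp (a * x)))"
    unfolding D_def by (rule density_density_eq) (auto simp: m_def)
   also have "(%x. ennreal (exp (- a * x) / c ka) * ennreal (c ka * exp (a * x))) = (%_. 1)"
    using c0 by (auto simp: fun_eq_iff ennreal_mult[symmetric] exp_minus)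
   finally show "density (D ka) (%x. ennreal (c ka * exp (a * x))) = m ka" by (simp add: density_1)
  qed
  have "D mu = D \<nu>"
   using False cc dist[OF mu] dist[OF \<nu>] by (intro Levy_uniqueness) (auto simp: ch[OF mu] ch[OF \<nu>] line)
  then show ?thesis using inv[OF mu] inv[OF \<nu>] False cc by metis
 qed
 then show ?thesis using mu \<nu> ms[OF mu] ms[OF \<nu>] by (intro measure_eqI) (auto simp: fin_meas_def)
qed

section \<open>Integrability from the domain of the generator\<close>

text \<open>A smooth substitute for the absolute value of \<open>f\<close>.\<close>

definition gr :: "(real => real) => real => real" where "gr f x = sqrt (1 + (f x)\<^sup>2)"
definition gr' :: "(real => real) => (real => real) => real => real" where "gr' f f' x = f x * f' x / gr f x"

lemma gr_ge: "1 <= gr f x" "\<bar>f x\<bar> <= gr f x" "0 < gr f x"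
proof -
 show 1: "1 <= gr f x" by (simp add: gr_def)
 show "\<bar>f x\<bar> <= gr f x" unfolding gr_def by (rule real_le_rsqrt) simp
 show "0 < gr f x" using 1 by linarith
qed

lemma gr_nonneg: "0 <= gr f x"
 using gr_ge(3) less_imp_le by blast

lemma C1pos_gr:
 assumes "C1pos f f'"
 shows "C1pos (gr f) (gr' f f')"
 unfolding C1pos_def
proof (intro conjI allI impI)
 have [measurable]: "f \<in> bm borel" "f' \<in> bm borel"
  and d: "\<And>x. 0 < x ==> (f has_real_derivative f' x) (at x)" and c: "continuous_on {0<..} f'"
  using assms by (auto simp: C1pos_def)
 have [measurable]: "gr f \<in> bm borel" unfolding gr_def[abs_def] by measurable
 then show "gr f \<in> bm borel" .
 show "gr' f f' \<in> bm borel" unfolding gr'_def[abs_def] by measurable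
 have dg: "(gr f has_real_derivative gr' f f' x) (at x)" if "0 < x" for x
 proof -
  have p: "0 < 1 + (f x)\<^sup>2" by (simp add: add_pos_nonneg)
  have "((%x. 1 + (f x)\<^sup>2) has_real_derivative 2 * (f x * f' x)) (at x)"
   by (auto intro!: derivative_eq_intros d[OF that])
  note D = DERIV_chain2[OF DERIV_real_sqrt[OF p] this]
  have half: "inverse s / 2 * (2 * b) = b / s" for s b :: real
  proof -
   have "inverse s / 2 * (2 * b) = inverse s * b" by simp
   then show ?thesis by (simp only: divide_inverse[of b s] mult.commute)
  qed
  show ?thesis using D unfolding gr_def[abs_def] gr'_def half .
 qed
 then show "0 < x ==> (gr f has_real_derivative gr' f f' x) (at x)" for x .
 have cd: "continuous_on {0<..} h" if "\<And>x. 0 < x ==> (h has_real_derivative k x) (at x)" for h k :: "real => real"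
  using that DERIV_continuous_on has_field_derivative_at_within by (metis greaterThan_iff)
 have nz: "gr f x \<noteq> 0" for x using gr_ge(3)[of f x] by simp
 show "continuous_on {0<..} (gr' f f')" unfolding gr'_def[abs_def]
  by (intro continuous_intros cd[OF d] cd[OF dg] c) (use nz in auto)
qed

text \<open>The function sqrt(1 + y^2) is 1-Lipschitz. Hence the conditions on the increments of
  \<open>f\<close> pass to \<open>gr f\<close>, which unlike |f| is differentiable.\<close>

lemma gr_diff: "\<bar>gr f x - gr f y\<bar> <= \<bar>f x - f y\<bar>"
proof -
 have "(gr f x - gr f y) * (gr f x + gr f y) = (f x - f y) * (f x + f y)"
  by (simp add: gr_def algebra_simps power2_eq_square real_sqrt_mult_self)
 then have "\<bar>gr f x - gr f y\<bar> * (gr f x + gr f y) = \<bar>f x - f y\<bar> * \<bar>f x + f y\<bar>"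
  using gr_ge(3)[of f x] gr_ge(3)[of f y] by (metis abs_mult abs_of_pos add_pos_pos)
 also have "... <= \<bar>f x - f y\<bar> * (gr f x + gr f y)"
  using gr_ge(2)[of f x] gr_ge(2)[of f y] by (intro mult_left_mono) linarith+
 finally show ?thesis using gr_ge(3)[of f x] gr_ge(3)[of f y] by (auto dest: mult_right_le_imp_le)
qed

lemma gr'_le: "\<bar>gr' f f' x\<bar> <= \<bar>f' x\<bar>"
proof -
 have "\<bar>f x\<bar> * \<bar>f' x\<bar> <= gr f x * \<bar>f' x\<bar>" using gr_ge(2) by (intro mult_right_mono) auto
 then show ?thesis using gr_ge(3)[of f x] by (simp add: gr'_def abs_mult divide_le_eq mult.commute)
qed

context jump_cluster_model
begin

abbreviation Lm :: "real => 'a \<times> 'a => real" where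
 "Lm t p \<equiv> lik (<) (c1 (fst p)) (c2 (snd p)) t"

text \<open>The conditions of \<open>gen_domain\<close>, transferred from \<open>P\<close> to the
  occupation measures, where the balance uses them.\<close>

definition admissible :: "(real => real) => (real => real) => bool" where
 "admissible f f' \<longleftrightarrow> C1pos f f' \<and> (\<forall>n.
  (nni (nu one 0 T 1 n) (%x. nni F1 (%z. ennreal (\<bar>f (x + ell' z) - f x\<bar> * x)))) < \<top> \<and>
  (nni (nu one 0 T 1 n) (%x. nni F2 (%z. ennreal \<bar>f (x + z) - f x\<bar>))) < \<top> \<and>
  (nni (nu one 0 T 1 n) (%x. ennreal (x * \<bar>f' x\<bar>))) < \<top>)"

text \<open>Up to constants, a common majorant of the integrands in the drift and in the compensator
  of the equation.\<close>

definition dom_fn :: "(real => real) => (real => real) => real => ennreal" where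
 "dom_fn f f' x = ennreal (x * gr f x) + ennreal (x * \<bar>f' x\<bar>) + nni F1 (%z. ennreal (\<bar>f (x + ell' z) - f x\<bar> * x))
  + nni F2 (%z. ennreal \<bar>f (x + z) - f x\<bar>) + nni F1 (%z. ennreal (x * gr f (x + ell' z)))"

text \<open>The observed scenarios for which the integrals over the second copy converge. They ask
  for a majorant uniform in time, which yields the path properties, for a finite time integral of
  \<open>dom_fn\<close>, and for finiteness at every single jump, where a statement for almost all
  times says nothing.\<close>

definition regular :: "(real => real) => (real => real) => 'a => bool" where
 "regular f f' w \<longleftrightarrow> w \<in> space Q \<and> config_ok T (c1 w) \<and>
  (\<exists>W. W \<in> bm Q \<and> nni Q (%w'. W w') < \<top> \<and>
    (AE w' in Q. \<forall>t\<in>{0..T}. ennreal (Lk t (w, w') * gr f (lev (<=) (w, w') t)) <= W w')) \<and>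
  (nni Q (%w'. nni lborel (%r. indicator {0<..T} r * (ennreal (Lm r (w, w')) * dom_fn f f' (lev (<) (w, w') r))))) < \<top> \<and>
  (\<forall>j\<in>{1..N1 T w}. nni Q (%w'. ennreal (Lm (tm (c1 w) j) (w, w')) *
    (ennreal (lev (<) (w, w') (tm (c1 w) j) * gr f (lev (<) (w, w') (tm (c1 w) j) + ell' (Z1 j w)))
    + ennreal (gr f (lev (<) (w, w') (tm (c1 w) j))))) < \<top>)"

lemma AE_section_finite:
 assumes "h \<in> bm QQ" "nni QQ (%p. h p) < \<top>"
 shows "AE w in Q. nni Q (%w'. h (w, w')) < \<top>"
proof -
 have "AE w in Q. nni Q (%w'. h (w, w')) \<noteq> \<infinity>"
  using assms by (intro nn_integral_PInf_AE borel_measurable_nn_integral_fst) (simp_all add: nn_integral_fst)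
 then show ?thesis by (simp add: less_top)
qed

lemma wgt_mono_time:
 assumes "okp (c1 (fst p)) (c2 (snd p))" "t <= T" "m <= n"
 shows "wgt one 0 t 1 m p r <= wgt one 0 T 1 n p r"
proof -
 have "0 <= lik (<) (c1 (fst p)) (c2 (snd p)) r" using assms(1) by (intro lik_nonneg[of T]) (auto simp: okp_def)
 then show ?thesis using assms(2,3) by (auto simp: wgt_def wt_def indicator_def)
qed

context
 fixes f f' :: "real => real"
 assumes adm: "admissible f f'"
begin

lemma f_meas [measurable]: "f \<in> bm borel" "f' \<in> bm borel" "gr f \<in> bm borel" "gr' f f' \<in> bm borel"
 using adm C1pos_gr[of f f'] by (auto simp: admissible_def C1pos_def)

lemma gr_C1pos: "C1pos (gr f) (gr' f f')"
 using adm C1pos_gr by (simp add: admissible_def)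

lemma T0: "(0::real) <= 0" "0 <= T" "T <= T"
 using T_pos by auto

lemma nu_1_pos: "AE x in nu one 0 T 1 n. lmin <= x"
 by (rule nu_pos[OF T0]) simp

lemma drift_bound:
 assumes x: "lmin <= x"
 shows "\<bar>\<alpha> * (\<beta> - x) * gr' f f' x\<bar> <= \<alpha> * (\<beta> / lmin + 1) * (x * \<bar>f' x\<bar>)"
proof -
 have "\<beta> <= \<beta> / lmin * x" using x lmin_pos params_pos by (simp add: field_simps)
 then have "\<bar>\<beta> - x\<bar> <= (\<beta> / lmin + 1) * x" using x lmin_pos params_pos by (simp add: distrib_right)
 then have "\<bar>\<beta> - x\<bar> * \<bar>gr' f f' x\<bar> <= ((\<beta> / lmin + 1) * x) * \<bar>f' x\<bar>" using gr'_le by (intro mult_mono) auto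
 then have "\<alpha> * (\<bar>\<beta> - x\<bar> * \<bar>gr' f f' x\<bar>) <= \<alpha> * (((\<beta> / lmin + 1) * x) * \<bar>f' x\<bar>)"
  using params_pos by (intro mult_left_mono) auto
 then show ?thesis using params_pos by (simp add: abs_mult mult.assoc)
qed

lemma jump_bound:
 assumes x: "0 < x"
 shows "nni F1 (%z. ennreal (x * gr f (x + ell' z))) <= ennreal (x * gr f x) + nni F1 (%z. ennreal (\<bar>f (x + ell' z) - f x\<bar> * x))"
proof -
 interpret P1: prob_space F1 by (rule M1.prob_space_K)
 have "nni F1 (%z. ennreal (x * gr f (x + ell' z))) <= nni F1 (%z. ennreal (x * gr f x) + ennreal (\<bar>f (x + ell' z) - f x\<bar> * x))"
 proof (rule nn_integral_mono)
  fix z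
  have "gr f (x + ell' z) <= gr f x + \<bar>f (x + ell' z) - f x\<bar>" using gr_diff[of f "x + ell' z" x] by linarith
  then have "x * gr f (x + ell' z) <= x * (gr f x + \<bar>f (x + ell' z) - f x\<bar>)" using x by (intro mult_left_mono) auto
  then have "ennreal (x * gr f (x + ell' z)) <= ennreal (x * gr f x + \<bar>f (x + ell' z) - f x\<bar> * x)"
   by (intro ennreal_leI) (simp add: algebra_simps)
  also have "... = ennreal (x * gr f x) + ennreal (\<bar>f (x + ell' z) - f x\<bar> * x)"
   using x gr_nonneg by (intro ennreal_plus) auto
  finally show "ennreal (x * gr f (x + ell' z)) <= ennreal (x * gr f x) + ennreal (\<bar>f (x + ell' z) - f x\<bar> * x)" .
 qed
 also have "... = ennreal (x * gr f x) + nni F1 (%z. ennreal (\<bar>f (x + ell' z) - f x\<bar> * x))"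
  by (subst nn_integral_add) (simp_all add: P1.emeasure_space_1[simplified])
 finally show ?thesis .
qed

lemma kernels_meas [measurable]:
 "(%x. nni F1 (%z. ennreal (\<bar>f (x + ell' z) - f x\<bar> * x))) \<in> bm borel"
 "(%x. nni F2 (%z. ennreal \<bar>f (x + z) - f x\<bar>)) \<in> bm borel"
 "(%x. nni F1 (%z. ennreal (x * gr f (x + ell' z)))) \<in> bm borel"
 "(%x. nni F2 (%z. ennreal (max 0 (gr f (x + z) - gr f x)))) \<in> bm borel"
 using kernel_meas(1)[OF T0, of "%_. 1" "%(x, z). ennreal (\<bar>f (x + ell' z) - f x\<bar> * x)"]
  kernel_meas(2)[OF T0, of "%_. 1" "%(x, z). ennreal \<bar>f (x + z) - f x\<bar>"]
  kernel_meas(1)[OF T0, of "%_. 1" "%(x, z). ennreal (x * gr f (x + ell' z))"]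
  kernel_meas(2)[OF T0, of "%_. 1" "%(x, z). ennreal (max 0 (gr f (x + z) - gr f x))"]
 by auto

lemma drift_finite: "nni (nu one 0 T 1 n) (%x. ennreal (max 0 (\<alpha> * (\<beta> - x) * gr' f f' x))) < \<top>"
proof -
 have "nni (nu one 0 T 1 n) (%x. ennreal (max 0 (\<alpha> * (\<beta> - x) * gr' f f' x)))
  <= nni (nu one 0 T 1 n) (%x. ennreal (\<alpha> * (\<beta> / lmin + 1)) * ennreal (x * \<bar>f' x\<bar>))"
 proof (rule nn_integral_mono_AE, use nu_1_pos in eventually_elim)
  fix x assume x: "lmin <= x"
  have "0 <= \<alpha> * (\<beta> / lmin + 1)" using params_pos lmin_pos by auto
  then show "ennreal (max 0 (\<alpha> * (\<beta> - x) * gr' f f' x)) <= ennreal (\<alpha> * (\<beta> / lmin + 1)) * ennreal (x * \<bar>f' x\<bar>)"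
   using drift_bound[OF x] x lmin_pos by (subst ennreal_mult'[symmetric]) (auto intro!: ennreal_leI)
 qed
 also have "... < \<top>" using adm by (simp add: nn_integral_cmult ennreal_mult_less_top admissible_def)
 finally show ?thesis .
qed

lemma gr_jump2_finite: "nni (nu one 0 T 1 n) (%x. nni F2 (%z. ennreal (max 0 (gr f (x + z) - gr f x)))) < \<top>"
proof -
 have "nni (nu one 0 T 1 n) (%x. nni F2 (%z. ennreal (max 0 (gr f (x + z) - gr f x)))) <= nni (nu one 0 T 1 n) (%x. nni F2 (%z. ennreal \<bar>f (x + z) - f x\<bar>))"
 proof (intro nn_integral_mono ennreal_leI)
  fix x z show "max 0 (gr f (x + z) - gr f x) <= \<bar>f (x + z) - f x\<bar>" using gr_diff[of f "x + z" x] by linarith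
 qed
 also have "... < \<top>" using adm by (simp add: admissible_def)
 finally show ?thesis .
qed

lemma gr_jump1_le:
 "nni (nu one 0 T 1 n) (%x. nni F1 (%z. ennreal (x * gr f (x + ell' z)))) <= nni (nu one 0 T 1 n) (%x. ennreal (x * gr f x))
  + nni (nu one 0 T 1 n) (%x. nni F1 (%z. ennreal (\<bar>f (x + ell' z) - f x\<bar> * x)))"
proof (subst nn_integral_add[symmetric])
 show "nni (nu one 0 T 1 n) (%x. nni F1 (%z. ennreal (x * gr f (x + ell' z)))) <= nni (nu one 0 T 1 n) (%x. ennreal (x * gr f x)
  + nni F1 (%z. ennreal (\<bar>f (x + ell' z) - f x\<bar> * x)))"
 proof (rule nn_integral_mono_AE, use nu_1_pos in eventually_elim)
  fix x assume "lmin <= x" then show "nni F1 (%z. ennreal (x * gr f (x + ell' z))) <= ennreal (x * gr f x)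
  + nni F1 (%z. ennreal (\<bar>f (x + ell' z) - f x\<bar> * x))" using lmin_pos by (intro jump_bound) linarith
 qed
qed measurable

text \<open>Induction on the level. Damping at rate 1 removes \<open>gr f\<close> from the
  right-hand side; the rest of it is bounded by the domain conditions, except for the gain at
  observed jumps, and this carries the previous level.\<close>

lemma growth_finite: "nni (nu one 0 T 1 n) (%x. ennreal (x * gr f x)) < \<top>"
proof (induction n)
 case 0
 then show ?case using T0 by (subst nu_zero) auto
next
 case (Suc n)
 let ?nu = "nu one 0 T 1" and ?n = "Suc n"
 let ?A = "nni (?nu ?n) (%x. ennreal (x * gr f x + max 0 (- (\<alpha> * (\<beta> - x) * gr' f f' x)) + max 0 (1 - 1) * gr f x))"
 have "nni (?nu ?n) (%x. ennreal (x * gr f x)) <= ?A"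
  by (rule nn_integral_mono_AE, use nu_1_pos in eventually_elim) (auto intro!: ennreal_leI)
 also have "... <= nni QQ (%p. ennreal (Yv one 0 1 ?n (gr f) T p)) + ?A
   + nni (?nu ?n) (%x. ennreal (gr f x)) + ennreal \<rho> * nni (?nu ?n) (%x. nni F2 (%z. ennreal (max 0 (gr f x - gr f (x + z)))))"
  by (intro add_increasing2[OF _ add_increasing2[OF _ add_increasing]]) auto
 also have "... = nni QQ (%p. ennreal (Yv one 0 1 ?n (gr f) 0 p)) + nni (?nu ?n) (%x. ennreal (max 0 (\<alpha> * (\<beta> - x) * gr' f f' x) + max 0 (1 - 1) * gr f x))
   + nni (?nu (?n - 1)) (%x. nni F1 (%z. ennreal (x * gr f (x + ell' z))))
   + ennreal \<rho> * nni (?nu ?n) (%x. nni F2 (%z. ennreal (max 0 (gr f (x + z) - gr f x))))"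
  by (rule balance[OF T0 _ _ gr_C1pos gr_nonneg]) auto
 also have "... < \<top>"
 proof -
  have "nni (?nu n) (%x. nni F1 (%z. ennreal (x * gr f (x + ell' z)))) < \<top>"
   by (rule le_less_trans[OF gr_jump1_le]) (use Suc adm in \<open>simp add: admissible_def\<close>)
  then show ?thesis using E_Yv_0[of ?n one 1 "gr f"] drift_finite[of ?n] gr_jump2_finite[of ?n]
   by (simp add: ennreal_mult_less_top)
 qed
 finally show ?case .
qed

lemma gr_jump1_finite: "nni (nu one 0 T 1 n) (%x. nni F1 (%z. ennreal (x * gr f (x + ell' z)))) < \<top>"
 by (rule le_less_trans[OF gr_jump1_le]) (use growth_finite adm in \<open>simp add: admissible_def\<close>)

lemma dom_fn_meas [measurable]: "dom_fn f f' \<in> bm borel"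
 unfolding dom_fn_def[abs_def] by measurable

lemma dom_fn_finite: "nni (nu one 0 T 1 n) (%x. dom_fn f f' x) < \<top>"
 unfolding dom_fn_def using growth_finite[of n] gr_jump1_finite[of n] adm
 by (simp add: nn_integral_add admissible_def)

text \<open>The right-hand side of the pathwise balance on (0, T]. Its terms grow with the end time,
  so it dominates the damped and cut path at all times simultaneously.\<close>

definition sup_bound :: "nat => 'a \<times> 'a => ennreal" where
 "sup_bound n p = ennreal (gr f l0) + I0 one 0 T 1 n (%x. ennreal (max 0 (\<alpha> * (\<beta> - x) * gr' f f' x))) p
  + S1 one 0 T 1 n (%(x, z). ennreal (x * gr f (x + ell' z))) p + S2 one 0 T 1 n (%(x, z). ennreal (max 0 (gr f (x + z) - gr f x))) p"

lemma sup_bound_meas [measurable]: "sup_bound n \<in> bm QQ"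
proof -
 have [measurable]: "I0 one 0 T 1 n (%x. ennreal (max 0 (\<alpha> * (\<beta> - x) * gr' f f' x))) \<in> bm QQ"
  "S1 one 0 T 1 n (%(x, z). ennreal (x * gr f (x + ell' z))) \<in> bm QQ"
  "S2 one 0 T 1 n (%(x, z). ennreal (max 0 (gr f (x + z) - gr f x))) \<in> bm QQ"
  by (intro I0_meas[OF T0] S1_meas[OF T0] S2_meas[OF T0]; measurable)+
 show ?thesis unfolding sup_bound_def[abs_def] by measurable
qed

lemma sup_bound_finite: "nni QQ (%p. sup_bound n p) < \<top>"
proof -
 interpret PP: prob_space QQ by (rule prob_space_pair) (unfold_locales)
 have m: "I0 one 0 T 1 n (%x. ennreal (max 0 (\<alpha> * (\<beta> - x) * gr' f f' x))) \<in> bm QQ"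
  "S1 one 0 T 1 n (%(x, z). ennreal (x * gr f (x + ell' z))) \<in> bm QQ"
  "S2 one 0 T 1 n (%(x, z). ennreal (max 0 (gr f (x + z) - gr f x))) \<in> bm QQ"
  by (intro I0_meas[OF T0] S1_meas[OF T0] S2_meas[OF T0]; measurable)+
 have 1: "nni QQ (%p. I0 one 0 T 1 n (%x. ennreal (max 0 (\<alpha> * (\<beta> - x) * gr' f f' x))) p) < \<top>"
  by (subst E_I0[OF T0]) (use drift_finite in simp_all)
 have 2: "nni QQ (%p. S1 one 0 T 1 n (%(x, z). ennreal (x * gr f (x + ell' z))) p) < \<top>"
  by (subst E_S1[OF T0]) (use gr_jump1_finite in simp_all)
 have 3: "nni QQ (%p. S2 one 0 T 1 n (%(x, z). ennreal (max 0 (gr f (x + z) - gr f x))) p) < \<top>"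
  by (subst E_S2[OF T0]) (use gr_jump2_finite in \<open>simp_all add: ennreal_mult_less_top\<close>)
 have "nni QQ (%p. sup_bound n p) = ennreal (gr f l0) + nni QQ (%p. I0 one 0 T 1 n (%x. ennreal (max 0 (\<alpha> * (\<beta> - x) * gr' f f' x))) p)
  + nni QQ (%p. S1 one 0 T 1 n (%(x, z). ennreal (x * gr f (x + ell' z))) p) + nni QQ (%p. S2 one 0 T 1 n (%(x, z). ennreal (max 0 (gr f (x + z) - gr f x))) p)"
  unfolding sup_bound_def using m by (simp add: nn_integral_add PP.emeasure_space_1)
 also have "... < \<top>" using 1 2 3 by simp
 finally show ?thesis .
qed

lemma sup_bound:
 assumes p: "p \<in> space QQ" and ok: "okp (c1 (fst p)) (c2 (snd p))" and t: "0 <= t" "t <= T"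
 shows "ennreal (Yv one 0 1 n (gr f) t p) <= sup_bound n p"
proof -
 note mono = ennreal_leI[OF wgt_mono_time[OF ok t(2)]]
 have "ennreal (Yv one 0 1 n (gr f) t p) <= ennreal (Yv one 0 1 n (gr f) t p) + I0 one 0 t 1 n (%x. ennreal (x * gr f x + max 0 (- (\<alpha> * (\<beta> - x) * gr' f f' x)) + max 0 (1 - 1) * gr f x)) p
   + S1 one 0 t 1 n (%(x, z). ennreal (gr f x)) p + S2 one 0 t 1 n (%(x, z). ennreal (max 0 (gr f x - gr f (x + z)))) p"
  by (simp add: add.assoc)
 also have "... = ennreal (Yv one 0 1 n (gr f) 0 p) + I0 one 0 t 1 n (%x. ennreal (max 0 (\<alpha> * (\<beta> - x) * gr' f f' x) + max 0 (1 - 1) * gr f x)) p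
   + S1 one 0 t 1 (n - 1) (%(x, z). ennreal (x * gr f (x + ell' z))) p + S2 one 0 t 1 n (%(x, z). ennreal (max 0 (gr f (x + z) - gr f x))) p"
  by (rule pointwise_balance[OF p ok T0(1) t _ _ gr_C1pos gr_nonneg]) auto
 also have "... <= sup_bound n p"
  unfolding sup_bound_def
 proof (intro add_mono)
  show "ennreal (Yv one 0 1 n (gr f) 0 p) <= ennreal (gr f l0)"
   using gr_nonneg by (intro ennreal_leI) (simp add: Yv_def initial_values[OF ok])
  show "I0 one 0 t 1 n (%x. ennreal (max 0 (\<alpha> * (\<beta> - x) * gr' f f' x) + max 0 (1 - 1) * gr f x)) p
   <= I0 one 0 T 1 n (%x. ennreal (max 0 (\<alpha> * (\<beta> - x) * gr' f f' x))) p"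
   unfolding I0_def by (intro nn_integral_mono mult_mono mono) auto
  show "S1 one 0 t 1 (n - 1) (%(x, z). ennreal (x * gr f (x + ell' z))) p <= S1 one 0 T 1 n (%(x, z). ennreal (x * gr f (x + ell' z))) p"
   unfolding S1_def by (intro sum_mono mult_mono mono) auto
  show "S2 one 0 t 1 n (%(x, z). ennreal (max 0 (gr f (x + z) - gr f x))) p <= S2 one 0 T 1 n (%(x, z). ennreal (max 0 (gr f (x + z) - gr f x))) p"
   unfolding S2_def by (intro sum_mono mult_mono mono) auto
 qed
 finally show ?thesis .
qed

text \<open>Along \<open>w\<close> the cut at level N_T(w) + 1 is never reached; this choice removes
  the cut from statements on a single scenario.\<close>

lemma card_idx_less: "card (idx R (c1 w) r) < Suc (N1 T w)"
 using card_mono[OF _ subset_trans[OF _ order_refl], of "{1..num (c1 w)}" "idx R (c1 w) r"] idx_in_Pow[of R "c1 w" r]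
 by (simp add: num_c1 less_Suc_eq_le)

lemma Lm_le_wgt:
 assumes ok: "okp (c1 w) (c2 w')" and r: "r \<in> {0<..T}"
 shows "Lm r (w, w') <= exp T * wgt one 0 T 1 (Suc (N1 T w)) (w, w') r"
proof -
 have l: "0 <= Lm r (w, w')" using ok by (intro lik_nonneg[of T]) (auto simp: okp_def)
 have "1 <= exp T * exp (- r)" using r by (simp add: exp_add[symmetric])
 then have "1 * Lm r (w, w') <= exp T * exp (- r) * Lm r (w, w')" using l by (intro mult_right_mono) auto
 then show ?thesis using r card_idx_less[of "(<)" w r] by (simp add: wgt_def wt_def)
qed

text \<open>Finite expectations at every level give finite sections for almost every
  \<open>w\<close>, simultaneously for the countably many levels. Only then is the level chosen as a
  function of \<open>w\<close>; undoing the damping costs at most the factor exp T.\<close>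

lemma AE_regular: "AE w in Q. regular f f' w"
proof -
 let ?Ph = "%(x, z). ennreal (x * gr f (x + ell' z)) + ennreal (gr f x)"
 have I: "AE w in Q. nni Q (%w'. I0 one 0 T 1 n (dom_fn f f') (w, w')) < \<top>" for n
  by (rule AE_section_finite[OF I0_meas[OF T0]]) (use E_I0[OF T0] dom_fn_finite in auto)
 have S: "AE w in Q. nni Q (%w'. S1 one 0 T 1 n ?Ph (w, w')) < \<top>" for n
 proof (rule AE_section_finite[OF S1_meas[OF T0]])
  interpret P1: prob_space F1 by (rule M1.prob_space_K)
  have g: "nni (nu one 0 T 1 n) (%x. ennreal (gr f x)) <= nni (nu one 0 T 1 n) (%x. ennreal (1 / lmin) * ennreal (x * gr f x))"
  proof (rule nn_integral_mono_AE, use nu_1_pos in eventually_elim)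
   fix x assume x: "lmin <= x"
   have "gr f x <= 1 / lmin * (x * gr f x)" using mult_right_mono[OF x gr_nonneg[of f x]] lmin_pos by (simp add: field_simps)
   then show "ennreal (gr f x) <= ennreal (1 / lmin) * ennreal (x * gr f x)"
    using lmin_pos by (subst ennreal_mult'[symmetric]) (auto intro!: ennreal_leI)
  qed
  also have "... < \<top>" using growth_finite by (simp add: nn_integral_cmult ennreal_mult_less_top)
  finally have g: "nni (nu one 0 T 1 n) (%x. ennreal (gr f x)) < \<top>" .
  have "nni QQ (%p. S1 one 0 T 1 n ?Ph p) = nni (nu one 0 T 1 n) (%x. nni F1 (%z. ennreal (x * gr f (x + ell' z)) + ennreal (gr f x)))"
   by (subst E_S1[OF T0]) simp_all
  also have "... = nni (nu one 0 T 1 n) (%x. nni F1 (%z. ennreal (x * gr f (x + ell' z))) + ennreal (gr f x))"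
   by (intro nn_integral_cong) (subst nn_integral_add, simp_all add: P1.emeasure_space_1[simplified])
  also have "... < \<top>" using g gr_jump1_finite[of n] by (simp add: nn_integral_add)
  finally show "nni QQ (%p. S1 one 0 T 1 n ?Ph p) < \<top>" .
 qed (use f_meas in auto)
 have W: "AE w in Q. nni Q (%w'. sup_bound n (w, w')) < \<top>" for n
  by (rule AE_section_finite[OF sup_bound_meas sup_bound_finite])
 have "AE w in Q. \<forall>n. nni Q (%w'. I0 one 0 T 1 n (dom_fn f f') (w, w')) < \<top> \<and> nni Q (%w'. S1 one 0 T 1 n ?Ph (w, w')) < \<top>
  \<and> nni Q (%w'. sup_bound n (w, w')) < \<top>"
  unfolding AE_all_countable using I S W by auto
 then show ?thesis using c1_ok AE_space
 proof eventually_elim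
  case (elim w)
  let ?n = "Suc (N1 T w)"
  note ok = okp_c2[OF elim(2)]
  show ?case unfolding regular_def
  proof (intro conjI ballI)
   show "w \<in> space Q" "config_ok T (c1 w)" by fact+
   let ?W = "%w'. ennreal (exp T) * sup_bound ?n (w, w')"
   have [measurable]: "(%w'. sup_bound ?n (w, w')) \<in> bm Q"
    using measurable_Pair2[OF sup_bound_meas elim(3)] .
   have "nni Q (%w'. ?W w') < \<top>" using elim(1) by (subst nn_integral_cmult) (auto simp: ennreal_mult_less_top)
   moreover have "AE w' in Q. \<forall>t\<in>{0..T}. ennreal (Lk t (w, w') * gr f (lev (<=) (w, w') t)) <= ?W w'"
    using ok AE_space
   proof eventually_elim
    case E: (elim w')
    show ?case
    proof
     fix t assume t: "t \<in> {0..T}"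
     let ?y = "Lk t (w, w') * gr f (lev (<=) (w, w') t)"
     have l: "0 <= Lk t (w, w')" using E by (intro lik_nonneg[of T]) (auto simp: okp_def)
     have y: "Yv one 0 1 ?n (gr f) t (w, w') = exp (- t) * ?y"
      using card_idx_less[of "(<=)" w t] by (simp add: Yv_def)
     have "1 <= exp T * exp (- t)" using t by (simp add: exp_add[symmetric])
     then have "1 * ?y <= exp T * exp (- t) * ?y" using l gr_nonneg by (intro mult_right_mono) auto
     then have "ennreal ?y <= ennreal (exp T) * ennreal (Yv one 0 1 ?n (gr f) t (w, w'))"
      unfolding y by (subst ennreal_mult'[symmetric]) (auto simp: mult.assoc intro!: ennreal_leI)
     also have "... <= ?W w'" using elim(3) E t by (intro mult_left_mono sup_bound) (auto simp: space_pair_measure)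
     finally show "ennreal ?y <= ?W w'" .
    qed
   qed
   ultimately show "\<exists>W. W \<in> bm Q \<and> nni Q (%w'. W w') < \<top> \<and>
    (AE w' in Q. \<forall>t\<in>{0..T}. ennreal (Lk t (w, w') * gr f (lev (<=) (w, w') t)) <= W w')"
    by (intro exI[of _ ?W]) auto
   have mI: "(%w'. I0 one 0 T 1 ?n (dom_fn f f') (w, w')) \<in> bm Q"
    using measurable_Pair2[OF I0_meas[OF T0] elim(3)] by simp
   have "nni Q (%w'. nni lborel (%r. indicator {0<..T} r * (ennreal (Lm r (w, w')) * dom_fn f f' (lev (<) (w, w') r))))
    <= nni Q (%w'. ennreal (exp T) * I0 one 0 T 1 ?n (dom_fn f f') (w, w'))"
   proof (rule nn_integral_mono_AE, use ok AE_space in eventually_elim)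
    fix w' assume o: "okp (c1 w) (c2 w')" and w': "w' \<in> space Q"
    have pm: "(%_. (w, w')) \<in> measurable lborel QQ" using w' elim(3) by (simp add: space_pair_measure)
    note [measurable] = lev_meas[OF pm measurable_ident_sets[OF sets_lborel] is_ord(1)] wgt_meas[OF pm measurable_ident_sets[OF sets_lborel]]
    have "nni lborel (%r. indicator {0<..T} r * (ennreal (Lm r (w, w')) * dom_fn f f' (lev (<) (w, w') r)))
     <= nni lborel (%r. ennreal (exp T) * (ennreal (wgt one 0 T 1 ?n (w, w') r) * dom_fn f f' (lev (<) (w, w') r)))"
    proof (rule nn_integral_mono)
     fix r
     show "indicator {0<..T} r * (ennreal (Lm r (w, w')) * dom_fn f f' (lev (<) (w, w') r))
      <= ennreal (exp T) * (ennreal (wgt one 0 T 1 ?n (w, w') r) * dom_fn f f' (lev (<) (w, w') r))"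
      using Lm_le_wgt[OF o, of r] by (cases "r \<in> {0<..T}")
       (auto simp: mult.assoc[symmetric] ennreal_mult'[symmetric] intro!: mult_right_mono ennreal_leI)
    qed
    also have "... = ennreal (exp T) * I0 one 0 T 1 ?n (dom_fn f f') (w, w')"
     unfolding I0_def by (rule nn_integral_cmult) measurable
    finally show "nni lborel (%r. indicator {0<..T} r * (ennreal (Lm r (w, w')) * dom_fn f f' (lev (<) (w, w') r)))
     <= ennreal (exp T) * I0 one 0 T 1 ?n (dom_fn f f') (w, w')" .
   qed
   also have "... < \<top>" using elim(1) mI by (subst nn_integral_cmult) (auto simp: ennreal_mult_less_top)
   finally show "nni Q (%w'. nni lborel (%r. indicator {0<..T} r * (ennreal (Lm r (w, w')) * dom_fn f f' (lev (<) (w, w') r)))) < \<top>" .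
   fix j assume j: "j \<in> {1..N1 T w}"
   let ?r = "tm (c1 w) j"
   let ?G = "%w'. ennreal (lev (<) (w, w') ?r * gr f (lev (<) (w, w') ?r + ell' (Z1 j w))) + ennreal (gr f (lev (<) (w, w') ?r))"
   have mS: "(%w'. S1 one 0 T 1 ?n ?Ph (w, w')) \<in> bm Q"
    by (rule measurable_Pair2[OF S1_meas[OF T0] elim(3)]) measurable
   have "nni Q (%w'. ennreal (Lm ?r (w, w')) * ?G w') <= nni Q (%w'. ennreal (exp T) * S1 one 0 T 1 ?n ?Ph (w, w'))"
   proof (rule nn_integral_mono_AE, use ok in eventually_elim)
    fix w' assume o: "okp (c1 w) (c2 w')"
    have r: "?r \<in> {0<..T}" using o j by (auto simp: okp_def config_ok_def num_c1)
    have "ennreal (Lm ?r (w, w')) * ?G w' <= ennreal (exp T) * (ennreal (wgt one 0 T 1 ?n (w, w') ?r) * ?G w')"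
     unfolding mult.assoc[symmetric] using Lm_le_wgt[OF o r]
     by (intro mult_right_mono) (auto simp: ennreal_mult'[symmetric] intro!: ennreal_leI)
    also have "ennreal (wgt one 0 T 1 ?n (w, w') ?r) * ?G w' <= S1 one 0 T 1 ?n ?Ph (w, w')"
     unfolding S1_def using j
     by (intro order_trans[OF _ member_le_sum[of j]]) (auto simp: num_c1 M1.jz_def)
    finally show "ennreal (Lm ?r (w, w')) * ?G w' <= ennreal (exp T) * S1 one 0 T 1 ?n ?Ph (w, w')"
     by (simp add: mult_left_mono)
   qed
   also have "... < \<top>" using elim(1) mS by (subst nn_integral_cmult) (auto simp: ennreal_mult_less_top)
   finally show "nni Q (%w'. ennreal (Lm ?r (w, w')) * ?G w') < \<top>" .
  qed
 qed
qed

end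

declare f_meas [measurable del] kernels_meas [measurable del] dom_fn_meas [measurable del] sup_bound_meas [measurable del]

end

section \<open>Uniqueness of weak limits\<close>

lemma weak_limit_unique:
 assumes "fin_meas mu" "fin_meas \<nu>" "weakly_tendsto ka mu G" "weakly_tendsto ka \<nu> G" "G \<noteq> bot"
 shows "mu = \<nu>"
proof (rule fin_meas_eqI[OF assms(1,2), of 1])
 fix k
 have c: "continuous_on {0<..} (%x::real. x ^ k * exp (- 1 * x))" by (intro continuous_intros)
 have b: "bounded ((%x::real. x ^ k * exp (- 1 * x)) ` {0<..})"
 proof (rule boundedI)
  fix y assume "y \<in> (%x::real. x ^ k * exp (- 1 * x)) ` {0<..}"
  then obtain x :: real where x: "0 < x" "y = x ^ k * exp (- 1 * x)" by auto
  then show "norm y <= fact k / 1 ^ k" using power_exp_bound[of x 1 k] by (simp add: abs_mult)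
 qed
 show "lint mu (%x. x ^ k * exp (- 1 * x)) = lint \<nu> (%x. x ^ k * exp (- 1 * x))"
 proof (rule tendsto_unique[OF assms(5)])
  show "((%s. lint (ka s) (%x. x ^ k * exp (- 1 * x))) \<longlongrightarrow> lint mu (%x. x ^ k * exp (- 1 * x))) G"
   by (rule assms(3)[unfolded weakly_tendsto_def, rule_format, OF c b])
  show "((%s. lint (ka s) (%x. x ^ k * exp (- 1 * x))) \<longlongrightarrow> lint \<nu> (%x. x ^ k * exp (- 1 * x))) G"
   by (rule assms(4)[unfolded weakly_tendsto_def, rule_format, OF c b])
 qed
qed simp

lemma left_lim_eqI:
 assumes "fin_meas \<nu>" "weakly_tendsto mu \<nu> (at_left s)"
 shows "left_lim mu s = \<nu>"
 unfolding left_lim_def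
proof (rule the_equality)
 show "\<nu>' = \<nu>" if "fin_meas \<nu>' \<and> weakly_tendsto mu \<nu>' (at_left s)" for \<nu>'
  by (rule weak_limit_unique[of _ _ mu "at_left s"]) (use that assms in simp_all)
qed (use assms in simp)

context jump_cluster_model
begin

section \<open>The frozen filter\<close>

text \<open>The filter with the observed path \<open>w\<close> frozen: the image, under the
  intensity, of \<open>Q\<close> weighted by the likelihood, both as functions of the second
  scenario. The default 1 makes the map take values in the state space; for proper
  \<open>c1 w\<close> and nonnegative \<open>t\<close> it concerns a null set only.\<close>

definition kap :: "(real => real => bool) => real => 'a => real measure" where
 "kap R t w = distr (density Q (%w'. ennreal (lik R (c1 w) (c2 w') t))) (restrict_space borel {0<..})
  (%w'. if 0 < lev R (w, w') t then lev R (w, w') t else 1)"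

lemma kap_sets [simp]: "sets (kap R t w) = sets (restrict_space borel {0<..})"
 and kap_space [simp]: "space (kap R t w) = {0<..}"
 by (simp_all add: kap_def space_restrict_space)

lemma section_meas:
 assumes "w \<in> space Q" "is_ord R"
 shows "(%w'. lev R (w, w') t) \<in> bm Q" "(%w'. lik R (c1 w) (c2 w') t) \<in> bm Q"
proof -
 have m: "(%w'. (w, w')) \<in> measurable Q QQ" using assms(1) by simp
 show "(%w'. lev R (w, w') t) \<in> bm Q" by (rule lev_meas[OF m _ assms(2)]) simp
 show "(%w'. lik R (c1 w) (c2 w') t) \<in> bm Q" using lik_meas[OF m _ assms(2), of "%_. t"] by simp
qed

lemma AE_section_pos:
 assumes "config_ok T (c1 w)"
 shows "AE w' in Q. \<forall>R t. 0 < lik R (c1 w) (c2 w') t \<and> (0 <= t \<longrightarrow> lmin <= lev R (w, w') t \<and> 0 < lev R (w, w') t)"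
 using c2_ok by eventually_elim (use assms lik_pos intn_pos intn_ge in \<open>auto simp: lev_def\<close>)

context
 fixes w :: 'a and t :: real and R
 assumes w: "w \<in> space Q" and c: "config_ok T (c1 w)" and t: "0 <= t" and R: "is_ord R"
begin

lemma kap_map: "(%w'. if 0 < lev R (w, w') t then lev R (w, w') t else 1) \<in> measurable Q (restrict_space borel {0<..})"
proof -
 note [measurable] = section_meas(1)[OF w R]
 show ?thesis by (rule measurable_restrict_space2) auto
qed

lemma nn_integral_kap:
 assumes Ps: "Ps \<in> bm borel"
 shows "nni (kap R t w) (%x. Ps x) = nni Q (%w'. ennreal (lik R (c1 w) (c2 w') t) * Ps (lev R (w, w') t))"
proof -
 let ?l = "%w'. if 0 < lev R (w, w') t then lev R (w, w') t else 1"
 note [measurable] = section_meas[OF w R]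
 have Ps': "Ps \<in> bm (restrict_space borel {0<..})" by (rule measurable_restrict_space1[OF Ps])
 have "nni (kap R t w) (%x. Ps x) = nni (density Q (%w'. ennreal (lik R (c1 w) (c2 w') t))) (%w'. Ps (?l w'))"
  unfolding kap_def using Ps' kap_map by (intro nn_integral_distr) auto
 also have "... = nni Q (%w'. ennreal (lik R (c1 w) (c2 w') t) * Ps (?l w'))"
  using measurable_compose[OF kap_map Ps'] by (intro nn_integral_density) auto
 also have "... = nni Q (%w'. ennreal (lik R (c1 w) (c2 w') t) * Ps (lev R (w, w') t))"
  by (rule nn_integral_cong_AE, use AE_section_pos[OF c] in eventually_elim) (use t in auto)
 finally show ?thesis .
qed

lemma integral_kap:
 fixes h :: "real => real"
 assumes h: "h \<in> bm borel"
 shows "integrable (kap R t w) h \<longleftrightarrow> integrable Q (%w'. lik R (c1 w) (c2 w') t * h (lev R (w, w') t))"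
  and "lint (kap R t w) (%x. h x) = lint Q (%w'. lik R (c1 w) (c2 w') t * h (lev R (w, w') t))"
proof -
 let ?l = "%w'. if 0 < lev R (w, w') t then lev R (w, w') t else 1"
 note [measurable] = section_meas[OF w R] h
 have h': "h \<in> bm (restrict_space borel {0<..})" by (rule measurable_restrict_space1[OF h])
 have m: "?l \<in> measurable (density Q (%w'. ennreal (lik R (c1 w) (c2 w') t))) (restrict_space borel {0<..})"
  using kap_map by simp
 have hm: "(%w'. h (?l w')) \<in> bm Q" by (rule measurable_compose[OF kap_map h'])
 have nn: "AE w' in Q. 0 <= lik R (c1 w) (c2 w') t" using AE_section_pos[OF c] by eventually_elim (auto intro: less_imp_le)
 have ae: "AE w' in Q. lik R (c1 w) (c2 w') t *\<^sub>R h (?l w') = lik R (c1 w) (c2 w') t * h (lev R (w, w') t)"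
  using AE_section_pos[OF c] by eventually_elim (use t in auto)
 have "integrable (kap R t w) h \<longleftrightarrow> integrable (density Q (%w'. ennreal (lik R (c1 w) (c2 w') t))) (%w'. h (?l w'))"
  unfolding kap_def by (rule integrable_distr_eq[OF m h'])
 also have "... \<longleftrightarrow> integrable Q (%w'. lik R (c1 w) (c2 w') t *\<^sub>R h (?l w'))"
  by (rule integrable_density[OF hm _ nn]) measurable
 also have "... \<longleftrightarrow> integrable Q (%w'. lik R (c1 w) (c2 w') t * h (lev R (w, w') t))"
  using hm ae by (intro integrable_cong_AE) measurable
 finally show "integrable (kap R t w) h \<longleftrightarrow> integrable Q (%w'. lik R (c1 w) (c2 w') t * h (lev R (w, w') t))" .
 have "lint (kap R t w) (%x. h x) = lint (density Q (%w'. ennreal (lik R (c1 w) (c2 w') t))) (%w'. h (?l w'))"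
  unfolding kap_def by (rule integral_distr[OF m h'])
 also have "... = lint Q (%w'. lik R (c1 w) (c2 w') t *\<^sub>R h (?l w'))"
  by (rule integral_density[OF hm _ nn]) measurable
 also have "... = lint Q (%w'. lik R (c1 w) (c2 w') t * h (lev R (w, w') t))"
  using hm ae by (intro integral_cong_AE) measurable
 finally show "lint (kap R t w) (%x. h x) = lint Q (%w'. lik R (c1 w) (c2 w') t * h (lev R (w, w') t))" .
qed

end

lemma regularD:
 assumes "regular f f' w"
 shows "w \<in> space Q" "config_ok T (c1 w)"
 using assms by (auto simp: regular_def)

text \<open>One integrable majorant for all times. The bound for left limits follows from the one
  for the right-continuous path by letting the time increase to \<open>t\<close>.\<close>

lemma regular_dom:
 assumes reg: "regular f f' w" and adm: "admissible f f'"
 obtains v where "integrable Q v"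
  "AE w' in Q. \<forall>t\<in>{0..T}. Lk t (w, w') * gr f (lev (<=) (w, w') t) <= v w'"
  "AE w' in Q. \<forall>t\<in>{0<..T}. Lm t (w, w') * gr f (lev (<) (w, w') t) <= v w'"
proof -
 from reg obtain W where W: "W \<in> bm Q" "nni Q (%w'. W w') < \<top>"
  "AE w' in Q. \<forall>t\<in>{0..T}. ennreal (Lk t (w, w') * gr f (lev (<=) (w, w') t)) <= W w'"
  by (auto simp: regular_def)
 have fin: "AE w' in Q. W w' \<noteq> \<infinity>" using W(1,2) by (intro nn_integral_PInf_AE) auto
 define v where "v w' = enn2real (W w')" for w'
 have iv: "integrable Q v"
 proof (rule integrableI_nonneg)
  have "nni Q (%w'. ennreal (v w')) = nni Q (%w'. W w')"
   by (rule nn_integral_cong_AE, use fin in eventually_elim) (simp add: v_def less_top)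
  then show "nni Q (%w'. ennreal (v w')) < \<infinity>" using W(2) by simp
 qed (use W(1) in \<open>auto simp: v_def[abs_def]\<close>)
 have b: "AE w' in Q. \<forall>t\<in>{0..T}. Lk t (w, w') * gr f (lev (<=) (w, w') t) <= v w'"
  using W(3) fin
 proof eventually_elim
  case (elim w')
  show ?case
  proof
   fix t assume "t \<in> {0..T}"
   then have "ennreal (Lk t (w, w') * gr f (lev (<=) (w, w') t)) <= ennreal (v w')"
    using elim by (simp add: v_def less_top)
   then show "Lk t (w, w') * gr f (lev (<=) (w, w') t) <= v w'"
    by (simp add: ennreal_le_iff v_def)
  qed
 qed
 have gc: "continuous_on {0<..} (gr f)"
  using C1pos_gr[of f f'] adm unfolding admissible_def C1pos_def
  by (auto intro!: continuous_at_imp_continuous_on DERIV_isCont)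
 have "AE w' in Q. \<forall>t\<in>{0<..T}. Lm t (w, w') * gr f (lev (<) (w, w') t) <= v w'"
  using b AE_section_pos[OF regularD(2)[OF reg]]
 proof eventually_elim
  case (elim w')
  show ?case
  proof
   fix t assume t: "t \<in> {0<..T}"
   have "isCont (gr f) (lev (<) (w, w') t)"
    using gc elim(2) t by (auto simp: continuous_on_eq_continuous_at)
   then have "((%s. Lk s (w, w') * gr f (lev (<=) (w, w') s)) \<longlongrightarrow> Lm t (w, w') * gr f (lev (<) (w, w') t)) (at_left t)"
    unfolding lev_def by (intro tendsto_mult isCont_tendsto_compose[of _ "gr f"] lik_left intn_left) auto
   moreover have "\<forall>\<^sub>F s in at_left t. Lk s (w, w') * gr f (lev (<=) (w, w') s) <= v w'"
    using eventually_at_left_real[of 0 t] t by (auto elim!: eventually_mono intro!: elim(1)[simplified, rule_format])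
   ultimately show "Lm t (w, w') * gr f (lev (<) (w, w') t) <= v w'"
    by (rule tendsto_upperbound) simp
  qed
 qed
 with iv b show thesis by (rule that)
qed

lemma admissible_zero: "admissible (%_. 0) (%_. 0)"
 by (simp add: admissible_def C1pos_def)

abbreviation regular0 :: "'a => bool" where "regular0 \<equiv> regular (%_. 0) (%_. 0)"

lemma gr_zero [simp]: "gr (%_. 0) = (%_. 1)"
 by (simp add: gr_def fun_eq_iff)

lemma bounded_continuous_borel:
 fixes h :: "real => real"
 assumes h: "continuous_on {0<..} h" and b: "bounded (h ` {0<..})"
 obtains k B where "k \<in> bm borel" "\<And>x. 0 < x ==> k x = h x" "\<And>x. \<bar>k x\<bar> <= B" "\<And>x. 0 < x ==> isCont k x"
proof -
 obtain B where B: "\<And>x. 0 < x ==> \<bar>h x\<bar> <= B" using b unfolding bounded_iff by auto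
 define k where "k x = (if 0 < x then h x else 0)" for x
 have "(%x. indicator {0<..} x *\<^sub>R h x) \<in> bm borel"
  by (rule borel_measurable_continuous_on_indicator[OF _ h]) simp
 also have "(%x. indicator {0<..} x *\<^sub>R h x) = k" by (auto simp: k_def indicator_def)
 finally have m: "k \<in> bm borel" .
 have "0 <= B" using B[of 1] by linarith
 then have bk: "\<bar>k x\<bar> <= B" for x using B[of x] by (simp add: k_def)
 have "continuous_on {0<..} k" using h by (rule continuous_on_eq) (simp add: k_def)
 then have "isCont k x" if "0 < x" for x using that by (auto simp: continuous_on_eq_continuous_at)
 with m bk show thesis by (intro that[of k B]) (auto simp: k_def)
qed

context
 fixes w :: 'a
 assumes reg0: "regular0 w"
begin

lemma fin_meas_kap:
 assumes "t \<in> {0..T}" "is_ord R" "R = (<) ==> 0 < t"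
 shows "fin_meas (kap R t w)"
proof -
 obtain v where v: "integrable Q v"
  "AE w' in Q. \<forall>t\<in>{0..T}. Lk t (w, w') * gr (%_. 0) (lev (<=) (w, w') t) <= v w'"
  "AE w' in Q. \<forall>t\<in>{0<..T}. Lm t (w, w') * gr (%_. 0) (lev (<) (w, w') t) <= v w'"
  using regular_dom[OF reg0 admissible_zero] .
 note w = regularD[OF reg0]
 have le: "AE w' in Q. lik R (c1 w) (c2 w') t <= v w'"
  using assms(2) v(2,3) unfolding is_ord_def
  by (elim disjE; elim AE_mp; intro AE_I2) (use assms in auto)
 have "emeasure (kap R t w) (space (kap R t w)) = nni (kap R t w) (%x. 1)" by simp
 also have "... = nni Q (%w'. ennreal (lik R (c1 w) (c2 w') t))"
  by (subst nn_integral_kap[OF w]) (use assms in auto)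
 also have "... <= nni Q (%w'. ennreal (norm (v w')))"
  by (rule nn_integral_mono_AE, use le in eventually_elim) (auto intro!: ennreal_leI)
 also have "... < \<infinity>" using v(1) by (simp add: integrable_iff_bounded)
 finally show ?thesis unfolding fin_meas_def by (intro conjI finite_measureI) auto
qed

text \<open>The paths converge for each fixed second scenario, and the majorant uniform in time
  allows dominated convergence.\<close>

lemma kap_weak:
 shows "t \<in> {0..<T} ==> weakly_tendsto (%s. kap (<=) s w) (kap (<=) t w) (at_right t)"
  and "t \<in> {0<..T} ==> weakly_tendsto (%s. kap (<=) s w) (kap (<) t w) (at_left t)"
proof -
 obtain v where v: "integrable Q v"
  "AE w' in Q. \<forall>t\<in>{0..T}. Lk t (w, w') * gr (%_. 0) (lev (<=) (w, w') t) <= v w'"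
  using regular_dom[OF reg0 admissible_zero] .
 note w = regularD[OF reg0]
 have main: "(%n. lint (kap (<=) (X n) w) (%x. h x)) \<longlonglongrightarrow> lint (kap R t w) (%x. h x)"
  if h: "continuous_on {0<..} h" "bounded (h ` {0<..})" and X: "\<And>n. X n \<in> {0..T}" and t: "0 <= t" and R: "is_ord R"
   and lim: "\<And>w'. (%n. lev (<=) (w, w') (X n)) \<longlonglongrightarrow> lev R (w, w') t"
    "\<And>w'. (%n. Lk (X n) (w, w')) \<longlonglongrightarrow> lik R (c1 w) (c2 w') t"
  for h :: "real => real" and X t R
 proof -
  obtain k B where k: "k \<in> bm borel" "\<And>x. 0 < x ==> k x = h x" "\<And>x. \<bar>k x\<bar> <= B" "\<And>x. 0 < x ==> isCont k x"
   using bounded_continuous_borel[OF h] by metis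
  have e: "lint (kap R' s w) (%x. h x) = lint Q (%w'. lik R' (c1 w) (c2 w') s * k (lev R' (w, w') s))" if "0 <= s" "is_ord R'" for R' s
  proof -
   have "lint (kap R' s w) (%x. h x) = lint (kap R' s w) (%x. k x)"
    by (intro Bochner_Integration.integral_cong refl) (simp add: k(2))
   then show ?thesis by (simp add: integral_kap(2)[OF w that k(1)])
  qed
  have "(%n. lint Q (%w'. Lk (X n) (w, w') * k (lev (<=) (w, w') (X n)))) \<longlonglongrightarrow> lint Q (%w'. lik R (c1 w) (c2 w') t * k (lev R (w, w') t))"
  proof (rule integral_dominated_convergence[where w="%w'. B * v w'"])
   note [measurable] = section_meas[OF w(1) R] section_meas[OF w(1) is_ord(2)] k(1)
   show "(%w'. lik R (c1 w) (c2 w') t * k (lev R (w, w') t)) \<in> bm Q" by measurable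
   show "(%w'. Lk (X n) (w, w') * k (lev (<=) (w, w') (X n))) \<in> bm Q" for n
    unfolding fst_conv snd_conv by measurable
   show "integrable Q (%w'. B * v w')" using v(1) by simp
   show "AE w' in Q. (%n. Lk (X n) (w, w') * k (lev (<=) (w, w') (X n))) \<longlonglongrightarrow> lik R (c1 w) (c2 w') t * k (lev R (w, w') t)"
    using AE_section_pos[OF w(2)]
    by eventually_elim (use t in \<open>auto intro!: tendsto_mult lim[simplified] isCont_tendsto_compose[of _ k] k(4)\<close>)
   show "AE w' in Q. norm (Lk (X n) (w, w') * k (lev (<=) (w, w') (X n))) <= B * v w'" for n
    using v(2) AE_section_pos[OF w(2)]
   proof eventually_elim
    case (elim w')
    have l: "0 <= Lk (X n) (w, w')" using elim(2) by (simp add: less_imp_le)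
    have "Lk (X n) (w, w') <= v w'" using elim(1) X[of n] by simp
    then have "\<bar>k (lev (<=) (w, w') (X n))\<bar> * Lk (X n) (w, w') <= B * v w'"
     using l k(3) by (intro mult_mono) (auto intro: order_trans[OF abs_ge_zero])
    then show ?case using l by (simp add: abs_mult mult.commute)
   qed
  qed
  then show ?thesis using X by (subst e[OF t R], subst e) auto
 qed
 show "weakly_tendsto (%s. kap (<=) s w) (kap (<=) t w) (at_right t)" if t: "t \<in> {0..<T}"
  unfolding weakly_tendsto_def
 proof (intro allI impI)
  fix h :: "real => real" assume h: "continuous_on {0<..} h" "bounded (h ` {0<..})"
  show "((%s. lint (kap (<=) s w) (%x. h x)) \<longlongrightarrow> lint (kap (<=) t w) (%x. h x)) (at_right t)"
  proof (rule tendsto_at_right_sequentially[where b=T])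
   fix X assume X: "\<And>n. t < X n" "\<And>n. X n < T" "X \<longlonglongrightarrow> t"
   have r: "filterlim X (at_right t) sequentially"
    using X by (auto simp: filterlim_at intro!: always_eventually dest: less_imp_neq)
   have XT: "X n \<in> {0..T}" for n using X(1,2)[of n] t by auto
   show "(%n. lint (kap (<=) (X n) w) (%x. h x)) \<longlonglongrightarrow> lint (kap (<=) t w) (%x. h x)"
    using t filterlim_compose[OF intn_right r] filterlim_compose[OF lik_right r]
    by (intro main[OF h XT]) (auto simp: lev_def)
  qed (use t in auto)
 qed
 show "weakly_tendsto (%s. kap (<=) s w) (kap (<) t w) (at_left t)" if t: "t \<in> {0<..T}"
  unfolding weakly_tendsto_def
 proof (intro allI impI)
  fix h :: "real => real" assume h: "continuous_on {0<..} h" "bounded (h ` {0<..})"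
  show "((%s. lint (kap (<=) s w) (%x. h x)) \<longlongrightarrow> lint (kap (<) t w) (%x. h x)) (at_left t)"
  proof (rule tendsto_at_left_sequentially[where b=0])
   fix X assume X: "\<And>n. X n < t" "\<And>n. 0 < X n" "X \<longlonglongrightarrow> t"
   have r: "filterlim X (at_left t) sequentially"
    using X by (auto simp: filterlim_at intro!: always_eventually dest: less_imp_neq)
   have XT: "X n \<in> {0..T}" for n using X(1,2)[of n] t by auto
   show "(%n. lint (kap (<=) (X n) w) (%x. h x)) \<longlonglongrightarrow> lint (kap (<) t w) (%x. h x)"
    using t filterlim_compose[OF intn_left r] filterlim_compose[OF lik_left r]
    by (intro main[OF h XT]) (auto simp: lev_def)
  qed (use t in auto)
 qed
qed

lemma left_lim_kap:
 assumes t: "t \<in> {0<..T}" and eq: "\<And>s. s \<in> {0..T} ==> mu s = kap (<=) s w"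
 shows "left_lim mu t = kap (<) t w"
proof (rule left_lim_eqI)
 show "fin_meas (kap (<) t w)" using t by (intro fin_meas_kap) auto
 have ev: "\<forall>\<^sub>F s in at_left t. kap (<=) s w = mu s"
  using eventually_at_left_real[of 0 t] t by (auto elim!: eventually_mono simp: eq)
 show "weakly_tendsto mu (kap (<) t w) (at_left t)"
  unfolding weakly_tendsto_def
 proof (intro allI impI)
  fix h :: "real => real" assume h: "continuous_on {0<..} h" "bounded (h ` {0<..})"
  have "((%s. lint (kap (<=) s w) (%x. h x)) \<longlongrightarrow> lint (kap (<) t w) (%x. h x)) (at_left t)"
   using kap_weak(2)[OF t] h unfolding weakly_tendsto_def by blast
  then show "((%s. lint (mu s) (%x. h x)) \<longlongrightarrow> lint (kap (<) t w) (%x. h x)) (at_left t)"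
   by (rule Lim_transform_eventually) (use ev in \<open>auto elim: eventually_mono\<close>)
 qed
qed

text \<open>At a fixed time without an observed jump only the second process could jump, and almost
  surely it does not.\<close>

lemma kap_off_jumps:
 assumes r: "0 < r" "r <= T" "r \<notin> times (c1 w)"
 shows "kap (<=) r w = kap (<) r w"
proof -
 note w = regularD[OF reg0]
 have ae: "AE w' in Q. lev (<=) (w, w') r = lev (<) (w, w') r \<and> Lk r (w, w') = Lm r (w, w')"
  using M2.AE_no_jump[OF r(1,2)]
  by eventually_elim (use r(3) in \<open>simp add: lev_def intn_lik_off c2_def M2.times_cfg\<close>)
 show ?thesis
 proof (rule measure_eqI)
  fix A assume "A \<in> sets (kap (<=) r w)"
  then have A: "A \<in> sets borel" "A \<in> sets (restrict_space borel {0<..})" by (auto simp: sets_restrict_space_iff)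
  have "emeasure (kap R r w) A = nni Q (%w'. ennreal (lik R (c1 w) (c2 w') r) * indicator A (lev R (w, w') r))" if "is_ord R" for R
   using nn_integral_kap[OF w less_imp_le[OF r(1)] that, of "indicator A"] A by simp
  then show "emeasure (kap (<=) r w) A = emeasure (kap (<) r w) A"
   using ae by (simp, intro nn_integral_cong_AE) (auto elim: eventually_mono)
 qed simp
qed

end

end

lemma LINT_Icc_Ioc: "(LINT r:{a::real..b}|lborel. q r) = (LINT r:{a<..b}|lborel. (q r :: real))"
 unfolding set_lebesgue_integral_def
 by (rule integral_discrete_difference[where X="{a}"]) (auto simp: indicator_def less_eq_real_def)

context jump_cluster_model
begin

definition dl1 :: "(real => real) => real => real" where "dl1 f x = lint F1 (%z. (f (x + ell' z) - f x) * x)"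
definition dl2 :: "(real => real) => real => real" where "dl2 f x = lint F2 (%z. f (x + z) - f x)"

abbreviation LQ :: "(real \<times> 'a) measure" where "LQ \<equiv> lborel >< Q"

definition Em :: "(real => real) => 'a => real => real" where
 "Em h w r = lint Q (%w'. Lm r (w, w') * h (lev (<) (w, w') r))"

definition Fm :: "(real => real) => 'a => real => real \<times> 'a => real" where
 "Fm h w t q = indicator {0<..t} (fst q) * (Lm (fst q) (w, snd q) * h (lev (<) (w, snd q) (fst q)))"

context
 fixes f f' :: "real => real" and w :: 'a
 assumes adm: "admissible f f'" and reg: "regular f f' w"
begin

lemmas wS = regularD(1)[OF reg] and cS = regularD(2)[OF reg]
lemmas fm [measurable] = f_meas[OF adm]
lemmas dm [measurable] = dom_fn_meas[OF adm]

lemma pair_meas: "q \<in> measurable M Q ==> (%x. (w, q x)) \<in> measurable M QQ"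
 using wS by (intro measurable_Pair) auto

lemma Lm_meas:
 assumes "q \<in> measurable M Q" "r \<in> bm M"
 shows "(%x. lik (<) (c1 w) (c2 (q x)) (r x)) \<in> bm M" "(%x. lev (<) (w, q x) (r x)) \<in> bm M"
 using lik_meas[OF pair_meas[OF assms(1)] assms(2), of "(<)"] lev_meas[OF pair_meas[OF assms(1)] assms(2), of "(<)"] by auto

lemma LQ_meas [measurable]:
 "(%q. lik (<) (c1 w) (c2 (snd q)) (fst q)) \<in> bm LQ" "(%q. lev (<) (w, snd q) (fst q)) \<in> bm LQ"
 using Lm_meas[OF measurable_snd, of fst lborel] measurable_fst[of lborel Q] by auto

lemma Fm_meas: "h \<in> bm borel ==> Fm h w t \<in> bm LQ"
proof -
 assume [measurable]: "h \<in> bm borel"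
 have [measurable]: "fst \<in> bm LQ" using measurable_fst[of lborel Q] by simp
 show ?thesis unfolding Fm_def[abs_def] fst_conv snd_conv by measurable
qed

lemma dom_product: "nni LQ (%q. indicator {0<..T} (fst q) * (ennreal (Lm (fst q) (w, snd q)) * dom_fn f f' (lev (<) (w, snd q) (fst q)))) < \<top>"
proof -
 interpret PL: pair_sigma_finite lborel Q ..
 have [measurable]: "fst \<in> bm LQ" using measurable_fst[of lborel Q] by simp
 have "(%q. indicator {0<..T} (fst q) * (ennreal (Lm (fst q) (w, snd q)) * dom_fn f f' (lev (<) (w, snd q) (fst q)))) \<in> bm LQ"
  unfolding fst_conv snd_conv by measurable
 from PL.nn_integral_snd[OF this] show ?thesis using reg by (simp add: regular_def)
qed

lemma AE_LQ_pos: "AE q in LQ. \<forall>R. 0 < lik R (c1 w) (c2 (snd q)) (fst q) \<and> (0 <= fst q \<longrightarrow> lmin <= lev R (w, snd q) (fst q))"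
proof -
 interpret PL: pair_sigma_finite lborel Q ..
 have "AE w' in Q. \<forall>R r. 0 < lik R (c1 w) (c2 w') r \<and> (0 <= r \<longrightarrow> lmin <= lev R (w, w') r)"
  using AE_section_pos[OF cS] by eventually_elim auto
 then obtain N where N: "N \<in> null_sets Q" "{w'\<in>space Q. \<not> (\<forall>R r. 0 < lik R (c1 w) (c2 w') r \<and> (0 <= r \<longrightarrow> lmin <= lev R (w, w') r))} \<subseteq> N"
  by (auto simp: eventually_ae_filter)
 have "UNIV \<times> N \<in> null_sets LQ"
 proof (rule null_setsI)
  have "emeasure LQ (UNIV \<times> N) = emeasure lborel (UNIV::real set) * emeasure Q N"
   by (rule emeasure_pair_measure_Times) (use N in auto)
  then show "emeasure LQ (UNIV \<times> N) = 0" using N by auto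
 qed (use N in auto)
 then show ?thesis
 proof (rule AE_I')
  show "{q \<in> space LQ. \<not> (\<forall>R. 0 < lik R (c1 w) (c2 (snd q)) (fst q) \<and> (0 <= fst q \<longrightarrow> lmin <= lev R (w, snd q) (fst q)))} \<subseteq> UNIV \<times> N"
  proof
   fix q assume "q \<in> {q \<in> space LQ. \<not> (\<forall>R. 0 < lik R (c1 w) (c2 (snd q)) (fst q) \<and> (0 <= fst q \<longrightarrow> lmin <= lev R (w, snd q) (fst q)))}"
   then have "snd q \<in> {w'\<in>space Q. \<not> (\<forall>R r. 0 < lik R (c1 w) (c2 w') r \<and> (0 <= r \<longrightarrow> lmin <= lev R (w, w') r))}"
    by (auto simp: space_pair_measure)
   then show "q \<in> UNIV \<times> N" using N(2) by (auto simp: mem_Times_iff)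
  qed
 qed
qed

lemma AE_dom: "AE q in LQ. 0 < fst q \<longrightarrow> fst q <= T \<longrightarrow> dom_fn f f' (lev (<) (w, snd q) (fst q)) < \<top>"
proof -
 have [measurable]: "fst \<in> bm LQ" using measurable_fst[of lborel Q] by simp
 have "AE q in LQ. indicator {0<..T} (fst q) * (ennreal (Lm (fst q) (w, snd q)) * dom_fn f f' (lev (<) (w, snd q) (fst q))) \<noteq> \<infinity>"
 proof (rule nn_integral_PInf_AE)
  show "(%q. indicator {0<..T} (fst q) * (ennreal (Lm (fst q) (w, snd q)) * dom_fn f f' (lev (<) (w, snd q) (fst q)))) \<in> bm LQ"
   unfolding fst_conv snd_conv by measurable
 qed (use dom_product in simp)
 then show ?thesis using AE_LQ_pos
 proof eventually_elim
  case (elim q)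
  show ?case
  proof (intro impI)
   assume "0 < fst q" "fst q <= T"
   then have "ennreal (Lm (fst q) (w, snd q)) * dom_fn f f' (lev (<) (w, snd q) (fst q)) \<noteq> \<top>" using elim(1) by simp
   moreover have "ennreal (Lm (fst q) (w, snd q)) \<noteq> 0" using elim(2)[rule_format, of "(<)"] by simp
   ultimately show "dom_fn f f' (lev (<) (w, snd q) (fst q)) < \<top>"
    by (auto simp: ennreal_mult_eq_top_iff less_top)
  qed
 qed
qed

definition dominated :: "(real => real) => bool" where
 "dominated h \<longleftrightarrow> h \<in> bm borel \<and> (\<exists>B\<ge>0. \<forall>x\<ge>lmin. ennreal \<bar>h x\<bar> <= ennreal B * dom_fn f f' x)"

lemma Fm_integrable:
 assumes h: "dominated h" and t: "t <= T"
 shows "integrable LQ (Fm h w t)"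
proof (rule integrableI_bounded)
 obtain B where B: "0 <= B" "\<And>x. lmin <= x ==> ennreal \<bar>h x\<bar> <= ennreal B * dom_fn f f' x" and hm: "h \<in> bm borel"
  using h by (auto simp: dominated_def)
 show "Fm h w t \<in> bm LQ" by (rule Fm_meas[OF hm])
 have [measurable]: "fst \<in> bm LQ" using measurable_fst[of lborel Q] by simp
 let ?d = "%q. indicator {0<..T} (fst q) * (ennreal (Lm (fst q) (w, snd q)) * dom_fn f f' (lev (<) (w, snd q) (fst q)))"
 have "nni LQ (%q. ennreal (norm (Fm h w t q))) <= nni LQ (%q. ennreal B * ?d q)"
 proof (rule nn_integral_mono_AE, use AE_LQ_pos in eventually_elim)
  fix q :: "real \<times> 'a"
  assume E: "\<forall>R. 0 < lik R (c1 w) (c2 (snd q)) (fst q) \<and> (0 <= fst q \<longrightarrow> lmin <= lev R (w, snd q) (fst q))"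
  show "ennreal (norm (Fm h w t q)) <= ennreal B * ?d q"
  proof (cases "fst q \<in> {0<..t}")
   case True
   let ?l = "lev (<) (w, snd q) (fst q)"
   have l: "0 < Lm (fst q) (w, snd q)" using E by simp
   have "ennreal (norm (Fm h w t q)) = ennreal (Lm (fst q) (w, snd q)) * ennreal \<bar>h ?l\<bar>"
    using True l by (simp add: Fm_def abs_mult ennreal_mult)
   also have "... <= ennreal (Lm (fst q) (w, snd q)) * (ennreal B * dom_fn f f' ?l)"
    using B(2)[of ?l] E True by (intro mult_left_mono) auto
   also have "... = ennreal B * ?d q" using True t by (simp add: mult_ac)
   finally show ?thesis .
  qed (simp add: Fm_def)
 qed
 also have "... = ennreal B * nni LQ (%q. ?d q)"
  unfolding fst_conv snd_conv by (rule nn_integral_cmult) measurable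
 also have "... < \<infinity>" using dom_product by (simp add: ennreal_mult_less_top)
 finally show "nni LQ (%q. ennreal (norm (Fm h w t q))) < \<infinity>" .
qed

lemma Fm_fubini:
 assumes h: "dominated h" and t: "t <= T"
 shows "lint LQ (%q. Fm h w t q) = (LINT r:{0<..t}|lborel. Em h w r)"
  and "lint LQ (%q. Fm h w t q) = lint Q (%w'. (LINT r:{0<..t}|lborel. Lm r (w, w') * h (lev (<) (w, w') r)))"
  and "integrable Q (%w'. LINT r:{0<..t}|lborel. Lm r (w, w') * h (lev (<) (w, w') r))"
  and "set_integrable lborel {0<..t} (Em h w)"
  and "AE r in lborel. 0 < r \<longrightarrow> r <= t \<longrightarrow> integrable Q (%w'. Lm r (w, w') * h (lev (<) (w, w') r))"
proof -
 interpret PL: pair_sigma_finite lborel Q ..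
 note i = Fm_integrable[OF h t]
 have i': "integrable LQ (%(r, w'). Fm h w t (r, w'))" using i by (simp add: case_prod_beta')
 have e1: "lint Q (%w'. Fm h w t (r, w')) = indicator {0<..t} r *\<^sub>R Em h w r" for r
  by (simp add: Fm_def Em_def)
 have e2: "lint lborel (%r. Fm h w t (r, w')) = (LINT r:{0<..t}|lborel. Lm r (w, w') * h (lev (<) (w, w') r))" for w'
  by (simp add: Fm_def set_lebesgue_integral_def)
 show "lint LQ (%q. Fm h w t q) = (LINT r:{0<..t}|lborel. Em h w r)"
  using PL.integral_fst'[OF i] unfolding e1 by (simp add: set_lebesgue_integral_def)
 show "lint LQ (%q. Fm h w t q) = lint Q (%w'. (LINT r:{0<..t}|lborel. Lm r (w, w') * h (lev (<) (w, w') r)))"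
  using PL.integral_snd[OF i'] unfolding e2 by (simp add: case_prod_beta')
 show "integrable Q (%w'. LINT r:{0<..t}|lborel. Lm r (w, w') * h (lev (<) (w, w') r))"
  using PL.integrable_snd[OF i'] unfolding e2 .
 show "set_integrable lborel {0<..t} (Em h w)"
  using PL.integrable_fst'[OF i] unfolding e1 by (simp add: set_integrable_def)
 show "AE r in lborel. 0 < r \<longrightarrow> r <= t \<longrightarrow> integrable Q (%w'. Lm r (w, w') * h (lev (<) (w, w') r))"
  using PL.AE_integrable_fst'[OF i] by eventually_elim (auto simp: Fm_def)
qed

lemma dominated_add:
 assumes "dominated h" "dominated k"
 shows "dominated (%x. h x + k x)"
proof -
 from assms obtain A B where [measurable]: "h \<in> bm borel" "k \<in> bm borel"
  and A: "0 <= A" "\<And>x. lmin <= x ==> ennreal \<bar>h x\<bar> <= ennreal A * dom_fn f f' x"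
  and B: "0 <= B" "\<And>x. lmin <= x ==> ennreal \<bar>k x\<bar> <= ennreal B * dom_fn f f' x"
  by (auto simp: dominated_def)
 have "ennreal \<bar>h x + k x\<bar> <= ennreal (A + B) * dom_fn f f' x" if "lmin <= x" for x
 proof -
  have "ennreal \<bar>h x + k x\<bar> <= ennreal (\<bar>h x\<bar> + \<bar>k x\<bar>)" by (intro ennreal_leI) simp
  also have "... = ennreal \<bar>h x\<bar> + ennreal \<bar>k x\<bar>" by (rule ennreal_plus) auto
  also have "... <= ennreal A * dom_fn f f' x + ennreal B * dom_fn f f' x" by (intro add_mono A B that)
  also have "... = ennreal (A + B) * dom_fn f f' x" using A B by (simp add: ennreal_plus distrib_right del: ennreal_plus_if)
  finally show ?thesis .
 qed
 then show ?thesis unfolding dominated_def using A B by (intro conjI exI[of _ "A + B"]) auto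
qed

lemma dominated_cmult:
 assumes "dominated h"
 shows "dominated (%x. a * h x)"
proof -
 from assms obtain A where [measurable]: "h \<in> bm borel"
  and A: "0 <= A" "\<And>x. lmin <= x ==> ennreal \<bar>h x\<bar> <= ennreal A * dom_fn f f' x"
  by (auto simp: dominated_def)
 have "ennreal \<bar>a * h x\<bar> <= ennreal (\<bar>a\<bar> * A) * dom_fn f f' x" if "lmin <= x" for x
 proof -
  have "ennreal \<bar>a * h x\<bar> = ennreal \<bar>a\<bar> * ennreal \<bar>h x\<bar>" by (simp add: abs_mult ennreal_mult)
  also have "... <= ennreal \<bar>a\<bar> * (ennreal A * dom_fn f f' x)" by (intro mult_left_mono A that) simp
  also have "... = ennreal (\<bar>a\<bar> * A) * dom_fn f f' x" using A by (simp add: ennreal_mult mult.assoc)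
  finally show ?thesis .
 qed
 then show ?thesis unfolding dominated_def using A by (intro conjI exI[of _ "\<bar>a\<bar> * A"]) auto
qed

lemma dominatedI:
 assumes "h \<in> bm borel" "0 <= B" "\<And>x. lmin <= x ==> \<bar>h x\<bar> <= B * k x"
  "\<And>x. lmin <= x ==> ennreal (k x) <= dom_fn f f' x"
 shows "dominated h"
 unfolding dominated_def
proof (intro conjI exI allI impI)
 fix x assume x: "lmin <= x"
 have "ennreal \<bar>h x\<bar> <= ennreal (B * k x)" by (intro ennreal_leI assms(3) x)
 also have "... = ennreal B * ennreal (k x)" using assms(2) by (rule ennreal_mult')
 also have "... <= ennreal B * dom_fn f f' x" by (intro mult_left_mono assms(4) x) simp
 finally show "ennreal \<bar>h x\<bar> <= ennreal B * dom_fn f f' x" .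
qed (use assms in auto)

lemma dom_fn_ge:
 "ennreal (x * gr f x) <= dom_fn f f' x" "ennreal (x * \<bar>f' x\<bar>) <= dom_fn f f' x"
 "nni F1 (%z. ennreal (\<bar>f (x + ell' z) - f x\<bar> * x)) <= dom_fn f f' x"
 "nni F2 (%z. ennreal \<bar>f (x + z) - f x\<bar>) <= dom_fn f f' x"
 "nni F1 (%z. ennreal (x * gr f (x + ell' z))) <= dom_fn f f' x"
 unfolding dom_fn_def by (simp_all add: add_increasing add_increasing2 add.assoc)

lemma dominated_basic:
 shows "dominated f" "dominated (%x. (x - 1) * f x)" "dominated (%x. x * f x)" "dominated (%x. \<alpha> * (\<beta> - x) * f' x)" "dominated one"
  "dominated (gr f)"
proof -
 have g: "dominated (%x. x * gr f x)"
  by (rule dominatedI[of _ 1 "%x. x * gr f x"]) (use dom_fn_ge(1) gr_nonneg lmin_pos in \<open>auto simp: abs_mult\<close>)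
 have x: "1 <= x / lmin" "0 < x" if "lmin <= x" for x using that lmin_pos by auto
 have a: "\<bar>f x\<bar> <= 1 / lmin * (x * gr f x)" "gr f x <= 1 / lmin * (x * gr f x)" if "lmin <= x" for x
 proof -
  have "gr f x * 1 <= gr f x * (x / lmin)" using x[OF that] gr_nonneg by (intro mult_left_mono) auto
  then show "gr f x <= 1 / lmin * (x * gr f x)" by (simp add: mult.commute)
  then show "\<bar>f x\<bar> <= 1 / lmin * (x * gr f x)" using gr_ge(2)[of f x] by linarith
 qed
 show f: "dominated f" by (rule dominatedI[of _ "1 / lmin" "%x. x * gr f x"]) (use a dom_fn_ge(1) lmin_pos in auto)
 show "dominated (gr f)"
  by (rule dominatedI[of _ "1 / lmin" "%x. x * gr f x"]) (use a dom_fn_ge(1) lmin_pos gr_nonneg in auto)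
 show "dominated one"
 proof (rule dominatedI[of _ "1 / lmin" "%x. x * gr f x"])
  fix x assume "lmin <= x" then show "\<bar>1 :: real\<bar> <= 1 / lmin * (x * gr f x)" using a(2)[of x] gr_ge(1)[of f x] by linarith
 qed (use dom_fn_ge(1) lmin_pos in auto)
 show xf: "dominated (%x. x * f x)"
 proof (rule dominatedI[of _ 1 "%x. x * gr f x"])
  fix x assume "lmin <= x" then show "\<bar>x * f x\<bar> <= 1 * (x * gr f x)"
   using lmin_pos gr_ge(2)[of f x] by (auto simp: abs_mult intro!: mult_left_mono)
 qed (use dom_fn_ge(1) in auto)
 show "dominated (%x. (x - 1) * f x)"
  using dominated_add[OF xf dominated_cmult[OF f, of "-1"]] by (simp add: algebra_simps)
 show "dominated (%x. \<alpha> * (\<beta> - x) * f' x)"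
 proof (rule dominatedI[of _ "\<alpha> * (\<beta> / lmin + 1)" "%x. x * \<bar>f' x\<bar>"])
  fix x assume xl: "lmin <= x"
  have "\<beta> <= \<beta> / lmin * x" using xl lmin_pos params_pos by (simp add: field_simps)
  then have "\<bar>\<beta> - x\<bar> <= (\<beta> / lmin + 1) * x" using xl lmin_pos params_pos by (simp add: distrib_right)
  then have "\<bar>\<beta> - x\<bar> * \<bar>f' x\<bar> <= ((\<beta> / lmin + 1) * x) * \<bar>f' x\<bar>" by (intro mult_right_mono) auto
  then have "\<alpha> * (\<bar>\<beta> - x\<bar> * \<bar>f' x\<bar>) <= \<alpha> * (((\<beta> / lmin + 1) * x) * \<bar>f' x\<bar>)"
   using params_pos by (intro mult_left_mono) auto
  then show "\<bar>\<alpha> * (\<beta> - x) * f' x\<bar> <= \<alpha> * (\<beta> / lmin + 1) * (x * \<bar>f' x\<bar>)"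
   using params_pos by (simp add: abs_mult mult.assoc)
 qed (use dom_fn_ge(2) params_pos lmin_pos in auto)
qed

lemma dl_meas [measurable]: "dl1 f \<in> bm borel" "dl2 f \<in> bm borel"
proof -
 interpret P1: prob_space F1 by (rule M1.prob_space_K)
 interpret P2: prob_space F2 by (rule M2.prob_space_K)
 have "(%(x, z). (f (x + ell' z) - f x) * x) \<in> bm (borel >< F1)" "(%(x, z). f (x + z) - f x) \<in> bm (borel >< F2)"
  by measurable
 from P1.borel_measurable_lebesgue_integral[OF this(1)] P2.borel_measurable_lebesgue_integral[OF this(2)]
 show "dl1 f \<in> bm borel" "dl2 f \<in> bm borel"
  by (simp_all add: dl1_def[abs_def] dl2_def[abs_def])
qed

lemma dominated_dl: "dominated (dl1 f)" "dominated (dl2 f)"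
proof -
 \<comment> \<open>A non-integrable function has Bochner integral 0, so the bound holds in every
   case.\<close>
 have nb: "ennreal \<bar>lint M (%z. k z)\<bar> <= nni M (%z. ennreal \<bar>k z\<bar>)" for k :: "real => real" and M
  using integral_norm_bound_ennreal[of M k] by (cases "integrable M k") (simp_all add: not_integrable_integral_eq)
 show "dominated (dl1 f)" unfolding dominated_def
 proof (intro conjI exI[of _ 1] allI impI)
  fix x assume x: "lmin <= x"
  have "ennreal \<bar>dl1 f x\<bar> <= nni F1 (%z. ennreal \<bar>(f (x + ell' z) - f x) * x\<bar>)" unfolding dl1_def by (rule nb)
  also have "... = nni F1 (%z. ennreal (\<bar>f (x + ell' z) - f x\<bar> * x))" using x lmin_pos by (simp add: abs_mult)
  finally show "ennreal \<bar>dl1 f x\<bar> <= ennreal 1 * dom_fn f f' x" using dom_fn_ge(3)[of x] by simp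
 qed auto
 show "dominated (dl2 f)" unfolding dominated_def
 proof (intro conjI exI[of _ 1] allI impI)
  fix x
  have "ennreal \<bar>dl2 f x\<bar> <= nni F2 (%z. ennreal \<bar>f (x + z) - f x\<bar>)" unfolding dl2_def by (rule nb)
  then show "ennreal \<bar>dl2 f x\<bar> <= ennreal 1 * dom_fn f f' x" using dom_fn_ge(4)[of x] by simp
 qed auto
qed

text \<open>Campbell's formula for the second process with a signed integrand, obtained from the
  positive and the negative part (\<open>k\<close> equal to 1 and -1). Both are dominated by
  \<open>dom_fn\<close>, hence integrable, and may be subtracted.\<close>

lemma compensation2:
 assumes t: "0 <= t" "t <= T"
 shows "lint Q (%w'. (\<Sum>j\<in>{j\<in>{1..num (c2 w')}. 0 < tm (c2 w') j \<and> tm (c2 w') j <= t}. Lm (tm (c2 w') j) (w, w') *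
   (f (lev (<) (w, w') (tm (c2 w') j) + mk (c2 w') j) - f (lev (<) (w, w') (tm (c2 w') j)))))
  = \<rho> * lint LQ (%q. Fm (dl2 f) w t q)"
proof -
 interpret PL: pair_sigma_finite lborel Q ..
 have ts: "(0::real) <= 0" "0 <= t" "t <= T" using t by auto
 \<comment> \<open>With this level and without damping the weight reduces to the plain
   likelihood.\<close>
 let ?n = "Suc (N1 T w)"
 have wg: "wgt one 0 t 0 ?n (w, w') r = indicator {0<..t} r * Lm r (w, w')" for w' r
  using card_idx_less[OF adm, of "(<)" w r] by (simp add: wgt_def wt_def)
 define b where "b k x = nni F2 (%z. ennreal (max 0 (k * (f (x + z) - f x))))" for k x :: real
 define S where "S k w' = (\<Sum>j=1..num (c2 w'). indicator {0<..t} (tm (c2 w') j) * Lm (tm (c2 w') j) (w, w') *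
   max 0 (k * (f (lev (<) (w, w') (tm (c2 w') j) + mk (c2 w') j) - f (lev (<) (w, w') (tm (c2 w') j)))))" for k :: real and w'
 define d where "d k x = enn2real (b k x)" for k x
 have bm [measurable]: "b k \<in> bm borel" for k
  unfolding b_def[abs_def] using kernel_meas(2)[OF ts, of "%_. 1" "%(x, z). ennreal (max 0 (k * (f (x + z) - f x)))"] by simp
 have bk: "b k x <= dom_fn f f' x" if "k \<in> {1, -1}" for k x
  unfolding b_def using that by (intro order_trans[OF nn_integral_mono dom_fn_ge(4)] ennreal_leI) auto
 have dd: "dominated (d k)" if "k \<in> {1, -1}" for k
  unfolding dominated_def
 proof (intro conjI exI[of _ 1] allI impI)
  show "d k \<in> bm borel" unfolding d_def[abs_def] by measurable
  fix x
  have "ennreal \<bar>d k x\<bar> <= b k x" unfolding d_def by (cases "b k x") auto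
  then show "ennreal \<bar>d k x\<bar> <= ennreal 1 * dom_fn f f' x" using bk[OF that, of x] by simp
 qed auto
 have S: "integrable Q (S k) \<and> lint Q (%w'. S k w') = \<rho> * lint LQ (%q. Fm (d k) w t q)" if k: "k \<in> {1, -1}" for k
 proof -
  have Sm: "S2 one 0 t 0 ?n (%(x, z). ennreal (max 0 (k * (f (x + z) - f x)))) \<in> bm QQ"
   by (rule S2_meas[OF ts]) measurable
  have sS: "AE w' in Q. S2 one 0 t 0 ?n (%(x, z). ennreal (max 0 (k * (f (x + z) - f x)))) (w, w') = ennreal (S k w')"
   using AE_section_pos[OF cS]
  proof eventually_elim
   case (elim w')
   have l: "0 <= Lm r (w, w')" for r using elim by (simp add: less_imp_le)
   have "S2 one 0 t 0 ?n (%(x, z). ennreal (max 0 (k * (f (x + z) - f x)))) (w, w') =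
    (\<Sum>j=1..num (c2 w'). ennreal (indicator {0<..t} (tm (c2 w') j) * Lm (tm (c2 w') j) (w, w') *
     max 0 (k * (f (lev (<) (w, w') (tm (c2 w') j) + mk (c2 w') j) - f (lev (<) (w, w') (tm (c2 w') j))))))"
    unfolding S2_def wg prod.case snd_conv by (intro sum.cong refl ennreal_mult[symmetric]) (use l in auto)
   also have "... = ennreal (S k w')"
    unfolding S_def by (rule sum_ennreal) (use l in \<open>auto intro!: mult_nonneg_nonneg\<close>)
   finally show ?case .
  qed
  have Snn: "AE w' in Q. 0 <= S k w'"
   using AE_section_pos[OF cS] by eventually_elim (auto simp: S_def less_imp_le intro!: sum_nonneg mult_nonneg_nonneg)
  have m: "S k \<in> bm Q"
  proof -
   have c: "cfg_meas Q c2" using c2_meas[of "%x. x" Q] by simp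
   have tmj: "(%x. tm (c2 x) j) \<in> bm Q" and [measurable]: "(%x. mk (c2 x) j) \<in> bm Q" for j
    using c by (auto simp: cfg_meas_def)
   note [measurable] = tmj Lm_meas[OF measurable_ident_sets[OF refl] tmj]
   show ?thesis unfolding S_def[abs_def] fst_conv snd_conv by (rule cfg_meas_sum[OF c]) measurable
  qed
  have "nni Q (%w'. ennreal (S k w')) = nni Q (%w'. S2 one 0 t 0 ?n (%(x, z). ennreal (max 0 (k * (f (x + z) - f x)))) (w, w'))"
   by (rule nn_integral_cong_AE, use sS in eventually_elim) simp
  also have "... = ennreal \<rho> * nni Q (%w'. I0 one 0 t 0 ?n (b k) (w, w'))"
   unfolding b_def[abs_def] by (subst E_S2_fixed[OF ts]) simp_all
  also have "nni Q (%w'. I0 one 0 t 0 ?n (b k) (w, w')) = nni LQ (%q. ennreal (indicator {0<..t} (fst q) * Lm (fst q) (w, snd q)) * b k (lev (<) (w, snd q) (fst q)))"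
  proof -
   have [measurable]: "fst \<in> bm LQ" using measurable_fst[of lborel Q] by simp
   have "(%q. ennreal (indicator {0<..t} (fst q) * Lm (fst q) (w, snd q)) * b k (lev (<) (w, snd q) (fst q))) \<in> bm LQ"
    unfolding fst_conv snd_conv by measurable
   from PL.nn_integral_snd[OF this] show ?thesis by (simp add: I0_def wg)
  qed
  also have "... = nni LQ (%q. ennreal (Fm (d k) w t q))"
  proof (rule nn_integral_cong_AE, use AE_dom AE_LQ_pos in eventually_elim)
   case (elim q)
   show ?case
   proof (cases "fst q \<in> {0<..t}")
    case True
    then have "b k (lev (<) (w, snd q) (fst q)) < \<top>" using elim(1) t bk[OF k] by (auto intro: le_less_trans)
    then have "ennreal (d k (lev (<) (w, snd q) (fst q))) = b k (lev (<) (w, snd q) (fst q))" by (simp add: d_def)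
    then show ?thesis using True elim(2)[rule_format, of "(<)"] by (simp add: Fm_def ennreal_mult d_def)
   qed (simp add: Fm_def)
  qed
  also have "... = ennreal (lint LQ (%q. Fm (d k) w t q))"
   by (rule nn_integral_eq_integral[OF Fm_integrable[OF dd[OF k] t(2)]], use AE_LQ_pos in eventually_elim)
    (auto simp: Fm_def d_def indicator_def less_imp_le)
  finally have e: "nni Q (%w'. ennreal (S k w')) = ennreal (\<rho> * lint LQ (%q. Fm (d k) w t q))"
   using params_pos by (simp add: ennreal_mult')
  have i: "integrable Q (S k)" using m Snn e by (intro integrableI_nonneg) auto
  have "0 <= lint LQ (%q. Fm (d k) w t q)"
   by (rule Bochner_Integration.integral_nonneg_AE, use AE_LQ_pos in eventually_elim) (auto simp: Fm_def d_def indicator_def less_imp_le)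
  then show ?thesis using i e nn_integral_eq_integral[OF i Snn] params_pos
   by (simp add: Bochner_Integration.integral_nonneg_AE[OF Snn])
 qed
 have "lint LQ (%q. Fm (dl2 f) w t q) = lint LQ (%q. Fm (d 1) w t q - Fm (d (-1)) w t q)"
 proof (rule integral_cong_AE)
  show "Fm (dl2 f) w t \<in> bm LQ" "(%q. Fm (d 1) w t q - Fm (d (-1)) w t q) \<in> bm LQ"
   using Fm_meas[of "dl2 f"] Fm_meas[of "d 1"] Fm_meas[of "d (-1)"] dd by (auto simp: dominated_def)
  show "AE q in LQ. Fm (dl2 f) w t q = Fm (d 1) w t q - Fm (d (-1)) w t q"
   using AE_dom
  proof eventually_elim
   case (elim q)
   show ?case
   proof (cases "fst q \<in> {0<..t}")
    case True
    let ?x = "lev (<) (w, snd q) (fst q)"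
    have "nni F2 (%z. ennreal \<bar>f (?x + z) - f ?x\<bar>) < \<top>"
     using elim True t dom_fn_ge(4)[of ?x] by (auto intro: le_less_trans)
    then have i: "integrable F2 (%z. f (?x + z) - f ?x)" by (intro integrableI_bounded) (auto, measurable)
    have mx: "ennreal (max 0 y) = ennreal y" for y by (simp add: max_def ennreal_neg)
    have "dl2 f ?x = d 1 ?x - d (-1) ?x"
     unfolding dl2_def d_def b_def mx using real_lebesgue_integral_def[OF i] by simp
    then show ?thesis by (simp add: Fm_def right_diff_distrib)
   qed (simp add: Fm_def)
  qed
 qed
 also have "... = lint LQ (%q. Fm (d 1) w t q) - lint LQ (%q. Fm (d (-1)) w t q)"
  using Fm_integrable[OF dd t(2)] by (intro Bochner_Integration.integral_diff) auto
 finally have D: "\<rho> * lint LQ (%q. Fm (dl2 f) w t q) = lint Q (%w'. S 1 w') - lint Q (%w'. S (-1) w')"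
  using S[of 1] S[of "-1"] by (simp add: right_diff_distrib)
 also have "... = lint Q (%w'. S 1 w' - S (-1) w')" using S[of 1] S[of "-1"] by simp
 also have "... = lint Q (%w'. (\<Sum>j\<in>{j\<in>{1..num (c2 w')}. 0 < tm (c2 w') j \<and> tm (c2 w') j <= t}. Lm (tm (c2 w') j) (w, w') *
   (f (lev (<) (w, w') (tm (c2 w') j) + mk (c2 w') j) - f (lev (<) (w, w') (tm (c2 w') j)))))"
  unfolding sum_filter_indicator S_def sum_subtractf[symmetric]
  by (intro Bochner_Integration.integral_cong refl sum.cong) (auto simp: max_def algebra_simps)
 finally show ?thesis by simp
qed

end

declare fm [measurable del] dm [measurable del] LQ_meas [measurable del] dl_meas [measurable del]

definition zk :: "(real => real) => 'a => real \<times> real => real" where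
 "zk f w p = lint Q (%w'. Lm (fst p) (w, w') * (lev (<) (w, w') (fst p) * f (lev (<) (w, w') (fst p) + ell' (snd p))))
  - Em f w (fst p)"

definition gn :: "(real => real) => (real => real) => real => real" where
 "gn f f' x = \<alpha> * (\<beta> - x) * f' x + dl1 f x + \<rho> * dl2 f x"

text \<open>A majorant of |zk| that is finite at every observed jump and almost everywhere for the
  compensator.\<close>

definition zdom :: "(real => real) => 'a => real \<times> real => ennreal" where
 "zdom f w p = nni Q (%w'. ennreal (Lm (fst p) (w, w')) * (ennreal (lev (<) (w, w') (fst p) * gr f (lev (<) (w, w') (fst p) + ell' (snd p)))
  + ennreal (gr f (lev (<) (w, w') (fst p)))))"

context
 fixes f f' :: "real => real" and w :: 'a
 assumes adm: "admissible f f'" and reg: "regular f f' w"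
begin

lemmas w9 = regularD(1)[OF reg] and c9 = regularD(2)[OF reg]
lemmas fm9 [measurable] = f_meas[OF adm] and dm9 [measurable] = dom_fn_meas[OF adm] and dl9 [measurable] = dl_meas[OF adm reg]
lemmas Lm9 = Lm_meas[OF adm reg]

lemma integrable_of_zdom:
 assumes r: "0 < fst p" and fin: "zdom f w p < \<top>"
 shows "integrable Q (%w'. Lm (fst p) (w, w') * (lev (<) (w, w') (fst p) * f (lev (<) (w, w') (fst p) + ell' (snd p))))"
  and "integrable Q (%w'. Lm (fst p) (w, w') * f (lev (<) (w, w') (fst p)))"
  and "ennreal \<bar>zk f w p\<bar> <= zdom f w p"
proof -
 let ?L = "%w'. Lm (fst p) (w, w')" and ?l = "%w'. lev (<) (w, w') (fst p)"
 let ?u = "%w'. ?L w' * (?l w' * f (?l w' + ell' (snd p)))" and ?v = "%w'. ?L w' * f (?l w')"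
 have [measurable]: "(%w'. lik (<) (c1 w) (c2 w') (fst p)) \<in> bm Q" "?l \<in> bm Q"
  using section_meas[OF w9 is_ord(1)] by auto
 have m: "?u \<in> bm Q" "?v \<in> bm Q" unfolding fst_conv snd_conv by measurable
 have pw: "AE w' in Q. ennreal \<bar>?u w'\<bar> + ennreal \<bar>?v w'\<bar> <= ennreal (?L w') * (ennreal (?l w' * gr f (?l w' + ell' (snd p))) + ennreal (gr f (?l w')))"
  using AE_section_pos[OF c9]
 proof eventually_elim
  case (elim w')
  have p: "0 < ?L w'" "0 < ?l w'" using elim[rule_format, of "(<)" "fst p"] r by auto
  have "\<bar>?u w'\<bar> <= ?L w' * (?l w' * gr f (?l w' + ell' (snd p)))" "\<bar>?v w'\<bar> <= ?L w' * gr f (?l w')"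
   using p gr_ge(2) by (auto simp: abs_mult intro!: mult_left_mono)
  then have "ennreal \<bar>?u w'\<bar> + ennreal \<bar>?v w'\<bar> <= ennreal (?L w' * (?l w' * gr f (?l w' + ell' (snd p)))) + ennreal (?L w' * gr f (?l w'))"
   by (intro add_mono ennreal_leI)
  also have "... = ennreal (?L w') * (ennreal (?l w' * gr f (?l w' + ell' (snd p))) + ennreal (gr f (?l w')))"
   using p by (simp only: distrib_left ennreal_mult'[OF less_imp_le[OF p(1)]])
  finally show ?case .
 qed
 have uv: "nni Q (%w'. ennreal \<bar>?u w'\<bar>) + nni Q (%w'. ennreal \<bar>?v w'\<bar>) <= zdom f w p"
  unfolding zdom_def using m pw by (subst nn_integral_add[symmetric]) (auto intro!: nn_integral_mono_AE)
 have "nni Q (%w'. ennreal \<bar>?u w'\<bar>) <= zdom f w p" "nni Q (%w'. ennreal \<bar>?v w'\<bar>) <= zdom f w p"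
  using order_trans[OF _ uv] by (auto simp: add_increasing add_increasing2)
 then have f2: "nni Q (%w'. ennreal \<bar>?u w'\<bar>) < \<infinity>" "nni Q (%w'. ennreal \<bar>?v w'\<bar>) < \<infinity>"
  using fin by (auto intro: le_less_trans)
 show iu: "integrable Q ?u" using m(1) f2(1) by (intro integrableI_bounded) auto
 show iv: "integrable Q ?v" using m(2) f2(2) by (intro integrableI_bounded) auto
 have "ennreal \<bar>zk f w p\<bar> <= ennreal (\<bar>lint Q (%w'. ?u w')\<bar> + \<bar>lint Q (%w'. ?v w')\<bar>)"
  unfolding zk_def Em_def by (intro ennreal_leI) linarith
 also have "... = ennreal \<bar>lint Q (%w'. ?u w')\<bar> + ennreal \<bar>lint Q (%w'. ?v w')\<bar>" by (rule ennreal_plus) auto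
 also have "... <= nni Q (%w'. ennreal \<bar>?u w'\<bar>) + nni Q (%w'. ennreal \<bar>?v w'\<bar>)"
  using integral_norm_bound_ennreal[OF iu] integral_norm_bound_ennreal[OF iv] by (intro add_mono) auto
 also note uv
 finally show "ennreal \<bar>zk f w p\<bar> <= zdom f w p" .
qed

lemma zdom_jump:
 assumes "j \<in> {1..N1 T w}"
 shows "zdom f w (tm (c1 w) j, Z1 j w) < \<top>"
 using reg assms unfolding regular_def zdom_def by simp

text \<open>The pathwise Ito formula, now without damping and cut, integrated over the second
  scenario. Only the unobserved jumps are compensated here; the term - (x - 1) f of the drift waits
  for the compensator of the observed ones.\<close>

lemma filter_equation:
 assumes t: "t \<in> {0..T}"
 shows "lint Q (%w'. Lk t (w, w') * f (lev (<=) (w, w') t)) = f l0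
  + lint LQ (%q. Fm (%x. \<alpha> * (\<beta> - x) * f' x - (x - 1) * f x) w t q) + \<rho> * lint LQ (%q. Fm (dl2 f) w t q)
  + (\<Sum>j\<in>{j\<in>{1..N1 T w}. 0 < tm (c1 w) j \<and> tm (c1 w) j <= t}. zk f w (tm (c1 w) j, Z1 j w))"
  and "integrable Q (%w'. Lk t (w, w') * f (lev (<=) (w, w') t))"
proof -
 let ?c = "c1 w"
 let ?ps = "%x. \<alpha> * (\<beta> - x) * f' x - (x - 1) * f x"
 let ?J = "{j\<in>{1..N1 T w}. 0 < tm ?c j \<and> tm ?c j <= t}"
 have t0: "0 <= t" "t <= T" using t by auto
 have dps: "dominated f f' ?ps"
  using dominated_add[OF adm reg dominated_basic(4)[OF adm reg] dominated_cmult[OF adm reg dominated_basic(2)[OF adm reg], of "-1"]]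
  by simp
 define A where "A w' = Lk t (w, w') * f (lev (<=) (w, w') t)" for w'
 define B where "B w' = (LINT r:{0<..t}|lborel. Lm r (w, w') * ?ps (lev (<) (w, w') r))" for w'
 define u where "u j w' = Lm (tm ?c j) (w, w') * (lev (<) (w, w') (tm ?c j) * f (lev (<) (w, w') (tm ?c j) + ell' (Z1 j w)))" for j w'
 define v where "v j w' = Lm (tm ?c j) (w, w') * f (lev (<) (w, w') (tm ?c j))" for j w'
 define Cs where "Cs w' = (\<Sum>j\<in>?J. u j w' - v j w')" for w'
 define D where "D w' = (\<Sum>j\<in>{j\<in>{1..num (c2 w')}. 0 < tm (c2 w') j \<and> tm (c2 w') j <= t}. Lm (tm (c2 w') j) (w, w') *
   (f (lev (<) (w, w') (tm (c2 w') j) + mk (c2 w') j) - f (lev (<) (w, w') (tm (c2 w') j))))" for w'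
 obtain vv where vv: "integrable Q vv" "AE w' in Q. \<forall>t\<in>{0..T}. Lk t (w, w') * gr f (lev (<=) (w, w') t) <= vv w'"
  "AE w' in Q. \<forall>t\<in>{0<..T}. Lm t (w, w') * gr f (lev (<) (w, w') t) <= vv w'"
  using regular_dom[OF reg adm] .
 have iA: "integrable Q A"
 proof (rule Bochner_Integration.integrable_bound[OF vv(1)])
  note [measurable] = section_meas[OF w9 is_ord(2)]
  show "A \<in> bm Q" unfolding A_def[abs_def] fst_conv snd_conv by measurable
  show "AE w' in Q. norm (A w') <= norm (vv w')" using vv(2) AE_section_pos[OF c9]
  proof eventually_elim
   case (elim w')
   have "0 < Lk t (w, w')" using elim(2) by simp
   then have "\<bar>A w'\<bar> <= Lk t (w, w') * gr f (lev (<=) (w, w') t)"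
    using gr_ge(2) by (auto simp: A_def abs_mult intro!: mult_left_mono)
   also have "... <= vv w'" using elim(1) t by blast
   finally show ?case by simp
  qed
 qed
 then show "integrable Q (%w'. Lk t (w, w') * f (lev (<=) (w, w') t))" unfolding A_def .
 have iB: "integrable Q B" unfolding B_def by (rule Fm_fubini(3)[OF adm reg dps t0(2)])
 have iu: "integrable Q (u j)" "integrable Q (v j)" if "j \<in> ?J" for j
  using integrable_of_zdom(1,2)[of "(tm ?c j, Z1 j w)"] zdom_jump[of j] that unfolding u_def v_def by auto
 have iC: "integrable Q Cs" unfolding Cs_def using iu by (intro Bochner_Integration.integrable_sum Bochner_Integration.integrable_diff) auto
 have pw: "AE w' in Q. A w' - f l0 - B w' - Cs w' = D w'"
  using okp_c2[OF c9]
 proof eventually_elim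
  case (elim w')
  let ?d = "c2 w'"
  have ok: "config_ok T ?c" "config_ok T ?d" "times ?c \<inter> times ?d = {}" using elim by (auto simp: okp_def)
  have fd: "\<And>x. 0 < x ==> (f has_real_derivative f' x) (at x)" and fc: "continuous_on {0<..} f'"
   using adm by (auto simp: admissible_def C1pos_def)
  note ito = pathwise_ito(2)[OF ok fd fc order_refl t0(1), of 0 "%_. 1"]
  note iv = initial_values[of "(w, w')", unfolded fst_conv snd_conv, OF elim]
  have Bq: "(LINT r:{0..t}|lborel. exp (- 0 * r) * 1 * lik (<) ?c ?d r *
    (\<alpha> * (\<beta> - intn (<) ?c ?d r) * f' (intn (<) ?c ?d r) - (intn (<) ?c ?d r - 1 + 0) * f (intn (<) ?c ?d r))) = B w'"
   unfolding LINT_Icc_Ioc B_def lev_def by (simp add: mult.assoc)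
  have Cq: "(\<Sum>j\<in>{j\<in>{1..num ?c}. 0 < tm ?c j \<and> tm ?c j <= t}. exp (- 0 * tm ?c j) * lik (<) ?c ?d (tm ?c j) *
     (1 * intn (<) ?c ?d (tm ?c j) * f (intn (<) ?c ?d (tm ?c j) + mk ?c j) - 1 * f (intn (<) ?c ?d (tm ?c j)))) = Cs w'"
   unfolding Cs_def u_def v_def lev_def using c1_jump(2)[OF w9]
   by (intro sum.cong) (auto simp: num_c1 algebra_simps)
  have Dq: "(\<Sum>j\<in>{j\<in>{1..num ?d}. 0 < tm ?d j \<and> tm ?d j <= t}. exp (- 0 * tm ?d j) * lik (<) ?c ?d (tm ?d j) *
     1 * (f (intn (<) ?c ?d (tm ?d j) + mk ?d j) - f (intn (<) ?c ?d (tm ?d j)))) = D w'"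
   unfolding D_def lev_def by simp
  have "A w' - f l0 = B w' + Cs w' + D w'"
   using ito[unfolded Bq Cq Dq] iv by (simp add: A_def lev_def)
  then show ?case by simp
 qed
 have iX: "integrable Q (%w'. A w' - f l0 - B w' - Cs w')" using iA iB iC by auto
 \<comment> \<open>The sum over the jumps of the second process is almost surely equal to an
   integrable combination, and \<open>Q\<close> is complete.\<close>
 have Dm: "D \<in> bm Q"
  by (rule borel_measurable_AE_complete[OF _ pw M1.complete_Q]) (use iX in \<open>auto simp: null_sets_def\<close>)
 have "lint Q (%w'. A w' - f l0 - B w' - Cs w') = lint Q (%w'. D w')"
  using iX Dm pw by (intro integral_cong_AE) auto
 moreover have "lint Q (%w'. A w' - f l0 - B w' - Cs w') = lint Q (%w'. A w') - f l0 - lint Q (%w'. B w') - lint Q (%w'. Cs w')"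
  using iA iB iC by (simp add: prob_space)
 moreover have "lint Q (%w'. B w') = lint LQ (%q. Fm ?ps w t q)"
  unfolding B_def by (rule Fm_fubini(2)[OF adm reg dps t0(2), symmetric])
 moreover have "lint Q (%w'. D w') = \<rho> * lint LQ (%q. Fm (dl2 f) w t q)"
  unfolding D_def by (rule compensation2[OF adm reg t0])
 moreover have "lint Q (%w'. Cs w') = (\<Sum>j\<in>?J. zk f w (tm ?c j, Z1 j w))"
 proof -
  have "lint Q (%w'. Cs w') = (\<Sum>j\<in>?J. lint Q (%w'. u j w' - v j w'))"
   unfolding Cs_def using iu by (intro Bochner_Integration.integral_sum Bochner_Integration.integrable_diff) auto
  also have "... = (\<Sum>j\<in>?J. lint Q (%w'. u j w') - lint Q (%w'. v j w'))"
   by (intro sum.cong refl Bochner_Integration.integral_diff iu)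
  finally show ?thesis by (simp add: zk_def Em_def u_def v_def)
 qed
 ultimately show "lint Q (%w'. Lk t (w, w') * f (lev (<=) (w, w') t)) = f l0
  + lint LQ (%q. Fm ?ps w t q) + \<rho> * lint LQ (%q. Fm (dl2 f) w t q) + (\<Sum>j\<in>?J. zk f w (tm ?c j, Z1 j w))"
  by (simp add: A_def)
qed

lemma LB_meas: "fst \<in> bm (lborel >< F1)" "snd \<in> bm (lborel >< F1)"
 using measurable_fst[of lborel F1] measurable_snd[of lborel F1] by (auto simp: measurable_cong_sets[OF refl M1.sets_K])

lemma zdom_meas: "zdom f w \<in> bm (borel >< borel)"
 and zk_meas: "zk f w \<in> bm (borel >< borel)"
proof -
 have r [measurable]: "(%q. fst (fst q)) \<in> bm ((borel >< borel) >< Q)" "(%q. snd (fst q)) \<in> bm ((borel >< borel) >< Q)"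
  for q :: "(real \<times> real) \<times> 'a" by measurable
 note [measurable] = Lm9[OF measurable_snd r(1)]
 have 1: "(%q. ennreal (Lm (fst (fst q)) (w, snd q)) * (ennreal (lev (<) (w, snd q) (fst (fst q)) * gr f (lev (<) (w, snd q) (fst (fst q)) + ell' (snd (fst q))))
  + ennreal (gr f (lev (<) (w, snd q) (fst (fst q)))))) \<in> bm ((borel >< borel) >< Q)"
  unfolding fst_conv snd_conv by measurable
 have 2: "(%(p, w'). Lm (fst p) (w, w') * (lev (<) (w, w') (fst p) * f (lev (<) (w, w') (fst p) + ell' (snd p)))) \<in> bm ((borel >< borel) >< Q)"
  "(%(p, w'). Lm (fst p) (w, w') * f (lev (<) (w, w') (fst p))) \<in> bm ((borel >< borel) >< Q)" for p :: "real \<times> real"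
  unfolding fst_conv snd_conv case_prod_beta' by measurable
 show "zdom f w \<in> bm (borel >< borel)"
  using borel_measurable_nn_integral_fst[OF 1] by (simp add: zdom_def[abs_def])
 show "zk f w \<in> bm (borel >< borel)"
  using borel_measurable_diff[OF borel_measurable_lebesgue_integral[OF 2(1)] borel_measurable_lebesgue_integral[OF 2(2)]]
  by (simp add: zk_def[abs_def] Em_def)
qed

lemma LB_cong: "h \<in> bm (borel >< borel) ==> h \<in> bm (lborel >< F1)" for h :: "real \<times> real => _"
proof -
 assume h: "h \<in> bm (borel >< borel)"
 have "sets (lborel >< F1) = sets (borel >< (borel :: real measure))" by (intro sets_pair_measure_cong sets_lborel M1.sets_K)
 from measurable_cong_sets[OF this refl] h show ?thesis by blast
qed

definition Edom :: "real => ennreal" where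
 "Edom r = nni Q (%w'. ennreal (Lm r (w, w')) * dom_fn f f' (lev (<) (w, w') r))"

lemma Edom_finite: "nni lborel (%r. indicator {0<..T} r * Edom r) < \<top>" "AE r in lborel. 0 < r \<longrightarrow> r <= T \<longrightarrow> Edom r < \<top>"
proof -
 interpret PL: pair_sigma_finite lborel Q ..
 note LQm = LQ_meas[OF adm reg]
 have [measurable]: "fst \<in> bm LQ" using measurable_fst[of lborel Q] by simp
 note [measurable] = LQm
 have m: "(%q. indicator {0<..T} (fst q) * (ennreal (Lm (fst q) (w, snd q)) * dom_fn f f' (lev (<) (w, snd q) (fst q)))) \<in> bm LQ"
  unfolding fst_conv snd_conv by measurable
 have sec: "nni Q (%w'. indicator {0<..T} r * (ennreal (Lm r (w, w')) * dom_fn f f' (lev (<) (w, w') r))) = indicator {0<..T} r * Edom r" for r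
 proof -
  note [measurable] = section_meas[OF w9 is_ord(1), of r]
  show ?thesis unfolding Edom_def fst_conv snd_conv by (rule nn_integral_cmult) measurable
 qed
 have m2: "(%r. indicator {0<..T} r * Edom r) \<in> bm lborel"
  using borel_measurable_nn_integral_fst[OF m] by (simp add: sec[simplified])
 show fin: "nni lborel (%r. indicator {0<..T} r * Edom r) < \<top>"
  using nn_integral_fst[OF m] dom_product[OF adm reg] by (simp add: sec[simplified])
 have "AE r in lborel. indicator {0<..T} r * Edom r \<noteq> \<infinity>"
  using m2 fin by (intro nn_integral_PInf_AE) auto
 then show "AE r in lborel. 0 < r \<longrightarrow> r <= T \<longrightarrow> Edom r < \<top>" by eventually_elim (auto simp: less_top)
qed

text \<open>The gain term is a summand of \<open>dom_fn\<close>, which gives the 1; the loss term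
  gives 1 / lmin, through \<open>gr f x <= x * gr f x / lmin\<close> on the range of the
  intensity.\<close>

lemma zdom_le_Edom:
 assumes r: "0 < r"
 shows "nni F1 (%z. zdom f w (r, z)) <= ennreal (1 + 1 / lmin) * Edom r"
proof -
 interpret P1: prob_space F1 by (rule M1.prob_space_K)
 interpret P1Q: pair_sigma_finite F1 Q ..
 note s = section_meas[OF w9 is_ord(1), of r]
 have [measurable]: "(%q. lik (<) (c1 w) (c2 (snd q)) r) \<in> bm (F1 >< Q)" "(%q. lev (<) (w, snd q) r) \<in> bm (F1 >< Q)"
  using measurable_compose[OF measurable_snd s(2)] measurable_compose[OF measurable_snd s(1)] by auto
 let ?k = "%z w'. ennreal (Lm r (w, w')) * (ennreal (lev (<) (w, w') r * gr f (lev (<) (w, w') r + ell' z)) + ennreal (gr f (lev (<) (w, w') r)))"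
 have m: "(%(z, w'). ?k z w') \<in> bm (F1 >< Q)"
  unfolding case_prod_beta' fst_conv snd_conv by measurable
 have "nni F1 (%z. zdom f w (r, z)) = nni Q (%w'. nni F1 (%z. ?k z w'))"
  using P1Q.Fubini'[OF m] by (simp add: zdom_def)
 also have "... <= nni Q (%w'. ennreal (1 + 1 / lmin) * (ennreal (Lm r (w, w')) * dom_fn f f' (lev (<) (w, w') r)))"
 proof (rule nn_integral_mono_AE, use AE_section_pos[OF c9] in eventually_elim)
  case (elim w')
  let ?l = "lev (<) (w, w') r"
  have l: "lmin <= ?l" using elim r by simp
  have "gr f ?l <= 1 / lmin * (?l * gr f ?l)" using mult_right_mono[OF l gr_nonneg[of f ?l]] lmin_pos by (simp add: field_simps)
  then have "ennreal (gr f ?l) <= ennreal (1 / lmin) * ennreal (?l * gr f ?l)"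
   using lmin_pos by (subst ennreal_mult'[symmetric]) (auto intro!: ennreal_leI)
  also have "... <= ennreal (1 / lmin) * dom_fn f f' ?l" by (intro mult_left_mono dom_fn_ge(1)[OF adm reg]) simp
  finally have g: "ennreal (gr f ?l) <= ennreal (1 / lmin) * dom_fn f f' ?l" .
  have "nni F1 (%z. ?k z w') = ennreal (Lm r (w, w')) * (nni F1 (%z. ennreal (?l * gr f (?l + ell' z))) + ennreal (gr f ?l))"
   by (subst nn_integral_cmult) (simp_all add: nn_integral_add P1.emeasure_space_1[simplified])
  also have "... <= ennreal (Lm r (w, w')) * (dom_fn f f' ?l + ennreal (1 / lmin) * dom_fn f f' ?l)"
   by (intro mult_left_mono add_mono g dom_fn_ge(5)[OF adm reg]) simp
  also have "dom_fn f f' ?l + ennreal (1 / lmin) * dom_fn f f' ?l = ennreal (1 + 1 / lmin) * dom_fn f f' ?l"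
   using lmin_pos by (simp add: distrib_right ennreal_plus del: ennreal_plus_if)
  finally show "nni F1 (%z. ?k z w') <= ennreal (1 + 1 / lmin) * (ennreal (Lm r (w, w')) * dom_fn f f' ?l)"
   by (simp add: mult_ac)
 qed
 also have "... = ennreal (1 + 1 / lmin) * Edom r"
 proof -
  note [measurable] = s
  show ?thesis unfolding Edom_def fst_conv snd_conv by (rule nn_integral_cmult) measurable
 qed
 finally show ?thesis .
qed

lemma zdom_integral_finite: "nni (lborel >< F1) (%p. indicator {0<..T} (fst p) * zdom f w p) < \<top>"
proof -
 interpret P1: prob_space F1 by (rule M1.prob_space_K)
 have zs: "(%z. zdom f w (r, z)) \<in> bm F1" for r
  using measurable_Pair2[OF zdom_meas, of r] by (simp add: measurable_cong_sets[OF M1.sets_K refl])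
 note [measurable] = LB_cong[OF zdom_meas] LB_meas
 have m: "(%p. indicator {0<..T} (fst p) * zdom f w p) \<in> bm (lborel >< F1)" by measurable
 have "nni (lborel >< F1) (%p. indicator {0<..T} (fst p) * zdom f w p) = nni lborel (%r. indicator {0<..T} r * nni F1 (%z. zdom f w (r, z)))"
  using P1.nn_integral_fst[OF m] zs by (simp add: nn_integral_cmult)
 also have "... <= nni lborel (%r. ennreal (1 + 1 / lmin) * (indicator {0<..T} r * Edom r))"
  by (intro nn_integral_mono) (use zdom_le_Edom in \<open>auto simp: indicator_def\<close>)
 also have "... <= ennreal (1 + 1 / lmin) * nni lborel (%r. indicator {0<..T} r * Edom r)"
 proof (rule eq_refl, rule nn_integral_cmult)
  interpret PL: pair_sigma_finite lborel Q ..
  note LQm = LQ_meas[OF adm reg]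
  have [measurable]: "fst \<in> bm LQ" using measurable_fst[of lborel Q] by simp
  note [measurable] = LQm
  have "(%q. ennreal (Lm (fst q) (w, snd q)) * dom_fn f f' (lev (<) (w, snd q) (fst q))) \<in> bm LQ"
   unfolding fst_conv snd_conv by measurable
  from borel_measurable_nn_integral_fst[OF this] have [measurable]: "Edom \<in> bm lborel" by (simp add: Edom_def[abs_def])
  show "(%r. indicator {0<..T} r * Edom r) \<in> bm lborel" by measurable
 qed
 also have "... < \<top>" using Edom_finite(1) by (simp add: ennreal_mult_less_top)
 finally show ?thesis .
qed

lemma AE_zdom: "AE p in lborel >< F1. 0 < fst p \<longrightarrow> fst p <= T \<longrightarrow> zdom f w p < \<top>"
proof -
 note [measurable] = LB_cong[OF zdom_meas] LB_meas
 have "AE p in lborel >< F1. indicator {0<..T} (fst p) * zdom f w p \<noteq> \<infinity>"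
  using zdom_integral_finite by (intro nn_integral_PInf_AE) auto
 then show ?thesis by eventually_elim (auto simp: less_top)
qed

lemma zk_integrable:
 assumes t: "t <= T"
 shows "integrable (lborel >< F1) (%p. indicator {0<..t} (fst p) * zk f w p)"
proof (rule integrableI_bounded)
 note [measurable] = LB_cong[OF zk_meas] LB_meas
 show "(%p. indicator {0<..t} (fst p) * zk f w p) \<in> bm (lborel >< F1)" by measurable
 have "nni (lborel >< F1) (%p. ennreal (norm (indicator {0<..t} (fst p) * zk f w p))) <= nni (lborel >< F1) (%p. indicator {0<..T} (fst p) * zdom f w p)"
 proof (rule nn_integral_mono_AE, use AE_zdom in eventually_elim)
  case (elim p)
  then show ?case using integrable_of_zdom(3)[of p] t by (cases "fst p \<in> {0<..t}") auto
 qed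
 also have "... < \<infinity>" using zdom_integral_finite by simp
 finally show "nni (lborel >< F1) (%p. ennreal (norm (indicator {0<..t} (fst p) * zk f w p))) < \<infinity>" .
qed

text \<open>Integrating x f(x + ell z) over the marks gives dl1 f + x f, and f is subtracted.
  Finiteness of \<open>Edom r\<close> justifies the exchange with the integral over the second
  scenario.\<close>

lemma zk_mark_integral:
 assumes r: "0 < r" and fin: "Edom r < \<top>"
 shows "lint F1 (%z. zk f w (r, z)) = Em (%x. dl1 f x + (x - 1) * f x) w r"
proof -
 interpret P1: prob_space F1 by (rule M1.prob_space_K)
 interpret P1Q: pair_sigma_finite F1 Q ..
 let ?L = "%w'. Lm r (w, w')" and ?l = "%w'. lev (<) (w, w') r"
 note s = section_meas[OF w9 is_ord(1), of r]
 note [measurable] = s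
 have [measurable]: "(%q. lik (<) (c1 w) (c2 (snd q)) r) \<in> bm (F1 >< Q)" "(%q. lev (<) (w, snd q) r) \<in> bm (F1 >< Q)"
  using measurable_compose[OF measurable_snd s(2)] measurable_compose[OF measurable_snd s(1)] by auto
 let ?k = "%z w'. ?L w' * (?l w' * f (?l w' + ell' z))"
 have dint: "integrable Q (%w'. ?L w' * h (?l w'))" if h: "dominated f f' h" for h
 proof (rule integrableI_bounded)
  obtain B where B: "0 <= B" "\<And>x. lmin <= x ==> ennreal \<bar>h x\<bar> <= ennreal B * dom_fn f f' x" and [measurable]: "h \<in> bm borel"
   using h dominated_def[OF adm reg] by auto
  show "(%w'. ?L w' * h (?l w')) \<in> bm Q" unfolding fst_conv snd_conv by measurable
  have "nni Q (%w'. ennreal (norm (?L w' * h (?l w')))) <= nni Q (%w'. ennreal B * (ennreal (?L w') * dom_fn f f' (?l w')))"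
  proof (rule nn_integral_mono_AE, use AE_section_pos[OF c9] in eventually_elim)
   case (elim w')
   have "ennreal (norm (?L w' * h (?l w'))) = ennreal (?L w') * ennreal \<bar>h (?l w')\<bar>"
    using elim[rule_format, of "(<)" r] by (simp add: abs_mult ennreal_mult)
   also have "... <= ennreal (?L w') * (ennreal B * dom_fn f f' (?l w'))"
    using B(2)[of "?l w'"] elim r by (intro mult_left_mono) auto
   finally show ?case by (simp add: mult_ac)
  qed
  also have "... = ennreal B * Edom r" unfolding Edom_def fst_conv snd_conv by (rule nn_integral_cmult) measurable
  also have "... < \<infinity>" using fin by (simp add: ennreal_mult_less_top)
  finally show "nni Q (%w'. ennreal (norm (?L w' * h (?l w')))) < \<infinity>" .
 qed
 have ik: "integrable (F1 >< Q) (%(z, w'). ?k z w')"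
 proof (rule integrableI_bounded)
  show m: "(%(z, w'). ?k z w') \<in> bm (F1 >< Q)" unfolding case_prod_beta' fst_conv snd_conv by measurable
  have m': "(%(z, w'). ennreal \<bar>?k z w'\<bar>) \<in> bm (F1 >< Q)" unfolding case_prod_beta' fst_conv snd_conv by measurable
  have "nni (F1 >< Q) (%q. ennreal (norm (case q of (z, w') => ?k z w'))) = nni F1 (%z. nni Q (%w'. ennreal \<bar>?k z w'\<bar>))"
   using nn_integral_fst[OF m'] by (simp add: case_prod_beta')
  also have "... <= nni F1 (%z. zdom f w (r, z))"
   unfolding zdom_def
  proof (rule nn_integral_mono, rule nn_integral_mono_AE)
   fix z
   show "AE w' in Q. ennreal \<bar>?k z w'\<bar> <= ennreal (Lm (fst (r, z)) (w, w')) * (ennreal (lev (<) (w, w') (fst (r, z)) * gr f (lev (<) (w, w') (fst (r, z)) + ell' (snd (r, z))))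
    + ennreal (gr f (lev (<) (w, w') (fst (r, z)))))"
    using AE_section_pos[OF c9]
   proof eventually_elim
    case (elim w')
    have p: "0 < ?L w'" "0 < ?l w'" using elim[rule_format, of "(<)" r] r by auto
    have "ennreal \<bar>?k z w'\<bar> = ennreal (?L w') * ennreal (?l w' * \<bar>f (?l w' + ell' z)\<bar>)"
     using p by (simp add: abs_mult ennreal_mult')
    also have "... <= ennreal (?L w') * ennreal (?l w' * gr f (?l w' + ell' z))"
     using p gr_ge(2) by (intro mult_left_mono ennreal_leI) auto
    also have "... <= ennreal (?L w') * (ennreal (?l w' * gr f (?l w' + ell' z)) + ennreal (gr f (?l w')))"
     by (intro mult_left_mono) auto
    finally show ?case by simp
   qed
  qed
  also have "... <= ennreal (1 + 1 / lmin) * Edom r" by (rule zdom_le_Edom[OF r])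
  also have "... < \<infinity>" using fin by (simp add: ennreal_mult_less_top)
  finally show "nni (F1 >< Q) (%q. ennreal (norm (case q of (z, w') => ?k z w'))) < \<infinity>" .
 qed
 have inner: "AE w' in Q. lint F1 (%z. ?k z w') = ?L w' * (dl1 f (?l w') + ?l w' * f (?l w'))"
 proof -
  have m: "(%w'. ennreal (?L w') * dom_fn f f' (?l w')) \<in> bm Q" unfolding fst_conv snd_conv by measurable
  have "AE w' in Q. ennreal (?L w') * dom_fn f f' (?l w') \<noteq> \<infinity>"
   using m fin unfolding Edom_def by (intro nn_integral_PInf_AE) auto
  then show ?thesis using AE_section_pos[OF c9]
  proof eventually_elim
   case (elim w')
   let ?x = "?l w'"
   have p: "0 < ?L w'" "0 < ?x" using elim(2)[rule_format, of "(<)" r] r by auto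
   have "dom_fn f f' ?x < \<top>" using elim(1) p(1) by (auto simp: ennreal_mult_eq_top_iff less_top)
   then have "nni F1 (%z. ennreal (\<bar>f (?x + ell' z) - f ?x\<bar> * ?x)) < \<top>"
    using dom_fn_ge(3)[OF adm reg, of ?x] by (rule le_less_trans[rotated])
   then have "integrable F1 (%z. (f (?x + ell' z) - f ?x) * ?x)"
    using p by (intro integrableI_bounded) (measurable, simp add: abs_mult)
   then have "lint F1 (%z. (f (?x + ell' z) - f ?x) * ?x + ?x * f ?x) = dl1 f ?x + ?x * f ?x"
    by (simp add: dl1_def P1.prob_space[simplified])
   then have "lint F1 (%z. ?x * f (?x + ell' z)) = dl1 f ?x + ?x * f ?x" by (simp add: algebra_simps)
   then show ?case by simp
  qed
 qed
 have iq: "integrable Q (%w'. ?L w' * (dl1 f (?l w') + ?l w' * f (?l w')))"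
  by (rule dint[OF dominated_add[OF adm reg dominated_dl(1)[OF adm reg] dominated_basic(3)[OF adm reg]]])
 note iv = dint[OF dominated_basic(1)[OF adm reg]]
 have "lint F1 (%z. lint Q (%w'. ?k z w')) = lint Q (%w'. lint F1 (%z. ?k z w'))"
  using P1Q.Fubini_integral[OF ik] by simp
 also have "... = lint Q (%w'. ?L w' * (dl1 f (?l w') + ?l w' * f (?l w')))"
  using inner iq P1Q.integrable_snd[OF ik] by (intro integral_cong_AE) auto
 finally have e: "lint F1 (%z. lint Q (%w'. ?k z w')) = lint Q (%w'. ?L w' * (dl1 f (?l w') + ?l w' * f (?l w')))" .
 have "lint F1 (%z. zk f w (r, z)) = lint F1 (%z. lint Q (%w'. ?k z w')) - Em f w r"
  unfolding zk_def fst_conv snd_conv using P1Q.integrable_fst[OF ik]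
  by (subst Bochner_Integration.integral_diff) (auto simp: P1.prob_space[simplified])
 also have "... = lint Q (%w'. ?L w' * (dl1 f (?l w') + ?l w' * f (?l w')) - ?L w' * f (?l w'))"
  unfolding e Em_def using iq iv by (intro Bochner_Integration.integral_diff[symmetric]) auto
 also have "... = Em (%x. dl1 f x + (x - 1) * f x) w r"
  unfolding Em_def by (intro Bochner_Integration.integral_cong refl) (simp add: algebra_simps)
 finally show ?thesis .
qed

lemma dominated_gn: "dominated f f' (gn f f')"
 unfolding gn_def[abs_def]
 by (intro dominated_add[OF adm reg] dominated_cmult[OF adm reg] dominated_basic(4)[OF adm reg] dominated_dl[OF adm reg])

text \<open>Adding the compensator of the observed jumps, dl1 f + (x - 1) f, to the drift of
  \<open>filter_equation\<close> cancels (x - 1) f and completes the generator; the same quantity is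
  subtracted in the compensated jump integral.\<close>

lemma filter_zakai:
 assumes t: "t \<in> {0..T}"
 shows "lint Q (%w'. Lk t (w, w') * f (lev (<=) (w, w') t)) = f l0 + (LINT r:{0<..t}|lborel. Em (gn f f') w r)
  + ((\<Sum>j\<in>{j\<in>{1..N1 T w}. 0 < tm (c1 w) j \<and> tm (c1 w) j <= t}. zk f w (tm (c1 w) j, Z1 j w))
   - lint (lborel >< F1) (%p. indicator {0<..t} (fst p) * zk f w p))"
proof -
 interpret P1: prob_space F1 by (rule M1.prob_space_K)
 interpret LF: pair_sigma_finite lborel F1 ..
 have t0: "t <= T" using t by auto
 let ?ps = "%x. \<alpha> * (\<beta> - x) * f' x - (x - 1) * f x" and ?h = "%x. dl1 f x + (x - 1) * f x"
 have d: "dominated f f' ?ps" "dominated f f' ?h"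
  using dominated_add[OF adm reg dominated_basic(4)[OF adm reg] dominated_cmult[OF adm reg dominated_basic(2)[OF adm reg], of "-1"]]
   dominated_add[OF adm reg dominated_dl(1)[OF adm reg] dominated_basic(2)[OF adm reg]] by auto
 note FI = Fm_integrable[OF adm reg _ t0]
 have "lint (lborel >< F1) (%p. indicator {0<..t} (fst p) * zk f w p) = lint lborel (%r. lint F1 (%z. indicator {0<..t} r * zk f w (r, z)))"
  using LF.integral_fst'[OF zk_integrable[OF t0]] by simp
 also have "... = lint lborel (%r. indicator {0<..t} r * Em ?h w r)"
 proof (rule integral_cong_AE)
  show "(%r. lint F1 (%z. indicator {0<..t} r * zk f w (r, z))) \<in> bm lborel"
   using LF.integrable_fst'[OF zk_integrable[OF t0]] by auto
  show "(%r. indicator {0<..t} r * Em ?h w r) \<in> bm lborel"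
   using Fm_fubini(4)[OF adm reg d(2) t0] by (auto simp: set_integrable_def)
  show "AE r in lborel. lint F1 (%z. indicator {0<..t} r * zk f w (r, z)) = indicator {0<..t} r * Em ?h w r"
   using Edom_finite(2) by eventually_elim (use t0 zk_mark_integral in \<open>auto simp: indicator_def\<close>)
 qed
 also have "... = lint LQ (%q. Fm ?h w t q)" using Fm_fubini(1)[OF adm reg d(2) t0] by (simp add: set_lebesgue_integral_def)
 finally have Z: "lint (lborel >< F1) (%p. indicator {0<..t} (fst p) * zk f w p) = lint LQ (%q. Fm ?h w t q)" .
 have "(LINT r:{0<..t}|lborel. Em (gn f f') w r) = lint LQ (%q. Fm (gn f f') w t q)"
  by (rule Fm_fubini(1)[OF adm reg dominated_gn t0, symmetric])
 also have "... = lint LQ (%q. Fm ?ps w t q + (Fm ?h w t q + \<rho> * Fm (dl2 f) w t q))"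
  by (intro Bochner_Integration.integral_cong refl) (simp add: Fm_def gn_def algebra_simps)
 also have "... = lint LQ (%q. Fm ?ps w t q) + (lint LQ (%q. Fm ?h w t q) + \<rho> * lint LQ (%q. Fm (dl2 f) w t q))"
  using FI[OF d(1)] FI[OF d(2)] FI[OF dominated_dl(2)[OF adm reg]] by simp
 finally have G: "(LINT r:{0<..t}|lborel. Em (gn f f') w r) = lint LQ (%q. Fm ?ps w t q) + (lint LQ (%q. Fm ?h w t q) + \<rho> * lint LQ (%q. Fm (dl2 f) w t q))" .
 show ?thesis unfolding filter_equation(1)[OF t] G Z by simp
qed

end

declare fm9 [measurable del] dm9 [measurable del] dl9 [measurable del]

end

section \<open>The Zakai equation\<close>

text \<open>Functions in \<open>gen_domain\<close> are arbitrary outside the state space; setting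
  them to 0 there makes them Borel on the line.\<close>

definition poscut :: "(real => real) => real => real" where "poscut f x = (if 0 < x then f x else 0)"

lemma poscut_pos [simp]: "0 < x ==> poscut f x = f x"
 by (simp add: poscut_def)

lemma poscut_borel: "continuous_on {0<..} f ==> poscut f \<in> bm borel"
proof -
 assume "continuous_on {0<..} f"
 from borel_measurable_continuous_on_indicator[OF _ this]
 have "(%x. indicator {0<..} x *\<^sub>R f x) \<in> bm borel" by simp
 also have "(%x. indicator {0<..} x *\<^sub>R f x) = poscut f" by (auto simp: poscut_def indicator_def)
 finally show ?thesis .
qed

lemma C1pos_poscut:
 assumes "f C1_differentiable_on {0<..}"
 shows "C1pos (poscut f) (poscut (deriv f))"
proof -
 obtain D where D: "\<And>x. 0 < x ==> (f has_vector_derivative D x) (at x)" "continuous_on {0<..} D"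
  using assms by (auto simp: C1_differentiable_on_def)
 have d: "(f has_real_derivative D x) (at x)" if "0 < x" for x
  using D(1)[OF that] by (simp add: has_real_derivative_iff_has_vector_derivative)
 have de: "deriv f x = D x" if "0 < x" for x using d[OF that] by (rule DERIV_imp_deriv)
 have cd: "continuous_on {0<..} (deriv f)" using D(2) by (rule continuous_on_eq) (simp add: de)
 have cf: "continuous_on {0<..} f"
  using d DERIV_continuous_on has_field_derivative_at_within by (metis greaterThan_iff)
 show ?thesis unfolding C1pos_def
 proof (intro conjI allI impI)
  show "poscut f \<in> bm borel" "poscut (deriv f) \<in> bm borel" using cf cd by (auto intro: poscut_borel)
  show "continuous_on {0<..} (poscut (deriv f))" using cd by (rule continuous_on_eq) simp
  fix x :: real assume x: "0 < x"
  have ev: "\<forall>\<^sub>F y in nhds x. f y = poscut f y"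
   using eventually_nhds_in_open[of "{0<..}" x] x by (auto elim: eventually_mono)
  show "(poscut f has_real_derivative poscut (deriv f) x) (at x)"
   using DERIV_cong_ev[OF refl ev refl] d[OF x] de[OF x] x by simp
 qed
qed

context jump_cluster_model
begin

lemma AE_P_pos: "AE w in P. \<forall>s\<in>{0..T}. 0 < lam s w"
proof -
 have "AE w in Q. \<forall>s\<in>{0..T}. 0 < lam s w"
  using c1_ok c2_ok AE_space by eventually_elim (auto simp: lam_eq intro!: intn_pos)
 moreover have "L T \<in> bm Q" using L_meas T_pos by auto
 ultimately show ?thesis unfolding P_def by (subst AE_density) auto
qed

lemma nu_finite_of_P:
 assumes ps: "ps \<in> bm borel"
  and le: "\<And>x. 0 < x ==> ps x <= ps' x" and fin: "nni P (%w. (\<integral>\<^sup>+s\<in>{0..T}. ps' (lam s w) \<partial>lborel)) < \<infinity>"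
 shows "nni (nu one 0 T 1 n) (%x. ps x) < \<top>"
proof -
 have "nni (nu one 0 T 1 n) (%x. ps x) <= nni P (%w. (\<integral>\<^sup>+s\<in>{0..T}. ps (lam s w) \<partial>lborel))"
  unfolding P_time_integral[OF ps] by (rule nu_dom[OF ps]) simp
 also have "... <= nni P (%w. (\<integral>\<^sup>+s\<in>{0..T}. ps' (lam s w) \<partial>lborel))"
  by (rule nn_integral_mono_AE, use AE_P_pos in eventually_elim)
   (auto intro!: nn_integral_mono le simp: indicator_def)
 finally show ?thesis using fin by simp
qed

text \<open>By \<open>nu_dom\<close> and \<open>P_time_integral\<close> the conditions under
  \<open>P\<close> bound the integrals against \<open>nu\<close>. Intensities and marks are almost
  surely positive, so \<open>poscut\<close> and \<open>ell'\<close> do not change the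
  integrands.\<close>

lemma gen_domain_admissible:
 assumes "f \<in> gen_domain"
 shows "admissible (poscut f) (poscut (deriv f))"
proof -
 have C1: "C1pos (poscut f) (poscut (deriv f))" using assms C1pos_poscut by (simp add: gen_domain_def)
 then have [measurable]: "poscut f \<in> bm borel" "poscut (deriv f) \<in> bm borel" by (auto simp: C1pos_def)
 have ts: "(0::real) <= 0" "0 <= T" "T <= T" using T_pos by auto
 have dom: "nni P (%w. (\<integral>\<^sup>+s\<in>{0..T}. (\<integral>\<^sup>+z\<in>{0<..}. ennreal (\<bar>f (lam s w + ell z) - f (lam s w)\<bar> * lam s w) \<partial>F1) \<partial>lborel)) < \<infinity>"
  "nni P (%w. (\<integral>\<^sup>+s\<in>{0..T}. (\<integral>\<^sup>+z\<in>{0<..}. ennreal \<bar>f (lam s w + z) - f (lam s w)\<bar> \<partial>F2) \<partial>lborel)) < \<infinity>"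
  "nni P (%w. (\<integral>\<^sup>+s\<in>{0..T}. ennreal (lam s w * \<bar>deriv f (lam s w)\<bar>) \<partial>lborel)) < \<infinity>"
  using assms T_pos unfolding gen_domain_def by auto
 show ?thesis unfolding admissible_def
 proof (intro conjI allI C1)
  fix n
  show "nni (nu one 0 T 1 n) (%x. nni F1 (%z. ennreal (\<bar>poscut f (x + ell' z) - poscut f x\<bar> * x))) < \<top>"
  proof (rule nu_finite_of_P[OF _ _ dom(1)])
   show "(%x. nni F1 (%z. ennreal (\<bar>poscut f (x + ell' z) - poscut f x\<bar> * x))) \<in> bm borel"
    using kernel_meas(1)[OF ts, of "%_. 1" "%(x, z). ennreal (\<bar>poscut f (x + ell' z) - poscut f x\<bar> * x)"] by simp
   fix x :: real assume x: "0 < x"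
   show "nni F1 (%z. ennreal (\<bar>poscut f (x + ell' z) - poscut f x\<bar> * x)) <= (\<integral>\<^sup>+z\<in>{0<..}. ennreal (\<bar>f (x + ell z) - f x\<bar> * x) \<partial>F1)"
    by (rule nn_integral_mono_AE, use F_pos(1) in eventually_elim)
     (use x ell_nonneg in \<open>auto simp: ell'_def max_def add_pos_nonneg\<close>)
  qed
  show "nni (nu one 0 T 1 n) (%x. nni F2 (%z. ennreal \<bar>poscut f (x + z) - poscut f x\<bar>)) < \<top>"
  proof (rule nu_finite_of_P[OF _ _ dom(2)])
   show "(%x. nni F2 (%z. ennreal \<bar>poscut f (x + z) - poscut f x\<bar>)) \<in> bm borel"
    using kernel_meas(2)[OF ts, of "%_. 1" "%(x, z). ennreal \<bar>poscut f (x + z) - poscut f x\<bar>"] by simp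
   fix x :: real assume x: "0 < x"
   show "nni F2 (%z. ennreal \<bar>poscut f (x + z) - poscut f x\<bar>) <= (\<integral>\<^sup>+z\<in>{0<..}. ennreal \<bar>f (x + z) - f x\<bar> \<partial>F2)"
    by (rule nn_integral_mono_AE, use F_pos(2) in eventually_elim) (use x in auto)
  qed
  show "nni (nu one 0 T 1 n) (%x. ennreal (x * \<bar>poscut (deriv f) x\<bar>)) < \<top>"
   by (rule nu_finite_of_P[OF _ _ dom(3)]) auto
 qed
qed

lemma jump_measure_alt:
 assumes w: "w \<in> space Q"
 shows "jump_measure T N1 Z1 w = distr (count_space {1..N1 T w}) (borel >< borel) (%j. (tm (c1 w) j, Z1 j w))"
 unfolding jump_measure_def using c1_jump(1)[OF w] by (intro distr_cong) (auto simp: space_pair_measure)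

text \<open>The measure is carried by its finitely many atoms, whose complement is open and hence
  measurable.\<close>

lemma jump_measure_AE:
 assumes w: "w \<in> space Q" and p: "\<And>j. j \<in> {1..N1 T w} ==> Ph (tm (c1 w) j, Z1 j w)"
 shows "AE p in jump_measure T N1 Z1 w. Ph p"
proof (rule AE_I')
 let ?g = "%j. (tm (c1 w) j, Z1 j w)"
 let ?N = "UNIV - ?g ` {1..N1 T w}"
 have m: "?g \<in> measurable (count_space {1..N1 T w}) (borel >< borel)" by (simp add: space_pair_measure)
 have "closed (?g ` {1..N1 T w})" by (intro finite_imp_closed) auto
 then have N: "?N \<in> sets (borel >< borel)" unfolding borel_prod by (metis Compl_eq_Diff_UNIV borel_open open_Compl)
 have "emeasure (jump_measure T N1 Z1 w) ?N = emeasure (count_space {1..N1 T w}) (?g -` ?N \<inter> {1..N1 T w})"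
  unfolding jump_measure_alt[OF w] using emeasure_distr[OF m N] by simp
 also have "?g -` ?N \<inter> {1..N1 T w} = {}" by auto
 finally show "?N \<in> null_sets (jump_measure T N1 Z1 w)"
  using N by (auto simp: null_sets_def jump_measure_def)
 show "{p \<in> space (jump_measure T N1 Z1 w). \<not> Ph p} \<subseteq> ?N" using p by auto
qed

lemma jump_measure_integral:
 assumes w: "w \<in> space Q" and h: "h \<in> bm (borel >< borel)"
 shows "integrable (jump_measure T N1 Z1 w) (h :: real \<times> real => real)"
  "lint (jump_measure T N1 Z1 w) (%p. h p) = (\<Sum>j=1..N1 T w. h (tm (c1 w) j, Z1 j w))"
proof -
 let ?g = "%j. (tm (c1 w) j, Z1 j w)"
 have m: "?g \<in> measurable (count_space {1..N1 T w}) (borel >< borel)" by (simp add: space_pair_measure)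
 show "integrable (jump_measure T N1 Z1 w) h"
  unfolding jump_measure_alt[OF w] integrable_distr_eq[OF m h] by (rule integrable_count_space) simp
 show "lint (jump_measure T N1 Z1 w) (%p. h p) = (\<Sum>j=1..N1 T w. h (tm (c1 w) j, Z1 j w))"
  unfolding jump_measure_alt[OF w] integral_distr[OF m h] by (simp add: lebesgue_integral_count_space_finite)
qed

lemma gen_poscut:
 assumes x: "0 < x" and m [measurable]: "poscut f \<in> bm borel"
 shows "gen f x = gn (poscut f) (poscut (deriv f)) x"
  and "nni F1 (%z. ennreal (\<bar>poscut f (x + ell' z) - poscut f x\<bar> * x)) < \<top> ==> nni F2 (%z. ennreal \<bar>poscut f (x + z) - poscut f x\<bar>) < \<top> ==> gen_defined f x"
proof -
 have e1: "indicator {0<..} z *\<^sub>R ((f (x + ell z) - f x) * x) = indicator {0<..} z * ((poscut f (x + ell' z) - poscut f x) * x)" for z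
  using x ell_nonneg[of z] by (auto simp: indicator_def ell'_def max_def add_pos_nonneg)
 have e2: "indicator {0<..} z *\<^sub>R ((f (x + z) - f x) * \<rho>) = indicator {0<..} z * (\<rho> * (poscut f (x + z) - poscut f x))" for z
  using x by (auto simp: indicator_def)
 have i1: "(LINT z:{0<..}|F1. (f (x + ell z) - f x) * x) = dl1 (poscut f) x"
  unfolding set_lebesgue_integral_def e1 dl1_def
  by (rule integral_cong_AE; (measurable)?) (use F_pos(1) in \<open>auto elim!: eventually_mono\<close>)
 have i2: "(LINT z:{0<..}|F2. (f (x + z) - f x) * \<rho>) = lint F2 (%z. \<rho> * (poscut f (x + z) - poscut f x))"
  unfolding set_lebesgue_integral_def e2
 proof (rule integral_cong_AE)
  show "AE z in F2. indicator {0<..} z * (\<rho> * (poscut f (x + z) - poscut f x)) = \<rho> * (poscut f (x + z) - poscut f x)"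
   using F_pos(2) by eventually_elim simp
 qed measurable
 show "gen f x = gn (poscut f) (poscut (deriv f)) x"
  unfolding gen_def gn_def i1 i2 using x by (simp add: dl2_def)
 assume fin: "nni F1 (%z. ennreal (\<bar>poscut f (x + ell' z) - poscut f x\<bar> * x)) < \<top>" "nni F2 (%z. ennreal \<bar>poscut f (x + z) - poscut f x\<bar>) < \<top>"
 have "integrable F1 (%z. (poscut f (x + ell' z) - poscut f x) * x)"
  using fin(1) x by (intro integrableI_bounded) (measurable, simp add: abs_mult)
 then have a: "integrable F1 (%z. indicator {0<..} z * ((poscut f (x + ell' z) - poscut f x) * x))"
  using integrable_mult_indicator[of "{0<..}" F1 "%z. (poscut f (x + ell' z) - poscut f x) * x"] by (simp only: M1.sets_K real_scaleR_def) simp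
 have "integrable F2 (%z. poscut f (x + z) - poscut f x)"
 proof (rule integrableI_bounded)
  show "(%z. poscut f (x + z) - poscut f x) \<in> bm F2" by measurable
 qed (use fin(2) in simp)
 then have b: "integrable F2 (%z. indicator {0<..} z * (\<rho> * (poscut f (x + z) - poscut f x)))"
  using integrable_mult_indicator[of "{0<..}" F2 "%z. \<rho> * (poscut f (x + z) - poscut f x)"] by simp
 show "gen_defined f x" unfolding gen_defined_def set_integrable_def e1 e2 using a b by blast
qed

lemma kap_solution:
 assumes f: "f \<in> gen_domain" and reg: "regular (poscut f) (poscut (deriv f)) w" and reg0: "regular0 w"
  and eq: "\<And>s. s \<in> {0..T} ==> mu s w = kap (<=) s w"
 shows "zakai_well_defined f mu w" and "t \<in> {0..T} ==> zakai_equation f mu w t"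
proof -
 interpret P1: prob_space F1 by (rule M1.prob_space_K)
 let ?f = "poscut f" and ?f' = "poscut (deriv f)"
 note adm = gen_domain_admissible[OF f]
 note w = regularD[OF reg]
 have fm [measurable]: "?f \<in> bm borel" by (rule f_meas(1)[OF adm])
 have gm: "gn ?f ?f' \<in> bm borel" using dominated_gn[OF adm reg] by (simp add: dominated_def[OF adm reg])
 have intf: "integrable (kap R s w) f \<longleftrightarrow> integrable Q (%w'. lik R (c1 w) (c2 w') s * ?f (lev R (w, w') s))"
  "lint (kap R s w) (%x. f x) = lint Q (%w'. lik R (c1 w) (c2 w') s * ?f (lev R (w, w') s))"
  "integrable (kap R s w) (gen f) \<longleftrightarrow> integrable Q (%w'. lik R (c1 w) (c2 w') s * gn ?f ?f' (lev R (w, w') s))"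
  "lint (kap R s w) (%x. gen f x) = lint Q (%w'. lik R (c1 w) (c2 w') s * gn ?f ?f' (lev R (w, w') s))"
  if "0 <= s" "is_ord R" for R s
 proof -
  have "integrable (kap R s w) f \<longleftrightarrow> integrable (kap R s w) ?f" "integrable (kap R s w) (gen f) \<longleftrightarrow> integrable (kap R s w) (gn ?f ?f')"
   by (intro Bochner_Integration.integrable_cong refl; simp add: gen_poscut(1))+
  moreover have "lint (kap R s w) (%x. f x) = lint (kap R s w) (%x. ?f x)" "lint (kap R s w) (%x. gen f x) = lint (kap R s w) (%x. gn ?f ?f' x)"
   by (intro Bochner_Integration.integral_cong refl; simp add: gen_poscut(1))+
  ultimately show "integrable (kap R s w) f \<longleftrightarrow> integrable Q (%w'. lik R (c1 w) (c2 w') s * ?f (lev R (w, w') s))"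
   "lint (kap R s w) (%x. f x) = lint Q (%w'. lik R (c1 w) (c2 w') s * ?f (lev R (w, w') s))"
   "integrable (kap R s w) (gen f) \<longleftrightarrow> integrable Q (%w'. lik R (c1 w) (c2 w') s * gn ?f ?f' (lev R (w, w') s))"
   "lint (kap R s w) (%x. gen f x) = lint Q (%w'. lik R (c1 w) (c2 w') s * gn ?f ?f' (lev R (w, w') s))"
   using integral_kap[OF w that fm] integral_kap[OF w that gm] by auto
 qed
 have ll: "left_lim (%t. mu t w) s = kap (<) s w" if "s \<in> {0<..T}" for s
  by (rule left_lim_kap[OF reg0 that]) (rule eq)
 have zi: "zakai_integrand f (%t. mu t w) p = zk ?f w p" and
  zd: "zdom ?f w p < \<top> ==> zakai_integrand_defined f (%t. mu t w) p" if p: "p \<in> {0<..T} \<times> {0<..}" for p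
 proof -
  obtain s z where sz: "p = (s, z)" "0 < s" "s <= T" "0 < z" using p by auto
  have hm: "(%x. x * ?f (x + ell' z)) \<in> bm borel" by measurable
  have e: "x * f (x + ell z) = x * ?f (x + ell' z)" if "0 < x" for x
   using that sz ell_nonneg[of z] by (simp add: ell'_def max_def add_pos_nonneg)
  have i: "integrable (kap (<) s w) (%x. x * f (x + ell z)) \<longleftrightarrow> integrable (kap (<) s w) (%x. x * ?f (x + ell' z))"
   "lint (kap (<) s w) (%x. x * f (x + ell z)) = lint (kap (<) s w) (%x. x * ?f (x + ell' z))"
   by (intro Bochner_Integration.integrable_cong Bochner_Integration.integral_cong refl; simp add: e)+
  note k = integral_kap[OF w less_imp_le[OF sz(2)] is_ord(1) hm]
  note l = ll[of s] intf(1,2)[OF less_imp_le[OF sz(2)] is_ord(1)]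
  show "zakai_integrand f (%t. mu t w) p = zk ?f w p"
   using sz l i k by (simp add: zakai_integrand_def zk_def Em_def)
  assume "zdom ?f w p < \<top>"
  from integrable_of_zdom(1,2)[OF adm reg _ this] sz
  show "zakai_integrand_defined f (%t. mu t w) p" using l i k by (simp add: zakai_integrand_defined_def)
 qed
 let ?S = "%t::real. {0<..t} \<times> {0::real<..}"
 have sub: "?S t \<subseteq> ?S T" if "t <= T" for t using that by auto
 have zi': "indicator (?S t) p *\<^sub>R zakai_integrand f (%t. mu t w) p = indicator (?S t) p * zk ?f w p" if "t <= T" for t p
  using zi[of p] sub[OF that] by (auto simp: indicator_def)
 have Sm: "?S t \<in> sets (borel >< borel)" for t by simp
 have zm: "(%p. indicator (?S t) p * zk ?f w p) \<in> bm (borel >< borel)" for t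
  using zk_meas[OF adm reg] Sm by measurable
 \<comment> \<open>The compensator gives no mass to marks outside (0, \<infinity>), so there the
   restriction to positive marks may be dropped.\<close>
 have AEz: "AE p in (lborel :: real measure) >< F1. 0 < snd p"
 proof (rule AE_I')
  have m: "{..0} \<in> sets F1" by (metis M1.sets_K atMost_borel)
  have "emeasure (lborel >< F1) ((UNIV :: real set) \<times> {..0}) = emeasure lborel (UNIV :: real set) * emeasure F1 {..0}"
   using P1.emeasure_pair_measure_Times[of "UNIV :: real set" lborel "{..0}"] m by simp
  moreover have "(UNIV :: real set) \<times> {..0} \<in> sets (lborel >< F1)" using m by (intro pair_measureI) auto
  ultimately show "(UNIV :: real set) \<times> {..0} \<in> null_sets (lborel >< F1)" using F1_distribution(2) by (intro null_setsI) auto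
 qed (auto simp: space_pair_measure)
 have zp: "AE p in lborel >< F1. indicator (?S t) p * zk ?f w p = indicator {0<..t} (fst p) * zk ?f w p" for t
  using AEz by eventually_elim (auto simp: indicator_def mem_Times_iff)
 have zpm: "(%p. indicator {0<..t} (fst p) * zk ?f w p) \<in> bm (lborel >< F1)" if "t <= T" for t
  using zk_integrable[OF adm reg that] by auto
 have zint: "integrable (lborel >< F1) (%p. indicator (?S t) p * zk ?f w p)"
  "lint (lborel >< F1) (%p. indicator (?S t) p * zk ?f w p) = lint (lborel >< F1) (%p. indicator {0<..t} (fst p) * zk ?f w p)"
  if "t <= T" for t
  using integrable_cong_AE[OF LB_cong[OF adm reg zm] zpm[OF that] zp] zk_integrable[OF adm reg that]
   integral_cong_AE[OF LB_cong[OF adm reg zm] zpm[OF that] zp] by auto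
 \<comment> \<open>Outside these finitely many times the filter agrees with its left limit, and a
   time integral ignores them.\<close>
 let ?X = "insert 0 (times (c1 w))"
 have X: "countable ?X" "emeasure lborel {x} = 0" for x :: real by (auto intro: countable_finite)
 have offX: "lint (mu s w) (%x. gen f x) = Em (gn ?f ?f') w s" if "s \<in> {0..T}" "s \<notin> ?X" for s
  using that eq[of s] kap_off_jumps[OF reg0, of s] intf(4)[of s "(<)"] by (simp add: Em_def)
 have gI: "(LINT s:{0..t}|lborel. lint (mu s w) (%x. gen f x)) = (LINT s:{0<..t}|lborel. Em (gn ?f ?f') w s)" if "t <= T" for t
  unfolding set_lebesgue_integral_def
  by (rule integral_discrete_difference[where X="?X"]) (use X offX that in \<open>auto simp: indicator_def\<close>)
 show "zakai_equation f mu w t" if t: "t \<in> {0..T}"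
 proof -
  have t0: "t <= T" "0 <= t" using t by auto
  have J: "(LINT p:?S t|jump_measure T N1 Z1 w. zakai_integrand f (%t. mu t w) p)
   = (\<Sum>j\<in>{j\<in>{1..N1 T w}. 0 < tm (c1 w) j \<and> tm (c1 w) j <= t}. zk ?f w (tm (c1 w) j, Z1 j w))"
  proof -
   have "(LINT p:?S t|jump_measure T N1 Z1 w. zakai_integrand f (%t. mu t w) p) = (\<Sum>j=1..N1 T w. indicator (?S t) (tm (c1 w) j, Z1 j w) * zk ?f w (tm (c1 w) j, Z1 j w))"
    unfolding set_lebesgue_integral_def zi'[OF t0(1)] by (rule jump_measure_integral(2)[OF w(1) zm])
   also have "... = (\<Sum>j=1..N1 T w. if 0 < tm (c1 w) j \<and> tm (c1 w) j <= t then zk ?f w (tm (c1 w) j, Z1 j w) else 0)"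
    using Z1_marks(3)[OF _ w(1)] by (intro sum.cong) (auto simp: indicator_def)
   finally show ?thesis by (simp only: sum.inter_filter[OF finite_atLeastAtMost])
  qed
  have K: "(LINT p:?S t|lborel >< F1. zakai_integrand f (%t. mu t w) p) = lint (lborel >< F1) (%p. indicator {0<..t} (fst p) * zk ?f w p)"
   unfolding set_lebesgue_integral_def zi'[OF t0(1)] by (rule zint(2)[OF t0(1)])
  show ?thesis unfolding zakai_equation_def J K gI[OF t0(1)]
   using filter_zakai[OF adm reg t] intf(2)[OF t0(2) is_ord(2)] eq[OF t] l0_pos by simp
 qed
 show "zakai_well_defined f mu w" unfolding zakai_well_defined_def
 proof (intro conjI ballI)
  show "integrable (mu s w) f" if "s \<in> {0..T}" for s
   using filter_equation(2)[OF adm reg that] intf(1)[of s "(<=)"] eq[OF that] that by simp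
  have TT: "T <= T" by simp
  show "AE s in lborel. s \<in> {0..T} \<longrightarrow> (AE x in mu s w. gen_defined f x) \<and> integrable (mu s w) (gen f)"
   using off_jumps_AE[of "c1 w" "c1 w"] AE_lborel_singleton[of 0] Edom_finite(2)[OF adm reg] Fm_fubini(5)[OF adm reg dominated_gn[OF adm reg] TT]
  proof eventually_elim
   case (elim s)
   show ?case
   proof (intro impI)
    assume "s \<in> {0..T}"
    then have s: "0 < s" "s <= T" "s \<in> {0..T}" using elim(2) by auto
    have k: "mu s w = kap (<) s w" using eq[OF s(3)] kap_off_jumps[OF reg0 s(1,2)] elim(1) by simp
    have "nni (kap (<) s w) (%x. dom_fn ?f ?f' x) < \<top>"
     using elim(3) s nn_integral_kap[OF w less_imp_le[OF s(1)] is_ord(1) dom_fn_meas[OF adm]] by (simp add: Edom_def[OF adm reg])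
    moreover have "dom_fn ?f ?f' \<in> bm (kap (<) s w)"
     using measurable_restrict_space1[OF dom_fn_meas[OF adm]] by (simp add: measurable_cong_sets[OF kap_sets refl])
    ultimately have "AE x in kap (<) s w. dom_fn ?f ?f' x \<noteq> \<infinity>" by (intro nn_integral_PInf_AE) auto
    then have "AE x in kap (<) s w. gen_defined f x" using AE_space
    proof eventually_elim
     case E: (elim x)
     then have "dom_fn ?f ?f' x < \<top>" by (simp add: less_top)
     then show ?case using E(2) gen_poscut(2)[OF _ fm, of x] dom_fn_ge(3,4)[OF adm reg, of x] by (auto intro: le_less_trans)
    qed
    then show "(AE x in mu s w. gen_defined f x) \<and> integrable (mu s w) (gen f)"
     unfolding k using elim(4) s intf(3)[of s "(<)"] by simp
   qed
  qed
  have "integrable lborel (%s. indicator {0..T} s *\<^sub>R (lint (mu s w) (%x. gen f x))) \<longleftrightarrow> integrable lborel (%s. indicator {0<..T} s *\<^sub>R Em (gn ?f ?f') w s)"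
   by (rule integrable_discrete_difference[where X="?X"]) (use X offX in \<open>auto simp: indicator_def\<close>)
  then show "set_integrable lborel {0..T} (%s. lint (mu s w) (%x. gen f x))"
   using Fm_fubini(4)[OF adm reg dominated_gn[OF adm reg] TT] by (simp add: set_integrable_def)
  fix ka assume "ka \<in> {jump_measure T N1 Z1 w, lborel >< F1}"
  then consider "ka = jump_measure T N1 Z1 w" | "ka = lborel >< F1" by blast
  then have "(AE p in ka. p \<in> ?S T \<longrightarrow> zakai_integrand_defined f (%t. mu t w) p) \<and> set_integrable ka (?S T) (zakai_integrand f (%t. mu t w))"
  proof cases
   case 1
   have "AE p in ka. p \<in> ?S T \<longrightarrow> zakai_integrand_defined f (%t. mu t w) p"
    unfolding 1 by (rule jump_measure_AE[OF w(1)]) (use zd zdom_jump[OF adm reg] in blast)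
   moreover have "set_integrable ka (?S T) (zakai_integrand f (%t. mu t w))"
    unfolding 1 set_integrable_def zi'[OF TT] by (rule jump_measure_integral(1)[OF w(1) zm])
   ultimately show ?thesis ..
  next
   case 2
   have "AE p in ka. p \<in> ?S T \<longrightarrow> zakai_integrand_defined f (%t. mu t w) p"
    unfolding 2 using AE_zdom[OF adm reg] by eventually_elim (use zd in auto)
   moreover have "set_integrable ka (?S T) (zakai_integrand f (%t. mu t w))"
    unfolding 2 set_integrable_def zi'[OF TT] by (rule zint(1)[OF TT])
   ultimately show ?thesis ..
  qed
  then show "AE p in ka. p \<in> ?S T \<longrightarrow> zakai_integrand_defined f (%t. mu t w) p"
   "set_integrable ka (?S T) (zakai_integrand f (%t. mu t w))" by auto
 qed
qed

end

lemma set_LINT_indicator: "(LINT x:A|M. f x) = lint M (%x. indicator A x * f x)" for f :: "_ => real"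
 by (simp add: set_lebesgue_integral_def)

context jump_cluster_model
begin

text \<open>The completion by all \<open>Q\<close>-null sets is needed because the number of jumps of \<open>N\<^sup>1\<close> is recovered from \<open>C\<close> only
almost surely: two jumps at the same time would be seen as one.\<close>

definition Hbar :: "real => 'a measure" where
 "Hbar t = sigma (space Q) {A \<in> sets Q. \<exists>B\<in>sets (H t). AE w in Q. w \<in> A \<longleftrightarrow> w \<in> B}"

lemma generated_subset:
 assumes "space G = space Q" "\<And>i. i \<in> I ==> X i \<in> bm G"
 shows "sets (generated_by Q X I) \<subseteq> sets G"
proof -
 have "X i -` A \<inter> space Q \<in> sets G" if "i \<in> I" "A \<in> sets borel" for i A
  using measurable_sets[OF assms(2)[OF that(1)] that(2)] assms(1) by simp
 then have "sigma_sets (space G) {X i -` A \<inter> space Q | i A. i \<in> I \<and> A \<in> sets borel} \<subseteq> sets G"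
  by (intro sets.sigma_sets_subset) blast
 then show ?thesis unfolding sets_generated by (simp add: assms(1))
qed

lemma C_G1: "s \<in> {0..T} ==> C s \<in> bm G1"
proof -
 assume s: "s \<in> {0..T}"
 note g = sigma_gen_obs[where X=N1 and Y=Z1, folded G1_def]
 have "(%w. (%n w. \<Sum>j=1..n. Z1 j w) (N1 s w) w) \<in> bm G1"
 proof (rule measurable_compose_countable[OF _ g(2)[OF s]])
  show "(%w. \<Sum>j=1..n. Z1 j w) \<in> bm G1" for n
   using g(3) by (intro borel_measurable_sum) auto
 qed
 then show ?thesis by (simp add: C_def[abs_def])
qed

lemma H_G1: "t \<in> {0..T} ==> sets (H t) \<subseteq> sets G1"
 unfolding H_def by (rule generated_subset) (use space_G C_G1 in auto)

lemma space_H: "space (H t) = space Q"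
 unfolding H_def by (rule space_generated)

text \<open>The sets that agree almost surely with a set of \<open>H t\<close> already form a
  sigma-algebra, so every member of \<open>Hbar t\<close> comes with a representative in
  \<open>H t\<close>.\<close>

lemma Hbar_sigma:
 assumes t: "t \<in> {0..T}"
 shows "sets (Hbar t) = {A \<in> sets Q. \<exists>B\<in>sets (H t). AE w in Q. w \<in> A \<longleftrightarrow> w \<in> B}" (is "_ = ?S")
  and "space (Hbar t) = space Q"
proof -
 have "sigma_algebra (space Q) ?S" unfolding sigma_algebra_iff2
 proof (intro conjI ballI allI impI)
  show "?S \<subseteq> Pow (space Q)" using sets.sets_into_space by blast
  show "{} \<in> ?S" by (auto intro!: bexI[of _ "{}"])
  show "space Q - s \<in> ?S" if "s \<in> ?S" for s
  proof -
   from that obtain B where B: "s \<in> sets Q" "B \<in> sets (H t)" "AE w in Q. w \<in> s \<longleftrightarrow> w \<in> B" by blast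
   have "space Q - B \<in> sets (H t)" using sets.compl_sets[OF B(2)] by (simp add: space_H)
   moreover have "AE w in Q. w \<in> space Q - s \<longleftrightarrow> w \<in> space Q - B" using B(3) by eventually_elim auto
   moreover have "space Q - s \<in> sets Q" using B(1) by auto
   ultimately show ?thesis by blast
  qed
  show "(\<Union>i. A i) \<in> ?S" if "range A \<subseteq> ?S" for A :: "nat => 'a set"
  proof -
   have "\<forall>i. \<exists>B. B \<in> sets (H t) \<and> (AE w in Q. w \<in> A i \<longleftrightarrow> w \<in> B)" using that by blast
   then obtain B where B: "\<And>i. B i \<in> sets (H t)" "\<And>i. AE w in Q. w \<in> A i \<longleftrightarrow> w \<in> B i" by metis
   have "AE w in Q. \<forall>i. w \<in> A i \<longleftrightarrow> w \<in> B i" using B(2) by (simp add: AE_all_countable)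
   then have "AE w in Q. w \<in> (\<Union>i. A i) \<longleftrightarrow> w \<in> (\<Union>i. B i)" by eventually_elim auto
   moreover have "(\<Union>i. B i) \<in> sets (H t)" using B(1) by auto
   moreover have "(\<Union>i. A i) \<in> sets Q" using that by auto
   ultimately show ?thesis by blast
  qed
 qed
 then show "sets (Hbar t) = ?S" unfolding Hbar_def by (rule sigma_algebra.sets_measure_of_eq)
 show "space (Hbar t) = space Q" unfolding Hbar_def by (rule space_measure_of) (use sets.sets_into_space in blast)
qed

lemma Hbar_props:
 assumes t: "t \<in> {0..T}"
 shows "sets (Hbar t) \<subseteq> sets Q" "null_sets Q \<subseteq> sets (Hbar t)" "sets (H t) \<subseteq> sets (Hbar t)"
proof -
 show "sets (Hbar t) \<subseteq> sets Q" unfolding Hbar_sigma[OF t] by blast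
 show "null_sets Q \<subseteq> sets (Hbar t)"
 proof
  fix A assume A: "A \<in> null_sets Q"
  then have "AE w in Q. w \<in> A \<longleftrightarrow> w \<in> {}" using AE_not_in[OF A] by simp
  moreover have "{} \<in> sets (H t)" by simp
  ultimately show "A \<in> sets (Hbar t)" unfolding Hbar_sigma[OF t] using A by blast
 qed
 show "sets (H t) \<subseteq> sets (Hbar t)" unfolding Hbar_sigma[OF t] using H_G1[OF t] sets_G_Q by auto
qed

lemma C_Hbar:
 assumes "t \<in> {0..T}" "s \<in> {0..t}"
 shows "C s \<in> bm (Hbar t)"
proof (rule measurableI)
 fix A :: "real set" assume "A \<in> sets borel"
 then have "C s -` A \<inter> space Q \<in> sets (H t)" unfolding H_def using assms(2) by (intro generated_in)
 then show "C s -` A \<inter> space (Hbar t) \<in> sets (Hbar t)" using Hbar_props(3)[OF assms(1)] Hbar_sigma(2)[OF assms(1)] by auto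
qed simp

text \<open>By \<open>mesh_count\<close> the number of jumps is almost surely the limit of the
  number of mesh cells on which \<open>C\<close> grows; the marks then follow from the sums
  \<open>C\<close> by \<open>obs_from_marks\<close>.\<close>

lemma obs_Hbar:
 assumes t: "t \<in> {0..T}"
 shows "M1.obs (Hbar t) t"
proof -
 note sp = Hbar_sigma(2)[OF t]
 have N: "N1 s \<in> measurable (Hbar t) (count_space UNIV)" if s: "s \<in> {0..t}" for s
 proof -
  have sT: "s \<in> {0..T}" using s t by auto
  define W where "W n w = (\<Sum>i<n. if C (s * real i / real n) w < C (s * real (Suc i) / real n) w then 1 else (0::real))" for n w
  have mW: "W n \<in> bm (Hbar t)" for n
   unfolding W_def
  proof (intro borel_measurable_sum)
   fix i assume "i \<in> {..<n}"
   then have "s * real i / real n \<in> {0..t}" "s * real (Suc i) / real n \<in> {0..t}"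
    using M1.mesh_times[of i n s] M1.mesh_times[of "Suc i" n s] sT s by auto
   note [measurable] = C_Hbar[OF t this(1)] C_Hbar[OF t this(2)]
   show "(%w. if C (s * real i / real n) w < C (s * real (Suc i) / real n) w then 1 else (0::real)) \<in> bm (Hbar t)"
    by measurable
  qed
  have "(%w. lim (%n. W n w)) \<in> bm (Hbar t)" using mW by (rule borel_measurable_lim_metric)
  moreover have "AE w in Q. lim (%n. W n w) = real (N1 s w)"
   using M1.AE_good AE_space
  proof eventually_elim
   case (elim w)
   show ?case
   proof (rule limI, rule tendsto_eventually)
    show "\<forall>\<^sub>F n in sequentially. W n w = real (N1 s w)"
     using M1.eventually_unit_increments[OF elim(2,1) sT] eventually_gt_at_top[of 0]
    proof eventually_elim
     case (elim n)
     show ?case unfolding W_def C_def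
      by (rule M1.mesh_count[OF \<open>w \<in> space Q\<close> sT elim(2,1)]) (use Z1_marks(3) \<open>w \<in> space Q\<close> in simp)
    qed
   qed
  qed
  ultimately have r: "(%w. real (N1 s w)) \<in> bm (Hbar t)"
   by (rule borel_measurable_AE_complete) (use Hbar_props[OF t] sp M1.complete_Q in auto)
  show ?thesis
  proof (rule measurable_count_space_eq2_countable[THEN iffD2], intro conjI ballI)
   fix n
   have "(%w. real (N1 s w)) -` {real n} \<inter> space (Hbar t) \<in> sets (Hbar t)" by (rule measurable_sets[OF r]) simp
   also have "(%w. real (N1 s w)) -` {real n} = N1 s -` {n}" by auto
   finally show "N1 s -` {n} \<inter> space (Hbar t) \<in> sets (Hbar t)" .
  qed auto
 qed
 show ?thesis unfolding M1.obs_def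
 proof (intro conjI ballI allI impI)
  fix j :: nat assume j: "1 <= j"
  show "(%w. if j <= N1 t w then Z1 j w else 0) \<in> bm (Hbar t)"
  proof (rule M1.obs_from_marks[OF sp Hbar_props(1,2)[OF t] t N _ j])
   show "(%w. \<Sum>k=1..N1 s w. Z1 k w) \<in> bm (Hbar t)" if "s \<in> {0..t}" for s
    using C_Hbar[OF t that] by (simp add: C_def[abs_def])
  qed
 qed (use sp N in auto)
qed

lemma cond_exp_filter:
 assumes t: "t \<in> {0..T}" and f [measurable]: "f \<in> bm borel" and b: "\<And>x. 0 <= f x" "\<And>x. f x <= B"
 shows "AE w in Q. real_cond_exp Q (H t) (%w. L t w * f (lam t w)) w = lint (kap (<=) t w) (%x. f x)"
proof -
 define ph where "ph p = Lk t p * f (lev (<=) p t)" for p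
 define K where "K w = nni Q (%w'. ennreal (ph (w, w')))" for w
 define k where "k w = enn2real (K w)" for w
 define X where "X w = L t w * f (lam t w)" for w
 have B0: "0 <= B" using b[of 0] by linarith
 have t0: "0 <= t" "t <= T" using t by auto
 have id: "(%x. x) \<in> measurable Q Q" by simp
 have c2m: "cfg_meas (G >< Q) (%p. c2 (snd p))" for G :: "'a measure" by (rule c2_meas) simp
 have phm: "ph \<in> bm (G >< Q)" if "M1.obs G t" for G
 proof -
  note [measurable] = c1_obs_meas(1,2)[OF that t measurable_fst c2m is_ord(2)]
  show ?thesis unfolding ph_def[abs_def] lev_def by measurable
 qed
 have obs1: "M1.obs G1 t"
 proof -
  have o: "M1.obs G1 T" by (rule obs_G1)
  then have [measurable]: "N1 t \<in> measurable G1 (count_space UNIV)" using t by (auto simp: M1.obs_def)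
  have "Z1 j \<in> bm G1" if "1 <= j" for j using sigma_gen_obs(3)[where X=N1 and Y=Z1, folded G1_def] that by auto
  then show ?thesis using o t unfolding M1.obs_def by auto
 qed
 have ph12: "ph \<in> bm (G1 >< G2)"
 proof -
  have c: "cfg_meas (G1 >< G2) (%p. c2 (snd p))" unfolding c2_def
   by (rule cfg_meas_compose[OF M2.cfg_meas_cfg[OF obs_G2 id_restrict_meas] measurable_snd])
  note [measurable] = c1_obs_meas(1,2)[OF obs1 t measurable_fst c is_ord(2)]
  show ?thesis unfolding ph_def[abs_def] lev_def by measurable
 qed
 have Km: "K \<in> bm G" if "M1.obs G t" for G
  unfolding K_def by (rule borel_measurable_nn_integral) (use phm[OF that] in simp)
 have km: "k \<in> bm G" if "M1.obs G t" for G
  unfolding k_def using Km[OF that] by simp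
 have KmQ [measurable]: "K \<in> bm Q" using measurable_compose[OF id_G(1) Km[OF obs1]] by simp
 have kmQ [measurable]: "k \<in> bm Q" unfolding k_def[abs_def] by measurable
 have phQ [measurable]: "ph \<in> bm QQ" by (rule G_pair_Q[OF ph12])
 have nn: "AE p in QQ. 0 <= ph p"
  using AE_okp by eventually_elim (auto simp: ph_def okp_def intro!: mult_nonneg_nonneg lik_nonneg b)
 have KB: "nni Q (%w. K w) <= ennreal B"
 proof -
  have "nni Q (%w. K w) = nni QQ (%p. ennreal (ph p))" unfolding K_def by (rule nn_integral_fst) simp
  also have "... <= nni QQ (%p. ennreal B * ennreal (Lk t p))"
  proof (rule nn_integral_mono_AE, use AE_okp in eventually_elim)
   fix p assume "okp (c1 (fst p)) (c2 (snd p))"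
   then have "0 <= Lk t p" by (auto simp: okp_def intro!: lik_nonneg)
   then have "ph p <= B * Lk t p" unfolding ph_def using b by (subst mult.commute) (rule mult_right_mono)
   then show "ennreal (ph p) <= ennreal B * ennreal (Lk t p)" using B0 by (simp add: ennreal_mult'[symmetric] ennreal_leI)
  qed
  also have "... = ennreal B * nni QQ (%p. ennreal (Lk t p))" by (rule nn_integral_cmult) measurable
  also have "... <= ennreal B * 1" by (rule mult_left_mono[OF E_lik_le_1[OF t0]]) simp
  finally show ?thesis by simp
 qed
 have fin: "nni Q (%w. K w) \<noteq> \<infinity>" using le_less_trans[OF KB ennreal_less_top] by auto
 have kK: "AE w in Q. ennreal (k w) = K w"
  using nn_integral_PInf_AE[OF KmQ fin] by eventually_elim (simp add: k_def less_top)
 have k_int: "integrable Q k"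
 proof (rule integrableI_bounded[OF kmQ])
  have "nni Q (%w. ennreal (norm (k w))) = nni Q (%w. K w)"
   by (rule nn_integral_cong_AE, use kK in eventually_elim) (simp add: k_def)
  then show "nni Q (%w. ennreal (norm (k w))) < \<infinity>" using fin by (simp add: less_top)
 qed
 have Xe: "AE w in Q. X w = ph (w, w) \<and> 0 <= X w"
  using L_eq AE_space c1_ok c2_ok
  by eventually_elim (use t lam_eq b lik_nonneg in \<open>auto simp: X_def ph_def lev_def\<close>)
 have [measurable]: "L t \<in> bm Q" by (rule L_meas[OF t])
 have "lam t \<in> bm Q"
  using measurable_cong[THEN iffD2, OF lam_eq[OF _ t] meas_intn[OF c1_meas[OF id] c2_meas[OF id] measurable_const is_ord(2)]] by simp
 then have Xm [measurable]: "X \<in> bm Q" unfolding X_def[abs_def] by measurable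
 have diag: "nni Q (%w. indicator A w * ennreal (X w)) = nni Q (%w. indicator A w * K w)" if A: "A \<in> sets G1" for A
 proof -
  have m: "(%p. indicator A (fst p) * ennreal (ph p)) \<in> bm (G1 >< G2)" using A ph12 by measurable
  have AQ: "A \<in> sets Q" using A sets_G_Q by auto
  have "nni Q (%w. indicator A w * ennreal (X w)) = nni Q (%w. indicator A w * ennreal (ph (w, w)))"
   by (rule nn_integral_cong_AE, use Xe in eventually_elim) simp
  also have "... = nni Q (%w. nni Q (%w'. indicator A w * ennreal (ph (w, w'))))"
   using freeze(2)[OF m] by simp
  also have "... = nni Q (%w. indicator A w * K w)"
  proof (rule nn_integral_cong)
   fix w assume w: "w \<in> space Q"
   have "(%w'. ennreal (ph (w, w'))) \<in> bm Q" using w by measurable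
   then show "nni Q (%w'. indicator A w * ennreal (ph (w, w'))) = indicator A w * K w"
    unfolding K_def by (rule nn_integral_cmult)
  qed
  finally show ?thesis .
 qed
 have X_int: "integrable Q X"
 proof (rule integrableI_bounded[OF Xm])
  have "nni Q (%w. ennreal (norm (X w))) = nni Q (%w. indicator (space Q) w * ennreal (X w))"
   by (rule nn_integral_cong_AE, use Xe AE_space in eventually_elim) simp
  also have "... = nni Q (%w. indicator (space Q) w * K w)" using sets.top[of G1] space_G by (intro diag) simp
  also have "... = nni Q (%w. K w)" by (rule nn_integral_cong) simp
  finally show "nni Q (%w. ennreal (norm (X w))) < \<infinity>" using fin by (simp add: less_top)
 qed
 have eqA: "(LINT w:A|Q. X w) = (LINT w:A|Q. k w)" if A: "A \<in> sets G1" for A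
 proof -
  have [measurable]: "A \<in> sets Q" using A sets_G_Q by auto
  have "lint Q (%w. indicator A w * X w) = enn2real (nni Q (%w. ennreal (indicator A w * X w)))"
   by (rule integral_eq_nn_integral, measurable, use Xe in eventually_elim) simp
  also have "nni Q (%w. ennreal (indicator A w * X w)) = nni Q (%w. indicator A w * K w)"
   unfolding diag[OF A, symmetric] by (intro nn_integral_cong) (simp add: indicator_def)
  also have "... = nni Q (%w. ennreal (indicator A w * k w))"
   by (rule nn_integral_cong_AE, use kK in eventually_elim) (simp add: indicator_def)
  also have "enn2real ... = lint Q (%w. indicator A w * k w)"
   by (rule integral_eq_nn_integral[symmetric]) (measurable, simp add: k_def)
  finally show ?thesis by (simp add: set_LINT_indicator)
 qed
 have "subalgebra Q (Hbar t)" "subalgebra Q (H t)"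
  using Hbar_props[OF t] Hbar_sigma(2)[OF t] space_H H_G1[OF t] sets_G_Q by (auto simp: subalgebra_def)
 then interpret hb: finite_measure_subalgebra Q "Hbar t" + h: finite_measure_subalgebra Q "H t" by unfold_locales
 let ?r = "real_cond_exp Q (H t) X"
 have rint: "integrable Q ?r" by (rule h.real_cond_exp_int(1)[OF X_int])
 \<comment> \<open>A set of \<open>Hbar t\<close> may be replaced by its representative in
   \<open>H t\<close>, so equal averages over the sets of \<open>H t\<close> give equal averages
   over those of \<open>Hbar t\<close>.\<close>
 have agree: "(LINT w:A|Q. g w) = (LINT w:A|Q. X w)" if A: "A \<in> sets (Hbar t)" and g: "integrable Q g"
  and e: "\<And>B. B \<in> sets (H t) ==> (LINT w:B|Q. g w) = (LINT w:B|Q. X w)" for A g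
 proof -
  obtain B where B: "A \<in> sets Q" "B \<in> sets (H t)" "AE w in Q. w \<in> A \<longleftrightarrow> w \<in> B" using A Hbar_sigma(1)[OF t] by blast
  have BQ: "B \<in> sets Q" using B(2) H_G1[OF t] sets_G_Q by auto
  have "(LINT w:A|Q. u w) = (LINT w:B|Q. u w)" if u: "integrable Q u" for u :: "'a => real"
   unfolding set_LINT_indicator
  proof (rule integral_cong_AE)
   show "AE w in Q. indicator A w * u w = indicator B w * u w" using B(3) by eventually_elim (simp add: indicator_def)
  qed (use u B(1) BQ in auto)
  then show ?thesis using g X_int e[OF B(2)] by simp
 qed
 have "AE w in Q. real_cond_exp Q (Hbar t) X w = ?r w"
 proof (rule hb.real_cond_exp_charact[OF _ X_int rint])
  show "(LINT w:A|Q. X w) = (LINT w:A|Q. ?r w)" if "A \<in> sets (Hbar t)" for A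
   by (rule agree[OF that rint, symmetric]) (rule h.real_cond_exp_intA[OF X_int, symmetric])
  show "?r \<in> bm (Hbar t)"
  proof (rule measurableI)
   fix A :: "real set" assume "A \<in> sets borel"
   then have "?r -` A \<inter> space (H t) \<in> sets (H t)" by (intro measurable_sets[OF borel_measurable_cond_exp])
   then show "?r -` A \<inter> space (Hbar t) \<in> sets (Hbar t)" using Hbar_props(3)[OF t] by (auto simp: space_H Hbar_sigma(2)[OF t])
  qed simp
 qed
 moreover have "AE w in Q. real_cond_exp Q (Hbar t) X w = k w"
 proof (rule hb.real_cond_exp_charact[OF _ X_int k_int km[OF obs_Hbar[OF t]]])
  show "(LINT w:A|Q. X w) = (LINT w:A|Q. k w)" if "A \<in> sets (Hbar t)" for A
   by (rule agree[OF that k_int, symmetric]) (rule eqA[symmetric], use H_G1[OF t] in auto)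
 qed
 moreover have "AE w in Q. k w = lint (kap (<=) t w) (%x. f x)"
  using c1_ok AE_space
 proof eventually_elim
  case (elim w)
  note [measurable] = section_meas[OF elim(2) is_ord(2)]
  have "lint (kap (<=) t w) (%x. f x) = lint Q (%w'. ph (w, w'))"
   by (simp add: integral_kap(2)[OF elim(2,1) t0(1) is_ord(2) f] ph_def)
  also have "... = k w" unfolding k_def K_def
  proof (rule integral_eq_nn_integral)
   show "(%w'. ph (w, w')) \<in> bm Q" using elim(2) by measurable
   show "AE w' in Q. 0 <= ph (w, w')" using AE_section_pos[OF elim(1)]
    by eventually_elim (simp add: ph_def, intro mult_nonneg_nonneg b, simp add: less_imp_le)
  qed
  finally show ?case by simp
 qed
 ultimately have "AE w in Q. ?r w = lint (kap (<=) t w) (%x. f x)" by eventually_elim simp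
 then show ?thesis by (simp only: X_def[abs_def])
qed

lemma weakly_tendsto_mono: "weakly_tendsto mu \<nu> G ==> G' <= G ==> weakly_tendsto mu \<nu> G'"
 unfolding weakly_tendsto_def using tendsto_mono by blast

lemma weakly_tendsto_cong:
 assumes "weakly_tendsto mu \<nu> G" "\<forall>\<^sub>F s in G. mu s = mu' s"
 shows "weakly_tendsto mu' \<nu> G"
 unfolding weakly_tendsto_def
proof (intro allI impI)
 fix h :: "real => real" assume "continuous_on {0<..} h" "bounded (h ` {0<..})"
 then have "((%s. lint (mu s) (%x. h x)) \<longlongrightarrow> lint \<nu> (%x. h x)) G" using assms(1) by (simp add: weakly_tendsto_def)
 then show "((%s. lint (mu' s) (%x. h x)) \<longlongrightarrow> lint \<nu> (%x. h x)) G"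
  by (rule Lim_transform_eventually) (use assms(2) in \<open>auto elim: eventually_mono\<close>)
qed

lemma fin_meas_kap_le: "regular0 w ==> t \<in> {0..T} ==> fin_meas (kap (<=) t w)"
 by (rule fin_meas_kap) (auto simp: fun_eq_iff)

text \<open>The bounded functions x^k exp(- x) are countably many and determine a finite measure, so
  the exceptional sets can be united.\<close>

lemma filter_eq_kap_at:
 assumes sg: "unnormalized_filter sg" and t: "t \<in> {0..T}"
 shows "AE w in Q. sg t w = kap (<=) t w"
proof -
 define g where "g k = poscut (%x. x ^ k * exp (- 1 * x))" for k
 have g0: "g k x = x ^ k * exp (- 1 * x)" if "0 < x" for k x using that by (simp add: g_def)
 have gb: "0 <= g k x \<and> g k x <= fact k" for k x
  using power_exp_bound[of x 1 k] by (auto simp: g_def poscut_def)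
 have gm: "g k \<in> bm borel" for k unfolding g_def by (rule poscut_borel) (intro continuous_intros)
 have one: "AE w in Q. lint (sg t w) (%x. g k x) = lint (kap (<=) t w) (%x. g k x)" for k
 proof -
  have "bounded (g k ` {0<..})" by (rule boundedI[of _ "fact k"]) (use gb in auto)
  moreover have "g k \<in> bm (restrict_space borel {0<..})" by (rule measurable_restrict_space1[OF gm])
  ultimately have "AE w in Q. lint (sg t w) (%x. g k x) = real_cond_exp Q (H t) (%w. L t w * g k (lam t w)) w"
   using sg t unfolding unnormalized_filter_def by blast
  moreover have "AE w in Q. real_cond_exp Q (H t) (%w. L t w * g k (lam t w)) w = lint (kap (<=) t w) (%x. g k x)"
   by (rule cond_exp_filter[OF t gm]) (use gb in auto)
  ultimately show ?thesis by eventually_elim simp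
 qed
 then have "AE w in Q. \<forall>k. lint (sg t w) (%x. g k x) = lint (kap (<=) t w) (%x. g k x)" by (simp add: AE_all_countable)
 then show ?thesis using AE_regular[OF admissible_zero] AE_space
 proof eventually_elim
  case (elim w)
  have fm: "fin_meas (sg t w)" "fin_meas (kap (<=) t w)"
   using sg t elim(3) fin_meas_kap_le[OF elim(2) t] by (auto simp: unnormalized_filter_def measure_process_def)
  have e: "lint mu (%x. g k x) = lint mu (%x. x ^ k * exp (- 1 * x))" if "fin_meas mu" for mu k
   by (intro Bochner_Integration.integral_cong refl g0) (simp add: fin_meas_space[OF that])
  show ?case by (rule fin_meas_eqI[OF fm, of 1]) (use elim(1) e[OF fm(1)] e[OF fm(2)] in auto)
 qed
qed

text \<open>Equality at rational times extends by right-continuity of both sides. The horizon is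
  added to the rational times because there is no time to its right.\<close>

lemma filter_eq_kap:
 assumes sg: "unnormalized_filter sg"
 shows "AE w in Q. \<forall>t\<in>{0..T}. sg t w = kap (<=) t w"
proof -
 let ?D = "insert T (\<rat> \<inter> {0..T})"
 have "AE w in Q. \<forall>t\<in>?D. sg t w = kap (<=) t w"
  using filter_eq_kap_at[OF sg] T_pos countable_rat by (intro AE_ball_countable') auto
 moreover have "AE w in Q. cadlag_path T (%t. sg t w)" using sg by (simp add: unnormalized_filter_def measure_process_def)
 ultimately show ?thesis using AE_regular[OF admissible_zero] AE_space
 proof eventually_elim
  case (elim w)
  show ?case
  proof
   fix t assume t: "t \<in> {0..T}"
   show "sg t w = kap (<=) t w"
   proof (cases "t = T")
    case False
    then have tT: "t \<in> {0..<T}" using t by auto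
    \<comment> \<open>The right limit along the rationals, where the two measures are already known
      to agree.\<close>
    let ?G = "at t within ({t<..} \<inter> \<rat>)"
    have sub: "?G <= at_right t" by (rule at_le) auto
    have "t islimpt ({t<..} \<inter> \<rat>)" unfolding islimpt_approachable
    proof (intro allI impI)
     fix e :: real assume "0 < e"
     then obtain q where q: "q \<in> \<rat>" "t < q" "q < t + e" using Rats_dense_in_real[of t "t + e"] by auto
     then show "\<exists>x'\<in>{t<..} \<inter> \<rat>. x' \<noteq> t \<and> dist x' t < e" by (intro bexI[of _ q]) (auto simp: dist_real_def)
    qed
    then have ne: "?G \<noteq> bot" by (simp add: trivial_limit_within)
    have ev: "\<forall>\<^sub>F s in ?G. kap (<=) s w = sg s w"
    proof -
     have "\<forall>\<^sub>F s in at_right t. s < T" using eventually_at_right_real[of t T] tT by (auto elim: eventually_mono)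
     then have "\<forall>\<^sub>F s in ?G. s < T" by (rule filter_leD[OF sub])
     moreover have "\<forall>\<^sub>F s in ?G. s \<in> {t<..} \<inter> \<rat>" by (simp add: eventually_at_filter)
     ultimately show ?thesis by eventually_elim (use elim(1) tT in auto)
    qed
    show ?thesis
    proof (rule weak_limit_unique[of _ _ "%t. sg t w" ?G])
     show "fin_meas (sg t w)" "fin_meas (kap (<=) t w)"
      using sg t elim(4) fin_meas_kap_le[OF elim(3) t] by (auto simp: unnormalized_filter_def measure_process_def)
     show "weakly_tendsto (%t. sg t w) (sg t w) ?G"
      using elim(2) tT sub by (auto simp: cadlag_path_def intro: weakly_tendsto_mono)
     show "weakly_tendsto (%t. sg t w) (kap (<=) t w) ?G"
      by (rule weakly_tendsto_cong[OF weakly_tendsto_mono[OF kap_weak(1)[OF elim(3) tT] sub] ev])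
    qed (rule ne)
   qed (use elim(1) in simp)
  qed
 qed
qed

section \<open>Uniqueness\<close>

definition mf :: "nat => real => real" where "mf k x = x ^ k * exp (- (1 / \<alpha>) * x)"

text \<open>The bound of \<open>power_exp_bound\<close> for c = 1 / \<alpha>.\<close>

definition mb :: "nat => real" where "mb k = fact k / (1 / \<alpha>) ^ k"

lemma mf_bounds: "0 <= x ==> 0 <= mf k x" "0 <= x ==> mf k x <= mb k"
 using power_exp_bound[of x "1 / \<alpha>" k] params_pos by (auto simp: mf_def mb_def)

lemma mf_abs: "0 <= x ==> \<bar>mf k x\<bar> <= mb k"
 using mf_bounds[of x k] by simp

lemma mf_Suc: "x * mf k x = mf (Suc k) x"
 by (simp add: mf_def)

lemma mf_meas [measurable]: "mf k \<in> bm borel"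
 unfolding mf_def[abs_def] by measurable

lemma mf_deriv: "(mf k has_real_derivative real k * mf (k - 1) x - 1 / \<alpha> * mf k x) (at x)"
 unfolding mf_def[abs_def] by (auto intro!: derivative_eq_intros simp: algebra_simps params_pos less_imp_neq[OF params_pos(1), symmetric])

lemma mf_integrable: "fin_meas \<nu> ==> integrable \<nu> (mf k)"
 by (rule fin_meas_integrable[of _ _ "mb k"]) (use mf_abs[of _ k] in auto)

lemma P_bounded:
 assumes t: "t \<in> {0..T}" and le: "\<And>x. 0 < x ==> g x <= ennreal B"
 shows "nni P (%w. (\<integral>\<^sup>+s\<in>{0..t}. g (lam s w) \<partial>lborel)) < \<infinity>"
proof -
 have "nni P (%w. (\<integral>\<^sup>+s\<in>{0..t}. g (lam s w) \<partial>lborel)) <= nni P (%w. (\<integral>\<^sup>+s\<in>{0..T}. ennreal B \<partial>lborel))"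
 proof (rule nn_integral_mono_AE, use AE_P_pos in eventually_elim)
  fix w assume "\<forall>s\<in>{0..T}. 0 < lam s w"
  then show "(\<integral>\<^sup>+s\<in>{0..t}. g (lam s w) \<partial>lborel) <= (\<integral>\<^sup>+s\<in>{0..T}. ennreal B \<partial>lborel)"
   using t by (intro nn_integral_mono) (auto simp: indicator_def intro: le)
 qed
 also have "... = nni QQ (%p. ennreal (Lk T p) * nni lborel (%r. indicator {0<..T} r * ennreal B))"
  using P_time_integral[of "%_. ennreal B"] by simp
 also have "... = nni QQ (%p. ennreal (Lk T p) * (ennreal B * ennreal T))"
  using T_pos by (simp add: nn_integral_cmult_indicator mult.commute[of "indicator _ _"])
 also have "... = nni QQ (%p. ennreal (Lk T p)) * (ennreal B * ennreal T)" by (rule nn_integral_multc) measurable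
 also have "... <= 1 * (ennreal B * ennreal T)" using T_pos by (intro mult_right_mono E_lik_le_1) auto
 also have "... < \<infinity>" by (simp add: ennreal_mult_less_top)
 finally show ?thesis .
qed

lemma mf_jump1: "0 < x ==> 0 <= y ==> \<bar>x * mf k (x + y)\<bar> <= mb (Suc k)"
proof -
 assume a: "0 < x" "0 <= y"
 then have "x * mf k (x + y) <= (x + y) * mf k (x + y)" by (intro mult_right_mono mf_bounds) auto
 also have "... <= mb (Suc k)" using a unfolding mf_Suc by (intro mf_bounds) auto
 finally show ?thesis using a mf_bounds(1)[of "x + y" k] by simp
qed

text \<open>Multiplication by x only raises the index, so all integrands of the domain conditions
  are bounded and \<open>P_bounded\<close> applies.\<close>

lemma mf_domain: "mf k \<in> gen_domain"
proof -
 interpret P1: prob_space F1 by (rule M1.prob_space_K)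
 interpret P2: prob_space F2 by (rule M2.prob_space_K)
 have "mf k C1_differentiable_on {0<..}" unfolding C1_differentiable_on_def
 proof (intro exI[of _ "%x. real k * mf (k - 1) x - 1 / \<alpha> * mf k x"] conjI ballI)
  show "(mf k has_vector_derivative real k * mf (k - 1) x - 1 / \<alpha> * mf k x) (at x)" for x
   using mf_deriv by (simp add: has_real_derivative_iff_has_vector_derivative)
  show "continuous_on {0<..} (%x. real k * mf (k - 1) x - 1 / \<alpha> * mf k x)"
   unfolding mf_def by (intro continuous_intros)
 qed
 moreover have "(\<integral>\<^sup>+z\<in>{0<..}. ennreal (\<bar>mf k (x + ell z) - mf k x\<bar> * x) \<partial>F1) <= ennreal (2 * mb (Suc k))" if x: "0 < x" for x
 proof -
  have "\<bar>mf k (x + ell z) - mf k x\<bar> * x <= 2 * mb (Suc k)" if "0 < z" for z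
  proof -
   have "\<bar>x * mf k (x + ell z)\<bar> <= mb (Suc k)" "\<bar>x * mf k (x + 0)\<bar> <= mb (Suc k)"
    using mf_jump1[OF x, of "ell z"] mf_jump1[OF x, of 0] ell_nonneg[of z] that by auto
   moreover have "\<bar>mf k (x + ell z) - mf k x\<bar> * x = \<bar>x * mf k (x + ell z) - x * mf k (x + 0)\<bar>"
    using x by (simp add: abs_mult right_diff_distrib[symmetric] mult.commute)
   ultimately show ?thesis by linarith
  qed
  then have "(\<integral>\<^sup>+z\<in>{0<..}. ennreal (\<bar>mf k (x + ell z) - mf k x\<bar> * x) \<partial>F1) <= nni F1 (%z. ennreal (2 * mb (Suc k)))"
   by (intro nn_integral_mono) (auto simp: indicator_def intro!: ennreal_leI)
  then show ?thesis by (simp add: P1.emeasure_space_1[unfolded M1.space_K])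
 qed
 moreover have "(\<integral>\<^sup>+z\<in>{0<..}. ennreal \<bar>mf k (x + z) - mf k x\<bar> \<partial>F2) <= ennreal (2 * mb k)" if x: "0 < x" for x
 proof -
  have "\<bar>mf k (x + z) - mf k x\<bar> <= 2 * mb k" if "0 < z" for z
   using mf_abs[of "x + z" k] mf_abs[of x k] x that by simp
  then have "(\<integral>\<^sup>+z\<in>{0<..}. ennreal \<bar>mf k (x + z) - mf k x\<bar> \<partial>F2) <= nni F2 (%z. ennreal (2 * mb k))"
   by (intro nn_integral_mono) (auto simp: indicator_def intro!: ennreal_leI)
  then show ?thesis by (simp add: P2.emeasure_space_1[unfolded M2.space_K])
 qed
 moreover have "ennreal (x * \<bar>deriv (mf k) x\<bar>) <= ennreal (real k * mb (Suc (k - 1)) + 1 / \<alpha> * mb (Suc k))" if x: "0 < x" for x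
 proof (rule ennreal_leI)
  have "x * \<bar>deriv (mf k) x\<bar> = \<bar>x * (real k * mf (k - 1) x - 1 / \<alpha> * mf k x)\<bar>"
   using x by (simp add: DERIV_imp_deriv[OF mf_deriv] abs_mult)
  also have "x * (real k * mf (k - 1) x - 1 / \<alpha> * mf k x) = real k * (x * mf (k - 1) x) - 1 / \<alpha> * (x * mf k x)" by (simp add: algebra_simps)
  also have "\<bar>...\<bar> <= \<bar>real k * mf (Suc (k - 1)) x\<bar> + \<bar>1 / \<alpha> * mf (Suc k) x\<bar>" unfolding mf_Suc by (rule abs_triangle_ineq4)
  also have "... <= real k * mb (Suc (k - 1)) + 1 / \<alpha> * mb (Suc k)"
   unfolding abs_mult using x params_pos(1) mf_abs[of x] by (intro add_mono mult_mono) auto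
  finally show "x * \<bar>deriv (mf k) x\<bar> <= real k * mb (Suc (k - 1)) + 1 / \<alpha> * mb (Suc k)" .
 qed
 ultimately show ?thesis unfolding gen_domain_def
  by (intro CollectI conjI ballI) (assumption | rule P_bounded)+
qed

definition cf :: "nat => real" where "cf i = lint F2 (%z. mf i z)"

text \<open>The generator on \<open>mf k\<close> without the gain x f(x + ell z) of the observed
  jumps, as a linear form in the moments of order at most \<open>k\<close>. The numbers
  \<open>cf\<close> are the damped moments of the second mark.\<close>

definition dr :: "nat => (nat => real) => real" where
 "dr k m = \<alpha> * \<beta> * (real k * m (k - 1)) - (\<beta> + \<alpha> * real k + \<rho>) * m k
  + \<rho> * (\<Sum>j\<le>k. real (k choose j) * cf (k - j) * m j)"

lemma F_bounded_integrable:
 fixes h :: "real => real"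
 assumes [measurable]: "h \<in> bm borel" and b: "\<And>z. 0 < z ==> \<bar>h z\<bar> <= B"
 shows "integrable F1 h" "integrable F2 h"
proof -
 interpret P1: prob_space F1 by (rule M1.prob_space_K)
 interpret P2: prob_space F2 by (rule M2.prob_space_K)
 have "AE z in F1. norm (h z) <= B" using F_pos(1) by eventually_elim (simp add: b)
 then show "integrable F1 h" by (rule P1.integrable_const_bound) measurable
 have "AE z in F2. norm (h z) <= B" using F_pos(2) by eventually_elim (simp add: b)
 then show "integrable F2 h" by (rule P2.integrable_const_bound) measurable
qed

lemma LINT_F1_pos:
 assumes [measurable]: "h \<in> bm borel" and e: "\<And>z. 0 < z ==> g z = h z"
 shows "(LINT z:{0<..}|F1. g z) = (lint F1 (%z. h z) :: real)"
proof -
 have "(LINT z:{0<..}|F1. g z) = lint F1 (%z. indicator {0<..} z * h z)"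
  unfolding set_lebesgue_integral_def by (intro Bochner_Integration.integral_cong refl) (simp add: indicator_def e)
 also have "... = lint F1 (%z. h z)"
 proof (rule integral_cong_AE)
  show "AE z in F1. indicator {0<..} z * h z = h z" using F_pos(1) by eventually_elim simp
 qed measurable
 finally show ?thesis .
qed

lemma LINT_F2_pos:
 assumes [measurable]: "h \<in> bm borel" and e: "\<And>z. 0 < z ==> g z = h z"
 shows "(LINT z:{0<..}|F2. g z) = (lint F2 (%z. h z) :: real)"
proof -
 have "(LINT z:{0<..}|F2. g z) = lint F2 (%z. indicator {0<..} z * h z)"
  unfolding set_lebesgue_integral_def by (intro Bochner_Integration.integral_cong refl) (simp add: indicator_def e)
 also have "... = lint F2 (%z. h z)"
 proof (rule integral_cong_AE)
  show "AE z in F2. indicator {0<..} z * h z = h z" using F_pos(2) by eventually_elim simp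
 qed measurable
 finally show ?thesis .
qed

text \<open>Binomial theorem, with the exponential factor splitting as a product. It separates the
  state from the mark.\<close>

lemma mf_add: "mf k (x + z) = (\<Sum>j\<le>k. real (k choose j) * mf j x * mf (k - j) z)"
proof -
 have "mf k (x + z) = (\<Sum>j\<le>k. real (k choose j) * x ^ j * z ^ (k - j)) * (exp (- (1 / \<alpha>) * x) * exp (- (1 / \<alpha>) * z))"
  unfolding mf_def binomial_ring exp_add[symmetric] by (simp add: add_divide_distrib)
 also have "... = (\<Sum>j\<le>k. real (k choose j) * mf j x * mf (k - j) z)"
  unfolding sum_distrib_right by (intro sum.cong refl) (simp add: mf_def)
 finally show ?thesis .
qed

lemma mf_gen:
 assumes x: "0 < x"
 shows "gen (mf k) x = lint F1 (%z. x * mf k (x + ell' z)) + dr k (%j. mf j x)"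
proof -
 interpret P1: prob_space F1 by (rule M1.prob_space_K)
 interpret P2: prob_space F2 by (rule M2.prob_space_K)
 have "\<bar>x * mf k (x + ell' z)\<bar> <= mb (Suc k)" for z by (rule mf_jump1[OF x ell'_nonneg])
 then have i1: "integrable F1 (%z. x * mf k (x + ell' z))" by (intro F_bounded_integrable) measurable
 have "(LINT z:{0<..}|F1. (mf k (x + ell z) - mf k x) * x) = lint F1 (%z. x * mf k (x + ell' z) - x * mf k x)"
  by (rule LINT_F1_pos) (measurable, simp add: ell'_def algebra_simps)
 also have "... = lint F1 (%z. x * mf k (x + ell' z)) - x * mf k x"
  using i1 by (subst Bochner_Integration.integral_diff) (auto simp: P1.prob_space[unfolded M1.space_K])
 finally have a: "(LINT z:{0<..}|F1. (mf k (x + ell z) - mf k x) * x) = lint F1 (%z. x * mf k (x + ell' z)) - x * mf k x" .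
 have i2: "integrable F2 (mf j)" for j by (rule F_bounded_integrable(2)[of _ "mb j"]) (use mf_abs in auto)
 have "(LINT z:{0<..}|F2. (mf k (x + z) - mf k x) * \<rho>) = lint F2 (%z. \<rho> * (\<Sum>j\<le>k. real (k choose j) * mf j x * mf (k - j) z) - \<rho> * mf k x)"
  by (rule LINT_F2_pos) (measurable, simp only: mf_add[symmetric], simp add: algebra_simps)
 also have "... = lint F2 (%z. \<rho> * (\<Sum>j\<le>k. real (k choose j) * mf j x * mf (k - j) z)) - \<rho> * mf k x"
  using i2 by (subst Bochner_Integration.integral_diff) (auto simp: P2.prob_space[unfolded M2.space_K])
 also have "lint F2 (%z. \<rho> * (\<Sum>j\<le>k. real (k choose j) * mf j x * mf (k - j) z)) = \<rho> * (\<Sum>j\<le>k. real (k choose j) * cf (k - j) * mf j x)"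
  using i2 by (simp add: Bochner_Integration.integral_sum cf_def mult_ac)
 finally have b: "(LINT z:{0<..}|F2. (mf k (x + z) - mf k x) * \<rho>) = \<rho> * (\<Sum>j\<le>k. real (k choose j) * cf (k - j) * mf j x) - \<rho> * mf k x" .
 have kx: "real k * (x * mf (k - 1) x) = real k * mf k x" by (cases k) (simp_all add: mf_Suc)
 \<comment> \<open>The last term \<open>x * mf k x\<close> is cancelled by the loss at observed
   jumps in \<open>a\<close>; this is where the rate 1 / \<alpha> enters.\<close>
 have "\<alpha> * (\<beta> - x) * (real k * mf (k - 1) x - 1 / \<alpha> * mf k x)
  = \<alpha> * \<beta> * (real k * mf (k - 1) x) - \<beta> * mf k x - \<alpha> * (real k * (x * mf (k - 1) x)) + x * mf k x"
  using params_pos(1) by (simp add: field_simps)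
 then show ?thesis unfolding gen_def a b DERIV_imp_deriv[OF mf_deriv] dr_def kx by (simp add: algebra_simps)
qed

text \<open>By Fubini the gain at observed jumps in the generator equals the gain in the
  compensator. It drops out of the difference, and \<open>ell\<close> with it, so that only moments
  are left.\<close>

lemma moment_drift:
 assumes \<nu>: "fin_meas \<nu>"
 shows "lint \<nu> (%x. gen (mf k) x) - (LINT z:{0<..}|F1. lint \<nu> (%x. x * mf k (x + ell z)) - lint \<nu> (%x. mf k x))
  = dr k (%j. lint \<nu> (%x. mf j x)) + lint \<nu> (%x. mf k x)"
proof -
 interpret P1: prob_space F1 by (rule M1.prob_space_K)
 interpret N: finite_measure \<nu> using \<nu> by (simp add: fin_meas_def)
 interpret NP: pair_sigma_finite \<nu> F1 ..
 interpret NF: finite_measure "\<nu> >< F1" by (rule finite_measure_pair_measure) unfold_locales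
 let ?h = "%x z. x * mf k (x + ell' z)"
 note sp = fin_meas_space[OF \<nu>]
 have id [measurable]: "(%x. x) \<in> bm \<nu>" by (rule fin_meas_borel[OF \<nu>]) simp
 have hm [measurable]: "(%(x, z). ?h x z) \<in> bm (\<nu> >< F1)" by measurable
 have "\<bar>?h x z\<bar> <= mb (Suc k)" if "0 < x" for x z by (rule mf_jump1[OF that ell'_nonneg])
 then have hi: "integrable (\<nu> >< F1) (%(x, z). ?h x z)"
  by (intro NF.integrable_const_bound[of _ "mb (Suc k)"] AE_I2) (auto simp: space_pair_measure sp)
 have fub: "lint \<nu> (%x. lint F1 (%z. ?h x z)) = lint F1 (%z. lint \<nu> (%x. ?h x z))" by (rule NP.Fubini_integral[OF hi, symmetric])
 have hi1: "integrable \<nu> (%x. lint F1 (%z. ?h x z))" using NP.integrable_fst[OF hi] .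
 have hi2: "integrable F1 (%z. lint \<nu> (%x. ?h x z))" using NP.integrable_snd[OF hi] .
 have im: "integrable \<nu> (mf j)" for j by (rule mf_integrable[OF \<nu>])
 have di: "integrable \<nu> (%x. dr k (%j. mf j x))" unfolding dr_def using im by simp
 have d: "lint \<nu> (%x. dr k (%j. mf j x)) = dr k (%j. lint \<nu> (%x. mf j x))"
  unfolding dr_def using im by (simp add: Bochner_Integration.integral_sum)
 have "lint \<nu> (%x. gen (mf k) x) = lint \<nu> (%x. lint F1 (%z. ?h x z) + dr k (%j. mf j x))"
  by (intro Bochner_Integration.integral_cong refl mf_gen) (simp add: sp)
 also have "... = lint F1 (%z. lint \<nu> (%x. ?h x z)) + dr k (%j. lint \<nu> (%x. mf j x))"
  unfolding Bochner_Integration.integral_add[OF hi1 di] fub d ..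
 finally have 1: "lint \<nu> (%x. gen (mf k) x) = lint F1 (%z. lint \<nu> (%x. ?h x z)) + dr k (%j. lint \<nu> (%x. mf j x))" .
 have "(%z. lint \<nu> (%x. ?h x z)) \<in> bm F1" using hi2 by simp
 then have m: "(%z. lint \<nu> (%x. ?h x z) - lint \<nu> (%x. mf k x)) \<in> bm borel"
  by (simp add: measurable_cong_sets[OF M1.sets_K refl])
 have "(LINT z:{0<..}|F1. lint \<nu> (%x. x * mf k (x + ell z)) - lint \<nu> (%x. mf k x)) = lint F1 (%z. lint \<nu> (%x. ?h x z) - lint \<nu> (%x. mf k x))"
  by (rule LINT_F1_pos[OF m]) (simp add: ell'_def)
 also have "... = lint F1 (%z. lint \<nu> (%x. ?h x z)) - lint \<nu> (%x. mf k x)"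
  using hi2 by (subst Bochner_Integration.integral_diff) (auto simp: P1.prob_space[unfolded M1.space_K])
 finally show ?thesis unfolding 1 by simp
qed

end

text \<open>The integral equation makes \<open>u\<close> continuous and then differentiable; exp(- c
  s) u(s) is constant and vanishes at 0.\<close>

lemma linear_ode_zero:
 fixes u :: "real => real"
 assumes t: "0 <= t" and i: "(%r. c * u r) integrable_on {0..t}" and eq: "\<And>s. s \<in> {0..t} ==> u s = integral {0..s} (%r. c * u r)"
 shows "u t = 0"
proof -
 have "continuous_on {0..t} (%s. integral {0..s} (%r. c * u r))" by (rule indefinite_integral_continuous_1[OF i])
 then have cu: "continuous_on {0..t} u" by (rule continuous_on_eq) (simp add: eq)
 have c: "continuous_on {0..t} (%r. c * u r)" using cu by (intro continuous_intros)
 have d: "(u has_real_derivative c * u s) (at s within {0..t})" if s: "s \<in> {0..t}" for s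
 proof -
  have "((%s. integral {0..s} (%r. c * u r)) has_vector_derivative c * u s) (at s within {0..t})"
   by (rule integral_has_vector_derivative[OF c s])
  then have "(u has_vector_derivative c * u s) (at s within {0..t})"
   by (rule has_vector_derivative_transform[OF s, rotated]) (simp add: eq)
  then show ?thesis by (simp add: has_real_derivative_iff_has_vector_derivative)
 qed
 have "((%s. exp (- c * s) * u s) has_real_derivative 0) (at s within {0..t})" if "s \<in> {0..t}" for s
  by (rule derivative_eq_intros d[OF that] refl | simp add: algebra_simps)+
 then have "\<exists>a. \<forall>s\<in>{0..t}. exp (- c * s) * u s = a"
  by (intro has_field_derivative_zero_constant convex_real_interval) auto
 then obtain a where a: "\<And>s. s \<in> {0..t} ==> exp (- c * s) * u s = a" by blast
 have "u 0 = 0" using eq[of 0] t by simp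
 then have "a = 0" using a[of 0] t by simp
 then show ?thesis using a[of t] t by simp
qed

context jump_cluster_model
begin

text \<open>The equation for the countably many functions \<open>mf k\<close> along one path;
  everything up to \<open>solves_unique\<close> is then pathwise.\<close>

definition solves :: "(real => 'a => real measure) => 'a => bool" where
 "solves mu w \<longleftrightarrow> w \<in> space Q \<and> (\<forall>t\<in>{0..T}. fin_meas (mu t w)) \<and> cadlag_path T (%t. mu t w) \<and>
  (\<forall>k. zakai_well_defined (mf k) mu w \<and> (\<forall>t\<in>{0..T}. zakai_equation (mf k) mu w t))"

lemma AE_solves:
 assumes "strong_solution mu"
 shows "AE w in Q. solves mu w"
proof -
 have "AE w in Q. zakai_well_defined (mf k) mu w \<and> (\<forall>t\<in>{0..T}. zakai_equation (mf k) mu w t)" for k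
  using assms mf_domain[of k] by (simp add: strong_solution_def)
 then have "AE w in Q. \<forall>k. zakai_well_defined (mf k) mu w \<and> (\<forall>t\<in>{0..T}. zakai_equation (mf k) mu w t)"
  by (intro AE_all_countable[THEN iffD2] allI)
 moreover have "AE w in Q. cadlag_path T (%t. mu t w)" using assms by (simp add: strong_solution_def measure_process_def)
 ultimately show ?thesis using AE_space
  by eventually_elim (use assms in \<open>auto simp: solves_def strong_solution_def measure_process_def\<close>)
qed

definition mom :: "(real => 'a => real measure) => 'a => nat => real => real" where
 "mom mu w k t = lint (mu t w) (%x. mf k x)"

definition jmp :: "(real => 'a => real measure) => 'a => nat => real => real" where
 "jmp mu w k t = (LINT p:{0<..t} \<times> {0<..}|jump_measure T N1 Z1 w. zakai_integrand (mf k) (%t. mu t w) p)"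

context
 fixes mu w
 assumes sol: "solves mu w"
begin

lemma solD: "w \<in> space Q" "t \<in> {0..T} ==> fin_meas (mu t w)" "cadlag_path T (%t. mu t w)"
 "zakai_well_defined (mf k) mu w" "t \<in> {0..T} ==> zakai_equation (mf k) mu w t"
 using sol by (auto simp: solves_def)

lemma sol_left: "s \<in> {0<..T} ==> \<exists>\<nu>. fin_meas \<nu> \<and> weakly_tendsto (%t. mu t w) \<nu> (at_left s)"
 using solD(3) by (simp only: cadlag_path_def)

abbreviation zi :: "nat => real \<times> real => real" where "zi k \<equiv> zakai_integrand (mf k) (%t. mu t w)"

text \<open>Total drift of the \<open>k\<close>-th moment between jumps: the generator at
  \<open>s\<close> minus the compensator, the latter still evaluated at the left limit.\<close>

definition rate :: "nat => real => real" where
 "rate k s = lint (mu s w) (%x. gen (mf k) x) - (LINT z:{0<..}|F1. zi k (s, z))"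

lemma rate_eq:
 assumes t: "t \<in> {0..T}"
 shows "rate k integrable_on {0..t}" "mom mu w k t = mf k l0 + integral {0..t} (rate k) + jmp mu w k t"
proof -
 interpret P1: prob_space F1 by (rule M1.prob_space_K)
 interpret LP: pair_sigma_finite lborel F1 ..
 let ?S = "%t::real. {0<..t} \<times> {0::real<..}"
 let ?I = "%s. LINT z:{0<..}|F1. zi k (s, z)"
 have "set_integrable (lborel >< F1) (?S T) (zi k)"
  and g: "set_integrable lborel {0..T} (%s. lint (mu s w) (%x. gen (mf k) x))"
  using solD(4)[of k] by (auto simp: zakai_well_defined_def)
 moreover have "?S t \<in> sets (lborel >< F1)" "?S t \<subseteq> ?S T" using t by auto
 ultimately have zi: "set_integrable (lborel >< F1) (?S t) (zi k)" by (blast intro: set_integrable_subset)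
 have e: "lint F1 (%z. indicator (?S t) (s, z) *\<^sub>R zi k (s, z)) = indicator {0<..t} s *\<^sub>R ?I s" for s
  by (cases "s \<in> {0<..t}") (auto simp: set_lebesgue_integral_def indicator_def intro: Bochner_Integration.integral_cong)
 have "integrable lborel (%s. indicator {0<..t} s *\<^sub>R ?I s)"
  using LP.integrable_fst'[OF zi[unfolded set_integrable_def]] by (simp only: e)
 then have I1: "set_integrable lborel {0<..t} ?I" by (simp add: set_integrable_def)
 have "integrable lborel (%s. indicator {0..t} s *\<^sub>R ?I s)"
  by (rule integrable_discrete_difference[where X="{0}", THEN iffD1, OF _ _ _ _ I1[unfolded set_integrable_def]]) (auto simp: indicator_def)
 then have I: "set_integrable lborel {0..t} ?I" by (simp add: set_integrable_def)
 have comp: "(LINT p:?S t|lborel >< F1. zi k p) = (LINT s:{0..t}|lborel. ?I s)"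
  unfolding LINT_Icc_Ioc using LP.integral_fst'[OF zi[unfolded set_integrable_def]] unfolding set_lebesgue_integral_def[where M="lborel >< F1"] set_lebesgue_integral_def[where M=lborel] e by simp
 have g': "set_integrable lborel {0..t} (%s. lint (mu s w) (%x. gen (mf k) x))"
  by (rule set_integrable_subset[OF g]) (use t in auto)
 have r: "set_integrable lborel {0..t} (rate k)" unfolding rate_def[abs_def] by (rule set_integral_diff(1)[OF g' I])
 show "rate k integrable_on {0..t}" by (rule set_borel_integral_eq_integral(1)[OF r])
 have "mom mu w k t = mf k l0 + ((LINT s:{0..t}|lborel. lint (mu s w) (%x. gen (mf k) x)) - (LINT s:{0..t}|lborel. ?I s)) + jmp mu w k t"
  using solD(5)[OF t, of k] unfolding zakai_equation_def mom_def jmp_def comp by simp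
 also have "(LINT s:{0..t}|lborel. lint (mu s w) (%x. gen (mf k) x)) - (LINT s:{0..t}|lborel. ?I s) = (LINT s:{0..t}|lborel. rate k s)"
  unfolding rate_def by (rule set_integral_diff(2)[OF g' I, symmetric])
 also have "... = integral {0..t} (rate k)" by (rule set_borel_integral_eq_integral(2)[OF r])
 finally show "mom mu w k t = mf k l0 + integral {0..t} (rate k) + jmp mu w k t" .
qed

lemma jmp_meas: "set_integrable (jump_measure T N1 Z1 w) ({0<..t} \<times> {0<..}) (zi k)" if "t \<in> {0..T}"
proof (rule set_integrable_subset)
 show "set_integrable (jump_measure T N1 Z1 w) ({0<..T} \<times> {0<..}) (zi k)"
  using solD(4)[of k] by (auto simp: zakai_well_defined_def)
qed (use that in \<open>auto simp: jump_measure_def\<close>)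

lemma jmp_const:
 assumes "u \<in> {0..T}" "s \<in> {0..T}" "u <= s" and no: "times (c1 w) \<inter> {u<..s} = {}"
 shows "jmp mu w k u = jmp mu w k s"
 unfolding jmp_def set_lebesgue_integral_def
proof (rule integral_cong_AE)
 show "AE p in jump_measure T N1 Z1 w. indicator ({0<..u} \<times> {0<..}) p *\<^sub>R zi k p = indicator ({0<..s} \<times> {0<..}) p *\<^sub>R zi k p"
 proof (rule jump_measure_AE[OF solD(1)])
  fix j assume "j \<in> {1..N1 T w}"
  then have "tm (c1 w) j \<in> times (c1 w)" by (auto simp: times_def num_c1)
  then have "tm (c1 w) j \<notin> {u<..s}" using no by auto
  then show "indicator ({0<..u} \<times> {0<..}) (tm (c1 w) j, Z1 j w) *\<^sub>R zi k (tm (c1 w) j, Z1 j w)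
   = indicator ({0<..s} \<times> {0<..}) (tm (c1 w) j, Z1 j w) *\<^sub>R zi k (tm (c1 w) j, Z1 j w)"
   using assms(3) by (auto simp: indicator_def)
 qed
qed (use jmp_meas[OF assms(1)] jmp_meas[OF assms(2)] in \<open>auto simp: set_integrable_def\<close>)

text \<open>Off the observed jumps the equation itself makes every moment left-continuous, so the
  left limit has the same moments as the measure at \<open>s\<close>. This reconciles the generator,
  taken at \<open>s\<close>, with the compensator, taken at the left limit.\<close>

lemma left_lim_off_jumps:
 assumes s: "s \<in> {0<..T}" "s \<notin> times (c1 w)"
 shows "left_lim (%t. mu t w) s = mu s w"
proof -
 have sT: "s \<in> {0..T}" using s by auto
 obtain \<nu> where \<nu>: "fin_meas \<nu>" "weakly_tendsto (%t. mu t w) \<nu> (at_left s)"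
  using sol_left[OF s(1)] by blast
 have "\<nu> = mu s w"
 proof (rule fin_meas_eqI[OF \<nu>(1) solD(2)[OF sT]])
  show "0 < 1 / \<alpha>" using params_pos by simp
  fix k
  have "continuous_on {0<..} (mf k)" unfolding mf_def by (intro continuous_intros)
  moreover have "bounded (mf k ` {0<..})" by (rule boundedI[of _ "mb k"]) (use mf_abs in auto)
  ultimately have 1: "((%u. mom mu w k u) \<longlongrightarrow> lint \<nu> (%x. mf k x)) (at_left s)"
   using \<nu>(2) by (simp add: weakly_tendsto_def mom_def)
  have c: "continuous_on {0..s} (%u. integral {0..u} (rate k))" by (rule indefinite_integral_continuous_1[OF rate_eq(1)[OF sT]])
  have "((%u. integral {0..u} (rate k)) \<longlongrightarrow> integral {0..s} (rate k)) (at s within {0..s})"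
   using c sT by (simp add: continuous_on_def)
  moreover have "at s within {0..s} = at_left s" using s by (simp add: at_within_Icc_at_left)
  ultimately have "((%u. mf k l0 + integral {0..u} (rate k) + jmp mu w k s) \<longlongrightarrow> mf k l0 + integral {0..s} (rate k) + jmp mu w k s) (at_left s)"
   by (intro tendsto_intros) simp
  moreover have "\<forall>\<^sub>F u in at_left s. mf k l0 + integral {0..u} (rate k) + jmp mu w k s = mom mu w k u"
  proof -
   have "\<forall>\<^sub>F u in at_left s. \<forall>x\<in>times (c1 w). x \<notin> {u<..s}"
   proof (rule eventually_ball_finite, simp, safe)
    fix x assume "x \<in> times (c1 w)"
    then have "x \<noteq> s" using s(2) by auto
    then show "\<forall>\<^sub>F u in at_left s. x \<notin> {u<..s}"
     using eventually_at_left_real[of x s] by (cases "x < s") (auto elim: eventually_mono)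
   qed
   moreover have "\<forall>\<^sub>F u in at_left s. u \<in> {0<..<s}" using eventually_at_left_real[of 0 s] s by auto
   ultimately show ?thesis
   proof eventually_elim
    case (elim u)
    then have u: "u \<in> {0..T}" using s by auto
    have "times (c1 w) \<inter> {u<..s} = {}" "u <= s" using elim by auto
    then show ?case using rate_eq(2)[OF u, of k] jmp_const[OF u sT, of k] by simp
   qed
  qed
  ultimately have "((%u. mom mu w k u) \<longlongrightarrow> mf k l0 + integral {0..s} (rate k) + jmp mu w k s) (at_left s)"
   by (rule Lim_transform_eventually)
  then have 2: "((%u. mom mu w k u) \<longlongrightarrow> mom mu w k s) (at_left s)" using rate_eq(2)[OF sT, of k] by simp
  have "lint \<nu> (%x. mf k x) = mom mu w k s" by (rule tendsto_unique[OF _ 1 2]) simp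
  then show "lint \<nu> (%x. x ^ k * exp (- (1 / \<alpha>) * x)) = lint (mu s w) (%x. x ^ k * exp (- (1 / \<alpha>) * x))"
   by (simp add: mom_def mf_def)
 qed
 then show ?thesis using left_lim_eqI[OF \<nu>] by simp
qed

lemma moment_equation:
 assumes t: "t \<in> {0..T}"
 shows "(%s. dr k (%j. mom mu w j s) + mom mu w k s) integrable_on {0..t}"
  and "mom mu w k t = mf k l0 + integral {0..t} (%s. dr k (%j. mom mu w j s) + mom mu w k s) + jmp mu w k t"
proof -
 let ?X = "insert 0 (times (c1 w))"
 have X: "negligible ?X" by (intro negligible_finite) auto
 have e: "dr k (%j. mom mu w j s) + mom mu w k s = rate k s" if "s \<in> {0..t} - ?X" for s
 proof -
  have s: "s \<in> {0<..T}" "s \<notin> times (c1 w)" "s \<in> {0..T}" using that t by auto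
  show ?thesis unfolding rate_def mom_def zakai_integrand_def prod.case left_lim_off_jumps[OF s(1,2)]
   using moment_drift[OF solD(2)[OF s(3)], of k] by simp
 qed
 show "(%s. dr k (%j. mom mu w j s) + mom mu w k s) integrable_on {0..t}"
  by (rule integrable_spike[OF rate_eq(1)[OF t] X]) (rule e)
 have "integral {0..t} (rate k) = integral {0..t} (%s. dr k (%j. mom mu w j s) + mom mu w k s)"
  by (rule integral_spike[OF X]) (rule e)
 then show "mom mu w k t = mf k l0 + integral {0..t} (%s. dr k (%j. mom mu w j s) + mom mu w k s) + jmp mu w k t"
  using rate_eq(2)[OF t, of k] by simp
qed

end

text \<open>Triangularity: the lower moments agree and drop out, and of the sum only the last term
  is left, with coefficient \<open>cf 0\<close>.\<close>

lemma dr_diff: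
 assumes "\<And>j. j < k ==> m j = m' j"
 shows "dr k m - dr k m' = (\<rho> * cf 0 - (\<beta> + \<alpha> * real k + \<rho>)) * (m k - m' k)"
proof -
 have "real k * m (k - 1) = real k * m' (k - 1)" using assms[of "k - 1"] by (cases k) auto
 moreover have "(\<Sum>j<k. real (k choose j) * cf (k - j) * m j) = (\<Sum>j<k. real (k choose j) * cf (k - j) * m' j)"
  by (intro sum.cong refl) (simp add: assms)
 ultimately show ?thesis unfolding dr_def lessThan_Suc_atMost[symmetric] sum.lessThan_Suc by (simp add: algebra_simps)
qed

lemma left_lim_cong:
 assumes s: "0 < s" "s <= T" and sol: "solves mu w" and eq: "\<And>u. 0 <= u ==> u < s ==> mu u w = \<nu> u w"
 shows "left_lim (%t. mu t w) s = left_lim (%t. \<nu> t w) s"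
proof -
 obtain ka where ka: "fin_meas ka" "weakly_tendsto (%t. mu t w) ka (at_left s)"
  using sol_left[OF sol, of s] s by auto
 have "\<forall>\<^sub>F u in at_left s. mu u w = \<nu> u w"
  using eventually_at_left_real[OF s(1)] by (auto elim!: eventually_mono intro: eq)
 from weakly_tendsto_cong[OF ka(2) this] show ?thesis using left_lim_eqI[OF ka] left_lim_eqI[OF ka(1)] by simp
qed

text \<open>Induction on the number of jumps up to \<open>t\<close>: the jump terms only involve the past, and in between
 the moments against \<open>mf k\<close> solve a triangular system of linear equations.\<close>

lemma solves_unique:
 assumes mu: "solves mu w" and \<nu>: "solves \<nu> w"
 shows "\<forall>t\<in>{0..T}. N1 t w < n \<longrightarrow> mu t w = \<nu> t w"
proof (induction n)
 case (Suc n)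
 note w = solD(1)[OF mu]
 show ?case
 proof (intro ballI impI)
  fix t assume t: "t \<in> {0..T}" "N1 t w < Suc n"
  \<comment> \<open>The jump integral up to \<open>s\<close> involves only jumps with index at most
    \<open>n\<close>, through their left limits. Before such a jump the count is below
    \<open>n\<close>, where the induction hypothesis applies.\<close>
  have J: "jmp mu w k s = jmp \<nu> w k s" if s: "s \<in> {0..t}" for k s
   unfolding jmp_def set_lebesgue_integral_def
  proof (rule integral_cong_AE)
   have sT: "s \<in> {0..T}" using s t by auto
   show "(%p. indicator ({0<..s} \<times> {0<..}) p *\<^sub>R zakai_integrand (mf k) (%t. mu t w) p) \<in> bm (jump_measure T N1 Z1 w)"
    "(%p. indicator ({0<..s} \<times> {0<..}) p *\<^sub>R zakai_integrand (mf k) (%t. \<nu> t w) p) \<in> bm (jump_measure T N1 Z1 w)"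
    using jmp_meas[OF mu sT] jmp_meas[OF \<nu> sT] by (auto simp: set_integrable_def)
   show "AE p in jump_measure T N1 Z1 w. indicator ({0<..s} \<times> {0<..}) p *\<^sub>R zakai_integrand (mf k) (%t. mu t w) p
    = indicator ({0<..s} \<times> {0<..}) p *\<^sub>R zakai_integrand (mf k) (%t. \<nu> t w) p"
   proof (rule jump_measure_AE[OF w])
    fix j assume j: "j \<in> {1..N1 T w}"
    let ?t = "tm (c1 w) j"
    have tj: "?t <= u \<longleftrightarrow> j <= N1 u w" if "u \<in> {0..T}" for u
     using M1.jump_time_le_iff[OF w _ that, of j] c1_jump(1)[OF w j] j by simp
    have "left_lim (%t. mu t w) ?t = left_lim (%t. \<nu> t w) ?t" if a: "0 < ?t" "?t <= s"
    proof (rule left_lim_cong[OF a(1) _ mu])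
     show "?t <= T" using a sT by auto
     have jn: "j <= n" using tj[OF sT] a(2) M1.N_mono[OF w, of s t] s t by auto
     fix u assume u: "0 <= u" "u < ?t"
     then have uT: "u \<in> {0..T}" using a sT by auto
     then have "N1 u w < n" using tj[OF uT] u jn by auto
     then show "mu u w = \<nu> u w" using Suc uT by blast
    qed
    then show "indicator ({0<..s} \<times> {0<..}) (?t, Z1 j w) *\<^sub>R zakai_integrand (mf k) (%t. mu t w) (?t, Z1 j w)
     = indicator ({0<..s} \<times> {0<..}) (?t, Z1 j w) *\<^sub>R zakai_integrand (mf k) (%t. \<nu> t w) (?t, Z1 j w)"
     by (auto simp: indicator_def zakai_integrand_def)
   qed
  qed
  \<comment> \<open>Strong induction on the order \<open>k\<close>: once the lower moments agree,
    the difference of the \<open>k\<close>-th ones satisfies a homogeneous linear equation.\<close>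
  have D: "mom mu w k s = mom \<nu> w k s" if "s \<in> {0..t}" for k s
   using that
  proof (induction k arbitrary: s rule: less_induct)
   case (less k)
   let ?u = "%s. mom mu w k s - mom \<nu> w k s" and ?c = "\<rho> * cf 0 - (\<beta> + \<alpha> * real k + \<rho>) + 1"
   let ?g = "%mu r. dr k (%j. mom mu w j r) + mom mu w k r"
   have g: "?g mu r - ?g \<nu> r = ?c * ?u r" if "r \<in> {0..t}" for r
    using dr_diff[of k "%j. mom mu w j r" "%j. mom \<nu> w j r"] less.IH[OF _ that] by (simp add: algebra_simps)
   have main: "(%r. ?c * ?u r) integrable_on {0..v}" "?u v = integral {0..v} (%r. ?c * ?u r)" if v: "v \<in> {0..t}" for v
   proof -
    have vT: "v \<in> {0..T}" using v t by auto
    note i = moment_equation(1)[OF mu vT, of k] moment_equation(1)[OF \<nu> vT, of k]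
    have gv: "?g mu r - ?g \<nu> r = ?c * ?u r" if "r \<in> {0..v}" for r using g[of r] that v by auto
    have "(%r. ?g mu r - ?g \<nu> r) integrable_on {0..v}" using i by (rule integrable_diff)
    then show "(%r. ?c * ?u r) integrable_on {0..v}" by (rule integrable_eq) (rule gv)
    have "?u v = integral {0..v} (?g mu) - integral {0..v} (?g \<nu>)"
     unfolding moment_equation(2)[OF mu vT, of k] moment_equation(2)[OF \<nu> vT, of k] using J[OF v] by simp
    also have "... = integral {0..v} (%r. ?g mu r - ?g \<nu> r)" by (rule integral_diff[OF i, symmetric])
    also have "... = integral {0..v} (%r. ?c * ?u r)" by (rule integral_cong) (rule gv)
    finally show "?u v = integral {0..v} (%r. ?c * ?u r)" .
   qed
   have "?u s = 0"
    by (rule linear_ode_zero[where c="?c"]) (use less.prems main in auto)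
   then show ?case by simp
  qed
  have tt: "t \<in> {0..t}" using t by auto
  show "mu t w = \<nu> t w"
  proof (rule fin_meas_eqI[OF solD(2)[OF mu t(1)] solD(2)[OF \<nu> t(1)]])
   show "0 < 1 / \<alpha>" using params_pos by simp
   show "lint (mu t w) (%x. x ^ k * exp (- (1 / \<alpha>) * x)) = lint (\<nu> t w) (%x. x ^ k * exp (- (1 / \<alpha>) * x))" for k
    using D[OF tt, of k] by (simp add: mom_def mf_def)
  qed
 qed
qed simp

lemma strong_solution_unique:
 assumes "strong_solution mu" "strong_solution \<nu>"
 shows "indistinguishable mu \<nu>"
 unfolding indistinguishable_def using AE_solves[OF assms(1)] AE_solves[OF assms(2)]
 by eventually_elim (use solves_unique in blast)

lemma filter_strong_solution:
 assumes "unnormalized_filter sg"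
 shows "strong_solution sg"
 unfolding strong_solution_def
proof (intro conjI ballI)
 show "measure_process sg" using assms by (simp add: unnormalized_filter_def)
 fix f assume f: "f \<in> gen_domain"
 show "AE w in Q. zakai_well_defined f sg w \<and> (\<forall>t\<in>{0..T}. zakai_equation f sg w t)"
  using AE_regular[OF gen_domain_admissible[OF f]] AE_regular[OF admissible_zero] filter_eq_kap[OF assms]
 proof eventually_elim
  case (elim w)
  show ?case using kap_solution[OF f elim(1,2), of sg] elim(3) by blast
 qed
qed

end

theorem proposition3p5:
  fixes Q :: "'a measure" and F :: "real \<Rightarrow> 'a measure"
    and T \<alpha> \<beta> l0 \<rho> :: real and ell :: "real \<Rightarrow> real" and F1 F2 :: "real measure"
    and N1 N2 :: "real \<Rightarrow> 'a \<Rightarrow> nat" and Z1 Z2 :: "nat \<Rightarrow> 'a \<Rightarrow> real"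
    and \<sigma> :: "real \<Rightarrow> 'a \<Rightarrow> real measure"
  assumes "jump_cluster_model Q F T \<alpha> \<beta> l0 \<rho> ell F1 F2 N1 N2 Z1 Z2"
    and "jump_cluster_model.unnormalized_filter Q T \<alpha> \<beta> l0 ell N1 N2 Z1 Z2 \<sigma>"
  shows "jump_cluster_model.strong_solution Q T \<alpha> \<beta> l0 \<rho> ell F1 F2 N1 N2 Z1 Z2 \<sigma> \<and>
    (\<forall>\<mu>. jump_cluster_model.strong_solution Q T \<alpha> \<beta> l0 \<rho> ell F1 F2 N1 N2 Z1 Z2 \<mu> \<longrightarrow>
         jump_cluster_model.indistinguishable Q T \<mu> \<sigma>)"
proof -
  interpret jump_cluster_model Q F T \<alpha> \<beta> l0 \<rho> ell F1 F2 N1 N2 Z1 Z2 by (rule assms(1))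
  show ?thesis using filter_strong_solution[OF assms(2)] strong_solution_unique by blast
qed

end
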